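(* Let $g\ge2$ and let $P$ be a complex polynomial of degree $2g-2$ with roots $a_j$ satisfying $1<|a_1|<|a_2|<\cdots<|a_{2g-2}|$. Let $\Delta\subset\mathbb C$ be the unit disc, $\Delta^*=\Delta\setminus\{0\}$, and consider each of the three families of hyperelliptic curves, parameterized by $\lambda\in\Delta^*$: (a) $X_\lambda=\{(x,y)\in\mathbb C^2\mid y^2=x(x-\lambda)(x-1)P(x)\}$; (b) $X_\lambda=\{(x,y)\in\mathbb C^2\mid y^2=x(x^2-\lambda)P(x)\}$; (c) $X_\lambda=\{(x,y)\in\mathbb C^2\mid y^2=x(x-\lambda)(x-\lambda^2)P(x)\}$. Write the Bergman kernel of $X_\lambda$ as $\kappa_{X_\lambda}=k_\lambda(z)\,dz\otimes d\bar z$ in the local coordinate $z:=\sqrt x\neq0$. Then, for each of these families, as $\lambda\to0$, $\psi:=\log k_\lambda(z)$ extends to a subharmonic function in $\lambda\in\Delta$. Moreover, $\psi$ has Lelong number zero at $\lambda=0$.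
   Context: Bergman kernel: on an $n$-dimensional complex manifold $X$ with canonical bundle $\mathcal K$, $\kappa:=\sum_j e_j\otimes\overline{e_j}$, where $\{e_j\}$ is a complete orthonormal basis of the space $H^0_{L^2}(X,\mathcal K)$ of square-integrable holomorphic $n$-forms. The coordinate $z=\sqrt x$ (or its opposite on the other sheet) is used near $(0,0)\in X_\lambda$, so that $x=z^2$, $dx=2z\,dz$; $\psi$ is considered as a function of $\lambda$ for given $z$. The Lelong number at $0$ of a plurisubharmonic function $u$ in a neighbourhood of $0\in\mathbb C^n$ is $\lim_{r\to0^+}\frac{\sup_{|z|=r}u(z)}{\log r}$, i.e. the supremum of all $\nu\ge0$ such that $u(z)\le\nu\log|z|+O(1)$ near $0$.
   Formalization: Subharmonicity is asserted on Δ minus the λ for which z² is a branch point of X_λ (λ=z² in (a); z⁴ in (b); z², ±z in (c)), where k_λ(z) is undefined and tends to +∞; z with z² a root of (x−1)P (a) or P (b, c) is excluded, since √x is not a local coordinate there. *)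

theory Defs
  imports
    "HOL-Complex_Analysis.Complex_Analysis"
    "HOL-Computational_Algebra.Polynomial"
begin

section \<open>Riemann surfaces in the complex plane squared\<close>

text \<open>
  A Riemann surface is given as a subset \<open>X\<close> of \<open>\<complex>\<^sup>2\<close>; its complex structure consists of
  the holomorphic immersions \<open>\<phi>\<close> of open sets \<open>D \<subseteq> \<complex>\<close> that are homeomorphisms onto relatively
  open subsets of \<open>X\<close>.  The inverse of \<open>\<phi>\<close> is a local coordinate on \<open>\<phi> ` D\<close>.
\<close>

definition local_param ::
  "(complex \<times> complex) set \<Rightarrow> complex set \<Rightarrow> (complex \<Rightarrow> complex \<times> complex) \<Rightarrow> bool" where
  "local_param X D \<phi> \<longleftrightarrow>
     open D \<and> (\<lambda>t. fst (\<phi> t)) holomorphic_on D \<and> (\<lambda>t. snd (\<phi> t)) holomorphic_on D \<and>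
     (\<forall>t\<in>D. (deriv (\<lambda>s. fst (\<phi> s)) t, deriv (\<lambda>s. snd (\<phi> s)) t) \<noteq> (0, 0)) \<and>
     \<phi> ` D \<subseteq> X \<and> openin (top_of_set X) (\<phi> ` D) \<and>
     (\<exists>\<psi>. homeomorphism D (\<phi> ` D) \<phi> \<psi>)"

text \<open>
  A 1-form of type (1,0) on \<open>X\<close> is represented by the pair \<open>\<omega> p = (A p, B p)\<close> standing for the
  restriction of \<open>A dx + B dy\<close> to the tangent lines of \<open>X\<close>.  Distinct pairs may represent
  the same form, but \<open>\<omega>\<close> only enters through its coefficient \<open>pullback \<phi> \<omega>\<close> with respect to \<open>dt\<close>.
\<close>

type_synonym one_form = "complex \<times> complex \<Rightarrow> complex \<times> complex"

definition pullback :: "(complex \<Rightarrow> complex \<times> complex) \<Rightarrow> one_form \<Rightarrow> complex \<Rightarrow> complex" where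
  "pullback \<phi> \<omega> t =
     fst (\<omega> (\<phi> t)) * deriv (\<lambda>s. fst (\<phi> s)) t + snd (\<omega> (\<phi> t)) * deriv (\<lambda>s. snd (\<phi> s)) t"

definition holomorphic_form :: "(complex \<times> complex) set \<Rightarrow> one_form \<Rightarrow> bool" where
  "holomorphic_form X \<omega> \<longleftrightarrow> (\<forall>D \<phi>. local_param X D \<phi> \<longrightarrow> pullback \<phi> \<omega> holomorphic_on D)"

definition zero_form :: "(complex \<times> complex) set \<Rightarrow> one_form \<Rightarrow> bool" where
  "zero_form X \<omega> \<longleftrightarrow> (\<forall>D \<phi>. local_param X D \<phi> \<longrightarrow> (\<forall>t\<in>D. pullback \<phi> \<omega> t = 0))"

text \<open>
  Integration over \<open>X\<close>: cut \<open>X\<close> into countably many disjoint Borel pieces \<open>\<phi>\<^sub>n ` B\<^sub>n\<close>, each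
  contained in the image of a local parametrization, and add up the integrals in the local
  coordinates.  The results below do not depend on the chosen pieces, by the
  transformation formula.
\<close>

definition tiling ::
  "(complex \<times> complex) set \<Rightarrow> (nat \<Rightarrow> complex \<Rightarrow> complex \<times> complex) \<times> (nat \<Rightarrow> complex set) \<Rightarrow> bool"
where
  "tiling X = (\<lambda>(\<phi>, B).
     (\<forall>n. B n \<in> sets borel \<and> (\<exists>D. B n \<subseteq> D \<and> local_param X D (\<phi> n))) \<and>
     disjoint_family (\<lambda>n. \<phi> n ` B n) \<and> (\<Union>n. \<phi> n ` B n) = X)"

definition some_tiling ::
  "(complex \<times> complex) set \<Rightarrow> (nat \<Rightarrow> complex \<Rightarrow> complex \<times> complex) \<times> (nat \<Rightarrow> complex set)" where
  "some_tiling X = (SOME T. tiling X T)"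

text \<open>
  The inner product is \<open>\<langle>\<alpha>, \<beta>\<rangle> = (\<i>/2) \<integral>\<^sub>X \<alpha> \<and> cnj \<beta>\<close>; since \<open>(\<i>/2) dt \<and> cnj dt\<close> is
  Lebesgue measure, no further constant appears.
\<close>

definition square_integrable_form :: "(complex \<times> complex) set \<Rightarrow> one_form \<Rightarrow> bool" where
  "square_integrable_form X \<omega> \<longleftrightarrow>
     (case some_tiling X of (\<phi>, B) \<Rightarrow>
       (\<Sum>n. \<integral>\<^sup>+t\<in>B n. ennreal ((cmod (pullback (\<phi> n) \<omega> t))\<^sup>2) \<partial>lborel) < \<infinity>)"

definition form_inner :: "(complex \<times> complex) set \<Rightarrow> one_form \<Rightarrow> one_form \<Rightarrow> complex" where
  "form_inner X \<alpha> \<beta> =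
     (case some_tiling X of (\<phi>, B) \<Rightarrow>
       (\<Sum>n. LINT t:B n|lborel. pullback (\<phi> n) \<alpha> t * cnj (pullback (\<phi> n) \<beta> t)))"

definition L2_holomorphic_forms :: "(complex \<times> complex) set \<Rightarrow> one_form set" where
  "L2_holomorphic_forms X = {\<omega>. holomorphic_form X \<omega> \<and> square_integrable_form X \<omega>}"

definition complete_orthonormal :: "(complex \<times> complex) set \<Rightarrow> one_form set \<Rightarrow> bool" where
  "complete_orthonormal X E \<longleftrightarrow>
     E \<subseteq> L2_holomorphic_forms X \<and>
     (\<forall>\<alpha>\<in>E. \<forall>\<beta>\<in>E. form_inner X \<alpha> \<beta> = (if \<alpha> = \<beta> then 1 else 0)) \<and>
     (\<forall>\<omega>\<in>L2_holomorphic_forms X. (\<forall>\<alpha>\<in>E. form_inner X \<omega> \<alpha> = 0) \<longrightarrow> zero_form X \<omega>)"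


section \<open>The Bergman kernel\<close>

text \<open>
  The coefficient \<open>k\<close> in \<open>\<kappa> = \<Sum>\<^sub>j e\<^sub>j \<otimes> cnj e\<^sub>j = k dt \<otimes> cnj dt\<close>, at the point \<open>\<phi> t\<close> and in
  the coordinate given by \<open>\<phi>\<close>.  It does not depend on the orthonormal basis.
\<close>

definition bergman_coeff ::
  "(complex \<times> complex) set \<Rightarrow> (complex \<Rightarrow> complex \<times> complex) \<Rightarrow> complex \<Rightarrow> real" where
  "bergman_coeff X \<phi> t =
     (THE k. \<exists>E. complete_orthonormal X E \<and> ((\<lambda>e. (cmod (pullback \<phi> e t))\<^sup>2) has_sum k) E)"

text \<open>
  The coefficient in the coordinate \<open>z\<close> with \<open>x = z\<^sup>2\<close>.  On \<open>y\<^sup>2 = f x\<close> there may be two points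
  over \<open>x = z\<^sup>2\<close>; they are exchanged by the automorphism \<open>(x, y) \<mapsto> (x, - y)\<close>, which preserves
  the kernel, so that the value is the same on both sheets.
\<close>

definition bergman_sqrt_coeff :: "(complex \<times> complex) set \<Rightarrow> complex \<Rightarrow> real" where
  "bergman_sqrt_coeff X z =
     (THE k. \<exists>D \<phi>. local_param X D \<phi> \<and> (\<forall>t\<in>D. fst (\<phi> t) = t\<^sup>2) \<and> z \<in> D \<and>
                   k = bergman_coeff X \<phi> z)"


section \<open>The families of hyperelliptic curves\<close>

definition curve_a :: "complex poly \<Rightarrow> complex \<Rightarrow> (complex \<times> complex) set" where
  "curve_a P lam = {(x, y). y\<^sup>2 = x * (x - lam) * (x - 1) * poly P x}"

definition curve_b :: "complex poly \<Rightarrow> complex \<Rightarrow> (complex \<times> complex) set" where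
  "curve_b P lam = {(x, y). y\<^sup>2 = x * (x\<^sup>2 - lam) * poly P x}"

definition curve_c :: "complex poly \<Rightarrow> complex \<Rightarrow> (complex \<times> complex) set" where
  "curve_c P lam = {(x, y). y\<^sup>2 = x * (x - lam) * (x - lam\<^sup>2) * poly P x}"

text \<open>
  The parameters for which the coefficient in the coordinate \<open>z\<close> makes sense.  For \<open>z \<noteq> 0\<close>, the
  function \<open>sqrt x\<close> is a local coordinate of \<open>X lam\<close> over \<open>x = z\<^sup>2\<close> iff \<open>z\<^sup>2\<close> is not a branch point,
  that is, iff \<open>(z\<^sup>2, 0)\<close> is not on the curve.  On the three families, with \<open>z\<close> such that 0 is
  admissible, this is the whole unit disc if \<open>cmod z \<ge> 1\<close>; otherwise it is the disc without the
  values \<open>lam = z\<^sup>2\<close>, \<open>lam = z^4\<close>, \<open>lam \<in> {z\<^sup>2, z, - z}\<close>, respectively, where the coefficient has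
  the limit \<open>+\<infinity>\<close>.
\<close>

definition admissible_params ::
  "(complex \<Rightarrow> (complex \<times> complex) set) \<Rightarrow> complex \<Rightarrow> complex set" where
  "admissible_params X z = {lam \<in> ball 0 1. (z\<^sup>2, 0) \<notin> X lam}"


section \<open>Subharmonic functions and Lelong numbers\<close>

definition log_ext :: "real \<Rightarrow> ereal" where
  "log_ext t = (if t = 0 then -\<infinity> else ereal (ln t))"

text \<open>
  The mean value is written as the integral of the positive part minus that of the
  negative part; the former is finite for an upper semicontinuous function that is \<open>< \<infinity>\<close>.
\<close>

definition circle_integral :: "(complex \<Rightarrow> ereal) \<Rightarrow> complex \<Rightarrow> real \<Rightarrow> ereal" where
  "circle_integral u c r =
     enn2ereal (\<integral>\<^sup>+\<theta>\<in>{0..2 * pi}. e2ennreal (u (c + of_real r * cis \<theta>)) \<partial>lborel) -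
     enn2ereal (\<integral>\<^sup>+\<theta>\<in>{0..2 * pi}. e2ennreal (- u (c + of_real r * cis \<theta>)) \<partial>lborel)"

definition subharmonic_on :: "complex set \<Rightarrow> (complex \<Rightarrow> ereal) \<Rightarrow> bool" where
  "subharmonic_on S u \<longleftrightarrow>
     open S \<and> (\<forall>w\<in>S. u w < \<infinity>) \<and>
     (\<forall>w\<in>S. \<forall>c. u w < c \<longrightarrow> (\<forall>\<^sub>F v in at w within S. u v < c)) \<and>
     (\<forall>C\<in>components S. \<exists>w\<in>C. u w \<noteq> -\<infinity>) \<and>
     (\<forall>w r. 0 < r \<and> cball w r \<subseteq> S \<longrightarrow> u w \<le> circle_integral u w r / ereal (2 * pi))"

definition has_lelong_number :: "(complex \<Rightarrow> ereal) \<Rightarrow> complex \<Rightarrow> ereal \<Rightarrow> bool" where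
  "has_lelong_number u c \<nu> \<longleftrightarrow>
     ((\<lambda>r. (SUP w\<in>sphere c r. u w) / ereal (ln r)) \<longlongrightarrow> \<nu>) (at_right 0)"

end

theory Submission
 imports Defs "HOL-Computational_Algebra.Fundamental_Theorem_Algebra"
begin

text \<open>
The holomorphic square-integrable forms on \<open>y^2 = f x\<close>, \<open>deg f = 2 g + 1\<close>, are the forms
\<open>p(x) dx / y\<close> with \<open>deg p < g\<close>, and their inner product is twice that of the polynomials \<open>p\<close>
in the plane with weight \<open>1 / |f|\<close>. So \<open>k\<close> is \<open>2 |z|^2 / |f (z^2)|\<close> times the reproducing
kernel at \<open>z^2\<close> of the polynomials of degree \<open>< g\<close> with this weight.

For the smoothed weights \<open>1 / sqrt (|f|^2 + eps)\<close> the logarithm of the kernel is subharmonic in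
the parameter, as in Berndtsson's theorem: if \<open>p\<close> is extremal at \<open>lam\<close>, then \<open>p + d q\<close> is a competitor
at \<open>lam + d\<close>, where \<open>q\<close> is the projection of the variation of \<open>p\<close> to the polynomials, and
Hoermander's estimate for the projection error makes the quadratic term of its norm nonpositive.
Averaging over the four points \<open>d = r, i r, - r, - i r\<close> detects this without differentiating the
kernel. As \<open>eps\<close> tends to 0 the kernels decrease to the kernel for \<open>1 / |f|\<close>, so the limit
is subharmonic. It is finite at \<open>lam = 0\<close>, since \<open>x dx / y\<close> has finite norm on the degenerate curve;
being also bounded above near 0, it has Lelong number zero.
\<close>

section \<open>Area integrals in the plane\<close>

abbreviation wt :: "real => complex => real" where "wt p x \<equiv> (1 + cmod x) powr p"

abbreviation cont :: "('a::topological_space => 'b::topological_space) => bool" where "cont f \<equiv> continuous_on UNIV f"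

abbreviation L1 :: "('a::euclidean_space => 'b::{banach, second_countable_topology}) => bool" where "L1 F \<equiv> integrable lborel F"

abbreviation area_integral :: "('a::euclidean_space => 'b::{banach, second_countable_topology}) => 'b" (binder "\<integral>" 10)
 where "area_integral F \<equiv> integral\<^sup>L lborel F"

abbreviation nn_area_integral :: "('a::euclidean_space => ennreal) => ennreal" (binder "\<integral>\<^sup>+" 10)
 where "nn_area_integral F \<equiv> integral\<^sup>N lborel F"

lemmas B_integrable_bound = Bochner_Integration.integrable_bound and B_integral_diff = Bochner_Integration.integral_diff and B_integral_add = Bochner_Integration.integral_add and B_integrable_add = Bochner_Integration.integrable_add and B_integral_nonneg = Bochner_Integration.integral_nonneg and B_integrable_sum = Bochner_Integration.integrable_sum and B_integral_sum = Bochner_Integration.integral_sum and B_integrable_diff = Bochner_Integration.integrable_diff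

lemma integrable_dyadic:
 fixes f :: "complex => real" and c r :: "nat => real"
 assumes meas: "f \<in> borel_measurable borel"
  and nonneg: "\<And>x. 0 \<le> f x"
  and dom: "\<And>x. f x \<noteq> 0 ==> \<exists>k. cmod x \<le> r k \<and> f x \<le> c k"
  and c: "\<And>k. 0 \<le> c k" and r: "\<And>k. 0 \<le> r k"
  and summ: "summable (\<lambda>k. c k * (r k)^2)"
 shows "L1 f"
proof (rule integrableI_nonneg)
 have "(\<integral>\<^sup>+x. ennreal (f x)) \<le>
    (\<integral>\<^sup>+x. (\<Sum>k. ennreal (c k) * indicator (cball (0::complex) (r k)) x))"
 proof (rule nn_integral_mono)
  fix x :: complex
  show "ennreal (f x) \<le> (\<Sum>k. ennreal (c k) * indicator (cball 0 (r k)) x)"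
  proof (cases "f x = 0")
   case False
   then obtain k where k: "cmod x \<le> r k" "f x \<le> c k" using dom by blast
   have "ennreal (f x) \<le> ennreal (c k) * indicator (cball 0 (r k)) x"
    using k by (simp add: ennreal_leI)
   also have "... \<le> (\<Sum>k. ennreal (c k) * indicator (cball 0 (r k)) x)"
    (is "?g k \<le> _")
   proof -
    have "sum ?g {k} \<le> suminf ?g" by (rule sum_le_suminf) auto
    moreover have "sum ?g {k} = ?g k" using sum.insert[of "{}" k ?g, OF finite.emptyI] by (simp only: empty_iff not_False_eq_True sum.empty add_0_right simp_thms)
    ultimately show ?thesis by (simp only:)
   qed
   finally show ?thesis .
  qed simp
 qed
 also have "... = (\<Sum>k. \<integral>\<^sup>+x. ennreal (c k) * indicator (cball (0::complex) (r k)) x)"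
  by (intro nn_integral_suminf borel_measurable_times_ennreal borel_measurable_const
    borel_measurable_indicator) (simp add: borel_closed)
 also have "... = (\<Sum>k. ennreal (pi * (c k * (r k)^2)))"
  using c r by (intro suminf_cong)
   (simp add: nn_integral_cmult_indicator emeasure_cball DIM_complex unit_ball_vol_2
    ennreal_mult[symmetric] mult_ac)
 also have "... < \<infinity>"
  using c r summ by (subst suminf_ennreal2) (auto intro: summable_mult)
 finally show "(\<integral>\<^sup>+x. ennreal (f x)) < \<infinity>" .
qed (use meas nonneg in auto)

lemma integrable_decay:
 fixes p :: real
 assumes "p > 2"
 shows "L1 (\<lambda>x::complex. wt (-p) x)"
proof (rule integrable_dyadic[where r = "\<lambda>k. 2 ^ Suc k" and c = "\<lambda>k. (2 powr (-p)) ^ k"])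
 fix x :: complex
 define k where "k = nat \<lfloor>log 2 (1 + cmod x)\<rfloor>"
 have pos: "0 < 1 + cmod x" by (smt (verit) norm_ge_zero)
 hence l0: "0 \<le> log 2 (1 + cmod x)" by (subst zero_le_log_cancel_iff) auto
 have k1: "real k \<le> log 2 (1 + cmod x)" "log 2 (1 + cmod x) < real k + 1"
  unfolding k_def using l0 by linarith+
 have a: "2 ^ k \<le> 1 + cmod x"
  using k1(1) pos by (simp add: le_log_iff powr_realpow)
 have b: "1 + cmod x < 2 ^ Suc k"
 proof -
  have "1 + cmod x < 2 powr (real k + 1)" using k1(2) pos by (simp add: log_less_iff)
  thus ?thesis by (simp add: powr_add powr_realpow mult.commute)
 qed
 have "wt (-p) x \<le> (2 ^ k) powr (-p)"
  using a assms by (intro powr_mono2') auto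
 also have "... = (2 powr (-p)) ^ k"
  by (simp add: powr_powr mult.commute flip: powr_realpow)
 finally show "\<exists>k. cmod x \<le> 2 ^ Suc k \<and> wt (-p) x \<le> (2 powr (-p)) ^ k"
  using b by (intro exI[of _ k]) auto
next
 have "(2::real) powr (-p) < 2 powr (-2)" using assms by (intro powr_less_mono) auto
 hence q: "2 powr (-p) * 4 < (1::real)" by (simp add: powr_minus)
 have "(\<lambda>k. (2 powr (-p)) ^ k * (2 ^ Suc k)^2) = (\<lambda>k. 4 * ((2::real) powr (-p) * 4) ^ k)"
  by (auto simp: fun_eq_iff power2_eq_square power_mult_distrib)
   (metis mult_2_right numeral_Bit0 power_mult_distrib)
 moreover have "summable (\<lambda>k. 4 * ((2::real) powr (-p) * 4) ^ k)"
  using q by (intro summable_mult summable_geometric) auto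
 ultimately show "summable (\<lambda>k. (2 powr (-p)) ^ k * ((2::real) ^ Suc k)^2)" by simp
qed auto

lemma integrable_inverse_near_zero:
 "L1 (\<lambda>x::complex. 1 / cmod x * indicator (cball 0 1) x :: real)"
proof (rule integrable_dyadic[where r = "\<lambda>k. (1/2) ^ k" and c = "\<lambda>k. 2 * 2 ^ k"])
 fix x :: complex
 assume nz: "1 / cmod x * indicator (cball 0 1) x \<noteq> 0"
 hence x: "x \<noteq> 0" "cmod x \<le> 1" by (auto simp: indicator_def split: if_splits)
 define k where "k = nat \<lfloor>log 2 (1 / cmod x)\<rfloor>"
 have l0: "0 \<le> log 2 (1 / cmod x)" using x by simp
 have k1: "real k \<le> log 2 (1 / cmod x)" "log 2 (1 / cmod x) < real k + 1"
  unfolding k_def using l0 by linarith+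
 have a: "2 ^ k \<le> 1 / cmod x"
  using k1(1) x by (simp add: le_log_iff powr_realpow)
 have b: "1 / cmod x < 2 * 2 ^ k"
 proof -
  have "1 / cmod x < 2 powr (real k + 1)" using k1(2) x by (subst log_less_iff[symmetric]) auto
  thus ?thesis by (simp add: powr_add powr_realpow mult.commute)
 qed
 have "cmod x \<le> (1/2)^k"
  using a x by (simp add: field_simps)
 thus "\<exists>k. cmod x \<le> (1/2) ^ k \<and> 1 / cmod x * indicator (cball 0 1) x \<le> 2 * 2 ^ k"
  using b x by (intro exI[of _ k]) (auto simp: indicator_def)
next
 have "(\<lambda>k. 2 * 2 ^ k * ((1/2) ^ k)^2) = (\<lambda>k. 2 * ((1::real)/2) ^ k)"
  by (auto simp: fun_eq_iff power2_eq_square field_simps)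
 thus "summable (\<lambda>k. 2 * 2 ^ k * ((1/2) ^ k)^2 :: real)"
  by (simp add: summable_mult summable_geometric)
next
 show "(\<lambda>x::complex. 1 / cmod x * indicator (cball 0 1) x :: real) \<in> borel_measurable borel"
  by (intro borel_measurable_times borel_measurable_divide borel_measurable_const
    borel_measurable_indicator borel_closed closed_cball borel_measurable_norm measurable_ident_sets refl)
qed auto

lemma integrable_translate:
 fixes F :: "complex => 'b::{banach, second_countable_topology}"
 shows "L1 (\<lambda>x. F (v + x)) = L1 F"
proof (cases "F \<in> borel_measurable borel")
 case True
 have "L1 F = integrable (distr lborel borel ((+) v)) F"
  by (simp add: lborel_distr_plus)
 also have "... = L1 (\<lambda>x. F (v + x))"
  using True by (subst integrable_distr_eq) auto
 finally show ?thesis by simp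
next
 case False
 have "(\<lambda>x. F (v + x)) \<notin> borel_measurable borel"
 proof
  assume "(\<lambda>x. F (v + x)) \<in> borel_measurable borel"
  hence "(\<lambda>x. F (v + (x - v))) \<in> borel_measurable borel" by measurable
  thus False using False by simp
 qed
 with False show ?thesis by (auto simp: integrable_iff_bounded)
qed

lemma integral_translate:
 fixes F :: "complex => 'b::{banach, second_countable_topology}"
 assumes "F \<in> borel_measurable borel"
 shows "(\<integral>x. F (v + x)) = (\<integral>x. F x)"
proof -
 have "(\<integral>x. F x) = (\<integral>x. F x \<partial>distr lborel borel ((+) v))"
  by (simp add: lborel_distr_plus)
 also have "... = (\<integral>x. F (v + x))"
  using assms by (subst integral_distr) auto
 finally show ?thesis by simp
qed

lemma integral_reflect:
 fixes F :: "complex => 'b::{banach, second_countable_topology}"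
 assumes "F \<in> borel_measurable borel"
 shows "(\<integral>x. F (v - x)) = (\<integral>x. F x)"
proof -
 have "(lborel :: complex measure) = distr lborel borel (\<lambda>x. v + (-1) *\<^sub>R x)"
  using lborel_affine[of "-1" v] by (simp add: density_1)
 hence "(\<integral>x. F x) = (\<integral>x. F x \<partial>distr lborel borel (\<lambda>x. v + (-1) *\<^sub>R x))"
  by simp
 also have "... = (\<integral>x. F (v - x))"
  using assms by (subst integral_distr) auto
 finally show ?thesis by simp
qed

lemma integrable_reflect:
 fixes F :: "complex => 'b::{banach, second_countable_topology}"
 assumes "L1 F"
 shows "L1 (\<lambda>x. F (v - x))"
proof -
 have "(lborel :: complex measure) = distr lborel borel (\<lambda>x. v + (-1) *\<^sub>R x)"
  using lborel_affine[of "-1" v] by (simp add: density_1)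
 hence "integrable (distr lborel borel (\<lambda>x. v + (-1) *\<^sub>R x)) F"
  using assms by simp
 hence "L1 (\<lambda>x. F (v + (-1) *\<^sub>R x))"
  using assms by (subst (asm) integrable_distr_eq) auto
 thus ?thesis by simp
qed

section \<open>Wirtinger derivatives\<close>

definition wirtinger ::
 "(complex => complex) => complex => complex => complex => bool" where
 "wirtinger F a b x \<longleftrightarrow> (F has_derivative (\<lambda>h. a * h + b * cnj h)) (at x)"

lemma wirtinger_cong:
 "wirtinger F a b x ==> a = a' ==> b = b' ==> wirtinger F a' b' x"
 by simp

lemma wirtinger_const: "wirtinger (\<lambda>_. c) 0 0 x"
 unfolding wirtinger_def by (auto intro!: derivative_eq_intros)

lemma wirtinger_holomorphic:
 "(F has_field_derivative a) (at x) ==> wirtinger F a 0 x"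
 unfolding wirtinger_def has_field_derivative_def by (simp add: mult_commute_abs)

lemma wirtinger_add:
 "wirtinger F a b x ==> wirtinger G c d x ==>
  wirtinger (\<lambda>x. F x + G x) (a + c) (b + d) x"
 unfolding wirtinger_def
 by (auto intro!: derivative_eq_intros simp: algebra_simps fun_eq_iff)

lemma wirtinger_diff:
 "wirtinger F a b x ==> wirtinger G c d x ==>
  wirtinger (\<lambda>x. F x - G x) (a - c) (b - d) x"
 unfolding wirtinger_def
 by (auto intro!: derivative_eq_intros simp: algebra_simps fun_eq_iff)

lemma wirtinger_mult:
 "wirtinger F a b x ==> wirtinger G c d x ==>
  wirtinger (\<lambda>x. F x * G x) (a * G x + F x * c) (b * G x + F x * d) x"
 unfolding wirtinger_def
 by (auto intro!: derivative_eq_intros simp: algebra_simps fun_eq_iff)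

lemma wirtinger_cnj:
 "wirtinger F a b x ==> wirtinger (\<lambda>x. cnj (F x)) (cnj b) (cnj a) x"
 unfolding wirtinger_def
 by (drule bounded_linear.has_derivative[OF bounded_linear_cnj]) (simp add: algebra_simps)

lemma wirtinger_continuous: "wirtinger F a b x ==> isCont F x"
 unfolding wirtinger_def by (rule has_derivative_continuous)

lemma wirtinger_real_comp:
 assumes F: "wirtinger (\<lambda>x. of_real (F x)) a (cnj a) x"
  and \<phi>: "(\<phi> has_real_derivative d) (at (F x))"
 shows "wirtinger (\<lambda>x. of_real (\<phi> (F x))) (of_real d * a) (of_real d * cnj a) x"
proof -
 have "((\<lambda>x. Re (of_real (F x))) has_derivative (\<lambda>h. Re (a * h + cnj a * cnj h))) (at x)"
  using F unfolding wirtinger_def by (rule has_derivative_Re)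
 hence 1: "(F has_derivative (\<lambda>h. Re (a * h + cnj a * cnj h))) (at x)" by simp
 have "((\<lambda>x. \<phi> (F x)) has_derivative (\<lambda>h. d * Re (a * h + cnj a * cnj h))) (at x)"
  using has_derivative_compose[OF 1 \<phi>[unfolded has_field_derivative_def]] by simp
 hence "((\<lambda>x. complex_of_real (\<phi> (F x))) has_derivative
   (\<lambda>h. of_real (d * Re (a * h + cnj a * cnj h)))) (at x)"
  by (rule bounded_linear.has_derivative[OF bounded_linear_of_real])
 moreover have "of_real (d * Re (a * h + cnj a * cnj h)) =
   of_real d * a * h + of_real d * cnj a * cnj h" for h
  by (simp add: complex_eq_iff algebra_simps)
 ultimately show ?thesis unfolding wirtinger_def by simp
qed

lemma powr_decay_shift:
 fixes p :: real
 assumes "p \<ge> 0"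
 shows "wt (-p) y \<le> wt p (x - y) * wt (-p) x"
proof -
 have "1 + cmod x \<le> 1 + cmod (x - y) + cmod y"
  using norm_triangle_ineq[of "x - y" y] by simp
 also have "... \<le> (1 + cmod (x - y)) * (1 + cmod y)"
  by (simp add: algebra_simps)
 finally have "wt p x \<le> ((1 + cmod (x - y)) * (1 + cmod y)) powr p"
  using assms by (intro powr_mono2) auto
 also have "... = wt p (x - y) * wt p y"
  by (rule powr_mult)
 finally have *: "wt p x \<le> wt p (x - y) * wt p y" .
 define X where "X = wt p x"
 define Y where "Y = wt p y"
 have "1 + cmod x > 0" "1 + cmod y > 0" by (auto intro: add_pos_nonneg)
 hence "X > 0" "Y > 0" by (auto simp: X_def Y_def)
 moreover have "X \<le> wt p (x - y) * Y" using * by (simp only: X_def Y_def)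
 ultimately have "inverse Y \<le> wt p (x - y) * inverse X"
  by (simp add: field_simps)
 thus ?thesis by (simp only: X_def Y_def powr_minus)
qed

lemma powr_decay_near:
 fixes p :: real
 assumes "p \<ge> 0" "cmod (x - y) \<le> 1"
 shows "wt (-p) y \<le> 2 powr p * wt (-p) x"
proof -
 have "wt p (x - y) \<le> 2 powr p" using assms by (intro powr_mono2) auto
 thus ?thesis
  using powr_decay_shift[OF assms(1), of y x]
  by (meson mult_right_mono order_trans powr_ge_zero)
qed

lemma wirtinger_increment_bound:
 assumes F: "\<And>x. wirtinger F (a x) (b x) x"
  and a: "\<And>x. cmod (a x) \<le> C * wt (-p) x"
  and b: "\<And>x. cmod (b x) \<le> C * wt (-p) x"
  and p: "p \<ge> 0" and v: "cmod v \<le> 1" and C: "C \<ge> 0"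
 shows "cmod (F (x + v) - F x) \<le> 2 * C * 2 powr p * wt (-p) x * cmod v"
proof -
 have "norm (F (x + v) - F x) \<le> 2 * C * 2 powr p * wt (-p) x * norm (x + v - x)"
 proof (rule differentiable_bound[where S = "cball x 1" and f' = "\<lambda>y h. a y * h + b y * cnj h"])
  fix y assume y: "y \<in> cball x 1"
  show "(F has_derivative (\<lambda>h. a y * h + b y * cnj h)) (at y within cball x 1)"
   using F unfolding wirtinger_def by (rule has_derivative_at_withinI)
  have y': "wt (-p) y \<le> 2 powr p * wt (-p) x"
   using p y by (intro powr_decay_near) (auto simp: dist_norm)
  show "onorm (\<lambda>h. a y * h + b y * cnj h) \<le> 2 * C * 2 powr p * wt (-p) x"
  proof (rule onorm_le)
   fix h
   have "norm (a y * h + b y * cnj h) \<le> cmod (a y) * cmod h + cmod (b y) * cmod h"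
    by (metis complex_mod_cnj norm_mult norm_triangle_ineq)
   also have "... \<le> C * wt (-p) y * cmod h + C * wt (-p) y * cmod h"
    using a b by (intro add_mono mult_right_mono) auto
   also have "... = 2 * C * wt (-p) y * cmod h" by simp
   also have "... \<le> 2 * C * (2 powr p * wt (-p) x) * cmod h"
    using C y' by (intro mult_right_mono mult_left_mono) auto
   finally show "norm (a y * h + b y * cnj h) \<le>
     2 * C * 2 powr p * wt (-p) x * norm h" by (simp add: mult_ac)
  qed
 qed (use v in \<open>auto simp: dist_norm\<close>)
 thus ?thesis by simp
qed

lemma wirtinger_quotient_tendsto:
 assumes F: "wirtinger F a b x" and s: "s \<longlonglongrightarrow> 0" "\<And>n. s n \<noteq> (0::real)"
 shows "(\<lambda>n. (F (x + of_real (s n) * v) - F x) / of_real (s n)) \<longlonglongrightarrow> a * v + b * cnj v"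
proof -
 have "((\<lambda>t::real. x + of_real t * v) has_derivative (\<lambda>t. of_real t * v)) (at 0)"
 proof -
  have bl: "bounded_linear (\<lambda>t::real. of_real t * v)"
   by (rule bounded_linear_compose[OF bounded_linear_mult_left bounded_linear_of_real])
  show ?thesis
   using has_derivative_add[OF has_derivative_const[of x] bounded_linear.has_derivative[OF bl has_derivative_ident]]
   by simp
 qed
 moreover have "(F has_derivative (\<lambda>h. a * h + b * cnj h)) (at (x + of_real 0 * v))"
  using F by (simp add: wirtinger_def)
 ultimately have "((\<lambda>t. F (x + of_real t * v)) has_derivative
   (\<lambda>t. a * (of_real t * v) + b * cnj (of_real t * v))) (at 0)"
  by (rule has_derivative_compose)
 hence lim: "((\<lambda>t. norm (F (x + of_real t * v) - F (x + of_real 0 * v) -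
   (a * (of_real (t - 0) * v) + b * cnj (of_real (t - 0) * v))) / norm (t - 0)) \<longlongrightarrow> 0) (at 0)"
  unfolding has_derivative_iff_norm by (rule conjunct2)
 have "filterlim s (at 0) sequentially" using s by (simp add: filterlim_at)
 from filterlim_compose[OF lim this]
 have lim2: "(\<lambda>n. norm (F (x + of_real (s n) * v) - F (x + of_real 0 * v) -
   (a * (of_real (s n - 0) * v) + b * cnj (of_real (s n - 0) * v))) / norm (s n - 0)) \<longlonglongrightarrow> 0" .
 have gen: "cmod (P - (a * (c * v) + b * (c * w))) / cmod c = cmod (P / c - (a * v + b * w))"
  if "c \<noteq> 0" for P w c
 proof -
  have "P / c - (a * v + b * w) = (P - (a * (c * v) + b * (c * w))) / c"
   using that by (simp add: field_simps)
  thus ?thesis by (metis norm_divide)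
 qed
 have "norm (F (x + of_real (s n) * v) - F (x + of_real 0 * v) -
   (a * (of_real (s n - 0) * v) + b * cnj (of_real (s n - 0) * v))) / norm (s n - 0) =
   norm ((F (x + of_real (s n) * v) - F x) / of_real (s n) - (a * v + b * cnj v))" for n
  using gen[of "of_real (s n)" "F (x + of_real (s n) * v) - F x" "cnj v"] s(2)[of n] by simp
 hence "(\<lambda>n. norm (F (x + of_real (s n) * v) - F (x + of_real 0 * v) -
   (a * (of_real (s n - 0) * v) + b * cnj (of_real (s n - 0) * v))) / norm (s n - 0)) =
   (\<lambda>n. norm ((F (x + of_real (s n) * v) - F x) / of_real (s n) - (a * v + b * cnj v)))"
  by (rule ext)
 with lim2 have "(\<lambda>n. norm ((F (x + of_real (s n) * v) - F x) / of_real (s n) - (a * v + b * cnj v))) \<longlonglongrightarrow> 0"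
  by metis
 thus ?thesis by (rule LIM_zero_cancel[OF tendsto_norm_zero_cancel])
qed

lemma wirtinger_inverse:
 assumes "wirtinger F a b x" "F x \<noteq> 0"
 shows "wirtinger (\<lambda>x. inverse (F x)) (- a * inverse (F x) ^ 2) (- b * inverse (F x) ^ 2) x"
proof -
 have "((\<lambda>x. inverse (F x)) has_derivative (\<lambda>h. - (inverse (F x) * (a * h + b * cnj h) * inverse (F x)))) (at x)"
 proof -
  have "(F has_derivative (\<lambda>h. a * h + b * cnj h)) (at x)"
   using assms(1) by (simp only: wirtinger_def)
  thus ?thesis using assms(2) by (rule Deriv.has_derivative_inverse[rotated])
 qed
 moreover have "(\<lambda>h. - (w * (a * h + b * cnj h) * w)) = (\<lambda>h. - a * w ^ 2 * h + - b * w ^ 2 * cnj h)" for w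
  by (simp add: fun_eq_iff power2_eq_square algebra_simps)
 ultimately show ?thesis unfolding wirtinger_def by simp
qed

lemma wirtinger_id: "wirtinger (\<lambda>x. x) 1 0 x"
 by (rule wirtinger_holomorphic) simp

lemma wirtinger_reflect:
 assumes "wirtinger F a b (v - x)"
 shows "wirtinger (\<lambda>x. F (v - x)) (- a) (- b) x"
proof -
 have "((\<lambda>x. v - x) has_derivative (\<lambda>h. - h)) (at x)"
  by (auto intro!: derivative_eq_intros)
 from has_derivative_compose[OF this assms[unfolded wirtinger_def]] show ?thesis
  unfolding wirtinger_def by simp
qed

lemma integrable_decay_bound:
 fixes F :: "complex => 'b::{banach, second_countable_topology}"
 assumes "F \<in> borel_measurable borel" "p > 2"
  and "\<And>x. norm (F x) \<le> C * wt (-p) x"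
 shows "L1 F"
proof (rule B_integrable_bound)
 show "L1 (\<lambda>x::complex. C * wt (-p) x)"
  using integrable_decay[OF assms(2)] by simp
 show "AE x in lborel. norm (F x) \<le> norm (C * wt (-p) x)"
  by (intro AE_I2) (metis abs_ge_self assms(3) order_trans real_norm_def)
qed (use assms(1) in simp)

lemma integrable_decay_bound_continuous:
 fixes F :: "complex => 'b::{banach, second_countable_topology}"
 assumes "cont F" "p > 2"
  and "\<And>x. norm (F x) \<le> C * wt (-p) x"
 shows "L1 F"
 using assms by (intro integrable_decay_bound[of F p C] borel_measurable_continuous_onI)

lemma bound_nonneg:
 assumes "\<And>x. cmod (F x) \<le> C * wt (-p) x"
 shows "C \<ge> 0"
 using order_trans[OF norm_ge_zero assms[of 0]] by simp

lemma wirtinger_continuous_on: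
 assumes "\<And>x. wirtinger F (a x) (b x) x"
 shows "cont F"
 unfolding continuous_on_eq_continuous_at[OF open_UNIV] using wirtinger_continuous[OF assms] by blast

lemma wirtinger_integral_zero:
 assumes F: "\<And>x. wirtinger F (a x) (b x) x"
  and ca: "cont a" and cb: "cont b" and p: "p > 2"
  and bF: "\<And>x. cmod (F x) \<le> C * wt (-p) x"
  and ba: "\<And>x. cmod (a x) \<le> C * wt (-p) x"
  and bb: "\<And>x. cmod (b x) \<le> C * wt (-p) x"
 shows "(\<integral>x. a x) = 0" "(\<integral>x. b x) = 0"
proof -
 have cF: "cont F" by (rule wirtinger_continuous_on[OF F])
 have C: "C \<ge> 0" by (rule bound_nonneg[OF bF])
 have iF: "L1 F" and ia: "L1 a" and ib: "L1 b"
  using cF ca cb p bF ba bb by (blast intro: integrable_decay_bound_continuous)+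
 have mF: "F \<in> borel_measurable borel" by (rule borel_measurable_continuous_onI[OF cF])
 have key: "(\<integral>x. a x * v + b x * cnj v) = 0" if v: "cmod v \<le> 1" for v
 proof -
  define s where "s = (\<lambda>n. 1 / real (Suc n))"
  have s0: "s \<longlonglongrightarrow> 0" unfolding s_def by (rule LIMSEQ_inverse_real_of_nat[unfolded inverse_eq_divide])
  have s1: "s n \<noteq> 0" "\<bar>s n\<bar> \<le> 1" for n by (auto simp: s_def)
  define q where "q = (\<lambda>n x. (F (x + of_real (s n) * v) - F x) / of_real (s n))"
  have iq: "L1 (\<lambda>x. F (x + of_real (s n) * v))" for n
  proof -
   have "(\<lambda>x. F (x + of_real (s n) * v)) = (\<lambda>x. F (of_real (s n) * v + x))"
    by (simp add: add.commute)
   thus ?thesis using iF integrable_translate[of F "of_real (s n) * v"] by simp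
  qed
  have q0: "(\<integral>x. q n x) = 0" for n
  proof -
   have "(\<integral>x. q n x) =
     ((\<integral>x. F (x + of_real (s n) * v)) - (\<integral>x. F x)) / of_real (s n)"
    unfolding q_def using iq iF by (simp add: B_integral_diff)
   thus ?thesis
    using integral_translate[OF mF, of "of_real (s n) * v"] by (simp add: add.commute)
  qed
  have "(\<lambda>n. \<integral>x. q n x) \<longlonglongrightarrow> (\<integral>x. a x * v + b x * cnj v)"
  proof (rule integral_dominated_convergence[where w = "\<lambda>x. 2 * C * 2 powr p * wt (-p) x"])
   show "(\<lambda>x. a x * v + b x * cnj v) \<in> borel_measurable lborel"
    using ia ib by auto
   show "q n \<in> borel_measurable lborel" for n
    unfolding q_def using iq iF by auto
   show "L1 (\<lambda>x. 2 * C * 2 powr p * wt (-p) x)"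
    using integrable_decay[OF p] by simp
   show "AE x in lborel. (\<lambda>n. q n x) \<longlonglongrightarrow> a x * v + b x * cnj v"
    unfolding q_def using wirtinger_quotient_tendsto[OF F s0] s1 by simp
   show "AE x in lborel. norm (q n x) \<le> 2 * C * 2 powr p * wt (-p) x" for n
   proof (rule AE_I2)
    fix x
    have sv: "cmod (of_real (s n) * v) \<le> 1"
     using s1[of n] v by (simp add: norm_mult mult_le_one)
    have "cmod (F (x + of_real (s n) * v) - F x) \<le>
      2 * C * 2 powr p * wt (-p) x * cmod (of_real (s n) * v)"
     by (rule wirtinger_increment_bound[OF F ba bb _ sv C]) (use p in simp)
    also have "... \<le> 2 * C * 2 powr p * wt (-p) x * \<bar>s n\<bar>"
    proof (rule mult_left_mono)
     show "cmod (of_real (s n) * v) \<le> \<bar>s n\<bar>"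
      using v by (simp add: norm_mult mult_left_le)
    qed (use C in auto)
    finally show "norm (q n x) \<le> 2 * C * 2 powr p * wt (-p) x"
     unfolding q_def using s1[of n] by (simp add: norm_divide pos_divide_le_eq)
   qed
  qed
  thus ?thesis using q0 by (simp add: LIMSEQ_const_iff)
 qed
 have int: "(\<integral>x. a x * v + b x * cnj v) = (\<integral>x. a x) * v + (\<integral>x. b x) * cnj v" for v
  using ia ib by (simp add: B_integral_add)
 have e1: "(\<integral>x. a x) + (\<integral>x. b x) = 0"
  using key[of 1] unfolding int by simp
 have e2: "\<i> * ((\<integral>x. a x) - (\<integral>x. b x)) = 0"
  using key[of \<i>] unfolding int by (simp add: algebra_simps)
 show "(\<integral>x. a x) = 0" "(\<integral>x. b x) = 0"
  using e1 e2 by (auto simp: add_eq_0_iff)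
qed

lemma inverse_norm_decay_bound:
 assumes "p \<ge> 0"
 shows "1 / cmod z * wt (-p) (x - z) \<le>
  wt p x * (1 / cmod z * indicator (cball 0 1) z + wt (-p) z)"
proof -
 have a: "wt (-p) (x - z) \<le> wt p x * wt (-p) z"
  using powr_decay_shift[OF assms, of "x - z" "- z"] powr_decay_shift[OF assms, of "z - x" z]
  by (simp add: norm_minus_commute)
 have b: "wt (-p) z \<le> 1" using assms by (simp add: powr_minus ge_one_powr_ge_zero inverse_le_1_iff)
 have "1 / cmod z * wt (-p) z \<le>
   1 / cmod z * indicator (cball 0 1) z + wt (-p) z"
 proof (cases "cmod z \<le> 1")
  case True
  hence "1 / cmod z * wt (-p) z \<le> 1 / cmod z * indicator (cball 0 1) z"
   using b by (intro mult_left_mono) auto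
  thus ?thesis by (smt (verit) powr_ge_zero)
 next
  case False
  hence "1 / cmod z \<le> 1" by (simp add: divide_simps)
  hence "1 / cmod z * wt (-p) z \<le> 1 * wt (-p) z"
   by (intro mult_right_mono) auto
  thus ?thesis using False by simp
 qed
 hence "wt p x * (1 / cmod z * wt (-p) z) \<le>
   wt p x * (1 / cmod z * indicator (cball 0 1) z + wt (-p) z)"
  by (intro mult_left_mono) auto
 moreover have "1 / cmod z * wt (-p) (x - z) \<le> 1 / cmod z * (wt p x * wt (-p) z)"
  using a by (intro mult_left_mono) auto
 ultimately show ?thesis by (simp only: mult.left_commute)
qed

lemma integrable_inverse_norm_decay:
 assumes "p > 2"
 shows "L1 (\<lambda>z. 1 / cmod z * wt (-p) (x - z))"
proof (rule B_integrable_bound)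
 show "L1 (\<lambda>z. wt p x * (1 / cmod z * indicator (cball 0 1) z + wt (-p) z))"
  using integrable_decay[OF assms] integrable_inverse_near_zero by (intro integrable_mult_right B_integrable_add)
 show "AE z in lborel. norm (1 / cmod z * wt (-p) (x - z)) \<le>
   norm (wt p x * (1 / cmod z * indicator (cball 0 1) z + wt (-p) z))"
 proof (rule AE_I2)
  fix z
  have "norm (1 / cmod z * wt (-p) (x - z)) = 1 / cmod z * wt (-p) (x - z)"
   by simp
  also have "... \<le> wt p x * (1 / cmod z * indicator (cball 0 1) z + wt (-p) z)"
   using assms by (intro inverse_norm_decay_bound) simp
  finally show "norm (1 / cmod z * wt (-p) (x - z)) \<le>
   norm (wt p x * (1 / cmod z * indicator (cball 0 1) z + wt (-p) z))" by (rule order_trans) simp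
 qed
 have "cont (\<lambda>z. wt (-p) (x - z))"
  by (intro continuous_intros) (auto simp: add_nonneg_eq_0_iff)
 thus "(\<lambda>z. 1 / cmod z * wt (-p) (x - z)) \<in> borel_measurable lborel"
  by (auto dest!: borel_measurable_continuous_onI)
qed

section \<open>The Cauchy transform\<close>

locale cauchy_kernel =
 fixes K :: "complex => complex"
 assumes K_meas [measurable]: "K \<in> borel_measurable borel"
  and K_bound: "\<And>z. cmod (K z) \<le> 1 / cmod z"
begin

lemma bound:
 assumes "\<And>x. cmod (h x) \<le> C * wt (-p) x"
 shows "cmod (K z * h (x - z)) \<le> C * (1 / cmod z * wt (-p) (x - z))"
proof -
 have "cmod (K z * h (x - z)) \<le> 1 / cmod z * (C * wt (-p) (x - z))"
  unfolding norm_mult using K_bound assms by (intro mult_mono) auto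
 thus ?thesis by (simp only: mult.left_commute)
qed

lemma conv_integrable:
 assumes h: "cont h" "p > 2"
  and hb: "\<And>x. cmod (h x) \<le> C * wt (-p) x"
 shows "L1 (\<lambda>z. K z * h (x - z))"
proof (rule B_integrable_bound)
 show "L1 (\<lambda>z. C * (1 / cmod z * wt (-p) (x - z)))"
  using integrable_inverse_norm_decay[OF h(2)] by (rule integrable_mult_right)
 have "cont (\<lambda>z. h (x - z))"
  by (rule continuous_on_compose2[OF h(1)]) (auto intro!: continuous_intros)
 thus "(\<lambda>z. K z * h (x - z)) \<in> borel_measurable lborel"
  by (auto dest!: borel_measurable_continuous_onI)
 show "AE z in lborel. norm (K z * h (x - z)) \<le> norm (C * (1 / cmod z * wt (-p) (x - z)))"
  by (intro AE_I2) (metis abs_ge_self bound[OF hb] order_trans real_norm_def)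
qed

lemma conv_tendsto:
 fixes X :: "nat => complex"
 assumes X: "X \<longlonglongrightarrow> x" and d: "\<And>i. cmod (X i - x) \<le> 1"
  and h: "cont h" "p > 2"
  and hb: "\<And>x. cmod (h x) \<le> C * wt (-p) x"
 shows "(\<lambda>i. \<integral>z. K z * h (X i - z)) \<longlonglongrightarrow> (\<integral>z. K z * h (x - z))"
proof (rule integral_dominated_convergence[where
   w = "\<lambda>z. C * 2 powr p * (1 / cmod z * wt (-p) (x - z))"])
 show "(\<lambda>z. K z * h (x - z)) \<in> borel_measurable lborel" "(\<lambda>z. K z * h (X i - z)) \<in> borel_measurable lborel" for i
  using conv_integrable[OF h hb] by auto
 show "L1 (\<lambda>z. C * 2 powr p * (1 / cmod z * wt (-p) (x - z)))"
  using integrable_inverse_norm_decay[OF h(2)] by (rule integrable_mult_right)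
 have C: "C \<ge> 0" by (rule bound_nonneg[OF hb])
 show "AE z in lborel. norm (K z * h (X i - z)) \<le>
   C * 2 powr p * (1 / cmod z * wt (-p) (x - z))" for i
 proof (rule AE_I2)
  fix z
  have "wt (-p) (X i - z) \<le> 2 powr p * wt (-p) (x - z)"
   using d[of i] h(2) by (intro powr_decay_near) (auto simp: norm_minus_commute)
  hence "C * (1 / cmod z * wt (-p) (X i - z)) \<le>
    C * (1 / cmod z * (2 powr p * wt (-p) (x - z)))"
   using C by (intro mult_left_mono) auto
  with bound[OF hb, of z "X i"]
  show "norm (K z * h (X i - z)) \<le> C * 2 powr p * (1 / cmod z * wt (-p) (x - z))"
   by (simp add: mult_ac)
 qed
 show "AE z in lborel. (\<lambda>i. K z * h (X i - z)) \<longlonglongrightarrow> K z * h (x - z)"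
 proof (rule AE_I2)
  fix z
  have "isCont h (x - z)" using h(1) by (simp add: continuous_on_eq_continuous_at)
  hence "(\<lambda>i. h (X i - z)) \<longlonglongrightarrow> h (x - z)"
   by (rule isCont_tendsto_compose) (intro tendsto_intros X)
  thus "(\<lambda>i. K z * h (X i - z)) \<longlonglongrightarrow> K z * h (x - z)" by (intro tendsto_intros)
 qed
qed

lemma conv_continuous:
 assumes h: "cont h" "p > 2"
  and hb: "\<And>x. cmod (h x) \<le> C * wt (-p) x"
 shows "cont (\<lambda>x. \<integral>z. K z * h (x - z))"
 unfolding continuous_on_sequentially o_def
proof (intro allI ballI impI, elim conjE)
 fix X :: "nat => complex" and x assume X: "X \<longlonglongrightarrow> x"
 then obtain N where N: "\<And>i. i \<ge> N ==> cmod (X i - x) \<le> 1"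
  using LIMSEQ_iff[of X x] by (metis less_imp_le zero_less_one)
 have "(\<lambda>i. \<integral>z. K z * h (X (i + N) - z)) \<longlonglongrightarrow> (\<integral>z. K z * h (x - z))"
  using N by (intro conv_tendsto[OF LIMSEQ_ignore_initial_segment[OF X] _ h hb]) auto
 thus "(\<lambda>i. \<integral>z. K z * h (X i - z)) \<longlonglongrightarrow> (\<integral>z. K z * h (x - z))"
  by (rule LIMSEQ_offset)
qed

lemma conv_has_wirtinger:
 assumes h: "\<And>x. wirtinger h (a x) (b x) x" and p: "p > 2"
  and ca: "cont a" and cb: "cont b"
  and hb: "\<And>x. cmod (h x) \<le> C * wt (-p) x"
  and ab: "\<And>x. cmod (a x) \<le> C * wt (-p) x"
  and bb: "\<And>x. cmod (b x) \<le> C * wt (-p) x"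
 shows "wirtinger (\<lambda>x. \<integral>z. K z * h (x - z))
  (\<integral>z. K z * a (x - z)) (\<integral>z. K z * b (x - z)) x"
proof -
 let ?F = "\<lambda>x. \<integral>z. K z * h (x - z)"
 let ?A = "\<integral>z. K z * a (x - z)" and ?B = "\<integral>z. K z * b (x - z)"
 let ?R = "\<lambda>y v. h (y + v) - h y - (a y * v + b y * cnj v)"
 have C: "C \<ge> 0" by (rule bound_nonneg[OF hb])
 have ch: "cont h" by (rule wirtinger_continuous_on[OF h])
 note int = conv_integrable[OF ch p hb] conv_integrable[OF ca p ab] conv_integrable[OF cb p bb]
 have bl: "bounded_linear (\<lambda>v. ?A * v + ?B * cnj v)"
  by (intro bounded_linear_add bounded_linear_mult_right
    bounded_linear_compose[OF bounded_linear_mult_right bounded_linear_cnj])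
 have "((\<lambda>y. norm (?F y - ?F x - (?A * (y - x) + ?B * cnj (y - x))) / norm (y - x)) \<longlongrightarrow> 0) (at x)"
  unfolding tendsto_at_iff_sequentially o_def
 proof (intro allI impI)
  fix X assume "\<forall>i. X i \<in> UNIV - {x}" and X: "X \<longlonglongrightarrow> x"
  hence Xne: "X i \<noteq> x" for i by auto
  obtain N where N: "\<And>i. i \<ge> N ==> cmod (X i - x) \<le> 1"
   using X LIMSEQ_iff[of X x] by (metis less_imp_le zero_less_one)
  define v where "v = (\<lambda>i. X (i + N) - x)"
  have xX: "x + (y - x) = y" for y by simp
  have v: "v i \<noteq> 0" "cmod (v i) \<le> 1" for i using Xne N by (auto simp: v_def)
  have v0: "v \<longlonglongrightarrow> 0" unfolding v_def
   using LIMSEQ_ignore_initial_segment[OF X, of N] by (simp add: LIM_zero)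
  let ?q = "\<lambda>i z. K z * ?R (x - z) (v i) / of_real (cmod (v i))"
  have eq: "(\<integral>z. ?q i z) =
   (?F (x + v i) - ?F x - (?A * v i + ?B * cnj (v i))) / of_real (cmod (v i))" for i
  proof -
   have "?q i = (\<lambda>z. (K z * h ((x + v i) - z) - K z * h (x - z)
     - (K z * a (x - z) * v i + K z * b (x - z) * cnj (v i))) / of_real (cmod (v i)))"
    by (simp add: fun_eq_iff algebra_simps)
   thus ?thesis using int by simp
  qed
  have "(\<lambda>i. \<integral>z. ?q i z) \<longlonglongrightarrow> (\<integral>z. (0::complex) \<partial>(lborel :: complex measure))"
  proof (rule integral_dominated_convergence[where
   w = "\<lambda>z. (2 * C * 2 powr p + 2 * C) * (1 / cmod z * wt (-p) (x - z))"])
   show "L1 (\<lambda>z. (2 * C * 2 powr p + 2 * C) * (1 / cmod z * wt (-p) (x - z)))"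
    using integrable_inverse_norm_decay[OF p] by (rule integrable_mult_right)
   fix i
   have *: "?q i = (\<lambda>z. (K z * h ((x + v i) - z) - K z * h (x - z)
     - (K z * a (x - z) * v i + K z * b (x - z) * cnj (v i))) / of_real (cmod (v i)))"
    by (simp add: fun_eq_iff algebra_simps)
   show "?q i \<in> borel_measurable lborel"
    unfolding * using int[THEN borel_measurable_integrable] by measurable
   show "AE z in lborel. norm (?q i z)
    \<le> (2 * C * 2 powr p + 2 * C) * (1 / cmod z * wt (-p) (x - z))"
   proof (rule AE_I2)
    fix z
    let ?P = "wt (-p) (x - z)"
    have "cmod (?R (x - z) (v i)) \<le> cmod (h (x - z + v i) - h (x - z)) +
      (cmod (a (x - z)) * cmod (v i) + cmod (b (x - z)) * cmod (v i))"
    proof -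
     have "cmod (D - (A + B)) \<le> cmod D + (cmod A + cmod B)" for A B D
      using norm_triangle_ineq4[of D "A + B"] norm_triangle_ineq[of A B] by linarith
     from this[of "h (x - z + v i) - h (x - z)" "a (x - z) * v i" "b (x - z) * cnj (v i)"]
     show ?thesis by (simp only: norm_mult complex_mod_cnj)
    qed
    also have "... \<le> 2 * C * 2 powr p * ?P * cmod (v i) + (C * ?P * cmod (v i) + C * ?P * cmod (v i))"
     using p 
      wirtinger_increment_bound[OF h ab bb _ v(2)[of i] C, of "x - z"]
     by (intro add_mono mult_right_mono ab bb) auto
    also have "... = (2 * C * 2 powr p + 2 * C) * ?P * cmod (v i)" by (simp add: algebra_simps)
    finally have "cmod (?R (x - z) (v i)) / cmod (v i) \<le> (2 * C * 2 powr p + 2 * C) * ?P"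
     using v[of i] by (simp add: divide_le_eq)
    hence "cmod (K z) * (cmod (?R (x - z) (v i)) / cmod (v i)) \<le> 1 / cmod z * ((2 * C * 2 powr p + 2 * C) * ?P)"
     using K_bound by (intro mult_mono) auto
    thus "norm (?q i z)
     \<le> (2 * C * 2 powr p + 2 * C) * (1 / cmod z * ?P)"
     unfolding norm_mult norm_divide by (simp only: norm_of_real abs_norm_cancel times_divide_eq_right mult.left_commute)
   qed
  next
   show "AE z in lborel. (\<lambda>i. ?q i z) \<longlonglongrightarrow> 0"
   proof (rule AE_I2)
    fix z
    have "((\<lambda>y. norm (h y - h (x - z) - (a (x - z) * (y - (x - z)) + b (x - z) * cnj (y - (x - z)))) / norm (y - (x - z))) \<longlongrightarrow> 0) (at (x - z))"
     using h[of "x - z"] unfolding wirtinger_def has_derivative_iff_norm by blast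
    moreover have "filterlim (\<lambda>i. x - z + v i) (at (x - z)) sequentially"
     unfolding filterlim_at using v tendsto_add[OF tendsto_const[of "x - z"] v0] by simp
    ultimately have "(\<lambda>i. norm (h (x - z + v i) - h (x - z) - (a (x - z) * (x - z + v i - (x - z)) + b (x - z) * cnj (x - z + v i - (x - z)))) / norm (x - z + v i - (x - z))) \<longlonglongrightarrow> 0"
     by (rule filterlim_compose)
    hence "(\<lambda>i. norm (?R (x - z) (v i) / of_real (cmod (v i)))) \<longlonglongrightarrow> 0"
     unfolding add_diff_cancel_left' norm_divide norm_of_real abs_norm_cancel .
    hence "(\<lambda>i. ?R (x - z) (v i) / of_real (cmod (v i))) \<longlonglongrightarrow> 0"
     by (rule tendsto_norm_zero_cancel)
    hence "(\<lambda>i. K z * (?R (x - z) (v i) / of_real (cmod (v i)))) \<longlonglongrightarrow> K z * 0"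
     by (intro tendsto_intros)
    thus "(\<lambda>i. ?q i z) \<longlonglongrightarrow> 0"
     unfolding times_divide_eq_right mult_zero_right .
   qed
  qed auto
  hence "(\<lambda>i. (?F (x + v i) - ?F x - (?A * v i + ?B * cnj (v i))) / of_real (cmod (v i))) \<longlonglongrightarrow> 0"
   unfolding eq by simp
  hence "(\<lambda>i. norm (?F (x + v i) - ?F x - (?A * v i + ?B * cnj (v i))) / norm (v i)) \<longlonglongrightarrow> 0"
   by (drule_tac tendsto_norm_zero) (simp only: norm_divide norm_of_real abs_norm_cancel)
  hence "(\<lambda>i. norm (?F (X (i + N)) - ?F x - (?A * (X (i + N) - x) + ?B * cnj (X (i + N) - x))) / norm (X (i + N) - x)) \<longlonglongrightarrow> 0"
   unfolding v_def xX .
  thus "(\<lambda>i. norm (?F (X i) - ?F x - (?A * (X i - x) + ?B * cnj (X i - x))) / norm (X i - x)) \<longlonglongrightarrow> 0"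
   by (rule LIMSEQ_offset)
 qed
 with bl show ?thesis unfolding wirtinger_def has_derivative_iff_norm by blast
qed

end

lemma integral_scale:
 fixes F :: "complex => complex"
 assumes F: "F \<in> borel_measurable borel" and d: "d > 0"
 shows "(\<integral>x. F x) = of_real (d^2) * (\<integral>x. F (of_real d * x))"
proof -
 have "(\<integral>x. F x) = (\<integral>x. F x \<partial>density (distr lborel borel (\<lambda>x. 0 + d *\<^sub>R x)) (\<lambda>_. ennreal (\<bar>d\<bar> ^ DIM(complex))))"
  using lborel_affine[of d "0::complex"] d by simp
 also have "... = (\<integral>x. (\<bar>d\<bar> ^ DIM(complex)) *\<^sub>R F x \<partial>distr lborel borel (\<lambda>x. 0 + d *\<^sub>R x))"
  using F d by (intro integral_density) auto
 also have "... = (\<integral>x. (\<bar>d\<bar> ^ DIM(complex)) *\<^sub>R F (0 + d *\<^sub>R x))"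
  using F by (intro integral_distr) auto
 also have "... = of_real (d^2) * (\<integral>x. F (of_real d * x))"
  by (simp add: DIM_complex scaleR_conv_of_real)
 finally show ?thesis .
qed

lemma norm_integral_le:
 fixes f :: "complex => 'b::{banach, second_countable_topology}"
 assumes "L1 g" "\<And>x. norm (f x) \<le> g x"
 shows "norm (\<integral>x. f x) \<le> (\<integral>x. g x)"
proof -
 have "norm (\<integral>x. f x) \<le> (\<integral>x. norm (f x))" by (rule integral_norm_bound)
 also have "... \<le> (\<integral>x. g x)"
  by (rule integral_mono'[OF assms(1)]) (use assms(2) norm_ge_zero order_trans in blast)+
 finally show ?thesis .
qed

abbreviation poisson :: "complex => real" where "poisson s \<equiv> 1 / (1 + cmod s^2)^2"

definition poisson_mass :: real where
 "poisson_mass = (\<integral>s. poisson s)"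

lemma poisson_bound: "poisson s \<le> 4 * wt (-4) s"
proof -
 have p: "0 < 1 + cmod s" by (simp add: add_pos_nonneg)
 have "(1 + cmod s)^2 \<le> 2 * (1 + cmod s^2)"
  using zero_le_power2[of "1 - cmod s"] by (simp add: power2_eq_square algebra_simps)
 hence "((1 + cmod s)^2)^2 \<le> (2 * (1 + cmod s^2))^2"
  by (intro power_mono) auto
 moreover have "(2 * u)^2 = 4 * u^2" for u :: real by (simp add: power2_eq_square)
 moreover have "((1 + cmod s)^2)^2 = (1 + cmod s) ^ 4" by (simp flip: power_mult)
 ultimately have *: "(1 + cmod s) ^ 4 \<le> 4 * (1 + cmod s^2)^2" by (simp only:)
 have "0 < (1 + cmod s) ^ 4" using p by simp
 moreover have "wt (-4) s = 1 / (1 + cmod s) ^ 4"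
  using powr_realpow[OF p, of 4] by (simp add: powr_minus_divide)
 moreover have "0 < (1 + cmod s^2)^2"
  using zero_le_power2[of "cmod s"] by (intro zero_less_power) linarith
 moreover have "1 / Y \<le> 4 * (1 / X)" if "0 < X" "0 < Y" "X \<le> 4 * Y" for X Y :: real
  using that by (simp add: field_simps)
 ultimately show ?thesis using * by (simp only:)
qed

lemma poisson_continuous: "cont (\<lambda>s. poisson s)"
proof -
 have "1 + cmod s^2 \<noteq> 0" for s using zero_le_power2[of "cmod s"] by linarith
 note ne = this
 show ?thesis by (intro continuous_intros) (use ne in auto)
qed

lemma poisson_integrable: "L1 (\<lambda>s::complex. poisson s)"
proof (rule integrable_decay_bound_continuous[OF poisson_continuous, of 4 4])
 show "norm (poisson s) \<le> 4 * wt (- 4) s" for s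
  using poisson_bound[of s] by (simp only: real_norm_def abs_of_nonneg divide_nonneg_nonneg zero_le_one zero_le_power2)
qed simp

lemma poisson_mass_pos: "poisson_mass > 0"
proof -
 have nonneg: "0 \<le> poisson s" for s by simp
 have "poisson_mass \<noteq> 0"
 proof
  assume "poisson_mass = 0"
  hence "AE s in lborel. 1 / (1 + cmod (s::complex)^2)^2 = 0"
   unfolding poisson_mass_def using integral_nonneg_eq_0_iff_AE[OF poisson_integrable] nonneg by simp
  moreover have "poisson s \<noteq> 0" for s by (simp add: add_nonneg_eq_0_iff)
  ultimately have "AE s in (lborel :: complex measure). False" by simp
  thus False by (simp add: AE_iff_null null_sets_def)
 qed
 moreover have "poisson_mass \<ge> 0" unfolding poisson_mass_def by (rule B_integral_nonneg) simp
 ultimately show ?thesis by simp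
qed

interpretation recip: cauchy_kernel "\<lambda>z. 1 / z"
 by unfold_locales (auto simp: norm_divide)

lemma regularised_kernel:
 fixes d :: real
 assumes d: "d > 0"
 defines "D \<equiv> \<lambda>z. z * cnj z + of_real (d^2)"
 defines "k \<equiv> \<lambda>z. cnj z * inverse (D z)"
 shows "wirtinger k (- ((cnj z)^2) * inverse (D z) ^ 2) (of_real (d^2) * inverse (D z) ^ 2) z"
  and "cmod (k z) \<le> 1 / cmod z" and "cmod (k z) \<le> 1 / d"
  and "cmod (- ((cnj z)^2) * inverse (D z) ^ 2) \<le> 1 / d^2"
  and "cmod (of_real (d^2) * inverse (D z) ^ 2) \<le> 1 / d^2"
  and "D z = of_real (cmod z^2 + d^2)" and "D z \<noteq> 0"
proof -
 show Dz: "D z = of_real (cmod z^2 + d^2)" for z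
  unfolding D_def using complex_norm_square[of z] by simp
 have pos: "cmod z^2 + d^2 > 0" for z using d by (simp add: add_nonneg_pos)
 show ne: "D z \<noteq> 0" using pos[of z] unfolding Dz by (metis less_irrefl of_real_eq_0_iff)
 have "wirtinger D (cnj z) z z" unfolding D_def
  by (rule wirtinger_cong[OF wirtinger_add[OF wirtinger_mult[OF wirtinger_id
    wirtinger_cnj[OF wirtinger_id]] wirtinger_const]]) auto
 from wirtinger_mult[OF wirtinger_cnj[OF wirtinger_id] wirtinger_inverse[OF this ne]]
 show "wirtinger k (- ((cnj z)^2) * inverse (D z) ^ 2) (of_real (d^2) * inverse (D z) ^ 2) z"
  unfolding k_def
 proof (rule wirtinger_cong)
  have "cnj z * inverse (D z) * (z * inverse (D z)) + of_real (d^2) * inverse (D z) ^ 2 = (D z * inverse (D z)) * inverse (D z)"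
   unfolding D_def by (simp add: algebra_simps power2_eq_square)
  thus "cnj 1 * inverse (D z) + cnj z * (- z * (inverse (D z))^2) = complex_of_real (d^2) * (inverse (D z))^2"
   using ne by (simp add: power2_eq_square algebra_simps)
 qed (simp add: power2_eq_square)
 have nD: "cmod (D z) = cmod z^2 + d^2" unfolding Dz using pos[of z] by (simp only: norm_of_real)
 have nk: "cmod (k z) = cmod z / (cmod z^2 + d^2)"
  unfolding k_def by (simp add: norm_mult norm_inverse nD divide_inverse)
 show "cmod (k z) \<le> 1 / cmod z"
 proof (cases "z = 0")
  case False
  thus ?thesis unfolding nk using pos[of z] by (simp add: divide_simps power2_eq_square)
 qed (simp add: k_def)
 have "cmod z * d \<le> cmod z^2 + d^2"
  using zero_le_power2[of "cmod z - d"] zero_le_power2[of "cmod z"] zero_le_power2[of d]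
  unfolding power2_diff by linarith
 thus "cmod (k z) \<le> 1 / d"
  unfolding nk using pos[of z] d by (simp add: divide_simps mult.commute)
 have e: "u / (cmod z^2 + d^2)^2 \<le> 1 / d^2" if "0 \<le> u" "u \<le> cmod z^2 + d^2" for u
 proof -
  have "u / (cmod z^2 + d^2)^2 \<le> (cmod z^2 + d^2) / (cmod z^2 + d^2)^2"
   using that by (intro divide_right_mono) auto
  also have "... = 1 / (cmod z^2 + d^2)" using pos[of z] by (simp add: power2_eq_square)
  also have "... \<le> 1 / d^2" using d by (intro divide_left_mono) (auto intro!: mult_pos_pos add_nonneg_pos)
  finally show ?thesis .
 qed
 show "cmod (- ((cnj z)^2) * inverse (D z) ^ 2) \<le> 1 / d^2"
  using e[of "cmod z^2"] by (simp add: norm_mult norm_power norm_inverse nD divide_inverse power_inverse)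
 show "cmod (of_real (d^2) * inverse (D z) ^ 2) \<le> 1 / d^2"
  using e[of "d^2"] by (simp add: norm_mult norm_power norm_inverse nD divide_inverse power_inverse)
qed

lemma cauchy_transform_dbar:
 assumes h: "\<And>x. wirtinger h (a x) (b x) x" and p: "p > 2"
  and ca: "cont a" and cb: "cont b"
  and hb: "\<And>x. cmod (h x) \<le> C * wt (-p) x"
  and ab: "\<And>x. cmod (a x) \<le> C * wt (-p) x"
  and bb: "\<And>x. cmod (b x) \<le> C * wt (-p) x"
 shows "(\<integral>z. 1 / z * b (x - z)) = of_real poisson_mass * h x"
proof -
 have C: "C \<ge> 0" by (rule bound_nonneg[OF hb])
 have ch: "cont h" by (rule wirtinger_continuous_on[OF h])
 have cont_shift: "cont (\<lambda>z. f (x - z))" if "cont f" for f :: "complex => complex"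
  by (rule continuous_on_compose2[OF that]) (auto intro!: continuous_intros)
 define d where "d = (\<lambda>n. 1 / real (Suc n))"
 have d: "d n > 0" for n by (simp add: d_def)
 have d0: "d \<longlonglongrightarrow> 0" unfolding d_def by (rule LIMSEQ_inverse_real_of_nat[unfolded inverse_eq_divide])
 define D where "D = (\<lambda>n z. z * cnj z + of_real ((d n)^2))"
 define k where "k = (\<lambda>n z. cnj z * inverse (D n z))"
 define ka where "ka = (\<lambda>n z.  - ((cnj z)^2) * inverse (D n z) ^ 2)"
 define kb where "kb = (\<lambda>n z. of_real ((d n)^2) * inverse (D n z) ^ 2)"
 have Dne: "D n z \<noteq> 0" and Dz: "D n z = of_real (cmod z^2 + (d n)^2)" for n z
  unfolding D_def by (rule regularised_kernel[OF d])+
 have kw: "wirtinger (k n) (ka n z) (kb n z) z" for n z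
  unfolding k_def ka_def kb_def D_def by (rule regularised_kernel[OF d])
 have k1: "cmod (k n z) \<le> 1 / cmod z" "cmod (k n z) \<le> 1 / d n" for n z
  unfolding k_def D_def by (rule regularised_kernel[OF d])+
 have k2: "cmod (ka n z) \<le> 1 / (d n)^2" "cmod (kb n z) \<le> 1 / (d n)^2" for n z
  unfolding ka_def kb_def D_def by (rule regularised_kernel[OF d])+
 have cD: "cont (D n)" for n unfolding D_def by (intro continuous_intros)
 have ck: "cont (k n)" "cont (ka n)" "cont (kb n)" for n
  unfolding k_def ka_def kb_def using Dne by (auto intro!: continuous_intros cD)
 have kern: "cauchy_kernel (k n)" for n
  using k1 borel_measurable_continuous_onI[OF ck(1)] by unfold_locales auto
 have sb: "cmod (f (x - z)) \<le> C * wt p x * wt (-p) z"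
  if "\<And>x. cmod (f x) \<le> C * wt (-p) x" for f :: "complex => complex" and z
 proof -
  have "wt (-p) (x - z) \<le> wt p x * wt (-p) z"
   using powr_decay_shift[of p "z - x" z] p by (simp add: norm_minus_commute)
  hence "C * wt (-p) (x - z) \<le> C * (wt p x * wt (-p) z)"
   using C by (rule mult_left_mono)
  with that[of "x - z"] show ?thesis by (simp add: mult.assoc)
 qed
 have pb: "cmod (u * f (x - z)) \<le> M * (C * wt p x * wt (-p) z)"
  if "\<And>x. cmod (f x) \<le> C * wt (-p) x" "cmod u \<le> M" for f :: "complex => complex" and u z M
  unfolding norm_mult using that order_trans[OF norm_ge_zero that(2)] by (intro mult_mono sb) auto
 have zero: "(\<integral>z. kb n z * h (x - z) + k n z * (- b (x - z))) = 0" for n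
 proof (rule wirtinger_integral_zero(2)[where F = "\<lambda>z. k n z * h (x - z)" and p = p
    and a = "\<lambda>z. ka n z * h (x - z) + k n z * (- a (x - z))"
    and C = "(2 / d n + 1 / (d n)^2) * (C * wt p x)"])
  fix z
  show "wirtinger (\<lambda>z. k n z * h (x - z)) (ka n z * h (x - z) + k n z * (- a (x - z)))
    (kb n z * h (x - z) + k n z * (- b (x - z))) z"
   by (rule wirtinger_mult[OF kw wirtinger_reflect[OF h]])
  let ?Q = "C * wt p x * wt (-p) z"
  have Q: "?Q \<ge> 0" using C by simp
  have split: "(2 / d n + 1 / (d n)^2) * (C * wt p x) * wt (-p) z =
    1 / d n * ?Q + 1 / d n * ?Q + 1 / (d n)^2 * ?Q"
   by (simp add: algebra_simps)
  have nn: "1 / d n * ?Q \<ge> 0" "1 / (d n)^2 * ?Q \<ge> 0"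
   using d[of n] C by auto
  note pbs = pb[OF hb k1(2)[of n z], of z] pb[OF ab k1(2)[of n z], of z] pb[OF bb k1(2)[of n z], of z]
   pb[OF hb k2(1)[of n z], of z] pb[OF hb k2(2)[of n z], of z]
  show "cmod (k n z * h (x - z)) \<le> (2 / d n + 1 / (d n)^2) * (C * wt p x) * wt (-p) z"
   unfolding split using pbs nn by linarith
  show "cmod (ka n z * h (x - z) + k n z * (- a (x - z))) \<le> (2 / d n + 1 / (d n)^2) * (C * wt p x) * wt (-p) z"
   unfolding split using pbs nn norm_triangle_ineq[of "ka n z * h (x - z)" "k n z * (- a (x - z))"]
   by (simp add: norm_mult)
  show "cmod (kb n z * h (x - z) + k n z * (- b (x - z))) \<le> (2 / d n + 1 / (d n)^2) * (C * wt p x) * wt (-p) z"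
   unfolding split using pbs nn norm_triangle_ineq[of "kb n z * h (x - z)" "k n z * (- b (x - z))"]
   by (simp add: norm_mult)
 next
  show "cont (\<lambda>z. ka n z * h (x - z) + k n z * (- a (x - z)))"
   "cont (\<lambda>z. kb n z * h (x - z) + k n z * (- b (x - z)))"
   by (intro continuous_intros ck cont_shift ch ca cb)+
 qed (rule p)
 have int1: "L1 (\<lambda>z. kb n z * h (x - z))" for n
  by (rule integrable_decay_bound_continuous[where p = p and C = "1 / (d n)^2 * (C * wt p x)"])
   (use pb[OF hb k2(2)] p in \<open>auto intro!: continuous_intros ck cont_shift ch simp: mult.assoc\<close>)
 have int2: "L1 (\<lambda>z. k n z * b (x - z))" for n
  by (rule cauchy_kernel.conv_integrable[OF kern cb p bb])
 have eq: "(\<integral>z. kb n z * h (x - z)) = (\<integral>z. k n z * b (x - z))" for n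
  using zero[of n] int1[of n] int2[of n] by simp
 have sc: "(\<integral>z. kb n z * h (x - z)) =
   (\<integral>s. of_real (poisson s) * h (x - of_real (d n) * s))" for n
 proof -
  have "of_real ((d n)^2) * kb n (of_real (d n) * s) = of_real (poisson s)" for s
  proof -
   have "cmod (of_real (d n) * s)^2 + (d n)^2 = (d n)^2 * (1 + cmod s^2)"
    by (simp add: norm_mult power_mult_distrib algebra_simps)
   hence "of_real ((d n)^2) * kb n (of_real (d n) * s) =
     of_real ((d n)^2 * ((d n)^2 * inverse ((d n)^2 * (1 + cmod s^2)) ^ 2))"
    unfolding kb_def Dz by simp
   also have "(d n)^2 * ((d n)^2 * inverse ((d n)^2 * (1 + cmod s^2)) ^ 2) = poisson s"
   proof -
    have gen: "e * (e * inverse (e * q) ^ 2) = 1 / q^2" if "e \<noteq> 0" for e q :: real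
     using that by (simp add: power2_eq_square field_simps)
    show ?thesis by (rule gen) (use d[of n] in simp)
   qed
   finally show ?thesis .
  qed
  hence "of_real ((d n)^2) * (kb n (of_real (d n) * s) * h (x - of_real (d n) * s)) =
    of_real (poisson s) * h (x - of_real (d n) * s)" for s
   by (metis mult.assoc)
  moreover have "(\<integral>z. kb n z * h (x - z)) = of_real ((d n)^2) *
    (\<integral>s. kb n (of_real (d n) * s) * h (x - of_real (d n) * s))"
   by (rule integral_scale[OF _ d]) (use int1 in auto)
  ultimately show ?thesis
   by (simp only: integral_mult_right_zero[symmetric])
 qed
 have "(\<lambda>n. \<integral>s. of_real (poisson s) * h (x - of_real (d n) * s)) \<longlonglongrightarrow>
   (\<integral>s. of_real (poisson s) * h x)"
 proof (rule integral_dominated_convergence[where w = "\<lambda>s. C * (poisson s)"])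
  show "L1 (\<lambda>s::complex. C * (poisson s))"
   by (rule integrable_mult_right[OF poisson_integrable])
  have cp: "cont (\<lambda>s. complex_of_real (poisson s))"
   by (rule continuous_on_of_real[OF poisson_continuous])
  show "(\<lambda>s. complex_of_real (poisson s) * h x) \<in> borel_measurable lborel"
   using borel_measurable_continuous_onI[OF cp] by simp
  fix n
  have "cont (\<lambda>s. h (x - of_real (d n) * s))"
   by (rule continuous_on_compose2[OF ch]) (auto intro!: continuous_intros)
  thus "(\<lambda>s. complex_of_real (poisson s) * h (x - of_real (d n) * s)) \<in> borel_measurable lborel"
   using borel_measurable_continuous_onI[OF continuous_on_mult[OF cp]] by simp
  have "cmod (h y) \<le> C" for y
  proof -
   have "C * wt (-p) y \<le> C * 1"
    using C p powr_mono[of "-p" 0 "1 + cmod y"] by (intro mult_left_mono) (auto simp: add_nonneg_eq_0_iff)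
   thus ?thesis using hb[of y] by simp
  qed
  note hC = this
  have "cmod (of_real q * h y) \<le> C * q" if "q \<ge> 0" for q y
   using mult_left_mono[OF hC that] that by (simp add: norm_mult mult.commute)
  thus "AE s in lborel. norm (complex_of_real (poisson s) * h (x - of_real (d n) * s)) \<le>
    C * (poisson s)"
   by (blast intro: AE_I2 divide_nonneg_nonneg zero_le_one zero_le_power2)
 next
  show "AE s in lborel. (\<lambda>n. complex_of_real (poisson s) * h (x - of_real (d n) * s)) \<longlonglongrightarrow>
    complex_of_real (poisson s) * h x"
  proof (rule AE_I2)
   fix s
   have "(\<lambda>n. x - of_real (d n) * s) \<longlonglongrightarrow> x - of_real 0 * s"
    by (intro tendsto_intros d0)
   hence "(\<lambda>n. x - of_real (d n) * s) \<longlonglongrightarrow> x" by simp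
   moreover have "isCont h x" using ch by (simp add: continuous_on_eq_continuous_at)
   ultimately have "(\<lambda>n. h (x - of_real (d n) * s)) \<longlonglongrightarrow> h x" by (rule isCont_tendsto_compose[rotated])
   thus "(\<lambda>n. complex_of_real (poisson s) * h (x - of_real (d n) * s)) \<longlonglongrightarrow>
    complex_of_real (poisson s) * h x" by (intro tendsto_intros)
  qed
 qed
 moreover have "(\<integral>s. complex_of_real (poisson s) * h x) = of_real poisson_mass * h x"
  unfolding poisson_mass_def integral_mult_left_zero integral_complex_of_real ..
 ultimately have lim1: "(\<lambda>n. \<integral>z. k n z * b (x - z)) \<longlonglongrightarrow> of_real poisson_mass * h x"
  unfolding eq[symmetric] sc by simp
 have lim2: "(\<lambda>n. \<integral>z. k n z * b (x - z)) \<longlonglongrightarrow> (\<integral>z. 1 / z * b (x - z))"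
 proof (rule integral_dominated_convergence[where w = "\<lambda>z. C * (1 / cmod z * wt (-p) (x - z))"])
  show "(\<lambda>z. 1 / z * b (x - z)) \<in> borel_measurable lborel"
   by (rule borel_measurable_integrable[OF recip.conv_integrable[OF cb p bb]])
  show "(\<lambda>z. k n z * b (x - z)) \<in> borel_measurable lborel" for n
   by (rule borel_measurable_integrable[OF int2])
  show "L1 (\<lambda>z. C * (1 / cmod z * wt (-p) (x - z)))"
   by (rule integrable_mult_right[OF integrable_inverse_norm_decay[OF p]])
  show "AE z in lborel. norm (k n z * b (x - z)) \<le> C * (1 / cmod z * wt (-p) (x - z))" for n
   by (intro AE_I2 cauchy_kernel.bound[OF kern bb])
  have "AE z in lborel. z \<noteq> (0::complex)" by (rule AE_lborel_singleton)
  thus "AE z in lborel. (\<lambda>n. k n z * b (x - z)) \<longlonglongrightarrow> 1 / z * b (x - z)"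
  proof eventually_elim
   case (elim z)
   have "(\<lambda>n. k n z) \<longlonglongrightarrow> cnj z * inverse (z * cnj z + of_real (0^2))"
    unfolding k_def D_def using elim by (intro tendsto_intros d0) auto
   also have "cnj z * inverse (z * cnj z + of_real (0^2)) = 1 / z" using elim by (simp add: field_simps)
   finally show ?case by (intro tendsto_intros)
  qed
 qed
 show ?thesis by (rule LIMSEQ_unique[OF lim2 lim1])
qed

lemma decay_split:
 fixes A B X :: real
 assumes A: "A \<ge> 1" and B: "B > 0" and X: "0 \<le> X" "X \<le> A + B"
 shows "X powr (3/4) * (1 / B * A powr (-2)) \<le>
  2 * ((if B \<le> 1 then 1 / B else 0) + A powr (-9/4) + 2 powr (9/4) * (1 + B) powr (-9/4))"
proof -
 have le: "X powr (3/4) \<le> 2 * M powr (3/4)" if "X \<le> 2 * M" "M > 0" for M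
 proof -
  have "X powr (3/4) \<le> (2 * M) powr (3/4)" using X that by (intro powr_mono2) auto
  also have "... = 2 powr (3/4) * M powr (3/4)" using that by (simp add: powr_mult)
  also have "... \<le> 2 * M powr (3/4)"
   using powr_mono[of "3/4" 1 "2::real"] by (intro mult_right_mono) auto
  finally show ?thesis .
 qed
 have pos: "A powr (-9/4) \<ge> 0" "2 powr (9/4) * (1 + B) powr (-9/4) \<ge> 0" by auto
 show ?thesis
 proof (cases "B \<le> A")
  case True
  hence "X powr (3/4) * (1 / B * A powr (-2)) \<le> 2 * A powr (3/4) * (1 / B * A powr (-2))"
   using A B X by (intro mult_right_mono le) auto
  also have "... = 2 * (1 / B * A powr (-5/4))"
   using A by (simp add: powr_add[symmetric])
  finally have 1: "X powr (3/4) * (1 / B * A powr (-2)) \<le> 2 * (1 / B * A powr (-5/4))" .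
  show ?thesis
  proof (cases "B \<le> 1")
   case True
   have "A powr (-5/4) \<le> 1" using A powr_mono[of "-5/4" 0 A] by simp
   hence "1 / B * A powr (-5/4) \<le> 1 / B * 1" using B by (intro mult_left_mono) auto
   hence "2 * (1 / B * A powr (-5/4)) \<le> 2 * (1 / B)" by simp
   moreover have "2 * (1 / B) \<le> 2 * (1 / B + A powr (-9/4) + 2 powr (9/4) * (1 + B) powr (-9/4))"
    using pos by (intro mult_left_mono) auto
   ultimately show ?thesis unfolding if_P[OF True] using 1 by (meson order_trans)
  next
   case F: False
   have "1 / B * A powr (-5/4) \<le> 1 / B * B powr (-5/4)"
    using B True by (intro mult_left_mono powr_mono2') auto
   also have "... = B powr (-9/4)" using B powr_add[of B "-1" "-5/4"] by (simp add: powr_minus_divide)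
   also have "... \<le> ((1 + B) / 2) powr (-9/4)" using F by (intro powr_mono2') auto
   also have "... = 2 powr (9/4) * (1 + B) powr (-9/4)"
    using B by (simp add: powr_divide powr_minus_divide)
   finally have "2 * (1 / B * A powr (-5/4)) \<le> 2 * (2 powr (9/4) * (1 + B) powr (-9/4))" by simp
   moreover have "2 * (2 powr (9/4) * (1 + B) powr (-9/4)) \<le> 2 * (0 + A powr (-9/4) + 2 powr (9/4) * (1 + B) powr (-9/4))"
    by (intro mult_left_mono) auto
   ultimately show ?thesis unfolding if_not_P[OF F] using 1 by (meson order_trans)
  qed
 next
  case False
  hence B1: "B > 1" using A by simp
  have "X powr (3/4) * (1 / B * A powr (-2)) \<le> 2 * B powr (3/4) * (1 / B * A powr (-2))"
   using A B X False by (intro mult_right_mono le) auto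
  also have "... = 2 * (B powr (-1/4) * A powr (-2))"
   using B powr_add[of B "3/4" "-1"] by (simp add: powr_minus_divide)
  also have "... \<le> 2 * (A powr (-1/4) * A powr (-2))"
   using A False by (intro mult_left_mono mult_right_mono powr_mono2') auto
  also have "... = 2 * A powr (-9/4)" using A by (simp add: powr_add[symmetric])
  also have "... \<le> 2 * (0 + A powr (-9/4) + 2 powr (9/4) * (1 + B) powr (-9/4))"
   by (intro mult_left_mono) auto
  finally show ?thesis using B1 by (simp only: not_le[symmetric] if_False)
 qed
qed

lemma cauchy_transform_decay:
 obtains C where "C \<ge> 0"
  "\<And>x. L1 (\<lambda>z. 1 / cmod z * wt (-2) (x - z))"
  "\<And>x. (\<integral>z. 1 / cmod z * wt (-2) (x - z)) \<le> C * wt (-3/4) x"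
proof -
 define \<Phi> where "\<Phi> = (\<lambda>x z. 2 * ((1 / cmod z * indicator (cball 0 1) z) + wt (-9/4) (x - z)
   + 2 powr (9/4) * wt (-9/4) z))"
 define I where "I = (\<integral>z. 1 / cmod z * indicator (cball 0 1) z)"
 define J where "J = (\<integral>z. wt (-9/4) z)"
 have iJ: "L1 (\<lambda>z::complex. wt (-9/4) z)"
  using integrable_decay[of "9/4"] by simp
 have iJx: "L1 (\<lambda>z::complex. wt (-9/4) (x - z))" for x
  by (rule integrable_reflect[OF iJ])
 have i\<Phi>: "L1 (\<Phi> x)" for x
  unfolding \<Phi>_def using iJ iJx integrable_inverse_near_zero
  by (intro integrable_mult_right B_integrable_add) auto
 have e\<Phi>: "(\<integral>z. \<Phi> x z) = 2 * (I + J + 2 powr (9/4) * J)" for x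
 proof -
  have "(\<lambda>z::complex. wt (-9/4) z) \<in> borel_measurable borel"
   using borel_measurable_integrable[OF iJ] by simp
  hence "(\<integral>z. wt (-9/4) (x - z)) = J"
   unfolding J_def by (rule integral_reflect)
  moreover have "(\<integral>z. 2 * (f z + g z + c * k z)) = 2 * ((\<integral>z. f z) + (\<integral>z. g z) + c * (\<integral>z. k z))"
   if "L1 f" "L1 g" "L1 k" for f g k :: "complex => real" and c
   using that by simp
  ultimately show ?thesis
   unfolding \<Phi>_def I_def J_def using iJ iJx[of x] integrable_inverse_near_zero by presburger
 qed
 have I0: "I \<ge> 0" "J \<ge> 0" unfolding I_def J_def by (auto intro!: B_integral_nonneg)
 have b: "wt (3/4) x * (1 / cmod z * wt (-2) (x - z)) \<le> \<Phi> x z" for x z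
 proof (cases "z = 0")
  case False
  have "1 + cmod x \<le> 1 + cmod (x - z) + cmod z"
   using norm_triangle_ineq[of "x - z" z] by simp
  thus ?thesis
   using decay_split[of "1 + cmod (x - z)" "cmod z" "1 + cmod x"] False
   unfolding \<Phi>_def by (auto simp: indicator_def)
 qed (simp add: \<Phi>_def)
 have X: "wt (3/4) x > 0" for x by (simp add: add_pos_nonneg pos_add_strict order_less_le add_nonneg_eq_0_iff)
 have b2: "1 / cmod z * wt (-2) (x - z) \<le> wt (-3/4) x * \<Phi> x z" for x z
  using b[of x z] X[of x] by (simp add: powr_minus field_simps)
 have cont: "(\<lambda>z. 1 / cmod z * wt (-2) (x - z)) \<in> borel_measurable borel" for x
 proof -
  have "cont (\<lambda>z. wt (-2) (x - z))"
   by (intro continuous_intros) (auto simp: add_nonneg_eq_0_iff)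
  thus ?thesis by (auto dest!: borel_measurable_continuous_onI)
 qed
 have int: "L1 (\<lambda>z. 1 / cmod z * wt (-2) (x - z))" for x
 proof (rule B_integrable_bound)
  show "L1 (\<lambda>z. wt (-3/4) x * \<Phi> x z)"
   using i\<Phi> by (rule integrable_mult_right)
  show "AE z in lborel. norm (1 / cmod z * wt (-2) (x - z)) \<le> norm (wt (-3/4) x * \<Phi> x z)"
  proof (rule AE_I2)
   fix z
   have "norm (1 / cmod z * wt (-2) (x - z)) = 1 / cmod z * wt (-2) (x - z)" by simp
   also have "... \<le> norm (wt (-3/4) x * \<Phi> x z)" using b2 by (rule order_trans) simp
   finally show "norm (1 / cmod z * wt (-2) (x - z)) \<le> norm (wt (-3/4) x * \<Phi> x z)" .
  qed
 qed (use cont in simp)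
 have "(\<integral>z. 1 / cmod z * wt (-2) (x - z)) \<le>
   2 * (I + J + 2 powr (9/4) * J) * wt (-3/4) x" for x
 proof -
  have "(\<integral>z. 1 / cmod z * wt (-2) (x - z)) \<le> (\<integral>z. wt (-3/4) x * \<Phi> x z)"
   by (rule integral_mono[OF int integrable_mult_right[OF i\<Phi>] b2])
  thus ?thesis by (simp add: e\<Phi> mult.commute)
 qed
 thus ?thesis using int I0 by (intro that[of "2 * (I + J + 2 powr (9/4) * J)"]) auto
qed

lemma cauchy_transform_moments:
 fixes n :: nat
 assumes ch: "cont h"
  and hb: "\<And>x. cmod (h x) \<le> C * wt (- (real n + 2)) x"
  and n: "n > 0"
  and mom: "\<And>i. i < n ==> (\<integral>z. z ^ i * h z) = 0"
 obtains C' where "\<And>x. cmod (\<integral>z. 1 / z * h (x - z)) \<le> C' * wt (- (real n + 3/4)) x"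
proof -
 obtain C1 where C1: "C1 \<ge> 0"
  "\<And>x. L1 (\<lambda>z. 1 / cmod z * wt (-2) (x - z))"
  "\<And>x. (\<integral>z. 1 / cmod z * wt (-2) (x - z)) \<le> C1 * wt (-3/4) x"
  using cauchy_transform_decay by blast
 have C: "C \<ge> 0" by (rule bound_nonneg[OF hb])
 let ?\<beta> = "\<lambda>x. \<integral>z. 1 / z * h (x - z)"
 have pos: "1 + cmod x > 0" for x by (simp add: add_pos_nonneg)
 have pw: "cmod (y ^ i * h y) \<le> C * wt (- (real n + 2 - real i)) y" for y i
 proof -
  have "cmod (y ^ i * h y) \<le> (1 + cmod y) ^ i * (C * wt (- (real n + 2)) y)"
   unfolding norm_mult norm_power using hb by (intro mult_mono power_mono) auto
  also have "(1 + cmod y) ^ i = wt (real i) y" using pos by (simp add: powr_realpow)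
  finally show ?thesis by (simp add: mult.left_commute powr_add[symmetric] algebra_simps)
 qed
 have ci: "cont (\<lambda>y. y ^ i * h y)" for i
  by (intro continuous_intros ch)
 have ipow: "L1 (\<lambda>z. (x - z) ^ i * h (x - z))" if "i < n" for i x
  by (rule integrable_reflect, rule integrable_decay_bound_continuous[OF ci _ pw]) (use that in auto)
 have est: "cmod (\<integral>z. 1 / z * ((x - z) ^ i * h (x - z))) \<le> C * C1 * wt (-3/4) x" if "i \<le> n" for i x
 proof -
  have b: "cmod (1 / z * ((x - z) ^ i * h (x - z))) \<le> C * (1 / cmod z * wt (-2) (x - z))" for z
  proof -
   have "C * wt (- (real n + 2 - real i)) (x - z) \<le> C * wt (-2) (x - z)"
    using C that by (intro mult_left_mono powr_mono) auto
   hence "cmod ((x - z) ^ i * h (x - z)) \<le> C * wt (-2) (x - z)"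
    using pw[of "x - z" i] by linarith
   hence "1 / cmod z * cmod ((x - z) ^ i * h (x - z)) \<le> 1 / cmod z * (C * wt (-2) (x - z))"
    by (intro mult_left_mono) auto
   thus ?thesis by (simp only: norm_mult norm_divide norm_one mult.left_commute)
  qed
  have "cmod (\<integral>z. 1 / z * ((x - z) ^ i * h (x - z))) \<le> (\<integral>z. C * (1 / cmod z * wt (-2) (x - z)))"
   by (rule norm_integral_le[OF integrable_mult_right[OF C1(2)] b])
  also have "... \<le> C * (C1 * wt (-3/4) x)"
   unfolding integral_mult_right_zero by (intro mult_left_mono C1 C)
  finally show ?thesis by (simp add: mult_ac)
 qed
 have int0: "L1 (\<lambda>z. 1 / z * h (x - z))" for x
  by (rule recip.conv_integrable[OF ch _ hb]) (use n in simp)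
 have xn: "x ^ n * ?\<beta> x = (\<integral>z. 1 / z * ((x - z) ^ n * h (x - z)))" for x
 proof -
  let ?S = "\<lambda>z. \<Sum>i<n. x ^ (n - Suc i) * ((x - z) ^ i * h (x - z))"
  have iS: "L1 ?S"
   by (intro B_integrable_sum integrable_mult_right ipow) simp
  have S0: "(\<integral>z. ?S z) = 0"
  proof -
   have "(\<integral>z. (x - z) ^ i * h (x - z)) = 0" if "i < n" for i
    using integral_reflect[OF borel_measurable_continuous_onI[OF ci[of i]], of x] mom[OF that] by simp
   moreover have "(\<integral>z. ?S z) = (\<Sum>i<n. \<integral>z. x ^ (n - Suc i) * ((x - z) ^ i * h (x - z)))"
    by (intro B_integral_sum integrable_mult_right ipow) simp
   ultimately show ?thesis by simp
  qed
  have "(\<integral>z. 1 / z * ((x - z) ^ n * h (x - z))) = (\<integral>z. x ^ n * (1 / z * h (x - z)) - ?S z)"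
  proof (rule integral_cong_AE)
   have "AE z in lborel. z \<noteq> (0::complex)" by (rule AE_lborel_singleton)
   thus "AE z in lborel. 1 / z * ((x - z) ^ n * h (x - z)) = x ^ n * (1 / z * h (x - z)) - ?S z"
   proof eventually_elim
    case (elim z)
    have "(x - z) ^ n - x ^ n = ((x - z) - x) * (\<Sum>i<n. x ^ (n - Suc i) * (x - z) ^ i)"
     by (rule power_diff_sumr2)
    hence "(x - z) ^ n = x ^ n - z * (\<Sum>i<n. x ^ (n - Suc i) * (x - z) ^ i)" by (simp add: algebra_simps)
    moreover have "1 / z * ((X - z * S) * H) = X * (1 / z * H) - S * H" for X S H
     using elim by (simp add: field_simps)
    ultimately have "1 / z * ((x - z) ^ n * h (x - z)) = x ^ n * (1 / z * h (x - z)) - (\<Sum>i<n. x ^ (n - Suc i) * (x - z) ^ i) * h (x - z)"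
     by (simp only:)
    thus ?case by (simp add: sum_distrib_right mult.assoc)
   qed
   have "cont (\<lambda>z. (x - z) ^ n * h (x - z))"
    by (intro continuous_intros continuous_on_compose2[OF ch]) auto
   thus "(\<lambda>z. 1 / z * ((x - z) ^ n * h (x - z))) \<in> borel_measurable lborel"
    by (auto dest!: borel_measurable_continuous_onI)
   show "(\<lambda>z. x ^ n * (1 / z * h (x - z)) - ?S z) \<in> borel_measurable lborel"
    by (intro borel_measurable_diff borel_measurable_integrable[OF iS]
      borel_measurable_integrable[OF integrable_mult_right[OF int0]])
  qed
  also have "... = (\<integral>z. x ^ n * (1 / z * h (x - z))) - (\<integral>z. ?S z)"
   by (rule B_integral_diff[OF integrable_mult_right[OF int0] iS])
  finally show ?thesis by (simp only: S0 integral_mult_right_zero diff_zero)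
 qed
 have "cmod (?\<beta> x) \<le> 2 ^ n * (2 * (C * C1)) * wt (- (real n + 3/4)) x" for x
 proof -
  let ?P = "wt (-3/4) x"
  have "cmod (?\<beta> x) \<le> C * C1 * ?P" using est[of 0 x] by simp
  moreover have "cmod x ^ n * cmod (?\<beta> x) \<le> C * C1 * ?P"
   using est[of n x] xn[of x] by (metis norm_mult norm_power order_refl)
  ultimately have 1: "(1 + cmod x ^ n) * cmod (?\<beta> x) \<le> 2 * (C * C1) * ?P" by (simp add: algebra_simps)
  have 2: "(1 + cmod x) ^ n \<le> 2 ^ n * (1 + cmod x ^ n)"
  proof (cases "cmod x \<le> 1")
   case True
   hence "(1 + cmod x) ^ n \<le> 2 ^ n" by (intro power_mono) auto
   also have "... \<le> 2 ^ n * (1 + cmod x ^ n)" by simp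
   finally show ?thesis .
  next
   case False
   hence "(1 + cmod x) ^ n \<le> (2 * cmod x) ^ n" by (intro power_mono) auto
   also have "... \<le> 2 ^ n * (1 + cmod x ^ n)" by (simp add: power_mult_distrib)
   finally show ?thesis .
  qed
  have "(1 + cmod x) ^ n * cmod (?\<beta> x) \<le> 2 ^ n * (1 + cmod x ^ n) * cmod (?\<beta> x)"
   using 2 by (intro mult_right_mono) auto
  also have "... \<le> 2 ^ n * (2 * (C * C1) * ?P)"
   using 1 by (simp add: mult.assoc)
  finally have "wt (real n) x * cmod (?\<beta> x) \<le> 2 ^ n * (2 * (C * C1)) * ?P"
   using pos[of x] by (simp add: powr_realpow mult.assoc)
  hence "wt (- real n) x * (wt (real n) x * cmod (?\<beta> x)) \<le>
    wt (- real n) x * (2 ^ n * (2 * (C * C1)) * ?P)"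
   by (intro mult_left_mono) auto
  moreover have "wt (- real n) x * wt (real n) x = 1"
   using pos[of x] by (simp add: powr_add[symmetric])
  moreover have "wt (- real n) x * ?P = wt (- (real n + 3/4)) x"
   by (simp add: powr_add[symmetric])
  ultimately show ?thesis by (metis (no_types, lifting) mult.assoc mult.left_commute mult_1)
 qed
 thus ?thesis by (rule that)
qed

section \<open>The Bochner--Kodaira inequality\<close>

definition decays :: "(complex => complex) => bool" where
 "decays f \<longleftrightarrow> cont f \<and> (\<exists>C. \<forall>x. cmod (f x) \<le> C * wt (-3) x)"

lemma decays_continuous: "decays f ==> cont f"
 by (simp add: decays_def)

lemma decays_bound:
 assumes "decays f"
 obtains C where "C \<ge> 0" "\<And>x. cmod (f x) \<le> C * wt (-3) x"
 using assms bound_nonneg unfolding decays_def by blast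

lemma decays_integrable: "decays f ==> L1 f"
 using integrable_decay_bound_continuous[of f 3] unfolding decays_def by auto

lemma decays_add: "decays f ==> decays g ==> decays (\<lambda>x. f x + g x)"
proof -
 assume f: "decays f" and g: "decays g"
 obtain C where C: "\<And>x. cmod (f x) \<le> C * wt (-3) x" using decays_bound[OF f] by blast
 obtain D where D: "\<And>x. cmod (g x) \<le> D * wt (-3) x" using decays_bound[OF g] by blast
 have "cmod (f x + g x) \<le> (C + D) * wt (-3) x" for x
  using norm_triangle_ineq[of "f x" "g x"] C[of x] D[of x] by (simp add: distrib_right)
 thus ?thesis using f g unfolding decays_def by (auto intro!: continuous_intros)
qed

lemma decays_cmult: "decays f ==> decays (\<lambda>x. c * f x)"
proof -
 assume f: "decays f"
 obtain C where C: "\<And>x. cmod (f x) \<le> C * wt (-3) x" using decays_bound[OF f] by blast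
 have "cmod (c * f x) \<le> (cmod c * C) * wt (-3) x" for x
  using mult_left_mono[OF C[of x] norm_ge_zero[of c]] by (simp add: norm_mult mult.assoc)
 thus ?thesis using f unfolding decays_def by (auto intro!: continuous_intros)
qed

lemma decays_diff: "decays f ==> decays g ==> decays (\<lambda>x. f x - g x)"
 using decays_add[of f "\<lambda>x. (-1) * g x"] decays_cmult[of g "-1"] by simp

lemma decays_mult: "decays f ==> decays g ==> decays (\<lambda>x. f x * g x)"
proof -
 assume f: "decays f" and g: "decays g"
 obtain C where C: "C \<ge> 0" "\<And>x. cmod (f x) \<le> C * wt (-3) x" using decays_bound[OF f] by blast
 obtain D where D: "D \<ge> 0" "\<And>x. cmod (g x) \<le> D * wt (-3) x" using decays_bound[OF g] by blast
 have "cmod (f x * g x) \<le> (C * D) * wt (-3) x" for x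
 proof -
  have "wt (-3) x \<le> 1" using powr_mono[of "-3" 0 "1 + cmod x"] by (simp add: add_nonneg_eq_0_iff)
  hence "D * wt (-3) x \<le> D * 1" using D by (intro mult_left_mono)
  hence "cmod (g x) \<le> D" using D(2)[of x] by simp
  hence "cmod (f x) * cmod (g x) \<le> (C * wt (-3) x) * D"
   using C by (intro mult_mono) auto
  thus ?thesis by (simp add: norm_mult mult_ac)
 qed
 thus ?thesis using f g unfolding decays_def by (auto intro!: continuous_intros)
qed

lemma decays_translate: "decays f ==> decays (\<lambda>x. f (x + v))"
proof -
 assume f: "decays f"
 obtain C where C: "C \<ge> 0" "\<And>x. cmod (f x) \<le> C * wt (-3) x" using decays_bound[OF f] by blast
 have "cmod (f (x + v)) \<le> (C * wt 3 v) * wt (-3) x" for x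
 proof -
  have "wt (-3) (x + v) \<le> wt 3 v * wt (-3) x"
   using powr_decay_shift[of 3 "x + v" x] by (simp add: norm_minus_commute)
  from mult_left_mono[OF this C(1)] C(2)[of "x + v"] show ?thesis by (simp add: mult.assoc)
 qed
 moreover have "cont (\<lambda>x. f (x + v))"
  by (rule continuous_on_compose2[OF decays_continuous[OF f]]) (auto intro!: continuous_intros)
 ultimately show ?thesis unfolding decays_def by blast
qed

lemma decays_compact_support:
 assumes f: "cont f" and R: "\<And>x. cmod x > R ==> f x = 0"
 shows "decays f"
proof -
 have "continuous_on (cball 0 R) (\<lambda>x. cmod (f x) * wt 3 x)"
  by (intro continuous_intros continuous_on_subset[OF f]) (auto simp: add_nonneg_eq_0_iff)
 hence "compact ((\<lambda>x. cmod (f x) * wt 3 x) ` cball 0 R)"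
  by (intro compact_continuous_image) auto
 then obtain B where B: "\<And>x. x \<in> cball 0 R ==> cmod (f x) * wt 3 x \<le> B"
 proof -
  assume a: "\<And>B. (\<And>x. x \<in> cball 0 R ==> cmod (f x) * wt 3 x \<le> B) ==> thesis"
  obtain B where "\<forall>y\<in>(\<lambda>x. cmod (f x) * wt 3 x) ` cball 0 R. norm y \<le> B"
   using compact_imp_bounded[OF \<open>compact _\<close>] unfolding bounded_iff by blast
  hence "cmod (f x) * wt 3 x \<le> B" if "x \<in> cball 0 R" for x using that by force
  thus thesis by (rule a)
 qed
 have "cmod (f x) \<le> max 0 B * wt (-3) x" for x
 proof (cases "cmod x \<le> R")
  case True
  hence "cmod (f x) * wt 3 x \<le> max 0 B" using B[of x] by simp
  hence "cmod (f x) * wt 3 x * wt (-3) x \<le> max 0 B * wt (-3) x"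
   by (rule mult_right_mono) simp
  moreover have "wt 3 x * wt (-3) x = 1"
   by (subst powr_add[symmetric]) (simp add: add_nonneg_eq_0_iff)
  ultimately show ?thesis by (simp only: mult.assoc mult_1_right)
 next
  case False
  thus ?thesis using R[of x] by simp
 qed
 thus ?thesis using f unfolding decays_def by blast
qed

lemma decays_stokes:
 assumes "\<And>x. wirtinger F (a x) (b x) x" "decays F" "decays a" "decays b"
 shows "(\<integral>x. a x) = 0" "(\<integral>x. b x) = 0"
proof -
 obtain C where C: "C \<ge> 0" "\<And>x. cmod (F x) \<le> C * wt (-3) x" using decays_bound[OF assms(2)] by blast
 obtain A where A: "A \<ge> 0" "\<And>x. cmod (a x) \<le> A * wt (-3) x" using decays_bound[OF assms(3)] by blast
 obtain B where B: "B \<ge> 0" "\<And>x. cmod (b x) \<le> B * wt (-3) x" using decays_bound[OF assms(4)] by blast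
 have m: "M * wt (-3) x \<le> (C + A + B) * wt (-3) x" if "M \<le> C + A + B" for M x
  using that by (intro mult_right_mono) auto
 show "(\<integral>x. a x) = 0" "(\<integral>x. b x) = 0"
  by (rule wirtinger_integral_zero[OF assms(1) decays_continuous[OF assms(3)] decays_continuous[OF assms(4)], of 3 "C + A + B"];
   use order_trans[OF C(2) m] order_trans[OF A(2) m] order_trans[OF B(2) m] A(1) B(1) C(1) in auto)+
qed

lemma quotient_integral_tendsto:
 assumes A: "\<And>x. wirtinger A (A1 x) (A2 x) x" and dA: "decays A" "decays A1" "decays A2"
  and G: "decays G" and s: "s \<longlonglongrightarrow> 0" "\<And>n. s n \<noteq> 0" "\<And>n. \<bar>s n\<bar> \<le> 1" and v: "cmod v \<le> 1"
 shows "(\<lambda>n. \<integral>x. G x * ((A (x + of_real (s n) * v) - A x) / of_real (s n))) \<longlonglongrightarrow>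
   (\<integral>x. G x * (A1 x * v + A2 x * cnj v))"
proof -
 obtain C1 where C1: "C1 \<ge> 0" "\<And>x. cmod (A1 x) \<le> C1 * wt (-3) x" using decays_bound[OF dA(2)] by blast
 obtain C2 where C2: "C2 \<ge> 0" "\<And>x. cmod (A2 x) \<le> C2 * wt (-3) x" using decays_bound[OF dA(3)] by blast
 define C where "C = C1 + C2"
 have C: "C \<ge> 0" using C1 C2 by (simp add: C_def)
 have b1: "cmod (A1 x) \<le> C * wt (-3) x" for x
  using C1(2)[of x] C2(1) by (simp add: C_def distrib_right add_increasing2)
 have b2: "cmod (A2 x) \<le> C * wt (-3) x" for x
  using C2(2)[of x] C1(1) by (simp add: C_def distrib_right add_increasing)
 show ?thesis
 proof (rule integral_dominated_convergence[where w = "\<lambda>x. 2 * C * 2 powr 3 * cmod (G x)"])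
  show "L1 (\<lambda>x. 2 * C * 2 powr 3 * cmod (G x))"
   by (intro integrable_mult_right integrable_norm decays_integrable G)
  show "(\<lambda>x. G x * (A1 x * v + A2 x * cnj v)) \<in> borel_measurable lborel"
   using decays_integrable[OF G] decays_integrable[OF dA(2)] decays_integrable[OF dA(3)] by measurable
  show "(\<lambda>x. G x * ((A (x + of_real (s n) * v) - A x) / of_real (s n))) \<in> borel_measurable lborel" for n
   using decays_integrable[OF G] decays_integrable[OF decays_translate[OF dA(1)]] decays_integrable[OF dA(1)] by measurable
  show "AE x in lborel. (\<lambda>n. G x * ((A (x + of_real (s n) * v) - A x) / of_real (s n))) \<longlonglongrightarrow>
    G x * (A1 x * v + A2 x * cnj v)"
   by (intro AE_I2 tendsto_intros wirtinger_quotient_tendsto A s)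
  show "AE x in lborel. norm (G x * ((A (x + of_real (s n) * v) - A x) / of_real (s n))) \<le> 2 * C * 2 powr 3 * cmod (G x)" for n
  proof (rule AE_I2)
   fix x
   have sv: "cmod (of_real (s n) * v) \<le> \<bar>s n\<bar>"
    using v by (simp add: norm_mult mult_left_le)
   have "cmod (A (x + of_real (s n) * v) - A x) \<le> 2 * C * 2 powr 3 * wt (-3) x * cmod (of_real (s n) * v)"
    using wirtinger_increment_bound[OF A b1 b2 _ _ C] sv s(3)[of n] by simp
   also have "... \<le> 2 * C * 2 powr 3 * 1 * \<bar>s n\<bar>"
    using sv C powr_mono[of "-3" 0 "1 + cmod x"] by (intro mult_mono) (auto simp: add_nonneg_eq_0_iff)
   finally have "cmod (A (x + of_real (s n) * v) - A x) / \<bar>s n\<bar> \<le> 2 * C * 2 powr 3"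
    using s(2)[of n] by (simp add: divide_le_eq)
   hence "cmod (G x) * (cmod (A (x + of_real (s n) * v) - A x) / \<bar>s n\<bar>) \<le> cmod (G x) * (2 * C * 2 powr 3)"
    by (rule mult_left_mono) simp
   thus "norm (G x * ((A (x + of_real (s n) * v) - A x) / of_real (s n))) \<le> 2 * C * 2 powr 3 * cmod (G x)"
    by (simp only: norm_mult norm_divide norm_of_real mult.commute)
  qed
 qed
qed

lemma jacobian_symmetry_direction:
 assumes A: "\<And>x. wirtinger A (A1 x) (A2 x) x" and dA: "decays A" "decays A1" "decays A2"
  and B: "\<And>x. wirtinger B (B1 x) (B2 x) x" and dB: "decays B" "decays B1" "decays B2"
  and v: "cmod v \<le> 1"
 shows "(\<integral>x. (A1 x * u + A2 x * cnj u) * (B1 x * v + B2 x * cnj v)) =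
     (\<integral>x. (B1 x * u + B2 x * cnj u) * (A1 x * v + A2 x * cnj v))"
proof -
 define s where "s = (\<lambda>n. 1 / real (Suc n))"
 have s0: "s \<longlonglongrightarrow> 0" unfolding s_def by (rule LIMSEQ_inverse_real_of_nat[unfolded inverse_eq_divide])
 have s1: "s n \<noteq> 0" "\<bar>s n\<bar> \<le> 1" for n by (auto simp: s_def)
 define DA where "DA = (\<lambda>x. A1 x * u + A2 x * cnj u)"
 define DB where "DB = (\<lambda>x. B1 x * u + B2 x * cnj u)"
 have dDA: "decays DA" unfolding DA_def using decays_add[OF decays_cmult[OF dA(2), of u] decays_cmult[OF dA(3), of "cnj u"]]
  by (simp add: mult.commute)
 have dDB: "decays DB" unfolding DB_def using decays_add[OF decays_cmult[OF dB(2), of u] decays_cmult[OF dB(3), of "cnj u"]]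
  by (simp add: mult.commute)
 define Q where "Q = (\<lambda>n (f::complex => complex) x. (f (x + of_real (s n) * v) - f x) / of_real (s n))"
 have dQ: "decays (Q n f)" if "decays f" for n f
  using decays_cmult[OF decays_diff[OF decays_translate[OF that, of "of_real (s n) * v"] that], of "1 / of_real (s n)"]
  unfolding Q_def by simp
 have wQ: "wirtinger (Q n B) (Q n B1 x) (Q n B2 x) x" for n x
 proof -
  have t: "((\<lambda>x. x + of_real (s n) * v) has_derivative (\<lambda>h. h)) (at x)"
   using has_derivative_add[OF has_derivative_ident has_derivative_const[of "of_real (s n) * v"]] by simp
  have "wirtinger (\<lambda>x. B (x + of_real (s n) * v)) (B1 (x + of_real (s n) * v)) (B2 (x + of_real (s n) * v)) x"
   using has_derivative_compose[OF t B[unfolded wirtinger_def]] unfolding wirtinger_def .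
  from wirtinger_mult[OF wirtinger_diff[OF this B] wirtinger_const[of "1 / of_real (s n)"]]
  show ?thesis unfolding Q_def by simp
 qed
 have eq: "(\<integral>x. DA x * Q n B x) = (\<integral>x. DB x * ((A (x + of_real (- s n) * v) - A x) / of_real (- s n)))" for n
 proof -
  have w: "wirtinger (\<lambda>x. A x * Q n B x) (A1 x * Q n B x + A x * Q n B1 x) (A2 x * Q n B x + A x * Q n B2 x) x" for x
   by (rule wirtinger_mult[OF A wQ])
  note d = decays_mult[OF dA(1) dQ[OF dB(1)]] decays_add[OF decays_mult[OF dA(2) dQ[OF dB(1)]] decays_mult[OF dA(1) dQ[OF dB(2)]]]
    decays_add[OF decays_mult[OF dA(3) dQ[OF dB(1)]] decays_mult[OF dA(1) dQ[OF dB(3)]]]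
  note st = decays_stokes[OF w d]
  have "(\<integral>x. u * (A1 x * Q n B x + A x * Q n B1 x) + cnj u * (A2 x * Q n B x + A x * Q n B2 x)) = 0"
   using st decays_integrable[OF d(2)] decays_integrable[OF d(3)] by (simp del: distrib_left)
  moreover have "u * (A1 x * Q n B x + A x * Q n B1 x) + cnj u * (A2 x * Q n B x + A x * Q n B2 x) =
    DA x * Q n B x + A x * Q n DB x" for x
   unfolding DA_def DB_def Q_def by (simp add: add_divide_distrib diff_divide_distrib algebra_simps)
  ultimately have "(\<integral>x. DA x * Q n B x + A x * Q n DB x) = 0" by simp
  moreover have i: "L1 (\<lambda>x. DA x * Q n B x)" "L1 (\<lambda>x. A x * Q n DB x)"
   by (intro decays_integrable decays_mult dDA dQ dB dA dDB)+
  ultimately have 1: "(\<integral>x. DA x * Q n B x) = - (\<integral>x. A x * Q n DB x)"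
   by (simp add: eq_neg_iff_add_eq_0)
  let ?w = "of_real (s n) * v"
  have i2: "L1 (\<lambda>x. A x * DB (x + ?w))" "L1 (\<lambda>x. A x * DB x)"
    "L1 (\<lambda>x. A (x - ?w) * DB x)"
   using decays_integrable[OF decays_mult[OF dA(1) decays_translate[OF dDB]]] decays_integrable[OF decays_mult[OF dA(1) dDB]]
    decays_integrable[OF decays_mult[OF decays_translate[OF dA(1), of "- ?w"] dDB]] by auto
  have "(\<integral>x. A x * DB (x + ?w)) = (\<integral>x. A (x - ?w) * DB x)"
  proof -
   have "(\<integral>x. A ((- ?w + x)) * DB ((- ?w + x) + ?w)) = (\<integral>x. A x * DB (x + ?w))"
    using integral_translate[of "\<lambda>x. A x * DB (x + ?w)" "- ?w"] borel_measurable_integrable[OF i2(1)] by simp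
   moreover have "A ((- ?w + x)) * DB ((- ?w + x) + ?w) = A (x - ?w) * DB x" for x by simp
   ultimately show ?thesis by simp
  qed
  hence "- (\<integral>x. A x * Q n DB x) = - (((\<integral>x. A (x - ?w) * DB x) - (\<integral>x. A x * DB x)) / of_real (s n))"
   unfolding Q_def using i2 by (simp add: right_diff_distrib)
  also have "... = (\<integral>x. (A (x - ?w) * DB x - A x * DB x) / of_real (- s n))"
   using i2 by simp
  also have "... = (\<integral>x. DB x * ((A (x + of_real (- s n) * v) - A x) / of_real (- s n)))"
   by (intro Bochner_Integration.integral_cong) (auto simp: algebra_simps)
  finally show ?thesis using 1 by simp
 qed
 have l1: "(\<lambda>n. \<integral>x. DA x * Q n B x) \<longlonglongrightarrow> (\<integral>x. DA x * (B1 x * v + B2 x * cnj v))"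
  unfolding Q_def by (rule quotient_integral_tendsto[OF B dB dDA s0 s1 v])
 have l2: "(\<lambda>n. \<integral>x. DB x * ((A (x + of_real (- s n) * v) - A x) / of_real (- s n))) \<longlonglongrightarrow>
   (\<integral>x. DB x * (A1 x * v + A2 x * cnj v))"
  by (rule quotient_integral_tendsto[OF A dA dDB _ _ _ v]) (use s0 s1 tendsto_minus[OF s0] in auto)
 show ?thesis using LIMSEQ_unique[OF l1 l2[folded eq]] unfolding DA_def DB_def .
qed

lemma jacobian_symmetry:
 assumes A: "\<And>x. wirtinger A (A1 x) (A2 x) x" and dA: "decays A" "decays A1" "decays A2"
  and B: "\<And>x. wirtinger B (B1 x) (B2 x) x" and dB: "decays B" "decays B1" "decays B2"
 shows "(\<integral>x. A1 x * B2 x) = (\<integral>x. A2 x * B1 x)"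
proof -
 note i = decays_integrable[OF decays_mult[OF dA(2) dB(2)]] decays_integrable[OF decays_mult[OF dA(2) dB(3)]]
  decays_integrable[OF decays_mult[OF dA(3) dB(2)]] decays_integrable[OF decays_mult[OF dA(3) dB(3)]]
 have "(\<integral>x. (A1 x + A2 x) * (\<i> * (B1 x - B2 x))) = (\<integral>x. (B1 x + B2 x) * (\<i> * (A1 x - A2 x)))"
  using jacobian_symmetry_direction[OF A dA B dB, of \<i> 1] by (simp add: algebra_simps)
 moreover have "(A1 x + A2 x) * (\<i> * (B1 x - B2 x)) = \<i> * (A1 x * B1 x - A1 x * B2 x + A2 x * B1 x - A2 x * B2 x)" for x
  by (simp add: algebra_simps)
 moreover have "(B1 x + B2 x) * (\<i> * (A1 x - A2 x)) = \<i> * (A1 x * B1 x + A1 x * B2 x - A2 x * B1 x - A2 x * B2 x)" for x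
  by (simp add: algebra_simps)
 moreover have "(\<integral>x. \<i> * (A1 x * B1 x - A1 x * B2 x + A2 x * B1 x - A2 x * B2 x)) =
   \<i> * ((\<integral>x. A1 x * B1 x) - (\<integral>x. A1 x * B2 x) + (\<integral>x. A2 x * B1 x) - (\<integral>x. A2 x * B2 x))"
  using i by simp
 moreover have "(\<integral>x. \<i> * (A1 x * B1 x + A1 x * B2 x - A2 x * B1 x - A2 x * B2 x)) =
   \<i> * ((\<integral>x. A1 x * B1 x) + (\<integral>x. A1 x * B2 x) - (\<integral>x. A2 x * B1 x) - (\<integral>x. A2 x * B2 x))"
  using i by simp
 ultimately have "\<i> * ((\<integral>x. A1 x * B1 x) - (\<integral>x. A1 x * B2 x) + (\<integral>x. A2 x * B1 x) - (\<integral>x. A2 x * B2 x)) =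
  \<i> * ((\<integral>x. A1 x * B1 x) + (\<integral>x. A1 x * B2 x) - (\<integral>x. A2 x * B1 x) - (\<integral>x. A2 x * B2 x))"
  by (simp only:)
 thus ?thesis by (simp add: algebra_simps)
qed

lemma bochner_kodaira:
 fixes V l :: "complex => real"
 assumes V: "\<And>x. wirtinger (\<lambda>x. of_real (V x)) (v x) (cnj (v x)) x" and Vpos: "\<And>x. V x > 0"
  and v: "\<And>x. wirtinger v (w x) (of_real (l x)) x" and cw: "cont w" and cl: "cont l"
  and g: "\<And>x. wirtinger g (g1 x) (g2 x) x" and cg: "cont g1" "cont g2"
  and supp: "\<And>x. cmod x > R ==> g x = 0 \<and> g1 x = 0 \<and> g2 x = 0"
 shows "(\<integral>x. (l x - cmod (v x)^2 / V x) * cmod (g x)^2) \<le> (\<integral>x. V x * cmod (g2 x)^2)"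
proof -
 let ?V = "\<lambda>x. complex_of_real (V x)"
 have cont: "cont g" "cont ?V" "cont v"
  by (rule wirtinger_continuous_on[OF g] wirtinger_continuous_on[OF V] wirtinger_continuous_on[OF v])+
 have cVr: "cont V" using continuous_on_Re[OF cont(2)] by simp
 have cs: "decays (\<lambda>x. F x)" if "cont F" "\<And>x. g x = 0 ==> g1 x = 0 ==> g2 x = 0 ==> F x = 0" for F
  using that supp by (intro decays_compact_support[of F R]) auto
 note ci = continuous_intros cont cg cw cl
 have wA: "wirtinger (\<lambda>x. cnj (g x)) (cnj (g2 x)) (cnj (g1 x)) x" for x by (rule wirtinger_cnj[OF g])
 have wB: "wirtinger (\<lambda>x. ?V x * g x) (v x * g x + ?V x * g1 x) (cnj (v x) * g x + ?V x * g2 x) x" for x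
  by (rule wirtinger_mult[OF V g])
 have J: "(\<integral>x. cnj (g2 x) * (cnj (v x) * g x + ?V x * g2 x)) = (\<integral>x. cnj (g1 x) * (v x * g x + ?V x * g1 x))"
  by (rule jacobian_symmetry[OF wA _ _ _ wB]) (rule cs; (intro ci)?; simp)+
 have wS: "wirtinger (\<lambda>x. cnj (v x) * (g x * cnj (g x)))
   (of_real (l x) * (g x * cnj (g x)) + cnj (v x) * (g1 x * cnj (g x) + g x * cnj (g2 x)))
   (cnj (w x) * (g x * cnj (g x)) + cnj (v x) * (g2 x * cnj (g x) + g x * cnj (g1 x))) x" for x
  using wirtinger_mult[OF wirtinger_cnj[OF v] wirtinger_mult[OF g wirtinger_cnj[OF g]]] by simp
 have S: "(\<integral>x. of_real (l x) * (g x * cnj (g x)) + cnj (v x) * (g1 x * cnj (g x) + g x * cnj (g2 x))) = 0"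
  by (rule decays_stokes(1)[OF wS]) (rule cs; (intro ci)?; simp)+
 define F1 where "F1 = (\<lambda>x. cnj (g2 x) * (cnj (v x) * g x + ?V x * g2 x))"
 define F2 where "F2 = (\<lambda>x. cnj (g1 x) * (v x * g x + ?V x * g1 x))"
 define F3 where "F3 = (\<lambda>x. of_real (l x) * (g x * cnj (g x)) + cnj (v x) * (g1 x * cnj (g x) + g x * cnj (g2 x)))"
 have i: "L1 F1" "L1 F2" "L1 F3"
  unfolding F1_def F2_def F3_def by (rule decays_integrable, rule cs; (intro ci)?; simp)+
 have dK: "decays (\<lambda>x. of_real ((l x - cmod (v x)^2 / V x) * cmod (g x)^2))"
 proof (rule cs)
  have "V x \<noteq> 0" for x using Vpos[of x] by simp
  thus "cont (\<lambda>x. complex_of_real ((l x - cmod (v x)^2 / V x) * cmod (g x)^2))"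
   by (intro ci cVr) auto
 qed simp
 have dV: "decays (\<lambda>x. of_real (V x * cmod (g2 x)^2))"
  by (rule cs) (intro ci cVr | simp)+
 have iK: "L1 (\<lambda>x. (l x - cmod (v x)^2 / V x) * cmod (g x)^2)"
  using integrable_Re[OF decays_integrable[OF dK]] by simp
 have iV: "L1 (\<lambda>x. V x * cmod (g2 x)^2)"
  using integrable_Re[OF decays_integrable[OF dV]] by simp
 have pw: "(l x - cmod (v x)^2 / V x) * cmod (g x)^2 + Re (F1 x - F2 x - F3 x) \<le> V x * cmod (g2 x)^2" for x
 proof -
  have n: "of_real (cmod z^2) = z * cnj z" for z using complex_norm_square[of z] by simp
  have "0 \<le> cmod (?V x * g1 x + v x * g x)^2 / V x" using Vpos[of x] by simp
  also have "cmod (?V x * g1 x + v x * g x)^2 / V x =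
    Re (?V x * g1 x * cnj (g1 x) + v x * g x * cnj (g1 x) + g1 x * cnj (v x) * cnj (g x)) + cmod (v x)^2 / V x * cmod (g x)^2"
  proof -
   have "complex_of_real (cmod (?V x * g1 x + v x * g x)^2 / V x) =
    (?V x * g1 x + v x * g x) * cnj (?V x * g1 x + v x * g x) / ?V x" by (simp only: of_real_divide n)
   also have "... = ?V x * g1 x * cnj (g1 x) + v x * g x * cnj (g1 x) + g1 x * cnj (v x) * cnj (g x) + (v x * cnj (v x)) / ?V x * (g x * cnj (g x))"
    using Vpos[of x] by (simp add: field_simps)
   also have "(v x * cnj (v x)) / ?V x * (g x * cnj (g x)) = complex_of_real (cmod (v x)^2 / V x * cmod (g x)^2)"
    by (simp only: of_real_mult of_real_divide n)
   finally show ?thesis by (metis Re_complex_of_real plus_complex.simps(1))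
  qed
  finally have "0 \<le> Re (?V x * g1 x * cnj (g1 x) + v x * g x * cnj (g1 x) + g1 x * cnj (v x) * cnj (g x)) + cmod (v x)^2 / V x * cmod (g x)^2" .
  moreover have "Re (F1 x - F2 x - F3 x) = V x * cmod (g2 x)^2 - l x * cmod (g x)^2 -
    Re (?V x * g1 x * cnj (g1 x) + v x * g x * cnj (g1 x) + g1 x * cnj (v x) * cnj (g x))"
  proof -
   have "F1 x - F2 x - F3 x = of_real (V x * cmod (g2 x)^2 - l x * cmod (g x)^2) -
    (?V x * g1 x * cnj (g1 x) + v x * g x * cnj (g1 x) + g1 x * cnj (v x) * cnj (g x))"
    unfolding F1_def F2_def F3_def of_real_diff of_real_mult n by (simp add: algebra_simps)
   thus ?thesis by (metis Re_complex_of_real minus_complex.simps(1))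
  qed
  ultimately show ?thesis by (simp add: algebra_simps)
 qed
 have "(\<integral>x. (l x - cmod (v x)^2 / V x) * cmod (g x)^2 + Re (F1 x - F2 x - F3 x)) \<le> (\<integral>x. V x * cmod (g2 x)^2)"
  by (rule integral_mono[OF _ iV pw]) (intro B_integrable_add iK integrable_Re B_integrable_diff i)
 moreover have "(\<integral>x. Re (F1 x - F2 x - F3 x)) = 0"
 proof -
  have "(\<integral>x. Re (F1 x - F2 x - F3 x)) = Re (\<integral>x. F1 x - F2 x - F3 x)"
   by (rule integral_Re) (intro B_integrable_diff i)
  also have "(\<integral>x. F1 x - F2 x - F3 x) = (\<integral>x. F1 x) - (\<integral>x. F2 x) - (\<integral>x. F3 x)"
   using i by simp
  also have "... = 0" using J S unfolding F1_def F2_def F3_def by simp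
  finally show ?thesis by simp
 qed
 moreover have "L1 (\<lambda>x. Re (F1 x - F2 x - F3 x))"
  by (intro integrable_Re B_integrable_diff i)
 ultimately show ?thesis using iK by simp
qed

section \<open>Hoermander's estimate\<close>

text \<open>The cutoff is squared to make it continuously differentiable across the circle.\<close>

definition cutoff :: "real => complex => real" where
 "cutoff R x = (max 0 (1 - cmod x^2 / R^2))^2"

definition cutoff_deriv :: "real => complex => complex" where
 "cutoff_deriv R x = - 2 * of_real (max 0 (1 - cmod x^2 / R^2)) * x / of_real (R^2)"

lemma max_zero_square_deriv: "((\<lambda>t::real. (max 0 t)^2) has_real_derivative 2 * max 0 t) (at t)"
proof (cases "t = 0")
 case False
 then consider "t > 0" | "t < 0" by linarith
 thus ?thesis
 proof cases
  case 1
  have "((\<lambda>t::real. t^2) has_real_derivative 2 * t) (at t)" by (auto intro!: derivative_eq_intros)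
  moreover have "\<forall>\<^sub>F u in nhds t. u^2 = (max 0 u)^2"
   using eventually_nhds_in_open[of "{0<..}" t] 1 by (auto elim!: eventually_mono)
  ultimately show ?thesis using 1 DERIV_cong_ev[OF refl, of "\<lambda>t. t^2" "\<lambda>t. (max 0 t)^2" t] by simp
 next
  case 2
  have "((\<lambda>t::real. 0) has_real_derivative 0) (at t)" by simp
  moreover have "\<forall>\<^sub>F u in nhds t. (0::real) = (max 0 u)^2"
   using eventually_nhds_in_open[of "{..<0}" t] 2 by (auto elim!: eventually_mono)
  ultimately show ?thesis using 2 DERIV_cong_ev[OF refl, of "\<lambda>t. 0" "\<lambda>t. (max 0 t)^2" t 0 0] by simp
 qed
next
 case True
 have "((\<lambda>h. ((max 0 (0 + h))^2 - (max 0 0)^2) / h) \<longlongrightarrow> (0::real)) (at 0)"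
 proof (rule Lim_null_comparison)
  show "\<forall>\<^sub>F h::real in at 0. norm (((max 0 (0 + h))^2 - (max 0 0)^2) / h) \<le> \<bar>h\<bar>"
   by (intro always_eventually) (auto simp: max_def power2_eq_square)
  show "((\<lambda>h::real. \<bar>h\<bar>) \<longlongrightarrow> 0) (at 0)"
   by (rule tendsto_rabs_zero) simp
 qed
 thus ?thesis unfolding DERIV_def using True by simp
qed

lemma cutoff_wirtinger:
 assumes "R > 0"
 shows "wirtinger (\<lambda>x. of_real (cutoff R x)) (cnj (cutoff_deriv R x)) (cutoff_deriv R x) x"
proof -
 have "wirtinger (\<lambda>x. 1 - of_real (1 / R^2) * (x * cnj x)) (- of_real (1 / R^2) * cnj x) (- of_real (1 / R^2) * x) x"
  by (rule wirtinger_cong[OF wirtinger_diff[OF wirtinger_const wirtinger_mult[OF wirtinger_const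
     wirtinger_mult[OF wirtinger_id wirtinger_cnj[OF wirtinger_id]]]]]) auto
 moreover have "1 - of_real (1 / R^2) * (x * cnj x) = complex_of_real (1 - cmod x^2 / R^2)" for x
  using complex_norm_square[of x] by simp
 hence "(\<lambda>x. 1 - of_real (1 / R^2) * (x * cnj x)) = (\<lambda>x. complex_of_real (1 - cmod x^2 / R^2))"
  by (rule ext)
 moreover have "cnj (- of_real (1 / R^2) * cnj x) = - of_real (1 / R^2) * x" by simp
 ultimately have 1: "wirtinger (\<lambda>x. complex_of_real (1 - cmod x^2 / R^2)) (- of_real (1 / R^2) * cnj x) (cnj (- of_real (1 / R^2) * cnj x)) x"
  by (simp only:)
 show ?thesis
  using wirtinger_real_comp[OF 1 max_zero_square_deriv] unfolding cutoff_def
  by (rule wirtinger_cong) (auto simp: cutoff_deriv_def)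
qed

lemma cutoff_facts:
 assumes R: "R > 0"
 shows "0 \<le> cutoff R x" "cutoff R x \<le> 1" "cmod x > R ==> cutoff R x = 0" "cmod x > R ==> cutoff_deriv R x = 0"
  "cmod (cutoff_deriv R x) \<le> 2 / R" "cont (cutoff_deriv R)"
proof -
 have m: "0 \<le> max 0 (1 - cmod x^2 / R^2)" "max 0 (1 - cmod x^2 / R^2) \<le> 1" by auto
 show "0 \<le> cutoff R x" "cutoff R x \<le> 1" unfolding cutoff_def using m by (auto intro: power_le_one)
 have z: "max 0 (1 - cmod x^2 / R^2) = 0" if "cmod x > R"
 proof -
  have "R^2 \<le> cmod x^2" using that R by (intro power_mono) auto
  thus ?thesis using R by (simp add: field_simps)
 qed
 show z1: "cmod x > R ==> cutoff R x = 0" "cmod x > R ==> cutoff_deriv R x = 0"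
  using z by (auto simp: cutoff_def cutoff_deriv_def)
 show "cmod (cutoff_deriv R x) \<le> 2 / R"
 proof (cases "cmod x > R")
  case False
  have "cmod (cutoff_deriv R x) = 2 * max 0 (1 - cmod x^2 / R^2) * cmod x / R^2"
   unfolding cutoff_deriv_def using R m(1) by (simp add: norm_mult norm_divide norm_power)
  also have "... \<le> 2 * 1 * R / R^2"
   using m False R by (intro divide_right_mono mult_mono) auto
  also have "... = 2 / R" using R by (simp add: power2_eq_square)
  finally show ?thesis .
 qed (use z1 R in simp)
 show "cont (cutoff_deriv R)"
  unfolding cutoff_deriv_def[abs_def] using R by (intro continuous_intros) auto
qed

lemma cutoff_tendsto: "(\<lambda>n. cutoff (real (Suc n)) x) \<longlonglongrightarrow> 1"
proof -
 have "(\<lambda>n. (max 0 (1 - cmod x^2 * (inverse (real (Suc n)))^2))^2) \<longlonglongrightarrow> (max 0 (1 - cmod x^2 * 0^2))^2"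
  by (intro tendsto_intros LIMSEQ_inverse_real_of_nat)
 thus ?thesis unfolding cutoff_def by (simp add: divide_inverse power_inverse)
qed

lemma hormander_estimate:
 fixes V l S :: "complex => real" and n :: nat
 assumes V: "\<And>x. wirtinger (\<lambda>x. of_real (V x)) (v x) (cnj (v x)) x" and Vpos: "\<And>x. V x > 0"
  and v: "\<And>x. wirtinger v (v1 x) (of_real (l x)) x" and cv1: "cont v1" and cl: "cont l"
  and Vb: "\<And>x. V x \<le> CV * wt (2 * real n + 1) x"
  and kpos: "\<And>x. 0 \<le> l x - cmod (v x)^2 / V x"
  and w: "\<And>x. wirtinger w (w1 x) (w2 x) x" and cw: "cont w1" "cont w2"
  and h: "\<And>x. wirtinger (\<lambda>x. cnj (w x) / of_real (V x)) (h1 x) (h2 x) x" and ch: "cont h1" "cont h2"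
  and hb: "\<And>x. cmod (cnj (w x) / of_real (V x)) \<le> C * wt (- (real n + 2)) x"
  and h1b: "\<And>x. cmod (h1 x) \<le> C * wt (- (real n + 2)) x"
  and h2b: "\<And>x. cmod (h2 x) \<le> C * wt (- (real n + 2)) x"
  and n: "n > 0"
  and mom: "\<And>i. i < n ==> (\<integral>z. z ^ i * (cnj (w z) / of_real (V z))) = 0"
  and S: "\<And>x. cmod (w2 x)^2 \<le> (l x - cmod (v x)^2 / V x) * S x" and S0: "\<And>x. 0 \<le> S x" and iS: "L1 S"
 shows "L1 (\<lambda>x. cmod (w x)^2 / V x)"
  and "(\<integral>x. cmod (w x)^2 / V x) \<le> (\<integral>x. S x)"
proof -
 define h where "h = (\<lambda>x. cnj (w x) / of_real (V x))"
 define k where "k = (\<lambda>x. l x - cmod (v x)^2 / V x)"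
 define \<beta> where "\<beta> = (\<lambda>x. of_real (1 / poisson_mass) * (\<integral>z. 1 / z * h (x - z)))"
 define \<beta>1 where "\<beta>1 = (\<lambda>x. of_real (1 / poisson_mass) * (\<integral>z. 1 / z * h1 (x - z)))"
 have pm: "poisson_mass > 0" by (rule poisson_mass_pos)
 have p2: "real n + 2 > 2" using n by simp
 have hw: "wirtinger h (h1 x) (h2 x) x" for x unfolding h_def by (rule h)
 have hb': "cmod (h x) \<le> C * wt (- (real n + 2)) x" for x unfolding h_def by (rule hb)
 have C: "C \<ge> 0" by (rule bound_nonneg[OF hb'])
 have ch0: "cont h" by (rule wirtinger_continuous_on[OF hw])
 have cw0: "cont w" by (rule wirtinger_continuous_on[OF w])
 have cv: "cont v" by (rule wirtinger_continuous_on[OF v])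
 have cV: "cont V" using continuous_on_Re[OF wirtinger_continuous_on[OF V]] by simp
 have Vne: "V x \<noteq> 0" for x using Vpos[of x] by simp
 have \<beta>w: "wirtinger \<beta> (\<beta>1 x) (h x) x" for x
 proof -
  have "wirtinger \<beta> (of_real (1 / poisson_mass) * (\<integral>z. 1 / z * h1 (x - z)))
    (of_real (1 / poisson_mass) * (\<integral>z. 1 / z * h2 (x - z))) x"
   using wirtinger_mult[OF wirtinger_const recip.conv_has_wirtinger[OF hw p2 ch hb' h1b h2b], of "of_real (1 / poisson_mass)"]
   unfolding \<beta>_def by simp
  moreover have "of_real (1 / poisson_mass) * (\<integral>z. 1 / z * h2 (x - z)) = h x"
   using cauchy_transform_dbar[OF hw p2 ch hb' h1b h2b] pm by simp
  ultimately show ?thesis unfolding \<beta>1_def by simp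
 qed
 have c\<beta>: "cont \<beta>" by (rule wirtinger_continuous_on[OF \<beta>w])
 have c\<beta>1: "cont \<beta>1" unfolding \<beta>1_def
  by (intro continuous_intros recip.conv_continuous[OF ch(1) p2 h1b])
 obtain B where B: "\<And>x. cmod (\<beta> x) \<le> B * wt (- (real n + 3/4)) x"
 proof -
  have mom': "(\<integral>z. z ^ i * h z) = 0" if "i < n" for i
   unfolding h_def by (rule mom[OF that])
  obtain B' where B': "\<And>x. cmod (\<integral>z. 1 / z * h (x - z)) \<le> B' * wt (- (real n + 3/4)) x"
   using cauchy_transform_moments[OF ch0 hb' n mom'] by blast
  have "cmod (\<beta> x) \<le> (1 / poisson_mass * B') * wt (- (real n + 3/4)) x" for x
   using mult_left_mono[OF B'[of x], of "1 / poisson_mass"] pm unfolding \<beta>_def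
   by (simp add: norm_mult norm_divide)
  thus ?thesis by (rule that)
 qed
 have B0: "B \<ge> 0" using order_trans[OF norm_ge_zero B[of 0]] by simp
 have CV0: "CV \<ge> 0" using order_trans[OF less_imp_le[OF Vpos] Vb[of 0]] by simp
 have pos: "1 + cmod x > 0" for x by (simp add: add_pos_nonneg)
 have wh: "cmod (w x)^2 / V x = V x * cmod (h x)^2" for x
  unfolding h_def using Vpos[of x] by (simp add: norm_divide power2_eq_square)
 have Nb: "cmod (w x)^2 / V x \<le> (CV * C^2) * wt (-3) x" for x
 proof -
  have "V x * cmod (h x)^2 \<le> (CV * wt (2 * real n + 1) x) * (C * wt (- (real n + 2)) x)^2"
   using hb'[of x] Vb[of x] Vpos[of x] CV0 by (intro mult_mono power_mono) auto
  also have "(C * wt (- (real n + 2)) x)^2 = C^2 * wt (- 2 * real n - 4) x"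
   by (simp add: power_mult_distrib power2_eq_square powr_add[symmetric])
  also have "(CV * wt (2 * real n + 1) x) * (C^2 * wt (- 2 * real n - 4) x) =
    (CV * C^2) * (wt (2 * real n + 1) x * wt (- 2 * real n - 4) x)" by simp
  also have "wt (2 * real n + 1) x * wt (- 2 * real n - 4) x = wt (-3) x"
   by (subst powr_add[symmetric]) simp
  finally show ?thesis unfolding wh .
 qed
 have V\<beta>: "V x * cmod (\<beta> x)^2 \<le> (CV * B^2) * wt (-1/2) x" for x
 proof -
  have "V x * cmod (\<beta> x)^2 \<le> (CV * wt (2 * real n + 1) x) * (B * wt (- (real n + 3/4)) x)^2"
   using B[of x] Vb[of x] Vpos[of x] CV0 by (intro mult_mono power_mono) auto
  also have "(B * wt (- (real n + 3/4)) x)^2 = B^2 * wt (- 2 * real n - 3/2) x"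
   by (simp add: power_mult_distrib power2_eq_square powr_add[symmetric])
  also have "(CV * wt (2 * real n + 1) x) * (B^2 * wt (- 2 * real n - 3/2) x) =
    (CV * B^2) * (wt (2 * real n + 1) x * wt (- 2 * real n - 3/2) x)" by simp
  also have "wt (2 * real n + 1) x * wt (- 2 * real n - 3/2) x = wt (-1/2) x"
   by (subst powr_add[symmetric]) simp
  finally show ?thesis .
 qed
 define N where "N = (\<lambda>x. cmod (w x)^2 / V x)"
 have cN: "cont N" unfolding N_def using Vne by (intro continuous_intros cw0 cV) auto
 have N0: "N x \<ge> 0" for x unfolding N_def using Vpos[of x] by simp
 have NbN: "N x \<le> (CV * C^2) * wt (-3) x" for x unfolding N_def by (rule Nb)
 have iN: "L1 N"
  by (rule integrable_decay_bound_continuous[OF cN, of 3 "CV * C^2"]) (use NbN N0 in auto)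
 thus "L1 (\<lambda>x. cmod (w x)^2 / V x)" unfolding N_def .
 let ?E = "\<lambda>R x. V x * cmod (cutoff_deriv R x * \<beta> x)^2"
 let ?\<chi> = "\<lambda>R x. complex_of_real (cutoff R x)"
 let ?IS = "\<integral>x. S x" and ?IN = "\<integral>x. N x" and ?IE = "\<lambda>R. \<integral>x. ?E R x"
 have key: "(\<integral>x. cutoff R x * N x) \<le> ?IS / 2 + (1 + 3 * \<eta>) / 2 * ?IN
   + (1 / 2 + 1 / \<eta>) * ?IE R" if R: "R > 0" and \<eta>: "\<eta> > 0" for R \<eta>
 proof -
  define g where "g = (\<lambda>x. ?\<chi> R x * \<beta> x)"
  define g1 where "g1 = (\<lambda>x. cnj (cutoff_deriv R x) * \<beta> x + ?\<chi> R x * \<beta>1 x)"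
  define g2 where "g2 = (\<lambda>x. cutoff_deriv R x * \<beta> x + ?\<chi> R x * h x)"
  note cR = cutoff_facts[OF R]
  have gw: "wirtinger g (g1 x) (g2 x) x" for x
   unfolding g_def g1_def g2_def by (rule wirtinger_mult[OF cutoff_wirtinger[OF R] \<beta>w])
  have c\<chi>: "cont (?\<chi> R)" by (rule wirtinger_continuous_on[OF cutoff_wirtinger[OF R]])
  have c\<chi>r: "cont (cutoff R)" using continuous_on_Re[OF c\<chi>] by simp
  note ci = continuous_intros c\<chi> c\<chi>r c\<beta> c\<beta>1 cR(6) ch0 cw0 cw cV cv cl
  have cg: "cont g" "cont g1" "cont g2"
   unfolding g_def g1_def g2_def by (intro ci)+
  have supp: "g x = 0 \<and> g1 x = 0 \<and> g2 x = 0" if "cmod x > R" for x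
   unfolding g_def g1_def g2_def using cR(3,4)[OF that] by simp
  have cs: "decays (\<lambda>x. F x)" if "cont F" "\<And>x. cmod x > R ==> F x = 0" for F
   using that by (intro decays_compact_support[of F R]) auto
  have csr: "L1 F" if "cont F" "\<And>x. cmod x > R ==> F x = 0" for F :: "complex => real"
   using integrable_Re[OF decays_integrable[OF cs[of "\<lambda>x. of_real (F x)"]]] that by (simp add: continuous_on_of_real)
  have bk: "(\<integral>x. k x * cmod (g x)^2) \<le> (\<integral>x. V x * cmod (g2 x)^2)"
   unfolding k_def by (rule bochner_kodaira[OF V Vpos v cv1 cl gw cg(2,3) supp])
  have iE: "L1 (?E R)" by (rule csr) (use cR(4) in \<open>auto intro!: ci\<close>)
  have i\<chi>N: "L1 (\<lambda>x. cutoff R x * N x)" by (rule csr) (use cR(3) in \<open>auto intro!: ci cN\<close>)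
  have ik: "L1 (\<lambda>x. k x * cmod (g x)^2)"
   unfolding k_def by (rule csr) (use supp Vne in \<open>auto intro!: ci cg\<close>)
  have ig2: "L1 (\<lambda>x. V x * cmod (g2 x)^2)" by (rule csr) (use supp in \<open>auto intro!: ci cg\<close>)
  have b2: "(\<integral>x. V x * cmod (g2 x)^2) \<le> (1 + \<eta>) * ?IN + (1 + 1 / \<eta>) * ?IE R"
  proof -
   have pw: "V x * cmod (g2 x)^2 \<le> (1 + \<eta>) * N x + (1 + 1 / \<eta>) * ?E R x" for x
   proof -
    let ?a = "cmod (cutoff_deriv R x * \<beta> x)" and ?b = "cmod (h x)"
    have "cmod (g2 x) \<le> ?a + cmod (?\<chi> R x * h x)" unfolding g2_def by (rule norm_triangle_ineq)
    also have "cmod (?\<chi> R x * h x) \<le> ?b"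
     unfolding norm_mult using cR(1,2)[of x] by (simp add: mult_left_le_one_le)
    finally have "cmod (g2 x)^2 \<le> (?a + ?b)^2" by (intro power_mono) auto
    also have "... \<le> (1 + \<eta>) * ?b^2 + (1 + 1 / \<eta>) * ?a^2"
    proof -
     have "2 * a * b \<le> \<eta> * b^2 + 1 / \<eta> * a^2" for a b :: real
     proof -
      have "0 \<le> (\<eta> * b - a)^2 / \<eta>" using \<eta> by simp
      also have "... = \<eta> * b^2 + 1 / \<eta> * a^2 - 2 * a * b" using \<eta> by (simp add: field_simps power2_eq_square)
      finally show ?thesis by simp
     qed
     from this[of ?a ?b] show ?thesis by (simp add: power2_sum algebra_simps)
    qed
    finally have "V x * cmod (g2 x)^2 \<le> V x * ((1 + \<eta>) * ?b^2 + (1 + 1 / \<eta>) * ?a^2)"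
     using Vpos[of x] by (intro mult_left_mono) auto
    also have "... = (1 + \<eta>) * (V x * ?b^2) + (1 + 1 / \<eta>) * ?E R x" by (simp add: algebra_simps)
    finally show ?thesis unfolding N_def wh .
   qed
   have "(\<integral>x. V x * cmod (g2 x)^2) \<le> (\<integral>x. (1 + \<eta>) * N x + (1 + 1 / \<eta>) * ?E R x)"
    by (rule integral_mono[OF ig2 _ pw]) (intro B_integrable_add integrable_mult_right iN iE)
   also have "... = (1 + \<eta>) * ?IN + (1 + 1 / \<eta>) * ?IE R"
    by (subst B_integral_add) (simp_all only: integrable_mult_right iN iE integral_mult_right_zero)
   finally show ?thesis .
  qed
  have ww: "wirtinger (\<lambda>x. w x * g x) (w1 x * g x + w x * g1 x) (w2 x * g x + w x * g2 x) x" for x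
   by (rule wirtinger_mult[OF w gw])
  have dw2: "decays (\<lambda>x. w2 x * g x + w x * g2 x)" by (rule cs) (use supp in \<open>auto intro!: ci cg\<close>)
  have st: "(\<integral>x. w2 x * g x + w x * g2 x) = 0"
   by (rule decays_stokes(2)[OF ww _ _ dw2]; rule cs; use supp in \<open>auto intro!: ci cg\<close>)
  have pw: "cutoff R x * N x - Re (w2 x * g x + w x * g2 x) \<le> S x / 2 + k x * cmod (g x)^2 / 2 + (\<eta> * N x + 1 / (4 * \<eta>) * ?E R x)" for x
  proof -
   have e: "w x * (?\<chi> R x * h x) = of_real (cutoff R x * N x)"
   proof -
    have "w x * (?\<chi> R x * h x) = of_real (cutoff R x) * (w x * cnj (w x)) / of_real (V x)" unfolding h_def by simp
    also have "w x * cnj (w x) = of_real (cmod (w x)^2)" using complex_norm_square[of "w x"] by simp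
    finally show ?thesis unfolding N_def by simp
   qed
   have "cutoff R x * N x - Re (w2 x * g x + w x * g2 x) = - Re (w2 x * g x) - Re (w x * (cutoff_deriv R x * \<beta> x))"
   proof -
    have "w2 x * g x + w x * g2 x = w2 x * g x + w x * (cutoff_deriv R x * \<beta> x) + of_real (cutoff R x * N x)"
     unfolding g2_def e[symmetric] by (simp add: algebra_simps)
    hence "Re (w2 x * g x + w x * g2 x) = Re (w2 x * g x) + Re (w x * (cutoff_deriv R x * \<beta> x)) + cutoff R x * N x"
     by (simp only: plus_complex.simps Re_complex_of_real)
    thus ?thesis by linarith
   qed
   also have "... \<le> cmod (w2 x * g x) + cmod (w x * (cutoff_deriv R x * \<beta> x))"
    using abs_Re_le_cmod[of "w2 x * g x"] abs_Re_le_cmod[of "w x * (cutoff_deriv R x * \<beta> x)"] by linarith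
   also have "cmod (w2 x * g x) \<le> S x / 2 + k x * cmod (g x)^2 / 2"
   proof -
    have "cmod (w2 x) \<le> sqrt (k x * S x)" using S[of x] unfolding k_def by (simp add: real_le_rsqrt)
    hence "cmod (w2 x * g x) \<le> sqrt (k x * S x) * cmod (g x)" unfolding norm_mult by (intro mult_right_mono) auto
    also have "... = sqrt (S x) * sqrt (k x * cmod (g x)^2)" by (simp add: real_sqrt_mult)
    also have "... \<le> S x / 2 + k x * cmod (g x)^2 / 2"
    proof -
     have "sqrt (S x * (k x * cmod (g x)^2)) \<le> (S x + k x * cmod (g x)^2) / 2"
     proof (rule arith_geo_mean_sqrt[OF S0])
      have "0 \<le> k x" unfolding k_def by (rule kpos)
      thus "0 \<le> k x * cmod (g x)^2" by simp
     qed
     thus ?thesis by (simp only: real_sqrt_mult add_divide_distrib)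
    qed
    finally show ?thesis .
   qed
   also have "cmod (w x * (cutoff_deriv R x * \<beta> x)) \<le> \<eta> * N x + 1 / (4 * \<eta>) * ?E R x"
   proof -
    have am: "a * b \<le> \<eta> * (a^2 / u) + 1 / (4 * \<eta>) * (u * b^2)" if "u > 0" for a b u :: real
    proof -
     have "0 \<le> (2 * \<eta> * a - u * b)^2 / (4 * \<eta> * u)" using \<eta> that by simp
     also have "... = \<eta> * (a^2 / u) + 1 / (4 * \<eta>) * (u * b^2) - a * b" using \<eta> that by (simp add: field_simps power2_eq_square)
     finally show ?thesis by simp
    qed
    show ?thesis unfolding norm_mult[of "w x"] N_def by (rule am[OF Vpos])
   qed
   finally show ?thesis by simp
  qed
  have iRe: "L1 (\<lambda>x. Re (w2 x * g x + w x * g2 x))" by (rule integrable_Re[OF decays_integrable[OF dw2]])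
  have Re0: "(\<integral>x. Re (w2 x * g x + w x * g2 x)) = 0"
   using integral_Re[OF decays_integrable[OF dw2]] st by simp
  have "(\<integral>x. cutoff R x * N x) = (\<integral>x. cutoff R x * N x - Re (w2 x * g x + w x * g2 x))"
   using Re0 by (subst B_integral_diff[OF i\<chi>N iRe]) simp
  also have "... \<le> (\<integral>x. S x / 2 + k x * cmod (g x)^2 / 2 + (\<eta> * N x + 1 / (4 * \<eta>) * ?E R x))"
   by (rule integral_mono[OF B_integrable_diff[OF i\<chi>N iRe] _ pw])
    (intro B_integrable_add integrable_divide integrable_mult_right iS ik iN iE)
  also have "... = ?IS / 2 + (\<integral>x. k x * cmod (g x)^2) / 2 + (\<eta> * ?IN + 1 / (4 * \<eta>) * ?IE R)"
  proof -
   have "(\<integral>x. a x / 2 + b x / 2 + (\<eta> * c x + 1 / (4 * \<eta>) * d x)) = (\<integral>x. a x) / 2 + (\<integral>x. b x) / 2 + (\<eta> * (\<integral>x. c x) + 1 / (4 * \<eta>) * (\<integral>x. d x))"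
    if "L1 a" "L1 b" "L1 c" "L1 d" for a b c d :: "complex => real"
    using that by simp
   from this[OF iS ik iN iE] show ?thesis .
  qed
  also have "... \<le> ?IS / 2 + ((1 + \<eta>) * ?IN + (1 + 1 / \<eta>) * ?IE R) / 2 + (\<eta> * ?IN + 1 / (4 * \<eta>) * ?IE R)"
   using bk b2 by simp
  also have "... \<le> ?IS / 2 + (1 + 3 * \<eta>) / 2 * ?IN + (1 / 2 + 1 / \<eta>) * ?IE R"
  proof -
   have "0 \<le> ?IE R" using Vpos by (intro B_integral_nonneg) (simp add: less_imp_le)
   moreover have "(1 + 1 / \<eta>) / 2 + 1 / (4 * \<eta>) \<le> 1 / 2 + 1 / \<eta>" using \<eta> by (simp add: field_simps)
   ultimately have "((1 + 1 / \<eta>) / 2 + 1 / (4 * \<eta>)) * ?IE R \<le> (1 / 2 + 1 / \<eta>) * ?IE R" by (rule mult_right_mono[rotated])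
   moreover have "s / 2 + ((1 + \<eta>) * m + (1 + u) * e) / 2 + (\<eta> * m + t * e) = s / 2 + (1 + 3 * \<eta>) / 2 * m + ((1 + u) / 2 + t) * e" for s m e u t
    by (simp add: field_simps)
   ultimately show ?thesis by (simp only: add_le_cancel_left)
  qed
  finally show ?thesis .
 qed
 define I where "I = (\<integral>z. wt (-9/4) z)"
 have iI: "L1 (\<lambda>z::complex. wt (-9/4) z)" using integrable_decay[of "9/4"] by simp
 have I0: "I \<ge> 0" unfolding I_def by (rule B_integral_nonneg) simp
 have E: "?IE R \<le> 4 / R^2 * (CV * B^2 * (1 + R) powr (7/4)) * I" if R: "R > 0" for R
 proof -
  have pw: "?E R x \<le> 4 / R^2 * (CV * B^2 * (1 + R) powr (7/4)) * wt (-9/4) x" for x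
  proof (cases "cmod x > R")
   case True
   thus ?thesis using cutoff_facts(4)[OF R True] CV0 by simp
  next
   case False
   have "?E R x = cmod (cutoff_deriv R x)^2 * (V x * cmod (\<beta> x)^2)" by (simp add: norm_mult power_mult_distrib)
   also have "... \<le> (2 / R)^2 * ((CV * B^2) * wt (-1/2) x)"
    by (rule mult_mono[OF power_mono[OF cutoff_facts(5)[OF R]] V\<beta>]) (use Vpos[of x] in auto)
   also have "... = 4 / R^2 * (CV * B^2) * (wt (7/4) x * wt (-9/4) x)"
    by (subst powr_add[symmetric]) (simp add: power_divide)
   also have "... \<le> 4 / R^2 * (CV * B^2) * ((1 + R) powr (7/4) * wt (-9/4) x)"
    using False CV0 by (intro mult_left_mono mult_right_mono powr_mono2) auto
   finally show ?thesis by (simp only: mult.assoc)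
  qed
  have "?IE R \<le> (\<integral>x. 4 / R^2 * (CV * B^2 * (1 + R) powr (7/4)) * wt (-9/4) x)"
   by (rule integral_mono'[OF integrable_mult_right[OF iI] pw]) (use CV0 in simp)
  thus ?thesis unfolding I_def integral_mult_right_zero .
 qed
 have E0: "0 \<le> ?IE R" for R
  using Vpos by (intro B_integral_nonneg) (simp add: less_imp_le)
 have Elim: "(\<lambda>n. \<integral>x. ?E (real (Suc n)) x) \<longlonglongrightarrow> 0"
 proof (rule tendsto_sandwich[OF _ _ tendsto_const])
  show "\<forall>\<^sub>F n in sequentially. 0 \<le> ?IE (real (Suc n))" using E0 by simp
  define K where "K = 4 * (CV * B^2 * 2 powr (7/4)) * I"
  have "?IE R \<le> K * R powr (-1/4)" if R: "R \<ge> 1" for R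
  proof -
   have "(1 + R) powr (7/4) \<le> (2 * R) powr (7/4)" using R by (intro powr_mono2) auto
   also have "... = 2 powr (7/4) * R powr (7/4)" using R by (simp add: powr_mult)
   finally have "4 / R^2 * (CV * B^2 * (1 + R) powr (7/4)) * I \<le> 4 / R^2 * (CV * B^2 * (2 powr (7/4) * R powr (7/4))) * I"
    using CV0 I0 by (intro mult_right_mono mult_left_mono) auto
   also have "... = K * (R powr (7/4) / R^2)" unfolding K_def by simp
   also have "R powr (7/4) / R^2 = R powr (7/4) * R powr (-2)"
    using R powr_realpow[of R 2] by (simp add: powr_minus_divide)
   also have "... = R powr (-1/4)" by (subst powr_add[symmetric]) simp
   finally show ?thesis using E[of R] R by linarith
  qed
  thus "\<forall>\<^sub>F n in sequentially. ?IE (real (Suc n)) \<le> K * real (Suc n) powr (-1/4)" by simp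
  have "filterlim (\<lambda>n. real (Suc n)) at_top sequentially"
   by (rule filterlim_compose[OF filterlim_real_sequentially filterlim_Suc])
  hence "(\<lambda>n. real (Suc n) powr (-1/4)) \<longlonglongrightarrow> 0" by (intro tendsto_neg_powr) auto
  thus "(\<lambda>n. K * real (Suc n) powr (-1/4)) \<longlonglongrightarrow> 0" by (rule tendsto_mult_right_zero)
 qed
 have lim: "(\<lambda>n. \<integral>x. cutoff (real (Suc n)) x * N x) \<longlonglongrightarrow> ?IN"
 proof (rule integral_dominated_convergence[where w = N])
  show "N \<in> borel_measurable lborel" "L1 N" using iN by auto
  fix n
  have "cont (\<lambda>x. complex_of_real (cutoff (real (Suc n)) x))"
   by (rule wirtinger_continuous_on[OF cutoff_wirtinger]) simp
  hence "cont (cutoff (real (Suc n)))" using continuous_on_Re by fastforce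
  thus "(\<lambda>x. cutoff (real (Suc n)) x * N x) \<in> borel_measurable lborel"
   using borel_measurable_continuous_onI iN by (intro borel_measurable_times) auto
  show "AE x in lborel. norm (cutoff (real (Suc n)) x * N x) \<le> N x"
   using cutoff_facts(1,2)[of "real (Suc n)"] N0 by (intro AE_I2) (simp add: abs_mult mult_left_le_one_le)
 next
  show "AE x in lborel. (\<lambda>n. cutoff (real (Suc n)) x * N x) \<longlonglongrightarrow> N x"
   using tendsto_mult[OF cutoff_tendsto tendsto_const] by (intro AE_I2) fastforce
 qed
 have fin: "?IN \<le> ?IS / 2 + (1 + 3 * \<eta>) / 2 * ?IN" if \<eta>: "\<eta> > 0" for \<eta>
 proof -
  have "(\<lambda>n. ?IS / 2 + (1 + 3 * \<eta>) / 2 * ?IN + (1 / 2 + 1 / \<eta>) * ?IE (real (Suc n))) \<longlonglongrightarrow>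
   ?IS / 2 + (1 + 3 * \<eta>) / 2 * ?IN + (1 / 2 + 1 / \<eta>) * 0"
   by (intro tendsto_intros Elim)
  from LIMSEQ_le[OF lim this] show ?thesis using key[OF _ \<eta>] by auto
 qed
 have "(\<lambda>n. ?IS / 2 + (1 + 3 * inverse (real (Suc n))) / 2 * ?IN) \<longlonglongrightarrow>
   ?IS / 2 + (1 + 3 * 0) / 2 * ?IN"
  by (intro tendsto_intros LIMSEQ_inverse_real_of_nat) auto
 from LIMSEQ_le_const[OF this] have "?IN \<le> ?IS / 2 + (1 + 3 * 0) / 2 * ?IN"
  using fin by auto
 thus "(\<integral>x. cmod (w x)^2 / V x) \<le> ?IS" unfolding N_def by simp
qed

section \<open>Smoothed weights\<close>

definition growth :: "real => (complex => complex) => bool" where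
 "growth m f \<longleftrightarrow> (\<exists>C. \<forall>x. cmod (f x) \<le> C * wt m x)"

lemma growthI: "(\<And>x. cmod (f x) \<le> C * wt m x) ==> growth m f"
 unfolding growth_def by blast

lemma growth_bound:
 assumes "growth m f"
 obtains C where "C \<ge> 0" "\<And>x. cmod (f x) \<le> C * wt m x"
proof -
 obtain C where C: "\<And>x. cmod (f x) \<le> C * wt m x" using assms unfolding growth_def by blast
 show ?thesis using order_trans[OF norm_ge_zero C[of 0]] C by (intro that[of C]) auto
qed

lemma growth_mono: "growth m f ==> m \<le> m' ==> growth m' f"
proof -
 assume f: "growth m f" and m: "m \<le> m'"
 obtain C where C: "C \<ge> 0" "\<And>x. cmod (f x) \<le> C * wt m x" using growth_bound[OF f] by blast
 have "cmod (f x) \<le> C * wt m' x" for x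
 proof -
  have "wt m x \<le> wt m' x" using m by (intro powr_mono) auto
  from mult_left_mono[OF this C(1)] C(2)[of x] show ?thesis by linarith
 qed
 thus ?thesis by (rule growthI)
qed

lemma growth_mult: "growth m f ==> growth k g ==> growth (m + k) (\<lambda>x. f x * g x)"
proof -
 assume f: "growth m f" and g: "growth k g"
 obtain C where C: "C \<ge> 0" "\<And>x. cmod (f x) \<le> C * wt m x" using growth_bound[OF f] by blast
 obtain D where D: "D \<ge> 0" "\<And>x. cmod (g x) \<le> D * wt k x" using growth_bound[OF g] by blast
 have "cmod (f x * g x) \<le> (C * D) * wt (m + k) x" for x
 proof -
  have "cmod (f x * g x) \<le> (C * wt m x) * (D * wt k x)"
   unfolding norm_mult using C D by (intro mult_mono) auto
  thus ?thesis by (simp only: powr_add mult_ac)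
 qed
 thus ?thesis by (rule growthI)
qed

lemma growth_add: "growth m f ==> growth m g ==> growth m (\<lambda>x. f x + g x)"
proof -
 assume f: "growth m f" and g: "growth m g"
 obtain C where C: "\<And>x. cmod (f x) \<le> C * wt m x" using growth_bound[OF f] by blast
 obtain D where D: "\<And>x. cmod (g x) \<le> D * wt m x" using growth_bound[OF g] by blast
 have "cmod (f x + g x) \<le> (C + D) * wt m x" for x
  using norm_triangle_ineq[of "f x" "g x"] C[of x] D[of x] by (simp add: distrib_right)
 thus ?thesis by (rule growthI)
qed

lemma growth_const: "growth 0 (\<lambda>x. c)"
 by (rule growthI[of _ "cmod c"]) (simp add: add_nonneg_eq_0_iff)

lemma growth_cmult: "growth m f ==> growth m (\<lambda>x. c * f x)"
 using growth_mult[OF growth_const, of m f c] by simp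

lemma growth_minus: "growth m f ==> growth m (\<lambda>x. - f x)"
 unfolding growth_def by simp

lemma growth_diff: "growth m f ==> growth m g ==> growth m (\<lambda>x. f x - g x)"
 using growth_add[of m f "\<lambda>x. - g x"] growth_minus[of m g] by simp

lemma growth_cnj: "growth m f ==> growth m (\<lambda>x. cnj (f x))"
 unfolding growth_def by simp

lemma growth_integrable:
 assumes "growth m f" "m < -2" "f \<in> borel_measurable borel"
 shows "L1 f"
proof -
 obtain C where C: "\<And>x. cmod (f x) \<le> C * wt m x" using growth_bound[OF assms(1)] by blast
 show ?thesis
 proof (rule integrable_decay_bound[OF assms(3)])
  show "- m > 2" using assms(2) by simp
  show "cmod (f x) \<le> C * wt (- (- m)) x" for x unfolding minus_minus by (rule C)
 qed
qed

lemma growth_poly: "real (degree p) \<le> m ==> growth m (poly p)"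
proof (induction p arbitrary: m)
 case 0
 thus ?case by (intro growthI[of _ 0]) simp
next
 case (pCons a p)
 show ?case
 proof (cases "p = 0")
  case True
  thus ?thesis using growth_mono[OF growth_const[of a]] pCons.prems by simp
 next
  case False
  hence "growth (m - 1) (poly p)" using pCons.prems by (intro pCons.IH) simp
  moreover have "growth 1 (\<lambda>x. x)" by (rule growthI[of _ 1]) simp
  ultimately have "growth (1 + (m - 1)) (\<lambda>x. x * poly p x)" by (intro growth_mult)
  moreover have "growth m (\<lambda>x. a)" using growth_mono[OF growth_const[of a]] pCons.prems by simp
  ultimately show ?thesis using growth_add[of m "\<lambda>x. a" "\<lambda>x. x * poly p x"] by simp
 qed
qed

lemma poly_lower_bound:
 fixes p :: "complex poly"
 assumes "p \<noteq> 0"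
 obtains c R where "c > 0" "R \<ge> 0" "\<And>x. cmod x \<ge> R ==> c * wt (real (degree p)) x \<le> cmod (poly p x)"
proof -
 let ?d = "degree p"
 have "((\<lambda>x. cmod (poly p x / x ^ ?d)) \<longlongrightarrow> cmod (lead_coeff p)) at_infinity"
  by (intro tendsto_norm poly_divide_tendsto_aux)
 moreover have "cmod (lead_coeff p) / 2 < cmod (lead_coeff p)" using assms by simp
 ultimately have "\<forall>\<^sub>F x in at_infinity. cmod (lead_coeff p) / 2 < cmod (poly p x / x ^ ?d)"
  by (rule order_tendstoD)
 then obtain R where R: "\<And>x. R \<le> cmod x ==> cmod (lead_coeff p) / 2 < cmod (poly p x / x ^ ?d)"
  unfolding eventually_at_infinity by blast
 let ?c = "cmod (lead_coeff p) / 2 / 2 ^ ?d"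
 have "?c * wt (real ?d) x \<le> cmod (poly p x)" if "cmod x \<ge> max R 1" for x
 proof -
  have "(1 + cmod x) ^ ?d \<le> (2 * cmod x) ^ ?d" using that by (intro power_mono) auto
  hence "?c * (1 + cmod x) ^ ?d \<le> ?c * (2 ^ ?d * cmod x ^ ?d)"
   by (intro mult_left_mono) (auto simp: power_mult_distrib)
  also have "... = cmod (lead_coeff p) / 2 * cmod x ^ ?d" by simp
  also have "... \<le> cmod (poly p x / x ^ ?d) * cmod x ^ ?d"
   using R[of x] that by (intro mult_right_mono) auto
  also have "... = cmod (poly p x)" using that by (auto simp: norm_divide norm_power)
  finally show ?thesis by (simp add: powr_realpow add_pos_nonneg)
 qed
 thus ?thesis using assms by (intro that[of ?c "max R 1"]) auto
qed

locale regular_weight =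
 fixes f :: "complex poly" and n :: nat and \<epsilon> :: real
 assumes degf: "degree f = 2 * n + 1" and n: "n > 0" and eps: "\<epsilon> > 0"
begin

definition V :: "complex => real" where "V x = sqrt (cmod (poly f x)^2 + \<epsilon>)"
definition W :: "complex => real" where "W x = 1 / V x"
definition v :: "complex => complex" where
 "v x = poly (pderiv f) x * cnj (poly f x) * of_real (W x) / 2"

lemma Vpos: "V x > 0" unfolding V_def using eps by (simp add: add_nonneg_pos)

lemma Wpos: "W x > 0" unfolding W_def using Vpos by simp

lemma V_square: "(V x)^2 = cmod (poly f x)^2 + \<epsilon>"
 unfolding V_def using eps by simp

lemma VW: "V x * W x = 1" unfolding W_def using Vpos[of x] by simp

lemma cVW: "complex_of_real (V x) * of_real (W x) = 1"
 using VW[of x] by (metis of_real_1 of_real_mult)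

lemma eps_W: "\<epsilon> * (W x)^2 = 1 - cmod (poly f x)^2 * (W x)^2"
proof -
 have "(cmod (poly f x)^2 + \<epsilon>) * (W x)^2 = 1"
  unfolding V_square[symmetric] power_mult_distrib[symmetric] VW by simp
 thus ?thesis by (simp add: algebra_simps)
qed

lemma f_W_le: "cmod (poly f x) * W x \<le> 1"
proof -
 have "cmod (poly f x) \<le> V x" unfolding V_def using eps by (intro real_le_rsqrt) simp
 hence "cmod (poly f x) * W x \<le> V x * W x" using Wpos[of x] by (intro mult_right_mono) auto
 thus ?thesis by (simp add: VW)
qed

lemma V_wirtinger: "wirtinger (\<lambda>x. of_real (V x)) (v x) (cnj (v x)) x"
proof -
 have "wirtinger (poly f) (poly (pderiv f) x) 0 x"
  by (rule wirtinger_holomorphic[OF poly_DERIV])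
 from wirtinger_add[OF wirtinger_mult[OF this wirtinger_cnj[OF this]] wirtinger_const[of "of_real \<epsilon>"]]
 have "wirtinger (\<lambda>x. poly f x * cnj (poly f x) + of_real \<epsilon>) (poly (pderiv f) x * cnj (poly f x))
   (cnj (poly (pderiv f) x * cnj (poly f x))) x"
  by (rule wirtinger_cong) auto
 moreover have "poly f x * cnj (poly f x) + of_real \<epsilon> = of_real (cmod (poly f x)^2 + \<epsilon>)" for x
  using complex_norm_square[of "poly f x"] by simp
 ultimately have 1: "wirtinger (\<lambda>x. of_real (cmod (poly f x)^2 + \<epsilon>)) (poly (pderiv f) x * cnj (poly f x))
   (cnj (poly (pderiv f) x * cnj (poly f x))) x" by simp
 have "cmod (poly f x)^2 + \<epsilon> > 0" using eps by (simp add: add_nonneg_pos)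
 from wirtinger_real_comp[OF 1 DERIV_real_sqrt[OF this]]
 have 2: "wirtinger (\<lambda>x. of_real (V x)) (of_real (inverse (V x) / 2) * (poly (pderiv f) x * cnj (poly f x)))
   (of_real (inverse (V x) / 2) * cnj (poly (pderiv f) x * cnj (poly f x))) x"
  unfolding V_def .
 have "of_real (inverse s / 2) * (a * b) = a * b * complex_of_real (1 / s) / 2" for s a b
  unfolding of_real_divide of_real_inverse by (simp add: inverse_eq_divide)
 thus ?thesis unfolding v_def W_def by (rule wirtinger_cong[OF 2]) (simp_all add: inverse_eq_divide)
qed

lemma W_wirtinger: "wirtinger (\<lambda>x. of_real (W x)) (- v x * of_real (W x) ^ 2) (- cnj (v x) * of_real (W x) ^ 2) x"
 using wirtinger_inverse[OF V_wirtinger, of x] Vpos[of x] unfolding W_def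
 by (simp add: divide_inverse)

lemma W_continuous: "cont W"
 using continuous_on_Re[OF wirtinger_continuous_on[OF W_wirtinger]] by simp

lemma cW_continuous: "cont (\<lambda>x. complex_of_real (W x))"
 by (rule wirtinger_continuous_on[OF W_wirtinger])

lemma v_continuous: "cont v"
 unfolding v_def by (intro continuous_intros cW_continuous) auto

lemma growth_W: "growth (- (2 * real n + 1)) (\<lambda>x. of_real (W x))"
proof -
 have "f \<noteq> 0" using degf by auto
 then obtain c R where c: "c > 0" "R \<ge> 0"
  "\<And>x. cmod x \<ge> R ==> c * wt (real (degree f)) x \<le> cmod (poly f x)"
  using poly_lower_bound by blast
 have pos: "wt k x > 0" for x k by (simp add: add_nonneg_eq_0_iff order_less_le)
 define m where "m = 2 * real n + 1"
 define M where "M = 1 / c + (1 + R) powr m / sqrt \<epsilon>"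
 have "W x \<le> M * wt (- m) x" for x
 proof (cases "cmod x \<ge> R")
  case True
  have "c * wt m x \<le> V x"
  proof -
   have "cmod (poly f x) \<le> V x" unfolding V_def using eps by (intro real_le_rsqrt) simp
   moreover have "real (degree f) = m" using degf by (simp add: m_def)
   ultimately show ?thesis using c(3)[OF True] by simp
  qed
  hence "W x \<le> 1 / (c * wt m x)"
   unfolding W_def using c(1) pos[of x m] by (intro divide_left_mono) (auto intro: mult_pos_pos Vpos)
  also have "... = 1 / c * wt (- m) x" by (simp add: powr_minus_divide)
  also have "... \<le> M * wt (- m) x" unfolding M_def using eps by (intro mult_right_mono) auto
  finally show ?thesis .
 next
  case False
  have "sqrt \<epsilon> \<le> V x" unfolding V_def by simp
  hence "W x \<le> 1 / sqrt \<epsilon>" unfolding W_def using eps Vpos[of x] by (intro divide_left_mono) auto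
  also have "... = (wt m x / sqrt \<epsilon>) * wt (- m) x"
   using pos[of x m] by (simp add: powr_minus_divide)
  also have "... \<le> M * wt (- m) x"
  proof (rule mult_right_mono)
   have "wt m x \<le> (1 + R) powr m" using False by (intro powr_mono2) (auto simp: m_def)
   hence "wt m x / sqrt \<epsilon> \<le> (1 + R) powr m / sqrt \<epsilon>" using eps by (intro divide_right_mono) auto
   moreover have "0 \<le> 1 / c" using c(1) by simp
   ultimately show "wt m x / sqrt \<epsilon> \<le> M" unfolding M_def by linarith
  qed simp
  finally show ?thesis .
 qed
 thus ?thesis using Wpos unfolding m_def by (intro growthI[of _ M]) (simp add: less_imp_le)
qed

lemma growth_V: "growth (2 * real n + 1) (\<lambda>x. of_real (V x))"
proof -
 have "growth (2 * real n + 1) (poly f)" using degf by (intro growth_poly) simp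
 then obtain C where C: "C \<ge> 0" "\<And>x. cmod (poly f x) \<le> C * wt (2 * real n + 1) x"
  using growth_bound by blast
 have "V x \<le> (C + sqrt \<epsilon>) * wt (2 * real n + 1) x" for x
 proof -
  have "V x \<le> cmod (poly f x) + sqrt \<epsilon>"
   unfolding V_def using eps by (intro real_le_lsqrt) (auto simp: power2_sum)
  moreover have "1 \<le> wt (2 * real n + 1) x" by (intro ge_one_powr_ge_zero) auto
  hence "sqrt \<epsilon> * 1 \<le> sqrt \<epsilon> * wt (2 * real n + 1) x" using eps by (intro mult_left_mono) auto
  ultimately show ?thesis using C(2)[of x] by (simp add: distrib_right)
 qed
 thus ?thesis using Vpos by (intro growthI[of _ "C + sqrt \<epsilon>"]) (simp add: less_imp_le)
qed

lemma growth_fW: "growth 0 (\<lambda>x. poly f x * of_real (W x))"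
 by (rule growthI[of _ 1]) (use f_W_le Wpos in \<open>simp add: norm_mult less_imp_le add_nonneg_eq_0_iff\<close>)

lemma growth_v: "growth (2 * real n) v"
proof -
 have "growth (2 * real n) (poly (pderiv f))" by (rule growth_poly) (simp add: degree_pderiv degf)
 from growth_cmult[OF growth_mult[OF this growth_cnj[OF growth_fW]], of "1/2"]
 show ?thesis unfolding v_def by (simp add: mult.assoc)
qed

lemma projection_error_estimate:
 fixes f1 p q :: "complex poly"
 assumes df1: "degree f1 \<le> 2 * n" and dp: "degree p < n" and dq: "degree q < n"
 defines "w \<equiv> \<lambda>x. poly f1 x * poly p x * cnj (poly f x) * of_real (W x) ^ 2 / 2 - poly q x"
 defines "S \<equiv> \<lambda>x. \<epsilon> / 2 * cmod (poly f1 x)^2 * cmod (poly p x)^2 * W x ^ 5"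
 assumes orth: "\<And>i. i < n ==> (\<integral>z. z ^ i * (cnj (w z) * of_real (W z))) = 0"
 shows "L1 (\<lambda>x. cmod (w x)^2 * W x)" "L1 S"
  and "(\<integral>x. cmod (w x)^2 * W x) \<le> (\<integral>x. S x)"
proof -
 let ?f' = "poly (pderiv f)" and ?W = "\<lambda>x. complex_of_real (W x)" and ?F1 = "\<lambda>x. poly f1 x * poly p x"
 define F1' where "F1' = (\<lambda>x. poly (pderiv f1) x * poly p x + poly f1 x * poly (pderiv p) x)"
 have fw: "wirtinger (poly r) (poly (pderiv r) x) 0 x" for r x
  by (rule wirtinger_holomorphic[OF poly_DERIV])
 define v1 where "v1 = (\<lambda>x. poly (pderiv (pderiv f)) x * cnj (poly f x) * ?W x / 2 - ?f' x * cnj (poly f x) * v x * ?W x ^ 2 / 2)"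
 define l where "l = (\<lambda>x. cmod (?f' x)^2 * W x / 2 - cmod (v x)^2 * W x)"
 have n2: "of_real (cmod z^2) = z * cnj z" for z using complex_norm_square[of z] by simp
 have f'f: "?f' x * cnj (poly f x) = 2 * v x * of_real (V x)" for x
 proof -
  have "2 * v x * of_real (V x) = ?f' x * cnj (poly f x) * (of_real (V x) * of_real (W x))"
   unfolding v_def by simp
  thus ?thesis unfolding cVW by simp
 qed
 have vw: "wirtinger v (v1 x) (of_real (l x)) x" for x
 proof -
  have "wirtinger v ((poly (pderiv (pderiv f)) x * cnj (poly f x) + ?f' x * cnj 0) * ?W x * (1/2) + ?f' x * cnj (poly f x) * (- v x * ?W x ^ 2) * (1/2))
    ((0 * cnj (poly f x) + ?f' x * cnj (?f' x)) * ?W x * (1/2) + ?f' x * cnj (poly f x) * (- cnj (v x) * ?W x ^ 2) * (1/2)) x"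
   using wirtinger_mult[OF wirtinger_mult[OF wirtinger_mult[OF fw[of "pderiv f"] wirtinger_cnj[OF fw[of f]]] W_wirtinger] wirtinger_const[of "1/2"], of x]
   unfolding v_def by (simp add: algebra_simps)
  thus ?thesis
  proof (rule wirtinger_cong)
   show "(poly (pderiv (pderiv f)) x * cnj (poly f x) + ?f' x * cnj 0) * ?W x * (1/2) + ?f' x * cnj (poly f x) * (- v x * ?W x ^ 2) * (1/2) = v1 x"
    unfolding v1_def by simp
   have "?f' x * cnj (poly f x) * (- cnj (v x) * ?W x ^ 2) * (1/2) = - (v x * cnj (v x)) * ?W x * (of_real (V x) * ?W x)"
    unfolding f'f by (simp add: power2_eq_square)
   thus "(0 * cnj (poly f x) + ?f' x * cnj (?f' x)) * ?W x * (1/2) + ?f' x * cnj (poly f x) * (- cnj (v x) * ?W x ^ 2) * (1/2) = of_real (l x)"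
    unfolding l_def cVW of_real_diff of_real_mult of_real_divide n2 by simp
  qed
 qed
 have vsq: "cmod (v x)^2 = cmod (?f' x)^2 * cmod (poly f x)^2 * (W x)^2 / 4" for x
  unfolding v_def by (simp add: norm_mult power_mult_distrib power_divide)
 have k: "l x - cmod (v x)^2 / V x = \<epsilon> / 2 * cmod (?f' x)^2 * W x ^ 3" for x
 proof -
  have "l x - cmod (v x)^2 / V x = cmod (?f' x)^2 * W x / 2 - 2 * cmod (v x)^2 * W x"
   unfolding l_def W_def by simp
  also have "... = cmod (?f' x)^2 * W x / 2 * (1 - cmod (poly f x)^2 * (W x)^2)"
   unfolding vsq by (simp add: algebra_simps)
  also have "... = \<epsilon> / 2 * cmod (?f' x)^2 * W x ^ 3"
   unfolding eps_W[symmetric] by (simp add: power2_eq_square power3_eq_cube)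
  finally show ?thesis .
 qed
 define w1 where "w1 = (\<lambda>x. F1' x * cnj (poly f x) * ?W x ^ 2 / 2 - ?F1 x * cnj (poly f x) * v x * ?W x ^ 3 - poly (pderiv q) x)"
 define w2 where "w2 = (\<lambda>x. ?F1 x * cnj (?f' x) * of_real (\<epsilon> * W x ^ 4) / 2)"
 have ww: "wirtinger w (w1 x) (w2 x) x" for x
 proof -
  have W2: "wirtinger (\<lambda>x. ?W x ^ 2) (- 2 * v x * ?W x ^ 3) (- 2 * cnj (v x) * ?W x ^ 3) x"
   using wirtinger_mult[OF W_wirtinger W_wirtinger, of x]
   by (simp add: power2_eq_square power3_eq_cube algebra_simps)
  have F1: "wirtinger ?F1 (F1' x) 0 x"
   using wirtinger_mult[OF fw[of f1 x] fw[of p x]] unfolding F1'_def by simp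
  have "wirtinger w ((F1' x * cnj (poly f x) + ?F1 x * cnj 0) * ?W x ^ 2 * (1/2) + ?F1 x * cnj (poly f x) * (- 2 * v x * ?W x ^ 3) * (1/2) - poly (pderiv q) x)
    ((0 * cnj (poly f x) + ?F1 x * cnj (?f' x)) * ?W x ^ 2 * (1/2) + ?F1 x * cnj (poly f x) * (- 2 * cnj (v x) * ?W x ^ 3) * (1/2) - 0) x"
   using wirtinger_diff[OF wirtinger_mult[OF wirtinger_mult[OF wirtinger_mult[OF F1 wirtinger_cnj[OF fw[of f]]] W2] wirtinger_const[of "1/2"]] fw[of q]]
   unfolding w_def by (simp add: algebra_simps)
  thus ?thesis
  proof (rule wirtinger_cong)
   show "(F1' x * cnj (poly f x) + ?F1 x * cnj 0) * ?W x ^ 2 * (1/2) + ?F1 x * cnj (poly f x) * (- 2 * v x * ?W x ^ 3) * (1/2) - poly (pderiv q) x = w1 x"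
    unfolding w1_def by simp
   have "cnj (?f' x) * ?W x ^ 2 - 2 * cnj (poly f x) * cnj (v x) * ?W x ^ 3 = cnj (?f' x) * ?W x ^ 2 * (1 - (poly f x * cnj (poly f x)) * ?W x ^ 2)"
    unfolding v_def by (simp add: power2_eq_square power3_eq_cube algebra_simps)
   also have "1 - (poly f x * cnj (poly f x)) * ?W x ^ 2 = of_real (1 - cmod (poly f x)^2 * (W x)^2)"
    unfolding of_real_diff of_real_mult n2 by simp
   also have "... = of_real (\<epsilon> * (W x)^2)" by (simp only: eps_W)
   finally have e: "cnj (?f' x) * ?W x ^ 2 - 2 * cnj (poly f x) * cnj (v x) * ?W x ^ 3 = cnj (?f' x) * of_real (\<epsilon> * W x ^ 4)"
    by (simp add: power2_eq_square power4_eq_xxxx mult_ac)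
   have "(0 * cnj (poly f x) + ?F1 x * cnj (?f' x)) * ?W x ^ 2 * (1/2) + ?F1 x * cnj (poly f x) * (- 2 * cnj (v x) * ?W x ^ 3) * (1/2) - 0 =
     ?F1 x * (cnj (?f' x) * ?W x ^ 2 - 2 * cnj (poly f x) * cnj (v x) * ?W x ^ 3) / 2"
    by (simp add: algebra_simps)
   also have "... = w2 x" unfolding e w2_def by (simp add: mult_ac)
   finally show "(0 * cnj (poly f x) + ?F1 x * cnj (?f' x)) * ?W x ^ 2 * (1/2) + ?F1 x * cnj (poly f x) * (- 2 * cnj (v x) * ?W x ^ 3) * (1/2) - 0 = w2 x" .
  qed
 qed
 have hV: "cnj (w x) / of_real (V x) = cnj (w x) * ?W x" for x unfolding W_def by simp
 define h1 where "h1 = (\<lambda>x. cnj (w2 x) * ?W x + cnj (w x) * (- v x * ?W x ^ 2))"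
 define h2 where "h2 = (\<lambda>x. cnj (w1 x) * ?W x + cnj (w x) * (- cnj (v x) * ?W x ^ 2))"
 have hw: "wirtinger (\<lambda>x. cnj (w x) / of_real (V x)) (h1 x) (h2 x) x" for x
  unfolding hV h1_def h2_def by (rule wirtinger_mult[OF wirtinger_cnj[OF ww] W_wirtinger])
 have cont_poly: "cont (poly r)" for r :: "complex poly" by (intro continuous_intros)
 note ci = continuous_intros cW_continuous W_continuous v_continuous
 have cw: "cont w" by (rule wirtinger_continuous_on[OF ww])
 have cw1: "cont w1" unfolding w1_def F1'_def by (intro ci) auto
 have cw2: "cont w2" unfolding w2_def by (intro ci) auto
 have ch1: "cont h1" "cont h2" unfolding h1_def h2_def by (intro ci cw cw1 cw2)+
 have cv1: "cont v1" unfolding v1_def by (intro ci) auto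
 have cl: "cont l" unfolding l_def by (intro ci) auto
 define N where "N = real n"
 have N1: "N \<ge> 1" using n unfolding N_def by simp
 have gp: "growth (N - 1) (poly r)" "growth (N - 1) (poly (pderiv r))" if "degree r < n" for r
  using that n unfolding N_def by (auto intro!: growth_poly simp: degree_pderiv)
 have gf1: "growth (2 * N) (poly f1)" "growth (2 * N) (poly (pderiv f1))"
  using df1 unfolding N_def by (auto intro!: growth_poly simp: degree_pderiv)
 have gf': "growth (2 * N) ?f'" unfolding N_def by (rule growth_poly) (simp add: degree_pderiv degf)
 have gW: "growth (- (2 * N + 1)) ?W" unfolding N_def by (rule growth_W)
 have gv: "growth (2 * N) v" unfolding N_def by (rule growth_v)
 have gF1: "growth (3 * N - 1) ?F1" using growth_mult[OF gf1(1) gp(1)[OF dp]] by (rule growth_mono) simp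
 have gF1': "growth (3 * N - 1) F1'" unfolding F1'_def
  using growth_add[OF growth_mult[OF gf1(2) gp(1)[OF dp]] growth_mult[OF gf1(1) gp(2)[OF dp]]] by (rule growth_mono) simp
 have gfW: "growth 0 (\<lambda>x. cnj (poly f x) * ?W x)" using growth_cnj[OF growth_fW] by simp
 have gw: "growth (N - 1) w"
 proof -
  have "growth (N - 1) (\<lambda>x. 1/2 * (?F1 x * (cnj (poly f x) * ?W x) * ?W x))"
   by (intro growth_cmult growth_mono[OF growth_mult[OF growth_mult[OF gF1 gfW] gW]]) (use N1 in simp)
  from growth_diff[OF this gp(1)[OF dq]] show ?thesis
   unfolding w_def by (simp add: power2_eq_square mult_ac)
 qed
 have gw1: "growth (N - 1) w1"
 proof -
  have a: "growth (N - 1) (\<lambda>x. 1/2 * (F1' x * (cnj (poly f x) * ?W x) * ?W x))"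
   by (intro growth_cmult growth_mono[OF growth_mult[OF growth_mult[OF gF1' gfW] gW]]) (use N1 in simp)
  have b: "growth (N - 1) (\<lambda>x. ?F1 x * (cnj (poly f x) * ?W x) * v x * ?W x * ?W x)"
   by (intro growth_mono[OF growth_mult[OF growth_mult[OF growth_mult[OF growth_mult[OF gF1 gfW] gv] gW] gW]]) (use N1 in simp)
  from growth_diff[OF growth_diff[OF a b] gp(2)[OF dq]] show ?thesis
   unfolding w1_def by (simp add: power2_eq_square power3_eq_cube mult_ac)
 qed
 have geW: "growth 0 (\<lambda>x. complex_of_real (\<epsilon> * (W x)^2))"
 proof (rule growthI[of _ 1])
  fix x
  have "0 \<le> \<epsilon> * (W x)^2" using eps by simp
  moreover have "0 \<le> cmod (poly f x)^2 * (W x)^2" by simp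
  hence "\<epsilon> * (W x)^2 \<le> 1" using eps_W[of x] by linarith
  ultimately show "cmod (complex_of_real (\<epsilon> * (W x)^2)) \<le> 1 * wt 0 x"
   by (simp only: norm_of_real abs_of_nonneg powr_zero_eq_one) (simp add: add_nonneg_eq_0_iff)
 qed
 have gw2: "growth (N - 1) w2"
 proof -
  have "growth (N - 1) (\<lambda>x. 1/2 * (?F1 x * cnj (?f' x) * of_real (\<epsilon> * (W x)^2) * ?W x * ?W x))"
   by (intro growth_cmult growth_mono[OF growth_mult[OF growth_mult[OF growth_mult[OF growth_mult[OF gF1 growth_cnj[OF gf']] geW] gW] gW]]) (use N1 in simp)
  thus ?thesis unfolding w2_def by (simp add: power2_eq_square power4_eq_xxxx mult_ac)
 qed
 have gW2: "growth (- (4 * N + 2)) (\<lambda>x. ?W x ^ 2)"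
  using growth_mult[OF gW gW] unfolding power2_eq_square by (rule growth_mono) simp
 have gh: "growth (- (N + 2)) (\<lambda>x. cnj (w x) / of_real (V x))"
  unfolding hV by (rule growth_mono[OF growth_mult[OF growth_cnj[OF gw] gW]]) simp
 have gvW: "growth (- (N + 2)) (\<lambda>x. cnj (w x) * (- u x * ?W x ^ 2))" if "growth (2 * N) u" for u
  by (rule growth_mono[OF growth_mult[OF growth_cnj[OF gw] growth_mult[OF growth_minus[OF that] gW2]]]) simp
 have gh1: "growth (- (N + 2)) h1"
  unfolding h1_def by (rule growth_add[OF growth_mono[OF growth_mult[OF growth_cnj[OF gw2] gW]] gvW[OF gv]]) simp
 have gh2: "growth (- (N + 2)) h2"
  unfolding h2_def by (rule growth_add[OF growth_mono[OF growth_mult[OF growth_cnj[OF gw1] gW]] gvW[OF growth_cnj[OF gv]]]) simp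
 have gS: "growth (-3) (\<lambda>x. of_real (S x))"
 proof -
  have "growth (-3) (\<lambda>x. 1/2 * (?F1 x * cnj (?F1 x) * of_real (\<epsilon> * (W x)^2) * ?W x ^ 2 * ?W x))"
   by (intro growth_cmult growth_mono[OF growth_mult[OF growth_mult[OF growth_mult[OF growth_mult[OF gF1 growth_cnj[OF gF1]] geW] gW2] gW]]) (use N1 in simp)
  moreover have "1/2 * (?F1 x * cnj (?F1 x) * of_real (\<epsilon> * (W x)^2) * ?W x ^ 2 * ?W x) = complex_of_real (S x)" for x
  proof -
   have "complex_of_real (S x) = of_real \<epsilon> / 2 * (poly f1 x * cnj (poly f1 x)) * (poly p x * cnj (poly p x)) * of_real (W x ^ 5)"
    unfolding S_def n2[symmetric] by simp
   also have "W x ^ 5 = (W x)^2 * (W x)^2 * W x" by (simp add: power2_eq_square numeral_eq_Suc)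
   finally show ?thesis by (simp add: mult_ac)
  qed
  ultimately show ?thesis by simp
 qed
 have cS: "cont S" unfolding S_def by (intro ci) auto
 show iS: "L1 S"
  using integrable_Re[OF growth_integrable[OF gS _ borel_measurable_continuous_onI[OF continuous_on_of_real[OF cS]]]] by simp
 obtain A where A: "A \<ge> 0" "\<And>x. cmod (cnj (w x) / of_real (V x)) \<le> A * wt (- (N + 2)) x" using growth_bound[OF gh] by blast
 obtain A1 where A1: "A1 \<ge> 0" "\<And>x. cmod (h1 x) \<le> A1 * wt (- (N + 2)) x" using growth_bound[OF gh1] by blast
 obtain A2 where A2: "A2 \<ge> 0" "\<And>x. cmod (h2 x) \<le> A2 * wt (- (N + 2)) x" using growth_bound[OF gh2] by blast
 obtain CV where CV: "\<And>x. cmod (of_real (V x)) \<le> CV * wt (2 * real n + 1) x" using growth_bound[OF growth_V] by blast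
 have CV': "V x \<le> CV * wt (2 * real n + 1) x" for x using CV[of x] Vpos[of x] by simp
 define C where "C = A + A1 + A2"
 have Cm: "u \<le> C * wt (- (real n + 2)) x" if "u \<le> A' * wt (- (N + 2)) x" "A' \<le> C" for u A' x
  using that mult_right_mono[OF that(2), of "wt (- (N + 2)) x"] unfolding N_def by simp
 have wWV: "cmod (w x)^2 / V x = cmod (w x)^2 * W x" for x unfolding W_def by simp
 have SS: "cmod (w2 x)^2 \<le> (l x - cmod (v x)^2 / V x) * S x" for x
 proof -
  have "cmod (w2 x)^2 = cmod (poly f1 x)^2 * cmod (poly p x)^2 * cmod (?f' x)^2 * (\<epsilon> * W x ^ 4)^2 / 4"
  proof -
   have "cmod (complex_of_real (\<epsilon> * W x ^ 4)) = \<epsilon> * W x ^ 4"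
    using eps Wpos[of x] unfolding norm_of_real by simp
   thus ?thesis unfolding w2_def norm_mult norm_divide by (simp add: power_mult_distrib power_divide)
  qed
  also have "... = (l x - cmod (v x)^2 / V x) * S x"
   unfolding k S_def by (simp add: power2_eq_square numeral_eq_Suc)
  finally show ?thesis by simp
 qed
 have res: "L1 (\<lambda>x. cmod (w x)^2 / V x)"
  "(\<integral>x. cmod (w x)^2 / V x) \<le> (\<integral>x. S x)"
 proof -
  have "0 \<le> l x - cmod (v x)^2 / V x" for x unfolding k using eps Wpos[of x] by simp
  moreover have "0 \<le> S x" for x unfolding S_def using eps Wpos[of x] by simp
  moreover have "(\<integral>z. z ^ i * (cnj (w z) / of_real (V z))) = 0" if "i < n" for i
   unfolding hV by (rule orth[OF that])
  ultimately show "L1 (\<lambda>x. cmod (w x)^2 / V x)"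
   "(\<integral>x. cmod (w x)^2 / V x) \<le> (\<integral>x. S x)"
   using hormander_estimate[OF V_wirtinger Vpos vw cv1 cl CV' _ ww cw1 cw2 hw ch1 Cm[OF A(2)] Cm[OF A1(2)] Cm[OF A2(2)] n _ SS _ iS] A(1) A1(1) A2(1)
   unfolding C_def by auto
 qed
 show "L1 (\<lambda>x. cmod (w x)^2 * W x)" "(\<integral>x. cmod (w x)^2 * W x) \<le> (\<integral>x. S x)"
  using res unfolding wWV by auto
qed

end

section \<open>Kernels of spaces of polynomials\<close>

definition wnorm :: "(complex => real) => complex poly => real" where
 "wnorm W p = (\<integral>x. cmod (poly p x)^2 * W x)"

definition poly_kernel :: "(complex => real) => nat => complex => real" where
 "poly_kernel W n x = Sup {cmod (poly p x)^2 | p. degree p < n \<and> wnorm W p \<le> 1}"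

locale poly_weight =
 fixes W :: "complex => real" and n :: nat
 assumes n: "n > 0" and W_meas [measurable]: "W \<in> borel_measurable borel"
  and W_nonneg: "\<And>x. 0 \<le> W x" and W_pos: "AE x in lborel. W x > 0"
  and W_int: "L1 (\<lambda>x. ((1 + cmod x) ^ (n - 1))^2 * W x)"
begin

definition tame :: "(complex => complex) => bool" where
 "tame F \<longleftrightarrow> F \<in> borel_measurable borel \<and> (\<exists>C. \<forall>x. cmod (F x) \<le> C * (1 + cmod x) ^ (n - 1))"

definition ip :: "(complex => complex) => (complex => complex) => complex" where
 "ip F G = (\<integral>x. F x * cnj (G x) * of_real (W x))"

lemma tame_growth: "growth (real n - 1) F ==> F \<in> borel_measurable borel ==> tame F"
proof -
 assume g: "growth (real n - 1) F" and m: "F \<in> borel_measurable borel"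
 obtain C where C: "\<And>x. cmod (F x) \<le> C * wt (real n - 1) x" using growth_bound[OF g] by blast
 have "wt (real n - 1) x = (1 + cmod x) ^ (n - 1)" for x
  using n powr_realpow[of "1 + cmod x" "n - 1"] by (simp add: add_pos_nonneg of_nat_diff)
 thus ?thesis using C m unfolding tame_def by auto
qed

lemma tame_poly: "degree p < n ==> tame (poly p)"
 by (intro tame_growth growth_poly borel_measurable_continuous_onI continuous_intros) auto

lemma tame_bound:
 assumes "tame F"
 obtains C where "C \<ge> 0" "\<And>x. cmod (F x) \<le> C * (1 + cmod x) ^ (n - 1)"
proof -
 obtain C where C: "\<And>x. cmod (F x) \<le> C * (1 + cmod x) ^ (n - 1)" using assms unfolding tame_def by blast
 show ?thesis using order_trans[OF norm_ge_zero C[of 0]] C by (intro that[of C]) auto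
qed

lemma tame_meas: "tame F ==> F \<in> borel_measurable borel"
 unfolding tame_def by blast

lemma tame_add: "tame F ==> tame G ==> tame (\<lambda>x. F x + G x)"
proof -
 assume F: "tame F" and G: "tame G"
 obtain C where C: "\<And>x. cmod (F x) \<le> C * (1 + cmod x) ^ (n - 1)" using tame_bound[OF F] by blast
 obtain D where D: "\<And>x. cmod (G x) \<le> D * (1 + cmod x) ^ (n - 1)" using tame_bound[OF G] by blast
 have "cmod (F x + G x) \<le> (C + D) * (1 + cmod x) ^ (n - 1)" for x
  using norm_triangle_ineq[of "F x" "G x"] C[of x] D[of x] by (simp add: distrib_right)
 thus ?thesis using tame_meas[OF F] tame_meas[OF G] unfolding tame_def by auto
qed

lemma tame_cmult: "tame F ==> tame (\<lambda>x. c * F x)"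
proof -
 assume F: "tame F"
 obtain C where C: "\<And>x. cmod (F x) \<le> C * (1 + cmod x) ^ (n - 1)" using tame_bound[OF F] by blast
 have "cmod (c * F x) \<le> (cmod c * C) * (1 + cmod x) ^ (n - 1)" for x
  using mult_left_mono[OF C[of x] norm_ge_zero[of c]] by (simp add: norm_mult mult.assoc)
 thus ?thesis using tame_meas[OF F] unfolding tame_def by auto
qed

lemma tame_diff: "tame F ==> tame G ==> tame (\<lambda>x. F x - G x)"
 using tame_add[of F "\<lambda>x. (-1) * G x"] tame_cmult[of G "-1"] by simp

lemma tame_zero: "tame (\<lambda>x. 0)"
 unfolding tame_def by (auto intro: exI[of _ 0])

lemma tame_sum: "(\<And>i. i \<in> I ==> tame (F i)) ==> tame (\<lambda>x. \<Sum>i\<in>I. F i x)"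
proof (induction I rule: infinite_finite_induct)
 case (infinite A)
 thus ?case by (simp add: tame_zero)
next
 case empty
 thus ?case by (simp add: tame_zero)
next
 case (insert x A)
 thus ?case by (simp add: tame_add)
qed

lemma ip_integrable: 
 assumes F: "tame F" and G: "tame G"
 shows "L1 (\<lambda>x. F x * cnj (G x) * of_real (W x))"
proof -
 obtain C where C: "C \<ge> 0" "\<And>x. cmod (F x) \<le> C * (1 + cmod x) ^ (n - 1)" using tame_bound[OF F] by blast
 obtain D where D: "D \<ge> 0" "\<And>x. cmod (G x) \<le> D * (1 + cmod x) ^ (n - 1)" using tame_bound[OF G] by blast
 show ?thesis
 proof (rule B_integrable_bound)
  show "L1 (\<lambda>x. C * D * (((1 + cmod x) ^ (n - 1))^2 * W x))"
   by (rule integrable_mult_right[OF W_int])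
  show "(\<lambda>x. F x * cnj (G x) * of_real (W x)) \<in> borel_measurable lborel"
  proof -
   have "cnj \<in> borel_measurable borel" by (intro borel_measurable_continuous_onI continuous_intros)
   from measurable_compose[OF tame_meas[OF G] this] show ?thesis
    using tame_meas[OF F] W_meas by (intro borel_measurable_times borel_measurable_of_real) auto
  qed
  show "AE x in lborel. norm (F x * cnj (G x) * of_real (W x)) \<le> norm (C * D * (((1 + cmod x) ^ (n - 1))^2 * W x))"
  proof (rule AE_I2)
   fix x
   have "cmod (F x) * cmod (G x) * W x \<le> (C * (1 + cmod x) ^ (n - 1)) * (D * (1 + cmod x) ^ (n - 1)) * W x"
    using C D W_nonneg[of x] by (intro mult_right_mono mult_mono) auto
   also have "... = C * D * (((1 + cmod x) ^ (n - 1))^2 * W x)" by (simp add: power2_eq_square mult_ac)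
   also have "... \<le> norm (C * D * (((1 + cmod x) ^ (n - 1))^2 * W x))" by simp
   finally show "norm (F x * cnj (G x) * of_real (W x)) \<le> norm (C * D * (((1 + cmod x) ^ (n - 1))^2 * W x))"
    using W_nonneg[of x] by (simp add: norm_mult)
  qed
 qed
qed

lemma ip_add_left: "tame F ==> tame F' ==> tame G ==> ip (\<lambda>x. F x + F' x) G = ip F G + ip F' G"
 unfolding ip_def using ip_integrable[of F G] ip_integrable[of F' G] by (simp add: distrib_right)

lemma ip_cmult_left: "ip (\<lambda>x. c * F x) G = c * ip F G"
 unfolding ip_def by (simp add: mult.assoc)

lemma ip_diff_left: "tame F ==> tame F' ==> tame G ==> ip (\<lambda>x. F x - F' x) G = ip F G - ip F' G"
 unfolding ip_def using ip_integrable[of F G] ip_integrable[of F' G] by (simp add: left_diff_distrib)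

lemma ip_cnj: "ip G F = cnj (ip F G)"
proof -
 have "cnj (ip F G) = (\<integral>x. cnj (F x * cnj (G x) * of_real (W x)))" unfolding ip_def by (rule Bochner_Integration.integral_cnj[symmetric])
 thus ?thesis unfolding ip_def by (simp add: mult_ac)
qed

lemma ip_sum_left: "finite I ==> (\<And>i. i \<in> I ==> tame (F i)) ==> tame G ==> ip (\<lambda>x. \<Sum>i\<in>I. F i x) G = (\<Sum>i\<in>I. ip (F i) G)"
proof (induction I rule: finite_induct)
 case empty
 thus ?case by (simp add: ip_def)
next
 case (insert x A)
 thus ?case by (simp add: ip_add_left tame_sum)
qed

lemma norm_integrable: "tame F ==> L1 (\<lambda>x. cmod (F x)^2 * W x)"
proof -
 assume F: "tame F"
 have "F x * cnj (F x) * of_real (W x) = complex_of_real (cmod (F x)^2 * W x)" for x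
  using complex_norm_square[of "F x"] by simp
 hence "L1 (\<lambda>x. complex_of_real (cmod (F x)^2 * W x))"
  using ip_integrable[OF F F] by (simp only:)
 from integrable_Re[OF this] show ?thesis by (simp only: Re_complex_of_real)
qed

lemma ip_self: "ip F F = of_real (\<integral>x. cmod (F x)^2 * W x)"
proof -
 have "F x * cnj (F x) * of_real (W x) = complex_of_real (cmod (F x)^2 * W x)" for x
  using complex_norm_square[of "F x"] by simp
 thus ?thesis unfolding ip_def by (simp only: integral_complex_of_real)
qed

lemma ip_poly_self: "ip (poly p) (poly p) = of_real (wnorm W p)"
 unfolding ip_self wnorm_def ..

lemma wnorm_nonneg: "wnorm W p \<ge> 0"
 unfolding wnorm_def using W_nonneg by (intro B_integral_nonneg) simp

lemma wnorm_pos: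
 assumes p: "degree p < n" "p \<noteq> 0"
 shows "wnorm W p > 0"
proof -
 have "wnorm W p \<noteq> 0"
 proof
  assume "wnorm W p = 0"
  hence "AE x in lborel. cmod (poly p x)^2 * W x = 0"
   unfolding wnorm_def using integral_nonneg_eq_0_iff_AE[OF norm_integrable[OF tame_poly[OF p(1)]]] W_nonneg by simp
  moreover have "AE x in lborel. x \<notin> {x. poly p x = 0}"
   using poly_roots_finite[OF p(2)] by (intro AE_not_in) (auto intro: finite_imp_null_set_lborel)
  ultimately have "AE x in (lborel :: complex measure). False"
   using W_pos by eventually_elim auto
  thus False by (simp add: AE_iff_null null_sets_def)
 qed
 thus ?thesis using wnorm_nonneg[of p] by simp
qed

lemma wnorm_smult: "wnorm W (smult c p) = cmod c^2 * wnorm W p"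
 unfolding wnorm_def by (simp add: norm_mult power_mult_distrib mult.assoc)

lemma poly_sum_smult: "poly (\<Sum>i\<in>I. smult (c i) (e i)) = (\<lambda>x. \<Sum>i\<in>I. c i * poly (e i) x)"
 by (simp add: poly_sum fun_eq_iff)

lemma degree_sum_smult: "(\<And>i. i \<in> I ==> degree (e i) < n) ==> degree (\<Sum>i\<in>I. smult (c i) (e i)) < n"
proof -
 assume a: "\<And>i. i \<in> I ==> degree (e i) < n"
 have "degree (\<Sum>i\<in>I. smult (c i) (e i)) \<le> n - 1"
 proof (cases "finite I")
  case True
  have "degree (smult (c i) (e i)) \<le> n - 1" if "i \<in> I" for i
   using a[OF that] degree_smult_le[of "c i" "e i"] by linarith
  thus ?thesis by (intro degree_sum_le True) auto
 qed simp
 thus ?thesis using n by linarith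
qed

definition orthonormal :: "'i set => ('i => complex poly) => bool" where
 "orthonormal I e \<longleftrightarrow> (\<forall>i\<in>I. degree (e i) < n) \<and>
   (\<forall>i\<in>I. \<forall>j\<in>I. ip (poly (e i)) (poly (e j)) = (if i = j then 1 else 0))"

definition spanning :: "'i set => ('i => complex poly) => bool" where
 "spanning I e \<longleftrightarrow> (\<forall>p. degree p < n \<longrightarrow> (\<exists>c. p = (\<Sum>i\<in>I. smult (c i) (e i))))"

lemma ip_combination_left:
 assumes "orthonormal I e" "finite I" "j \<in> I"
 shows "ip (poly (\<Sum>i\<in>I. smult (c i) (e i))) (poly (e j)) = c j"
proof -
 have "ip (poly (\<Sum>i\<in>I. smult (c i) (e i))) (poly (e j)) = (\<Sum>i\<in>I. ip (\<lambda>x. c i * poly (e i) x) (poly (e j)))"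
  unfolding poly_sum_smult using assms unfolding orthonormal_def by (intro ip_sum_left) (auto intro: tame_cmult tame_poly)
 also have "... = (\<Sum>i\<in>I. if i = j then c i else 0)"
  using assms unfolding orthonormal_def by (intro sum.cong) (auto simp: ip_cmult_left)
 also have "... = c j" using assms by (simp add: sum.delta)
 finally show ?thesis .
qed

lemma wnorm_combination:
 assumes "orthonormal I e" "finite I"
 shows "wnorm W (\<Sum>i\<in>I. smult (c i) (e i)) = (\<Sum>i\<in>I. cmod (c i)^2)"
proof -
 let ?p = "\<Sum>i\<in>I. smult (c i) (e i)"
 have dp: "degree ?p < n" using assms unfolding orthonormal_def by (intro degree_sum_smult) auto
 have "of_real (wnorm W ?p) = ip (\<lambda>x. \<Sum>i\<in>I. c i * poly (e i) x) (poly ?p)"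
  unfolding ip_poly_self[symmetric] poly_sum_smult ..
 also have "... = (\<Sum>i\<in>I. ip (\<lambda>x. c i * poly (e i) x) (poly ?p))"
  using assms dp unfolding orthonormal_def by (intro ip_sum_left) (auto intro: tame_cmult tame_poly)
 also have "... = (\<Sum>i\<in>I. c i * cnj (c i))"
 proof (rule sum.cong)
  fix i assume i: "i \<in> I"
  have "ip (poly (e i)) (poly ?p) = cnj (c i)"
   using ip_combination_left[OF assms i, of c] ip_cnj[of "poly ?p" "poly (e i)"] by (metis ip_cnj)
  thus "ip (\<lambda>x. c i * poly (e i) x) (poly ?p) = c i * cnj (c i)" by (simp add: ip_cmult_left)
 qed simp
 also have "... = of_real (\<Sum>i\<in>I. cmod (c i)^2)" by (simp only: of_real_sum of_real_power complex_norm_square[symmetric])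
 finally show ?thesis by (simp only: of_real_eq_iff)
qed

lemma orthonormal_basis_upto:
 assumes "m \<le> n"
 shows "\<exists>e. orthonormal {..<m} e \<and> (\<forall>i<m. degree (e i) \<le> i) \<and>
  (\<forall>p. degree p < m \<or> p = 0 \<longrightarrow> (\<exists>c. p = (\<Sum>i<m. smult (c i) (e i))))"
 using assms
proof (induction m)
 case 0
 thus ?case by (auto simp: orthonormal_def)
next
 case (Suc m)
 have "m \<le> n" using Suc.prems by simp
 from Suc.IH[OF this] obtain e where e0: "orthonormal {..<m} e \<and> (\<forall>i<m. degree (e i) \<le> i) \<and>
  (\<forall>p. degree p < m \<or> p = 0 \<longrightarrow> (\<exists>c. p = (\<Sum>i<m. smult (c i) (e i))))" by blast
 have e: "orthonormal {..<m} e" "\<And>i. i < m ==> degree (e i) \<le> i"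
  "\<And>p. degree p < m \<or> p = 0 ==> \<exists>c. p = (\<Sum>i<m. smult (c i) (e i))"
  using e0 by blast+
 have mn: "m < n" using Suc.prems by simp
 define r where "r = (\<Sum>i<m. smult (ip (poly (monom 1 m)) (poly (e i))) (e i))"
 define b where "b = monom 1 m - r"
 have cr: "coeff r m = 0"
 proof -
  have "coeff (e i) m = 0" if "i < m" for i using e(2)[OF that] that by (intro coeff_eq_0) simp
  thus ?thesis unfolding r_def by (simp add: coeff_sum)
 qed
 have dr: "degree r \<le> m"
 proof -
  have "degree (smult (ip (poly (monom 1 m)) (poly (e i))) (e i)) \<le> m" if "i < m" for i
   using e(2)[OF that] degree_smult_le[of "ip (poly (monom 1 m)) (poly (e i))" "e i"] that by linarith
  thus ?thesis unfolding r_def by (intro degree_sum_le) auto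
 qed
 have cb: "coeff b m = 1" unfolding b_def using cr by simp
 hence b0: "b \<noteq> 0" by auto
 have db: "degree b \<le> m" unfolding b_def using dr by (intro degree_diff_le) (auto simp: degree_monom_le)
 have tm: "tame (poly (monom 1 m))" using mn degree_monom_le[of "1::complex" m] by (intro tame_poly) simp
 have tr: "tame (poly r)" using dr mn by (intro tame_poly) simp
 have te: "tame (poly (e i))" if "i < m" for i using e(1) that unfolding orthonormal_def by (intro tame_poly) auto
 have ob: "ip (poly b) (poly (e i)) = 0" if "i < m" for i
 proof -
  have "poly b = (\<lambda>x. poly (monom 1 m) x - poly r x)" unfolding b_def by (simp add: fun_eq_iff)
  hence "ip (poly b) (poly (e i)) = ip (poly (monom 1 m)) (poly (e i)) - ip (poly r) (poly (e i))"
   by (simp only: ip_diff_left[OF tm tr te[OF that]])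
  thus ?thesis unfolding r_def using ip_combination_left[OF e(1)] that by simp
 qed
 have wb: "wnorm W b > 0" using db mn b0 by (intro wnorm_pos) auto
 define s where "s = complex_of_real (1 / sqrt (wnorm W b))"
 have s0: "s \<noteq> 0" using wb unfolding s_def by simp
 define e' where "e' = e(m := smult s b)"
 have ps: "poly (smult s b) = (\<lambda>x. s * poly b x)" by (simp add: fun_eq_iff)
 have "ip (poly (smult s b)) (poly (smult s b)) = 1"
 proof -
  have "cmod s^2 * wnorm W b = 1"
   using wb unfolding s_def by (simp add: power_divide norm_divide)
  thus ?thesis unfolding ip_poly_self wnorm_smult by simp
 qed
 moreover have "ip (poly (smult s b)) (poly (e i)) = 0" if "i < m" for i
  using ob[OF that] unfolding ps ip_cmult_left by simp
 moreover from this have "ip (poly (e i)) (poly (smult s b)) = 0" if "i < m" for i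
  using that ip_cnj[of "poly (e i)" "poly (smult s b)"] by simp
 moreover have "degree (smult s b) \<le> m" using db by (meson degree_smult_le order_trans)
 ultimately have on: "orthonormal {..<Suc m} e'" and deg': "\<And>i. i < Suc m ==> degree (e' i) \<le> i"
  using e(1,2) mn unfolding orthonormal_def e'_def by (auto simp: less_Suc_eq intro: le_less_trans)
 have "\<exists>c. p = (\<Sum>i<Suc m. smult (c i) (e' i))" if p: "degree p < Suc m \<or> p = 0" for p
 proof -
  let ?q = "p - smult (coeff p m) b"
  have "degree ?q \<le> m" using p db by (intro degree_diff_le) (auto intro: order_trans[OF degree_smult_le])
  moreover have "coeff ?q m = 0" using cb by simp
  ultimately have "degree ?q < m \<or> ?q = 0" by (metis eq_zero_or_degree_less)
  then obtain c where c: "?q = (\<Sum>i<m. smult (c i) (e i))" using e(3) by blast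
  have "p = ?q + smult (coeff p m) b" by simp
  also have "... = (\<Sum>i<m. smult (c i) (e' i)) + smult (coeff p m / s) (e' m)"
   unfolding c e'_def using s0 by simp
  also have "... = (\<Sum>i<Suc m. smult ((c(m := coeff p m / s)) i) (e' i))" by simp
  finally show ?thesis by blast
 qed
 thus ?case using on deg' by blast
qed

lemma orthonormal_basis_exists: "\<exists>e. orthonormal {..<n} e \<and> spanning {..<n} e"
 using orthonormal_basis_upto[of n] unfolding spanning_def by blast

lemma kernel_orthonormal:
 assumes e: "orthonormal I e" "spanning I e" "finite I"
 shows "poly_kernel W n x = (\<Sum>i\<in>I. cmod (poly (e i) x)^2)"
  and "degree p < n ==> cmod (poly p x)^2 \<le> (\<Sum>i\<in>I. cmod (poly (e i) x)^2) * wnorm W p"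
  and "\<exists>p. degree p < n \<and> wnorm W p = 1 \<and> cmod (poly p x)^2 = (\<Sum>i\<in>I. cmod (poly (e i) x)^2)"
  and "(\<Sum>i\<in>I. cmod (poly (e i) x)^2) > 0"
proof -
 define K where "K = (\<Sum>i\<in>I. cmod (poly (e i) x)^2)"
 have de: "degree (e i) < n" if "i \<in> I" for i using e(1) that unfolding orthonormal_def by auto
 show ub: "cmod (poly p x)^2 \<le> (\<Sum>i\<in>I. cmod (poly (e i) x)^2) * wnorm W p" if "degree p < n" for p
 proof -
  obtain c where c: "p = (\<Sum>i\<in>I. smult (c i) (e i))" using e(2) \<open>degree p < n\<close> unfolding spanning_def by blast
  have "cmod (poly p x) \<le> (\<Sum>i\<in>I. cmod (c i) * cmod (poly (e i) x))"
   unfolding c poly_sum_smult by (rule order_trans[OF norm_sum]) (simp add: norm_mult)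
  hence "cmod (poly p x)^2 \<le> (\<Sum>i\<in>I. cmod (c i) * cmod (poly (e i) x))^2" by (intro power_mono) auto
  also have "... \<le> (\<Sum>i\<in>I. cmod (c i)^2) * (\<Sum>i\<in>I. cmod (poly (e i) x)^2)" by (rule Cauchy_Schwarz_ineq_sum)
  finally show ?thesis unfolding c wnorm_combination[OF e(1,3)] by (simp add: mult.commute)
 qed
 have Kpos: "K > 0"
 proof -
  have "cmod (poly 1 x)^2 \<le> K * wnorm W 1" unfolding K_def using n by (intro ub) simp
  hence "K \<noteq> 0" by auto
  moreover have "K \<ge> 0" unfolding K_def by (intro sum_nonneg) simp
  ultimately show ?thesis by simp
 qed
 thus "(\<Sum>i\<in>I. cmod (poly (e i) x)^2) > 0" unfolding K_def .
 define p where "p = (\<Sum>i\<in>I. smult (cnj (poly (e i) x) / of_real (sqrt K)) (e i))"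
 have dp: "degree p < n" unfolding p_def using de by (intro degree_sum_smult) auto
 have "wnorm W p = (\<Sum>i\<in>I. cmod (cnj (poly (e i) x) / of_real (sqrt K))^2)"
  unfolding p_def by (rule wnorm_combination[OF e(1,3)])
 also have "... = (\<Sum>i\<in>I. cmod (poly (e i) x)^2) / K"
  using Kpos by (simp add: norm_divide power_divide sum_divide_distrib)
 finally have wp: "wnorm W p = 1" unfolding K_def[symmetric] using Kpos by simp
 have "poly p x = (\<Sum>i\<in>I. of_real (cmod (poly (e i) x)^2) / of_real (sqrt K))"
  unfolding p_def poly_sum_smult
 proof (intro sum.cong refl)
  fix i
  show "cnj (poly (e i) x) / of_real (sqrt K) * poly (e i) x = of_real (cmod (poly (e i) x)^2) / of_real (sqrt K)"
   using complex_norm_square[of "poly (e i) x"] by (simp add: mult.commute)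
 qed
 also have "... = of_real (K / sqrt K)" unfolding K_def by (simp add: sum_divide_distrib)
 also have "K / sqrt K = sqrt K" using Kpos by (simp add: real_div_sqrt)
 finally have px: "cmod (poly p x)^2 = K" using Kpos by simp
 thus "\<exists>p. degree p < n \<and> wnorm W p = 1 \<and> cmod (poly p x)^2 = (\<Sum>i\<in>I. cmod (poly (e i) x)^2)"
  using dp wp unfolding K_def by blast
 show "poly_kernel W n x = (\<Sum>i\<in>I. cmod (poly (e i) x)^2)"
  unfolding poly_kernel_def K_def[symmetric]
 proof (rule cSup_eq_maximum)
  show "K \<in> {cmod (poly p x)^2 | p. degree p < n \<and> wnorm W p \<le> 1}"
   using dp wp px by (auto intro!: exI[of _ p])
  fix y assume "y \<in> {cmod (poly p x)^2 | p. degree p < n \<and> wnorm W p \<le> 1}"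
  then obtain r where r: "y = cmod (poly r x)^2" "degree r < n" "wnorm W r \<le> 1" by blast
  have "y \<le> K * wnorm W r" unfolding r(1) K_def by (rule ub[OF r(2)])
  also have "... \<le> K * 1" using Kpos r(3) by (intro mult_left_mono) auto
  finally show "y \<le> K" by simp
 qed
qed

lemma kernel_bound: "degree p < n ==> cmod (poly p x)^2 \<le> poly_kernel W n x * wnorm W p"
 using orthonormal_basis_exists kernel_orthonormal(1,2) by (metis finite_lessThan)

lemma kernel_attained: "\<exists>p. degree p < n \<and> wnorm W p = 1 \<and> cmod (poly p x)^2 = poly_kernel W n x"
 using orthonormal_basis_exists kernel_orthonormal(1,3) by (metis finite_lessThan)

lemma kernel_pos: "poly_kernel W n x > 0"
 using orthonormal_basis_exists kernel_orthonormal(1,4) by (metis finite_lessThan)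

lemma projection_exists:
 assumes F: "tame F"
 obtains q where "degree q < n" "\<And>i. i < n ==> (\<integral>z. z ^ i * (cnj (F z - poly q z) * of_real (W z))) = 0"
proof -
 obtain e :: "nat => complex poly" where e: "orthonormal {..<n} e" "spanning {..<n} e"
  using orthonormal_basis_exists by blast
 define q where "q = (\<Sum>i<n. smult (ip F (poly (e i))) (e i))"
 have de: "degree (e i) < n" if "i < n" for i using e(1) that unfolding orthonormal_def by auto
 have dq: "degree q < n" unfolding q_def using de by (intro degree_sum_smult) auto
 have tFq: "tame (\<lambda>x. F x - poly q x)" by (intro tame_diff F tame_poly dq)
 have o: "ip (\<lambda>x. F x - poly q x) (poly (e i)) = 0" if "i < n" for i
 proof -
  have "ip (poly q) (poly (e i)) = ip F (poly (e i))"
   unfolding q_def using ip_combination_left[OF e(1)] that by simp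
  thus ?thesis using ip_diff_left[OF F tame_poly[OF dq] tame_poly[OF de[OF that]]] by simp
 qed
 have "(\<integral>z. z ^ i * (cnj (F z - poly q z) * of_real (W z))) = 0" if i: "i < n" for i
 proof -
  have "degree (monom (1::complex) i) < n" using i degree_monom_le[of "1::complex" i] by simp
  then obtain c where c: "monom 1 i = (\<Sum>j<n. smult (c j) (e j))" using e(2) unfolding spanning_def by blast
  have "ip (poly (monom 1 i)) (\<lambda>x. F x - poly q x) = (\<Sum>j<n. ip (\<lambda>x. c j * poly (e j) x) (\<lambda>x. F x - poly q x))"
   unfolding c poly_sum_smult by (intro ip_sum_left tFq) (auto intro: tame_cmult tame_poly de)
  also have "... = 0"
  proof (intro sum.neutral ballI)
   fix j assume "j \<in> {..<n}"
   hence "ip (poly (e j)) (\<lambda>x. F x - poly q x) = 0"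
    using o[of j] ip_cnj[of "poly (e j)" "\<lambda>x. F x - poly q x"] by simp
   thus "ip (\<lambda>x. c j * poly (e j) x) (\<lambda>x. F x - poly q x) = 0" by (simp add: ip_cmult_left)
  qed
  finally show ?thesis unfolding ip_def by (simp add: poly_monom mult.assoc)
 qed
 thus ?thesis using dq that by blast
qed

lemma orthonormal_card_le:
 assumes e: "orthonormal I e" "finite I"
 shows "card I \<le> n"
proof -
 obtain b :: "nat => complex poly" where b: "orthonormal {..<n} b" "spanning {..<n} b"
  using orthonormal_basis_exists by blast
 have bessel: "(\<Sum>i\<in>I. cmod (poly (e i) x)^2) \<le> (\<Sum>j<n. cmod (poly (b j) x)^2)" for x
 proof -
  define s where "s = (\<Sum>i\<in>I. cmod (poly (e i) x)^2)"
  define p where "p = (\<Sum>i\<in>I. smult (cnj (poly (e i) x)) (e i))"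
  have dp: "degree p < n" unfolding p_def using e unfolding orthonormal_def by (intro degree_sum_smult) auto
  have wp: "wnorm W p = s" unfolding p_def wnorm_combination[OF e] s_def by simp
  have "poly p x = of_real s" unfolding p_def poly_sum_smult s_def of_real_sum
  proof (intro sum.cong refl)
   fix i
   show "cnj (poly (e i) x) * poly (e i) x = of_real (cmod (poly (e i) x)^2)"
    using complex_norm_square[of "poly (e i) x"] by (simp add: mult.commute)
  qed
  hence "s^2 \<le> (\<Sum>j<n. cmod (poly (b j) x)^2) * s"
   using kernel_orthonormal(2)[OF b finite_lessThan dp, of x] wp by simp
  moreover have "s \<ge> 0" unfolding s_def by (intro sum_nonneg) simp
  moreover have "0 \<le> (\<Sum>j<n. cmod (poly (b j) x)^2)" by (intro sum_nonneg) simp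
  ultimately show ?thesis unfolding s_def[symmetric] by (cases "s = 0") (auto simp: power2_eq_square)
 qed
 have one: "wnorm W (e i) = 1" if "i \<in> I" for i
  using e(1) that ip_poly_self[of "e i"] unfolding orthonormal_def by (metis of_real_eq_1_iff)
 have oneb: "wnorm W (b i) = 1" if "i < n" for i
  using b(1) that ip_poly_self[of "b i"] unfolding orthonormal_def by (metis lessThan_iff of_real_eq_1_iff)
 have inte: "L1 (\<lambda>x. cmod (poly (e i) x)^2 * W x)" if "i \<in> I" for i
  using e(1) that unfolding orthonormal_def by (intro norm_integrable tame_poly) auto
 have intb: "L1 (\<lambda>x. cmod (poly (b i) x)^2 * W x)" if "i < n" for i
  using b(1) that unfolding orthonormal_def by (intro norm_integrable tame_poly) auto
 have "real (card I) = (\<Sum>i\<in>I. wnorm W (e i))" using one by simp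
 also have "... = (\<integral>x. (\<Sum>i\<in>I. cmod (poly (e i) x)^2 * W x))"
  unfolding wnorm_def using inte by (intro B_integral_sum[symmetric]) auto
 also have "... \<le> (\<integral>x. (\<Sum>j<n. cmod (poly (b j) x)^2 * W x))"
 proof (rule integral_mono)
  show "L1 (\<lambda>x. \<Sum>i\<in>I. cmod (poly (e i) x)^2 * W x)"
   using inte by (intro B_integrable_sum) auto
  show "L1 (\<lambda>x. \<Sum>j<n. cmod (poly (b j) x)^2 * W x)"
   using intb by (intro B_integrable_sum) auto
  show "(\<Sum>i\<in>I. cmod (poly (e i) x)^2 * W x) \<le> (\<Sum>j<n. cmod (poly (b j) x)^2 * W x)" for x
   unfolding sum_distrib_right[symmetric] using bessel[of x] W_nonneg[of x] by (rule mult_right_mono)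
 qed
 also have "... = (\<Sum>j<n. wnorm W (b j))"
  unfolding wnorm_def using intb by (intro B_integral_sum) auto
 also have "... = real n" using oneb by simp
 finally show ?thesis by simp
qed

end

lemma kernel_comparison:
 assumes W: "poly_weight W n" and W': "poly_weight W' n" and c: "c > 0"
  and le: "\<And>p. degree p < n ==> c * wnorm W p \<le> wnorm W' p"
 shows "poly_kernel W' n x \<le> poly_kernel W n x / c"
proof -
 obtain p where p: "degree p < n" "wnorm W' p = 1" "cmod (poly p x)^2 = poly_kernel W' n x"
  using poly_weight.kernel_attained[OF W'] by blast
 have "c * wnorm W p \<le> 1" using le[OF p(1)] p(2) by simp
 hence "wnorm W p \<le> 1 / c" using c by (simp add: field_simps)
 hence "poly_kernel W n x * wnorm W p \<le> poly_kernel W n x * (1 / c)"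
  using poly_weight.kernel_pos[OF W, of x] by (intro mult_left_mono) auto
 thus ?thesis using poly_weight.kernel_bound[OF W p(1), of x] p(3) by simp
qed

lemma (in regular_weight) weight: "poly_weight W n"
proof
 show "n > 0" by (rule n)
 show "W \<in> borel_measurable borel" by (rule borel_measurable_continuous_onI[OF W_continuous])
 show "0 \<le> W x" for x using Wpos[of x] by simp
 show "AE x in lborel. 0 < W x" using Wpos by simp
 have g: "growth (real n - 1) (\<lambda>x. of_real ((1 + cmod x) ^ (n - 1)))"
  using n by (intro growthI[of _ 1]) (simp add: norm_power powr_realpow[symmetric] add_pos_nonneg of_nat_diff)
 have "growth (-3) (\<lambda>x. of_real ((1 + cmod x) ^ (n - 1)) * of_real ((1 + cmod x) ^ (n - 1)) * of_real (W x))"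
  using growth_mult[OF growth_mult[OF g g] growth_W] by (rule growth_mono) simp
 moreover have cont: "cont (\<lambda>x. complex_of_real (((1 + cmod x) ^ (n - 1))^2 * W x))"
  by (intro continuous_intros W_continuous)
 ultimately have "L1 (\<lambda>x. complex_of_real (((1 + cmod x) ^ (n - 1))^2 * W x))"
  by (intro growth_integrable[of "-3"] borel_measurable_continuous_onI) (simp_all add: power2_eq_square)
 thus "L1 (\<lambda>x. ((1 + cmod x) ^ (n - 1))^2 * W x)" using integrable_Re by fastforce
qed

section \<open>Variation of the weight\<close>

definition rot4 :: "(complex => real) => real => real" where
 "rot4 F r = F (of_real r) + F (\<i> * of_real r) + F (- of_real r) + F (- (\<i> * of_real r))"

lemma rot4_mono: "(\<And>d. cmod d = r ==> F d \<le> G d) ==> r \<ge> 0 ==> rot4 F r \<le> rot4 G r"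
 unfolding rot4_def by (intro add_mono) (auto simp: norm_mult)

lemma rot4_add: "rot4 (\<lambda>d. F d + G d) r = rot4 F r + rot4 G r"
 and rot4_diff: "rot4 (\<lambda>d. F d - G d) r = rot4 F r - rot4 G r"
 and rot4_const: "rot4 (\<lambda>d. c) r = 4 * c"
 and rot4_cmult: "rot4 (\<lambda>d. c * F d) r = c * rot4 F r"
 by (simp_all add: rot4_def algebra_simps)

lemma inverse_sqrt_upper:
 fixes t :: real
 assumes "\<bar>t\<bar> \<le> 1/2"
 shows "1 / sqrt (1 + t) \<le> 1 - t / 2 + 3 / 8 * t^2 + \<bar>t\<bar> ^ 3"
proof -
 define c where "c = \<bar>t\<bar> ^ 3"
 define z where "z = 1 - t / 2 + 3 / 8 * t^2"
 have t: "1 + t > 0" using assms by linarith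
 have c0: "c \<ge> 0" unfolding c_def by simp
 have abs_le: "\<bar>t ^ 3\<bar> \<le> c" "\<bar>t ^ 4\<bar> \<le> c / 2" "\<bar>t ^ 5\<bar> \<le> c / 4"
 proof -
  show "\<bar>t ^ 3\<bar> \<le> c" unfolding c_def by (simp add: power_abs)
  have u4: "u ^ 4 = u ^ 3 * u" "u ^ 5 = u ^ 4 * u" for u :: real
   by (simp_all add: power3_eq_cube numeral_eq_Suc)
  have "\<bar>t\<bar> ^ 3 * \<bar>t\<bar> \<le> \<bar>t\<bar> ^ 3 * (1/2)" using assms by (intro mult_left_mono) auto
  thus 4: "\<bar>t ^ 4\<bar> \<le> c / 2" unfolding c_def u4(1) abs_mult power_abs by simp
  have "\<bar>t ^ 4\<bar> * \<bar>t\<bar> \<le> (c / 2) * (1/2)" using assms 4 c0 by (intro mult_mono) auto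
  thus "\<bar>t ^ 5\<bar> \<le> c / 4" unfolding u4(2) abs_mult by simp
 qed
 have sq: "z^2 * (1 + t) = 1 + 5/8 * t ^ 3 - 15/64 * t ^ 4 + 9/64 * t ^ 5"
  unfolding z_def by (simp add: power2_eq_square numeral_eq_Suc field_simps)
 have tsq: "t^2 \<le> 1/4" "0 \<le> t^2" using assms abs_le_square_iff[of t "1/2"] by (auto simp: power2_eq_square)
 have c8: "c \<le> 1/8" using power_mono[OF assms, of 3] unfolding c_def by (simp add: power3_eq_cube)
 have zt: "z * (1 + t) = 1 + t / 2 - t^2 / 8 + 3 / 8 * t ^ 3"
  unfolding z_def by (simp add: power2_eq_square power3_eq_cube field_simps)
 have zt': "z * (1 + t) \<ge> 5/8" using zt tsq assms abs_le(1) c8 by linarith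
 have z0: "z > 0" unfolding z_def using assms tsq by linarith
 have "1 \<le> (z + c)^2 * (1 + t)"
 proof -
  have "(z + c)^2 * (1 + t) = z^2 * (1 + t) + 2 * (c * (z * (1 + t))) + c^2 * (1 + t)"
   by (simp add: power2_eq_square algebra_simps)
  moreover have "c * (z * (1 + t)) \<ge> c * (5/8)" using zt' c0 by (intro mult_left_mono)
  moreover have "c^2 * (1 + t) \<ge> 0" using t by simp
  ultimately show ?thesis using sq abs_le c0 by linarith
 qed
 hence "1 / (1 + t) \<le> (z + c)^2" using t by (simp add: divide_le_eq)
 hence "sqrt (1 / (1 + t)) \<le> z + c" using z0 c0 by (intro real_le_lsqrt) auto
 thus ?thesis unfolding z_def c_def by (simp add: real_sqrt_divide)
qed

lemma perturbation_bounds: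
 fixes a b1 b2 b3 d :: complex and M r :: real
 assumes a: "cmod a \<le> 1" and b: "cmod b1 \<le> M" "cmod b2 \<le> M" "cmod b3 \<le> M" and M: "M \<ge> 1"
  and r: "cmod d = r" "30 * M^2 * r \<le> 1"
 defines "s \<equiv> d * b1 + d^2 * b2 + d ^ 3 * b3"
 defines "t \<equiv> 2 * Re (cnj a * s) + cmod s^2"
 shows "\<bar>t\<bar> \<le> 15 * M^2 * r"
  and "1 / sqrt (1 + t) \<le> 1 - Re (cnj a * b1 * d) - Re (cnj a * b2 * d^2) - cmod b1^2 * r^2 / 2
   + 3 / 2 * (Re (cnj a * b1 * d))^2 + 3500 * M ^ 6 * r ^ 3"
proof -
 have r0: "r \<ge> 0" using r(1) by auto
 have M2: "M \<le> M^2" "1 \<le> M^2" using M by (auto simp: power2_eq_square intro: mult_left_mono[of 1 M M, simplified] order_trans[of 1 M "M * M"])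
 have r1: "r \<le> 1"
 proof -
  have "r * 1 \<le> r * (30 * M^2)" using M2 r0 by (intro mult_left_mono) auto
  thus ?thesis using r(2) by (simp add: mult.commute)
 qed
 have rr: "r^2 \<le> r" "r ^ 3 \<le> r^2" "0 \<le> r^2" "0 \<le> r ^ 3"
  using r0 r1 power_decreasing[of 1 2 r] power_decreasing[of 2 3 r] by auto
 have Mr: "0 \<le> M * r" "0 \<le> M * r^2" "0 \<le> M * r^3" "M * r^2 \<le> M * r" "M * r ^ 3 \<le> M * r^2" using M r0 rr by (auto intro: mult_left_mono)
 have n1: "cmod (d * b1) \<le> M * r" using mult_left_mono[OF b(1) r0] by (simp only: norm_mult r(1) mult.commute)
 have n2: "cmod (d^2 * b2) \<le> M * r^2" using mult_left_mono[OF b(2) rr(3)] by (simp only: norm_mult norm_power r(1) mult.commute)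
 have n3: "cmod (d ^ 3 * b3) \<le> M * r ^ 3" using mult_left_mono[OF b(3) rr(4)] by (simp only: norm_mult norm_power r(1) mult.commute)
 have ns1: "cmod (s - d * b1) \<le> 2 * (M * r^2)"
 proof -
  have "s - d * b1 = d^2 * b2 + d ^ 3 * b3" unfolding s_def by simp
  show ?thesis unfolding \<open>s - d * b1 = _\<close> using norm_triangle_ineq[of "d^2 * b2" "d ^ 3 * b3"] n2 n3 Mr by linarith
 qed
 have ns: "cmod s \<le> 3 * (M * r)"
 proof -
  have "cmod s \<le> cmod (d * b1) + cmod (s - d * b1)" using norm_triangle_ineq[of "d * b1" "s - d * b1"] by simp
  thus ?thesis using n1 ns1 Mr by linarith
 qed
 have Re_le: "\<bar>Re (cnj a * w)\<bar> \<le> cmod w" for w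
 proof -
  have "\<bar>Re (cnj a * w)\<bar> \<le> cmod a * cmod w" using abs_Re_le_cmod[of "cnj a * w"] by (simp add: norm_mult)
  also have "... \<le> 1 * cmod w" using a by (intro mult_right_mono) auto
  finally show ?thesis by simp
 qed
 have MM: "M^2 * r \<ge> M * r" "M^2 * r^2 \<le> M^2 * r" "0 \<le> M^2 * r^2" using M2 r0 rr by (auto intro: mult_right_mono mult_left_mono)
 have s2: "cmod s^2 \<le> 9 * (M^2 * r^2)"
  using power_mono[OF ns, of 2] by (simp add: power_mult_distrib)
 show tb: "\<bar>t\<bar> \<le> 15 * M^2 * r"
 proof -
  have "\<bar>t\<bar> \<le> 2 * cmod s + cmod s^2" unfolding t_def using Re_le[of s] zero_le_power2[of "cmod s"] by arith
  thus ?thesis using ns s2 MM by linarith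
 qed
 define m1 where "m1 = 2 * Re (cnj a * (d * b1))"
 define t2 where "t2 = 2 * Re (cnj a * (d^2 * b2)) + cmod b1^2 * r^2"
 have rho: "\<bar>t - m1 - t2\<bar> \<le> 10 * M^2 * r ^ 3"
 proof -
  have "t - m1 - t2 = 2 * Re (cnj a * (d ^ 3 * b3)) + (cmod s^2 - cmod (d * b1)^2)"
   unfolding t_def m1_def t2_def s_def by (simp add: norm_mult r(1) power_mult_distrib algebra_simps)
  moreover have "\<bar>cmod s^2 - cmod (d * b1)^2\<bar> \<le> 8 * (M^2 * r ^ 3)"
  proof -
   have "\<bar>cmod s^2 - cmod (d * b1)^2\<bar> = \<bar>cmod s - cmod (d * b1)\<bar> * (cmod s + cmod (d * b1))"
    by (simp add: power2_eq_square square_diff_square_factored abs_mult)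
   also have "... \<le> (2 * (M * r^2)) * (4 * (M * r))"
    using ns ns1 n1 norm_triangle_ineq3[of s "d * b1"] Mr by (intro mult_mono) auto
   finally show ?thesis by (simp add: power2_eq_square power3_eq_cube mult_ac)
  qed
  moreover have "\<bar>Re (cnj a * (d ^ 3 * b3))\<bar> \<le> M^2 * r ^ 3"
   using Re_le[of "d ^ 3 * b3"] n3 mult_right_mono[OF M2(1) rr(4)] by linarith
  ultimately show ?thesis by linarith
 qed
 have t2b: "\<bar>t2\<bar> \<le> 3 * M^2 * r^2"
 proof -
  have "cmod b1^2 * r^2 \<le> M^2 * r^2" using b(1) by (intro mult_right_mono power_mono) auto
  moreover have "0 \<le> cmod b1^2 * r^2" by simp
  moreover have "\<bar>Re (cnj a * (d^2 * b2))\<bar> \<le> M^2 * r^2"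
   using Re_le[of "d^2 * b2"] n2 mult_right_mono[OF M2(1) rr(3)] by linarith
  ultimately show ?thesis unfolding t2_def by linarith
 qed
 have m1b: "\<bar>m1\<bar> \<le> 2 * M^2 * r" unfolding m1_def using Re_le[of "d * b1"] n1 MM by linarith
 have M23: "M^2 * r ^ 3 \<le> M^2 * r^2" using rr M2 by (intro mult_left_mono) auto
 have tm: "\<bar>t - m1\<bar> \<le> 13 * M^2 * r^2" using rho t2b M23 by linarith
 have t2sq: "t^2 \<le> m1^2 + 221 * M ^ 4 * r ^ 3"
 proof -
  have "t^2 - m1^2 = (t - m1) * (t + m1)" by (simp add: power2_eq_square algebra_simps)
  also have "... \<le> \<bar>t - m1\<bar> * \<bar>t + m1\<bar>" by (simp add: abs_mult[symmetric])
  also have "... \<le> (13 * M^2 * r^2) * (17 * M^2 * r)"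
   using tm tb m1b r0 by (intro mult_mono) auto
  also have "... = 221 * M ^ 4 * r ^ 3" by (simp add: power2_eq_square power3_eq_cube power4_eq_xxxx)
  finally show ?thesis by simp
 qed
 have t3: "\<bar>t\<bar> ^ 3 \<le> 3375 * M ^ 6 * r ^ 3"
  using power_mono[OF tb, of 3] by (simp add: power_mult_distrib flip: power_mult)
 have tl: "\<bar>t\<bar> \<le> 1/2" using tb r(2) by simp
 have M6: "M^2 * r ^ 3 \<le> M ^ 6 * r ^ 3" "M ^ 4 * r ^ 3 \<le> M ^ 6 * r ^ 3" "0 \<le> M ^ 6 * r ^ 3"
  using M rr by (auto intro!: mult_right_mono power_increasing)
 have "1 / sqrt (1 + t) \<le> 1 - t / 2 + 3 / 8 * t^2 + \<bar>t\<bar> ^ 3" by (rule inverse_sqrt_upper[OF tl])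
 also have "... \<le> 1 - (m1 + t2) / 2 + 3 / 8 * m1^2 + 3500 * M ^ 6 * r ^ 3"
 proof -
  have gen: "1 - t / 2 + 3 / 8 * u + c \<le> 1 - (m1 + t2) / 2 + 3 / 8 * v + 3500 * Z"
   if "\<bar>t - m1 - t2\<bar> \<le> 10 * X" "u \<le> v + 221 * Y" "c \<le> 3375 * Z" "X \<le> Z" "Y \<le> Z" "0 \<le> Z" for u v c X Y Z :: real
   using that by argo
  show ?thesis unfolding mult.assoc by (rule gen[OF rho[unfolded mult.assoc] t2sq[unfolded mult.assoc] t3[unfolded mult.assoc] M6])
 qed
 also have "... = 1 - Re (cnj a * b1 * d) - Re (cnj a * b2 * d^2) - cmod b1^2 * r^2 / 2
   + 3 / 2 * (Re (cnj a * b1 * d))^2 + 3500 * M ^ 6 * r ^ 3"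
 proof -
  have "m1 = 2 * Re (cnj a * b1 * d)" "t2 = 2 * Re (cnj a * b2 * d^2) + cmod b1^2 * r^2"
   unfolding m1_def t2_def by (simp_all only: mult_ac)
  moreover have "1 - (2 * x + (2 * y + B)) / 2 + 3 / 8 * (2 * x)^2 + E = 1 - x - y - B / 2 + 3 / 2 * x^2 + E" for x y B E :: real
   by (simp add: power2_eq_square field_simps)
  ultimately show ?thesis by (simp only:)
 qed
 finally show "1 / sqrt (1 + t) \<le> 1 - Re (cnj a * b1 * d) - Re (cnj a * b2 * d^2) - cmod b1^2 * r^2 / 2
   + 3 / 2 * (Re (cnj a * b1 * d))^2 + 3500 * M ^ 6 * r ^ 3" .
qed

lemma rot4_identity:
 fixes p q \<alpha> \<beta> :: complex and B r :: real
 shows "rot4 (\<lambda>d. cmod (p + d * q)^2 * (1 - Re (\<alpha> * d) - Re (\<beta> * d^2) - B * r^2 / 2 + 3 / 2 * (Re (\<alpha> * d))^2)) r =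
   4 * cmod p^2 + 4 * r^2 * (cmod (\<alpha> * p / 2 - q)^2 - (B - (cmod \<alpha>)^2) * cmod p^2 / 2)
   + r ^ 4 * cmod q^2 * (3 * (cmod \<alpha>)^2 - 2 * B)"
 unfolding rot4_def cmod_power2
 by (simp add: power2_eq_square numeral_eq_Suc field_simps)

lemma rot4_perturbation:
 fixes p q a b1 b2 b3 :: complex and M r :: real
 assumes a: "cmod a \<le> 1" and b: "cmod b1 \<le> M" "cmod b2 \<le> M" "cmod b3 \<le> M" and M: "M \<ge> 1"
  and r: "r \<ge> 0" "30 * M^2 * r \<le> 1"
 defines "s \<equiv> \<lambda>d. d * b1 + d^2 * b2 + d ^ 3 * b3"
 shows "rot4 (\<lambda>d. cmod (p + d * q)^2 / sqrt (1 + (2 * Re (cnj a * s d) + cmod (s d)^2))) r \<le>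
  4 * cmod p^2 + 4 * r^2 * (cmod (cnj a * b1 * p / 2 - q)^2 - (1 - cmod a^2) * cmod b1^2 * cmod p^2 / 2)
  + 30000 * M ^ 6 * r ^ 3 * (cmod p^2 + cmod q^2)"
proof -
 have M2: "1 \<le> M^2" using M by (simp add: one_le_power)
 have r1: "r \<le> 1"
 proof -
  have "r * 1 \<le> r * (30 * M^2)" using M2 r by (intro mult_left_mono) auto
  thus ?thesis using r(2) by (simp add: mult.commute)
 qed
 let ?T = "\<lambda>d. 1 - Re (cnj a * b1 * d) - Re (cnj a * b2 * d^2) - cmod b1^2 * r^2 / 2 + 3 / 2 * (Re (cnj a * b1 * d))^2"
 let ?E = "3500 * M ^ 6 * r ^ 3"
 let ?P = "cmod p^2" and ?Q = "cmod q^2"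
 have E0: "?E \<ge> 0" using M r by simp
 have "rot4 (\<lambda>d. cmod (p + d * q)^2 / sqrt (1 + (2 * Re (cnj a * s d) + cmod (s d)^2))) r \<le>
   rot4 (\<lambda>d. cmod (p + d * q)^2 * ?T d + 2 * (?P + ?Q) * ?E) r"
 proof (rule rot4_mono)
  fix d :: complex assume d: "cmod d = r"
  have "cmod (p + d * q)^2 \<le> 2 * (?P + ?Q)"
  proof -
   have "cmod (p + d * q) \<le> cmod p + cmod q"
    using norm_triangle_ineq[of p "d * q"] d r1 r mult_right_mono[OF r1, of "cmod q"] by (simp add: norm_mult)
   hence "cmod (p + d * q)^2 \<le> (cmod p + cmod q)^2" by (intro power_mono) auto
   also have "... \<le> 2 * (?P + ?Q)" using zero_le_power2[of "cmod p - cmod q"] by (simp add: power2_eq_square algebra_simps)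
   finally show ?thesis .
  qed
  hence 1: "cmod (p + d * q)^2 * ?E \<le> 2 * (?P + ?Q) * ?E" using E0 by (rule mult_right_mono)
  have "cmod (p + d * q)^2 * (1 / sqrt (1 + (2 * Re (cnj a * s d) + cmod (s d)^2))) \<le> cmod (p + d * q)^2 * (?T d + ?E)"
   unfolding s_def by (intro mult_left_mono perturbation_bounds(2)[OF a b M d r(2)]) simp
  also have "... = cmod (p + d * q)^2 * ?T d + cmod (p + d * q)^2 * ?E" by (rule distrib_left)
  finally show "cmod (p + d * q)^2 / sqrt (1 + (2 * Re (cnj a * s d) + cmod (s d)^2)) \<le>
    cmod (p + d * q)^2 * ?T d + 2 * (?P + ?Q) * ?E" using 1 by simp
 qed (rule r)
 also have "... = rot4 (\<lambda>d. cmod (p + d * q)^2 * ?T d) r + 28000 * M ^ 6 * r ^ 3 * (?P + ?Q)"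
  unfolding rot4_add rot4_const by simp
 also have "rot4 (\<lambda>d. cmod (p + d * q)^2 * ?T d) r =
   4 * ?P + 4 * r^2 * (cmod (cnj a * b1 * p / 2 - q)^2 - (cmod b1^2 - cmod (cnj a * b1)^2) * ?P / 2)
   + r ^ 4 * ?Q * (3 * cmod (cnj a * b1)^2 - 2 * cmod b1^2)"
  by (rule rot4_identity)
 also have "cmod b1^2 - cmod (cnj a * b1)^2 = (1 - cmod a^2) * cmod b1^2"
  by (simp add: norm_mult power_mult_distrib algebra_simps)
 also have "r ^ 4 * ?Q * (3 * cmod (cnj a * b1)^2 - 2 * cmod b1^2) \<le> 2000 * M ^ 6 * r ^ 3 * (?P + ?Q)"
 proof -
  have "cmod (cnj a * b1) \<le> 1 * M" unfolding norm_mult using a b(1) by (intro mult_mono) auto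
  hence "cmod (cnj a * b1)^2 \<le> (1 * M)^2" by (intro power_mono) auto
  hence "3 * cmod (cnj a * b1)^2 - 2 * cmod b1^2 \<le> 3 * M^2" using zero_le_power2[of "cmod b1"] unfolding mult_1 by linarith
  hence "r ^ 4 * ?Q * (3 * cmod (cnj a * b1)^2 - 2 * cmod b1^2) \<le> r ^ 4 * ?Q * (3 * M^2)"
   using r by (intro mult_left_mono) auto
  also have "... \<le> r ^ 3 * (?P + ?Q) * (3 * M ^ 6)"
  proof -
   have x1: "r ^ 4 \<le> r ^ 3" using power_decreasing[of 3 4 r] r r1 by simp
   have x2: "r ^ 4 * ?Q \<le> r ^ 3 * (?P + ?Q)" by (intro mult_mono x1) (use r in auto)
   have x3: "3 * M^2 \<le> 3 * M ^ 6" using power_increasing[of 2 6 M] M by simp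
   show ?thesis by (rule mult_mono[OF x2 x3]) (use r in auto)
  qed
  also have "... \<le> 2000 * M ^ 6 * r ^ 3 * (?P + ?Q)"
  proof -
   have "0 \<le> M ^ 6 * r ^ 3 * (?P + ?Q)" using M r by simp
   moreover have "r ^ 3 * (?P + ?Q) * (3 * M ^ 6) = 3 * (M ^ 6 * r ^ 3 * (?P + ?Q))" by (simp only: mult_ac)
   moreover have "2000 * M ^ 6 * r ^ 3 * (?P + ?Q) = 2000 * (M ^ 6 * r ^ 3 * (?P + ?Q))" by (simp only: mult.assoc)
   ultimately show ?thesis by linarith
  qed
  finally show ?thesis .
 qed
 finally show ?thesis by (simp add: algebra_simps)
qed

lemma degree_perturbation:
 fixes f f1 f2 f3 :: "complex poly"
 assumes "degree f = 2 * n + 1" "degree f1 \<le> 2 * n" "degree f2 \<le> 2 * n" "degree f3 \<le> 2 * n"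
 shows "degree (f + smult d f1 + smult (d^2) f2 + smult (d ^ 3) f3) = 2 * n + 1"
proof -
 have "degree (smult d f1 + smult (d^2) f2 + smult (d ^ 3) f3) \<le> 2 * n"
  using assms by (intro degree_add_le) (auto intro: order_trans[OF degree_smult_le])
 hence "degree (f + (smult d f1 + smult (d^2) f2 + smult (d ^ 3) f3)) = degree f"
  using assms(1) by (intro degree_add_eq_left) auto
 thus ?thesis using assms(1) by (simp add: add.assoc)
qed

locale weight_family =
 fixes f f1 f2 f3 :: "complex poly" and n :: nat and \<epsilon> :: real
 assumes degf: "degree f = 2 * n + 1" and n: "n > 0" and eps: "\<epsilon> > 0"
  and degs: "degree f1 \<le> 2 * n" "degree f2 \<le> 2 * n" "degree f3 \<le> 2 * n"
begin

definition F :: "complex => complex poly" where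
 "F d = f + smult d f1 + smult (d^2) f2 + smult (d ^ 3) f3"

definition Wd :: "complex => complex => real" where "Wd d = regular_weight.W (F d) \<epsilon>"

abbreviation W0 :: "complex => real" where "W0 \<equiv> regular_weight.W f \<epsilon>"

abbreviation qW :: "complex poly => complex => complex" where "qW g x \<equiv> poly g x * of_real (W0 x)"

lemma degF: "degree (F d) = 2 * n + 1"
 unfolding F_def by (rule degree_perturbation[OF degf degs])

sublocale base: regular_weight f n \<epsilon> by unfold_locales (auto simp: degf n eps)

lemma regular: "regular_weight (F d) n \<epsilon>" by unfold_locales (auto simp: degF n eps)

lemma weight: "poly_weight (Wd d) n" unfolding Wd_def by (rule regular_weight.weight[OF regular])

lemma bounded_coefficients:
 obtains M where "M \<ge> 1" "\<And>x. cmod (qW f1 x) \<le> M"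
  "\<And>x. cmod (qW f2 x) \<le> M" "\<And>x. cmod (qW f3 x) \<le> M"
proof -
 have "\<exists>M. \<forall>x. cmod (qW g x) \<le> M" if "degree g \<le> 2 * n" for g
 proof -
  have "growth (2 * real n) (poly g)" using that by (intro growth_poly) simp
  from growth_mult[OF this base.growth_W] have "growth 0 (\<lambda>x. poly g x * of_real (W0 x))" by (rule growth_mono) simp
  from growth_bound[OF this] obtain C where C: "C \<ge> 0" "\<And>x. cmod (qW g x) \<le> C * wt 0 x" by blast
  have "cmod (qW g x) \<le> C" for x
  proof -
   have "wt 0 x \<le> 1" by (cases "1 + cmod x = 0") auto
   from mult_left_mono[OF this C(1)] C(2)[of x] show ?thesis by simp
  qed
  thus ?thesis by blast
 qed
 then obtain M1 M2 M3 where M: "\<And>x. cmod (qW f1 x) \<le> M1"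
  "\<And>x. cmod (qW f2 x) \<le> M2" "\<And>x. cmod (qW f3 x) \<le> M3" using degs by metis
 show ?thesis
  by (rule that[of "max 1 (max M1 (max M2 M3))"]) (use M in \<open>auto simp: le_max_iff_disj\<close>)
qed

lemma Wd_quotient:
 defines "s \<equiv> \<lambda>d x. d * (qW f1 x) + d^2 * (qW f2 x) + d ^ 3 * (qW f3 x)"
 shows "Wd d x = W0 x / sqrt (1 + (2 * Re (cnj (qW f x) * s d x) + cmod (s d x)^2))"
proof -
 let ?a = "poly f x * complex_of_real (W0 x)"
 have "poly (F d) x * of_real (W0 x) = ?a + s d x"
  unfolding F_def s_def by (simp add: algebra_simps)
 hence "cmod (poly (F d) x)^2 * (W0 x)^2 = cmod (?a + s d x)^2"
  by (metis base.Wpos norm_mult norm_of_real power_mult_distrib power2_abs)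
 also have "... = cmod ?a^2 + (2 * Re (cnj ?a * s d x) + cmod (s d x)^2)"
  unfolding cmod_power2 by (simp add: power2_eq_square algebra_simps)
 finally have "(cmod (poly (F d) x)^2 + \<epsilon>) * (W0 x)^2 = cmod ?a^2 + \<epsilon> * (W0 x)^2 + (2 * Re (cnj ?a * s d x) + cmod (s d x)^2)"
  by (simp add: algebra_simps)
 also have "cmod ?a^2 + \<epsilon> * (W0 x)^2 = 1" using base.eps_W[of x] by (simp add: norm_mult power_mult_distrib)
 finally have "sqrt (cmod (poly (F d) x)^2 + \<epsilon>) * W0 x = sqrt (1 + (2 * Re (cnj ?a * s d x) + cmod (s d x)^2))"
  using base.Wpos[of x] by (metis abs_of_pos real_sqrt_abs real_sqrt_mult)
 moreover have "Wd d x = 1 / sqrt (cmod (poly (F d) x)^2 + \<epsilon>)"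
  unfolding Wd_def regular_weight.W_def[OF regular] regular_weight.V_def[OF regular] ..
 moreover have "sqrt (cmod (poly (F d) x)^2 + \<epsilon>) > 0" using eps by (simp add: add_nonneg_pos)
 moreover have "w = W' / B" if "A * W' = B" "w = 1 / A" "A > 0" "W' > 0" for w W' A B :: real
  using that by auto
 ultimately show ?thesis using base.Wpos[of x] by blast
qed

lemma kernel_continuous:
 "((\<lambda>d. poly_kernel (Wd d) n x) \<longlongrightarrow> poly_kernel W0 n x) (at 0)"
proof -
 obtain M where M: "M \<ge> 1" "\<And>x. cmod (qW f1 x) \<le> M"
  "\<And>x. cmod (qW f2 x) \<le> M" "\<And>x. cmod (qW f3 x) \<le> M"
  using bounded_coefficients by blast
 define K where "K = poly_kernel W0 n x"
 have M0: "M^2 > 0" using M(1) by simp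
 have ev: "(1 - 15 * M^2 * cmod d) * K \<le> poly_kernel (Wd d) n x \<and> poly_kernel (Wd d) n x \<le> (1 + 15 * M^2 * cmod d) * K"
  if d: "30 * M^2 * cmod d \<le> 1" for d
 proof -
  define \<tau> where "\<tau> = 15 * M^2 * cmod d"
  have \<tau>: "0 \<le> \<tau>" "\<tau> \<le> 1/2" using d by (auto simp: \<tau>_def)
  have pw: "W0 y / (1 + \<tau>) \<le> Wd d y \<and> Wd d y \<le> W0 y / (1 - \<tau>)" for y
  proof -
   define t where "t = 2 * Re (cnj (qW f y) * (d * (qW f1 y) + d^2 * (qW f2 y) + d ^ 3 * (qW f3 y)))
     + cmod (d * (qW f1 y) + d^2 * (qW f2 y) + d ^ 3 * (qW f3 y))^2"
   have a1: "cmod (qW f y) \<le> 1"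
    using base.f_W_le[of y] base.Wpos[of y] by (simp add: norm_mult)
   have t: "\<bar>t\<bar> \<le> \<tau>" unfolding t_def \<tau>_def
    by (rule perturbation_bounds(1)[OF a1 M(2-4) M(1) refl d])
   have eq: "Wd d y = W0 y / sqrt (1 + t)" unfolding t_def by (rule Wd_quotient)
   have tp: "1 + t > 0" using t \<tau> by linarith
   have "sqrt (1 + t) \<le> 1 + \<tau>"
   proof (rule real_le_lsqrt)
    have "(1 + \<tau>)^2 = 1 + 2 * \<tau> + \<tau>^2" by (simp add: power2_eq_square algebra_simps)
    thus "1 + t \<le> (1 + \<tau>)^2" using t \<tau> zero_le_power2[of \<tau>] by linarith
   qed (use \<tau> in linarith)
   moreover have "1 - \<tau> \<le> sqrt (1 + t)"
   proof (rule real_le_rsqrt)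
    have "\<tau>^2 \<le> \<tau>" using \<tau> by (simp add: power2_eq_square mult_left_le)
    moreover have "(1 - \<tau>)^2 = 1 - 2 * \<tau> + \<tau>^2" by (simp add: power2_eq_square algebra_simps)
    ultimately show "(1 - \<tau>)^2 \<le> 1 + t" using t by linarith
   qed
   ultimately show ?thesis unfolding eq using base.Wpos[of y] \<tau> tp
    by (auto intro!: divide_left_mono mult_pos_pos)
  qed
  have wn: "wnorm W p \<le> c * wnorm W' p"
   if "poly_weight W n" "poly_weight W' n" "degree p < n" "\<And>y. W y \<le> c * W' y" for W W' c and p :: "complex poly"
  proof -
   have "wnorm W p \<le> (\<integral>y. c * (cmod (poly p y)^2 * W' y))"
    unfolding wnorm_def
   proof (rule integral_mono)
    show "L1 (\<lambda>y. cmod (poly p y)^2 * W y)"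
     "L1 (\<lambda>y. c * (cmod (poly p y)^2 * W' y))"
     using poly_weight.norm_integrable[OF that(1) poly_weight.tame_poly[OF that(1,3)]]
      poly_weight.norm_integrable[OF that(2) poly_weight.tame_poly[OF that(2,3)]] by auto
    show "cmod (poly p y)^2 * W y \<le> c * (cmod (poly p y)^2 * W' y)" for y
     using mult_left_mono[OF that(4)[of y], of "cmod (poly p y)^2"] by (simp add: mult_ac)
   qed
   thus ?thesis unfolding wnorm_def by simp
  qed
  have "poly_kernel (Wd d) n x \<le> K / (1 / (1 + \<tau>))" unfolding K_def
  proof (rule kernel_comparison[OF base.weight weight])
   fix p :: "complex poly" assume p: "degree p < n"
   have "wnorm W0 p \<le> (1 + \<tau>) * wnorm (Wd d) p"
    by (rule wn[OF base.weight weight p]) (use pw \<tau> in \<open>auto simp: field_simps\<close>)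
   thus "1 / (1 + \<tau>) * wnorm W0 p \<le> wnorm (Wd d) p" using \<tau> by (simp add: field_simps)
  qed (use \<tau> in auto)
  moreover have "K \<le> poly_kernel (Wd d) n x / (1 - \<tau>)" unfolding K_def
  proof (rule kernel_comparison[OF weight base.weight])
   fix p :: "complex poly" assume p: "degree p < n"
   have "wnorm (Wd d) p \<le> 1 / (1 - \<tau>) * wnorm W0 p"
    by (rule wn[OF weight base.weight p]) (use pw \<tau> in auto)
   thus "(1 - \<tau>) * wnorm (Wd d) p \<le> wnorm W0 p" using \<tau> by (simp add: field_simps)
  qed (use \<tau> in auto)
  ultimately show ?thesis unfolding \<tau>_def[symmetric] using \<tau> by (simp add: field_simps)
 qed
 have evd: "\<forall>\<^sub>F d in at 0. 30 * M^2 * cmod d \<le> 1"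
  unfolding eventually_at using M0 by (intro exI[of _ "1 / (30 * M^2)"]) (auto simp: field_simps)
 show ?thesis unfolding K_def[symmetric]
 proof (rule tendsto_sandwich)
  show "\<forall>\<^sub>F d in at 0. (1 - 15 * M^2 * cmod d) * K \<le> poly_kernel (Wd d) n x"
   "\<forall>\<^sub>F d in at 0. poly_kernel (Wd d) n x \<le> (1 + 15 * M^2 * cmod d) * K"
   by (rule eventually_mono[OF evd], use ev in blast)+
  have "((\<lambda>d. (1 - 15 * M^2 * cmod d) * K) \<longlongrightarrow> (1 - 15 * M^2 * cmod 0) * K) (at 0)" by (intro tendsto_intros)
  thus "((\<lambda>d. (1 - 15 * M^2 * cmod d) * K) \<longlongrightarrow> K) (at 0)" by simp
  have "((\<lambda>d. (1 + 15 * M^2 * cmod d) * K) \<longlongrightarrow> (1 + 15 * M^2 * cmod 0) * K) (at 0)" by (intro tendsto_intros)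
  thus "((\<lambda>d. (1 + 15 * M^2 * cmod d) * K) \<longlongrightarrow> K) (at 0)" by simp
 qed
qed

lemma kernel_four_mean:
 obtains K r0 where "K \<ge> 0" "r0 > 0"
  "\<And>r. 0 < r ==> r \<le> r0 ==> rot4 (\<lambda>d. ln (poly_kernel (Wd d) n x)) r \<ge> 4 * ln (poly_kernel W0 n x) - K * r ^ 3"
proof -
 interpret pw: poly_weight W0 n by (rule base.weight)
 obtain M where M: "M \<ge> 1" "\<And>x. cmod (qW f1 x) \<le> M"
  "\<And>x. cmod (qW f2 x) \<le> M" "\<And>x. cmod (qW f3 x) \<le> M"
  using bounded_coefficients by blast
 define B where "B = poly_kernel W0 n x"
 have Bpos: "B > 0" unfolding B_def by (rule pw.kernel_pos)
 obtain p where p: "degree p < n" "wnorm W0 p = 1" "cmod (poly p x)^2 = B"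
  using pw.kernel_attained unfolding B_def by blast
 have px: "poly p x \<noteq> 0" using p(3) Bpos by auto
 define G where "G = (\<lambda>x. poly f1 x * poly p x * cnj (poly f x) * of_real (W0 x) ^ 2 / 2)"
 have tG: "pw.tame G"
 proof (rule pw.tame_growth)
  have "growth (2 * real n + (real n - 1) + 0 + - (2 * real n + 1)) (\<lambda>x. poly f1 x * poly p x * (cnj (qW f x)) * of_real (W0 x))"
   using degs(1) p(1) by (intro growth_mult growth_poly growth_cnj base.growth_fW base.growth_W) auto
  hence "growth (real n - 1) (\<lambda>x. poly f1 x * poly p x * (cnj (qW f x)) * of_real (W0 x))"
   by (rule growth_mono) simp
  from growth_cmult[OF this, of "1/2"] show "growth (real n - 1) G"
   unfolding G_def by (simp add: power2_eq_square mult_ac)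
  show "G \<in> borel_measurable borel" unfolding G_def
   by (intro borel_measurable_continuous_onI continuous_intros base.cW_continuous) auto
 qed
 obtain q where q: "degree q < n" "\<And>i. i < n ==> (\<integral>z. z ^ i * (cnj (G z - poly q z) * of_real (W0 z))) = 0"
  using pw.projection_exists[OF tG] by blast
 define S where "S = (\<lambda>x. \<epsilon> / 2 * cmod (poly f1 x)^2 * cmod (poly p x)^2 * W0 x ^ 5)"
 note pe = base.projection_error_estimate[OF degs(1) p(1) q(1) q(2)[unfolded G_def]]
 define E where "E = (\<lambda>x. cmod (G x - poly q x)^2 * W0 x)"
 have iE: "L1 E" and iS: "L1 S" and ES: "(\<integral>x. E x) \<le> (\<integral>x. S x)"
  unfolding E_def G_def S_def by (rule pe, assumption)+
 have ip: "L1 (\<lambda>x. cmod (poly p x)^2 * W0 x)" "L1 (\<lambda>x. cmod (poly q x)^2 * W0 x)"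
  by (rule pw.norm_integrable[OF pw.tame_poly[OF p(1)]] pw.norm_integrable[OF pw.tame_poly[OF q(1)]])+
 define r1 where "r1 = 1 / (30 * M^2)"
 have r1: "r1 > 0" "30 * M^2 * r \<le> 1" if "r \<le> r1" for r
  using M(1) that unfolding r1_def by (auto simp: field_simps)
 define Nd where "Nd = (\<lambda>d. wnorm (Wd d) (p + smult d q))"
 define K1 where "K1 = 30000 * M ^ 6 * (1 + wnorm W0 q)"
 have dpq: "degree (p + smult d q) < n" for d
  using p(1) q(1) degree_add_le_max[of p "smult d q"] degree_smult_le[of d q] by (auto simp: max_def split: if_splits)
 have ipq: "L1 (\<lambda>y. cmod (poly p y + d * poly q y)^2 * Wd d y)" for d
  using poly_weight.norm_integrable[OF weight poly_weight.tame_poly[OF weight dpq[of d]], of d] by simp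
 have N4: "rot4 Nd r \<le> 4 + K1 * r ^ 3" if r: "0 < r" "r \<le> r1" for r
 proof -
  have pt: "rot4 (\<lambda>d. cmod (poly p y + d * poly q y)^2 * Wd d y) r \<le>
    4 * (cmod (poly p y)^2 * W0 y) + 4 * r^2 * (E y - S y) + 30000 * M ^ 6 * r ^ 3 * (cmod (poly p y)^2 * W0 y + cmod (poly q y)^2 * W0 y)" for y
  proof -
   let ?a = "poly f y * complex_of_real (W0 y)" and ?b1 = "poly f1 y * complex_of_real (W0 y)"
   let ?s = "\<lambda>d. d * ?b1 + d^2 * (qW f2 y) + d ^ 3 * (qW f3 y)"
   have a1: "cmod ?a \<le> 1"
    using base.f_W_le[of y] base.Wpos[of y] by (simp add: norm_mult)
   have "rot4 (\<lambda>d. cmod (poly p y + d * poly q y)^2 * Wd d y) r =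
     rot4 (\<lambda>d. W0 y * (cmod (poly p y + d * poly q y)^2 / sqrt (1 + (2 * Re (cnj ?a * ?s d) + cmod (?s d)^2)))) r"
    unfolding Wd_quotient by (intro arg_cong[where f = "\<lambda>F. rot4 F r"] ext) (simp only: times_divide_eq_right mult.commute)
   also have "... = W0 y * rot4 (\<lambda>d. cmod (poly p y + d * poly q y)^2 / sqrt (1 + (2 * Re (cnj ?a * ?s d) + cmod (?s d)^2))) r"
    by (rule rot4_cmult)
   also have "... \<le> W0 y * (4 * cmod (poly p y)^2 + 4 * r^2 * (cmod (cnj ?a * ?b1 * poly p y / 2 - poly q y)^2 - (1 - cmod ?a^2) * cmod ?b1^2 * cmod (poly p y)^2 / 2)
     + 30000 * M ^ 6 * r ^ 3 * (cmod (poly p y)^2 + cmod (poly q y)^2))"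
    using base.Wpos[of y] r r1(2)[OF r(2)] by (intro mult_left_mono rot4_perturbation a1 M) auto
   also have "cnj ?a * ?b1 * poly p y / 2 = G y" unfolding G_def by (simp add: power2_eq_square mult_ac)
   also have "(1 - cmod ?a^2) * cmod ?b1^2 * cmod (poly p y)^2 / 2 = \<epsilon> / 2 * cmod (poly f1 y)^2 * cmod (poly p y)^2 * W0 y ^ 4"
   proof -
    have "1 - cmod ?a^2 = \<epsilon> * (W0 y)^2" using base.eps_W[of y] by (simp add: norm_mult power_mult_distrib)
    thus ?thesis by (simp add: norm_mult power_mult_distrib power2_eq_square power4_eq_xxxx)
   qed
   finally show ?thesis unfolding E_def S_def by (simp add: algebra_simps numeral_eq_Suc)
  qed
  have "rot4 Nd r = (\<integral>y. rot4 (\<lambda>d. cmod (poly p y + d * poly q y)^2 * Wd d y) r)"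
  proof -
   have "(\<integral>y. A y + B y + C y + D y) = (\<integral>y. A y) + (\<integral>y. B y) + (\<integral>y. C y) + (\<integral>y. D y)"
    if "L1 A" "L1 B" "L1 C" "L1 D" for A B C D :: "complex => real"
    using that by simp
   from this[OF ipq ipq ipq ipq] show ?thesis
    unfolding rot4_def Nd_def wnorm_def poly_add poly_smult by (rule sym)
  qed
  also have "... \<le> (\<integral>y. 4 * (cmod (poly p y)^2 * W0 y) + 4 * r^2 * (E y - S y) + 30000 * M ^ 6 * r ^ 3 * (cmod (poly p y)^2 * W0 y + cmod (poly q y)^2 * W0 y))"
  proof (rule integral_mono[OF _ _ pt])
   show "L1 (\<lambda>y. rot4 (\<lambda>d. cmod (poly p y + d * poly q y)^2 * Wd d y) r)"
    unfolding rot4_def by (intro B_integrable_add ipq)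
   show "L1 (\<lambda>y. 4 * (cmod (poly p y)^2 * W0 y) + 4 * r^2 * (E y - S y) + 30000 * M ^ 6 * r ^ 3 * (cmod (poly p y)^2 * W0 y + cmod (poly q y)^2 * W0 y))"
    by (intro B_integrable_add B_integrable_diff integrable_mult_right ip iE iS)
  qed
  also have "... = 4 * wnorm W0 p + 4 * r^2 * ((\<integral>y. E y) - (\<integral>y. S y)) + 30000 * M ^ 6 * r ^ 3 * (wnorm W0 p + wnorm W0 q)"
  proof -
   have "(\<integral>y. 4 * P y + c * (E' y - S' y) + k * (P y + Q y)) = 4 * (\<integral>y. P y) + c * ((\<integral>y. E' y) - (\<integral>y. S' y)) + k * ((\<integral>y. P y) + (\<integral>y. Q y))"
    if "L1 P" "L1 Q" "L1 E'" "L1 S'" for P Q E' S' :: "complex => real" and c k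
    using that by simp
   from this[OF ip iE iS] show ?thesis unfolding wnorm_def .
  qed
  also have "... \<le> 4 + K1 * r ^ 3"
  proof -
   have "4 * r^2 * ((\<integral>y. E y) - (\<integral>y. S y)) \<le> 0" using ES by (intro mult_nonneg_nonpos) auto
   thus ?thesis unfolding p(2) K1_def by (simp add: mult_ac)
  qed
  finally show ?thesis .
 qed
 define c where "c = poly q x / poly p x"
 define r2 where "r2 = min (min 1 r1) (1 / (2 * (cmod c + 1)))"
 have r2: "r2 > 0" "r2 \<le> r1" "r2 \<le> 1" "r2 \<le> 1 / (2 * (cmod c + 1))" unfolding r2_def using r1(1)[of r1] by (auto simp: add_nonneg_pos)
 define K where "K = 4 * cmod c ^ 4 + K1"
 have K1: "K1 \<ge> 0" unfolding K1_def using M(1) pw.wnorm_nonneg[of q] by simp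
 have main: "rot4 (\<lambda>d. ln (poly_kernel (Wd d) n x)) r \<ge> 4 * ln B - K * r ^ 3" if r: "0 < r" "r \<le> r2" for r
 proof -
  have rc: "r * cmod c \<le> 1/2"
  proof -
   have "r * cmod c \<le> 1 / (2 * (cmod c + 1)) * (cmod c + 1)" using r r2(4) by (intro mult_mono) auto
   also have "... = 1/2" by (simp add: add_nonneg_eq_0_iff)
   finally show ?thesis .
  qed
  have nz: "1 + d * c \<noteq> 0" if "cmod d = r" for d
  proof
   assume "1 + d * c = 0"
   hence "d * c = -1" by (simp add: add_eq_0_iff)
   hence "cmod (d * c) = 1" by simp
   thus False using rc that by (simp add: norm_mult)
  qed
  have pq: "poly (p + smult d q) x = poly p x * (1 + d * c)" for d
   unfolding c_def using px by (simp add: algebra_simps)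
  have lower: "2 * ln (cmod (1 + d * c)) + ln B - (Nd d - 1) \<le> ln (poly_kernel (Wd d) n x)" if d: "cmod d = r" for d
  proof -
   have v: "cmod (poly (p + smult d q) x)^2 = B * cmod (1 + d * c)^2"
    unfolding pq by (simp add: norm_mult power_mult_distrib p(3))
   have vpos: "B * cmod (1 + d * c)^2 > 0" using Bpos nz[OF d] by simp
   have "p + smult d q \<noteq> 0" using v vpos by (metis less_irrefl norm_zero poly_0 zero_power2)
   hence Np: "Nd d > 0" unfolding Nd_def by (intro poly_weight.wnorm_pos[OF weight dpq])
   have "B * cmod (1 + d * c)^2 \<le> poly_kernel (Wd d) n x * Nd d"
    unfolding v[symmetric] Nd_def by (rule poly_weight.kernel_bound[OF weight dpq])
   hence "ln (B * cmod (1 + d * c)^2) \<le> ln (poly_kernel (Wd d) n x * Nd d)" using vpos by (intro ln_mono) auto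
   moreover have "ln (B * cmod (1 + d * c)^2) = ln B + 2 * ln (cmod (1 + d * c))"
    using Bpos nz[OF d] by (simp add: ln_mult ln_realpow)
   moreover have "ln (poly_kernel (Wd d) n x * Nd d) = ln (poly_kernel (Wd d) n x) + ln (Nd d)"
    using Np poly_weight.kernel_pos[OF weight, of d x] by (simp add: ln_mult)
   moreover have "ln (Nd d) \<le> Nd d - 1" using Np by (rule ln_le_minus_one)
   ultimately show ?thesis by linarith
  qed
  have "rot4 (\<lambda>d. (2 * ln (cmod (1 + d * c)) + ln B) - (Nd d - 1)) r \<le> rot4 (\<lambda>d. ln (poly_kernel (Wd d) n x)) r"
   by (rule rot4_mono) (use lower r in auto)
  moreover have "rot4 (\<lambda>d. (2 * ln (cmod (1 + d * c)) + ln B) - (Nd d - 1)) r = 2 * rot4 (\<lambda>d. ln (cmod (1 + d * c))) r + 4 * ln B - (rot4 Nd r - 4)"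
   unfolding rot4_diff rot4_add rot4_cmult rot4_const by simp
  moreover have "rot4 (\<lambda>d. ln (cmod (1 + d * c))) r \<ge> - 2 * cmod c ^ 4 * r ^ 3"
  proof -
   let ?w = "of_real r * c"
   have nzs: "1 + ?w \<noteq> 0" "1 + \<i> * ?w \<noteq> 0" "1 - ?w \<noteq> 0" "1 - \<i> * ?w \<noteq> 0"
    using nz[of "of_real r"] nz[of "\<i> * of_real r"] nz[of "- of_real r"] nz[of "- (\<i> * of_real r)"] r by (auto simp: norm_mult mult.assoc)
   have "rot4 (\<lambda>d. ln (cmod (1 + d * c))) r = ln (cmod (1 + ?w)) + ln (cmod (1 + \<i> * ?w)) + ln (cmod (1 - ?w)) + ln (cmod (1 - \<i> * ?w))"
    unfolding rot4_def by (simp add: mult.assoc)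
   also have "... = ln (cmod ((1 + ?w) * (1 + \<i> * ?w) * (1 - ?w) * (1 - \<i> * ?w)))"
    using nzs by (simp add: norm_mult ln_mult)
   also have "(1 + ?w) * (1 + \<i> * ?w) * (1 - ?w) * (1 - \<i> * ?w) = 1 - ?w ^ 4"
   proof -
    have "(1 + w) * (1 + \<i> * w) * (1 - w) * (1 - \<i> * w) = 1 - w ^ 4" for w :: complex
    proof -
     have "(1 + w) * (1 + \<i> * w) * (1 - w) * (1 - \<i> * w) = ((1 + w) * (1 - w)) * ((1 + \<i> * w) * (1 - \<i> * w))" by simp
     also have "... = (1 - w^2) * (1 + w^2)" by (simp add: power2_eq_square algebra_simps)
     also have "... = 1 - w ^ 4" by (simp add: power2_eq_square power4_eq_xxxx algebra_simps)
     finally show ?thesis .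
    qed
    thus ?thesis .
   qed
   finally have e: "rot4 (\<lambda>d. ln (cmod (1 + d * c))) r = ln (cmod (1 - ?w ^ 4))" .
   define y where "y = (r * cmod c) ^ 4"
   have y: "0 \<le> y" "y \<le> 1/2"
   proof -
    show "0 \<le> y" unfolding y_def by simp
    have "y \<le> (1/2) ^ 4" unfolding y_def using rc r by (intro power_mono) auto
    thus "y \<le> 1/2" by (simp add: power4_eq_xxxx)
   qed
   have "1 - y \<le> cmod (1 - ?w ^ 4)"
    using norm_triangle_ineq2[of 1 "?w ^ 4"] r unfolding y_def by (simp add: norm_mult norm_power)
   hence "ln (1 - y) \<le> ln (cmod (1 - ?w ^ 4))" using y by (intro ln_mono) auto
   moreover have "- 2 * y \<le> ln (1 - y)"
   proof -
    have "ln (1 / (1 - y)) \<le> 1 / (1 - y) - 1" using y by (intro ln_le_minus_one) auto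
    moreover have "ln (1 / (1 - y)) = - ln (1 - y)" using y by (simp add: ln_div)
    moreover have "1 / (1 - y) - 1 \<le> 2 * y"
    proof -
     have "1 \<le> (1 + 2 * y) * (1 - y)" using y mult_left_mono[OF y(2) y(1)] by (simp add: algebra_simps)
     thus ?thesis using y by (simp add: field_simps)
    qed
    ultimately show ?thesis by linarith
   qed
   moreover have "y \<le> cmod c ^ 4 * r ^ 3"
   proof -
    have "r ^ 4 \<le> r ^ 3" using power_decreasing[of 3 4 r] r r2(3) by simp
    hence "r ^ 4 * cmod c ^ 4 \<le> r ^ 3 * cmod c ^ 4" by (rule mult_right_mono) simp
    thus ?thesis unfolding y_def by (simp add: power_mult_distrib mult.commute)
   qed
   ultimately show ?thesis unfolding e by linarith
  qed
  moreover have "rot4 Nd r \<le> 4 + K1 * r ^ 3" using N4[of r] r r2(2) by simp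
  ultimately show ?thesis unfolding K_def by (simp add: algebra_simps)
 qed
 show ?thesis by (rule that[of K r2]) (use main r2(1) K1 in \<open>auto simp: K_def B_def\<close>)
qed

end

lemma rot4_poly:
 fixes p :: "complex poly"
 obtains K where "K \<ge> 0" "\<And>r. 0 < r ==> r \<le> 1 ==> rot4 (\<lambda>d. Re (poly p (z + d))) r \<le> 4 * Re (poly p z) + K * r ^ 3"
proof -
 define q where "q = pcompose p [:z, 1:]"
 have pq: "poly p (z + d) = poly q d" for d unfolding q_def by (simp add: poly_pcompose)
 obtain a0 a1 a2 s where q: "q = pCons a0 (pCons a1 (pCons a2 s))" by (metis pCons_cases)
 have "compact (poly s ` cball 0 1)" by (intro compact_continuous_image continuous_intros) auto
 then obtain B where B: "\<And>d. cmod d \<le> 1 ==> cmod (poly s d) \<le> B"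
 proof -
  obtain B where "\<forall>y\<in>poly s ` cball 0 1. norm y \<le> B"
   using compact_imp_bounded[OF \<open>compact (poly s ` cball 0 1)\<close>] unfolding bounded_iff by blast
  thus ?thesis by (intro that[of B]) auto
 qed
 have B0: "B \<ge> 0" using order_trans[OF norm_ge_zero B[of 0]] by simp
 have "rot4 (\<lambda>d. Re (poly p (z + d))) r \<le> 4 * Re (poly p z) + (4 * B) * r ^ 3" if r: "0 < r" "r \<le> 1" for r
 proof -
  have "rot4 (\<lambda>d. Re (poly p (z + d))) r \<le> rot4 (\<lambda>d. Re (a0 + d * a1 + d^2 * a2) + B * r ^ 3) r"
  proof (rule rot4_mono)
   fix d :: complex assume d: "cmod d = r"
   have "poly p (z + d) = (a0 + d * a1 + d^2 * a2) + d ^ 3 * poly s d"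
    unfolding pq q by (simp add: power2_eq_square power3_eq_cube algebra_simps)
   moreover have "Re (d ^ 3 * poly s d) \<le> B * r ^ 3"
   proof -
    have "Re (d ^ 3 * poly s d) \<le> r ^ 3 * cmod (poly s d)"
     using complex_Re_le_cmod[of "d ^ 3 * poly s d"] d by (simp add: norm_mult norm_power)
    also have "... \<le> r ^ 3 * B" using B[of d] d r by (intro mult_left_mono) auto
    finally show ?thesis by (simp add: mult.commute)
   qed
   ultimately show "Re (poly p (z + d)) \<le> Re (a0 + d * a1 + d^2 * a2) + B * r ^ 3" by simp
  qed (use r in simp)
  also have "... = 4 * Re (poly p z) + (4 * B) * r ^ 3"
   using pq[of 0] unfolding rot4_def q by (simp add: power2_eq_square algebra_simps)
  finally show ?thesis .
 qed
 thus ?thesis using B0 by (intro that[of "4 * B"]) auto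
qed

definition four_mean_at :: "(complex => real) => complex => bool" where
 "four_mean_at u z \<longleftrightarrow> (\<exists>K r0. K \<ge> 0 \<and> r0 > 0 \<and> (\<forall>r. 0 < r \<and> r \<le> r0 \<longrightarrow> rot4 (\<lambda>d. u (z + d)) r \<ge> 4 * u z - K * r ^ 3))"

text \<open>At an interior maximum of \<open>u - Re Q + \<eta> (\<bar>w - c\<bar>^2 - R^2)\<close> the mean over four points would
 have to drop by \<open>\<eta> r^2\<close>, while the hypothesis only permits a loss of order \<open>r\<^sup>3\<close>.\<close>

lemma four_mean_max_principle:
 assumes R: "R > 0" and cont: "continuous_on (cball c R) u"
  and four: "\<And>z. z \<in> ball c R ==> four_mean_at u z"
  and bd: "\<And>w. w \<in> sphere c R ==> u w \<le> Re (poly Q (w - c))"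
 shows "u c \<le> Re (poly Q 0)"
proof (rule ccontr)
 assume "\<not> u c \<le> Re (poly Q 0)"
 hence gap: "u c - Re (poly Q 0) > 0" by simp
 define \<eta> where "\<eta> = (u c - Re (poly Q 0)) / (2 * R^2)"
 have \<eta>: "\<eta> > 0" unfolding \<eta>_def using gap R by simp
 define \<phi> where "\<phi> = (\<lambda>w. u w - Re (poly Q (w - c)) + \<eta> * (cmod (w - c)^2 - R^2))"
 have "continuous_on (cball c R) \<phi>" unfolding \<phi>_def by (intro continuous_intros cont)
 then obtain z where z: "z \<in> cball c R" "\<And>w. w \<in> cball c R ==> \<phi> w \<le> \<phi> z"
  using continuous_attains_sup[of "cball c R" \<phi>] R by auto
 have "\<phi> c = (u c - Re (poly Q 0)) / 2" unfolding \<phi>_def \<eta>_def using R by (simp add: field_simps)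
 hence \<phi>c: "\<phi> c > 0" using gap by simp
 have "\<phi> w \<le> 0" if "w \<in> sphere c R" for w
  using bd[OF that] that unfolding \<phi>_def by (simp add: dist_norm norm_minus_commute)
 hence "z \<notin> sphere c R" using z(2)[of c] \<phi>c R by fastforce
 hence zb: "z \<in> ball c R" using z(1) by auto
 obtain K r0 where K: "K \<ge> 0" "r0 > 0" "\<And>r. 0 < r ==> r \<le> r0 ==> rot4 (\<lambda>d. u (z + d)) r \<ge> 4 * u z - K * r ^ 3"
  using four[OF zb] unfolding four_mean_at_def by blast
 obtain K' where K': "K' \<ge> 0" "\<And>r. 0 < r ==> r \<le> 1 ==> rot4 (\<lambda>d. Re (poly Q ((z - c) + d))) r \<le> 4 * Re (poly Q (z - c)) + K' * r ^ 3"
  using rot4_poly by blast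
 define r where "r = min (min r0 1) (min (R - dist c z) (\<eta> / (K + K' + 1)))"
 have KK: "K + K' + 1 > 0" using K K' by simp
 have r: "r > 0" "r \<le> r0" "r \<le> 1" "r \<le> R - dist c z" "r \<le> \<eta> / (K + K' + 1)"
  unfolding r_def using K(2) zb \<eta> KK by auto
 have "rot4 (\<lambda>d. \<phi> (z + d)) r \<le> rot4 (\<lambda>d. \<phi> z) r"
 proof (rule rot4_mono)
  fix d :: complex assume d: "cmod d = r"
  have "dist c (z + d) \<le> dist c z + cmod d"
   using dist_triangle[of c "z + d" z] by (simp add: dist_norm)
  thus "\<phi> (z + d) \<le> \<phi> z" using r(4) d by (intro z(2)) simp
 qed (use r in simp)
 hence 1: "rot4 (\<lambda>d. \<phi> (z + d)) r \<le> 4 * \<phi> z" by (simp add: rot4_const)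
 have sq: "rot4 (\<lambda>d. cmod (z + d - c)^2) r = 4 * cmod (z - c)^2 + 4 * r^2"
  unfolding rot4_def cmod_power2 by (simp add: power2_eq_square algebra_simps)
 have "rot4 (\<lambda>d. \<phi> (z + d)) r = rot4 (\<lambda>d. u (z + d)) r - rot4 (\<lambda>d. Re (poly Q ((z - c) + d))) r
   + \<eta> * (rot4 (\<lambda>d. cmod (z + d - c)^2) r - 4 * R^2)"
  unfolding \<phi>_def rot4_def by (simp add: algebra_simps)
 also have "... \<ge> (4 * u z - K * r ^ 3) - (4 * Re (poly Q (z - c)) + K' * r ^ 3) + \<eta> * (4 * cmod (z - c)^2 + 4 * r^2 - 4 * R^2)"
  unfolding sq using K(3)[OF r(1,2)] K'(2)[OF r(1,3)] by linarith
 finally have "4 * \<eta> * r^2 \<le> (K + K') * r ^ 3"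
  using 1 unfolding \<phi>_def by (simp add: algebra_simps)
 hence "(4 * \<eta>) * r^2 \<le> ((K + K') * r) * r^2" by (simp add: power2_eq_square power3_eq_cube mult_ac)
 hence "4 * \<eta> \<le> (K + K') * r" using r(1) by simp
 also have "... \<le> (K + K' + 1) * (\<eta> / (K + K' + 1))" using r K K' by (intro mult_mono) auto
 also have "... = \<eta>" using KK by simp
 finally show False using \<eta> by simp
qed

lemma poly_circle_integral:
 fixes Q :: "complex poly"
 shows "((\<lambda>t. Re (poly Q (of_real R * cis t))) has_integral 2 * pi * Re (poly Q 0)) {0..2 * pi}"
proof -
 have mono: "((\<lambda>t. (of_real R * cis t) ^ k) has_integral (if k = 0 then 2 * pi else 0)) {0..2 * pi}" for k
 proof (cases "k = 0")
  case True
  thus ?thesis using has_integral_const_real[of "1::complex" 0 "2 * pi"] by (simp add: scaleR_conv_of_real)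
 next
  case False
  have "((\<lambda>t. of_real R ^ k * cis (real k * t)) has_integral
    (of_real R ^ k * cis (real k * (2 * pi)) / (\<i> * of_nat k) - of_real R ^ k * cis (real k * 0) / (\<i> * of_nat k))) {0..2 * pi}"
  proof (rule fundamental_theorem_of_calculus)
   fix t :: real
   define c where "c = \<i> * of_nat k"
   have c: "c \<noteq> 0" using False unfolding c_def by simp
   have "((\<lambda>z. exp (c * z)) has_field_derivative exp (c * x) * c) (at x)" for x
    by (auto intro!: derivative_eq_intros)
   from DERIV_cmult[OF DERIV_cdivide[OF this, where c = c], where c = "of_real R ^ k"]
   have "((\<lambda>z. of_real R ^ k * (exp (c * z) / c)) has_field_derivative of_real R ^ k * exp (c * of_real t)) (at (of_real t))"
    using c by simp
   hence "((\<lambda>t. of_real R ^ k * (exp (c * of_real t) / c)) has_vector_derivative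
     of_real R ^ k * exp (c * of_real t)) (at t)"
    by (rule has_vector_derivative_real_field)
   moreover have "exp (c * of_real t) = cis (real k * t)" for t
    unfolding cis_conv_exp c_def by (simp add: mult.assoc)
   ultimately have "((\<lambda>t. of_real R ^ k * (cis (real k * t) / (\<i> * of_nat k))) has_vector_derivative of_real R ^ k * cis (real k * t)) (at t)"
    by (simp only: c_def)
   hence "((\<lambda>t. of_real R ^ k * (cis (real k * t) / (\<i> * of_nat k))) has_vector_derivative of_real R ^ k * cis (real k * t))
     (at t within {0..2 * pi})" by (rule has_vector_derivative_at_within)
   thus "((\<lambda>t. of_real R ^ k * cis (real k * t) / (\<i> * of_nat k)) has_vector_derivative of_real R ^ k * cis (real k * t))
     (at t within {0..2 * pi})" by (simp only: times_divide_eq_right)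
  qed simp
  moreover have "cis (real k * (2 * pi)) = 1"
   using cis_multiple_2pi[of "real k"] by (simp add: mult.commute mult.left_commute)
  moreover have "(of_real R * cis t) ^ k = of_real R ^ k * cis (real k * t)" for t
   by (simp only: power_mult_distrib Complex.DeMoivre)
  ultimately show ?thesis using False by simp
 qed
 have "((\<lambda>t. \<Sum>k\<le>degree Q. coeff Q k * (of_real R * cis t) ^ k) has_integral
   (\<Sum>k\<le>degree Q. coeff Q k * (if k = 0 then 2 * pi else 0))) {0..2 * pi}"
  by (intro has_integral_sum has_integral_mult_right mono) auto
 moreover have "(\<Sum>k\<le>degree Q. coeff Q k * (if k = 0 then 2 * pi else 0)) = of_real (2 * pi) * poly Q 0"
 proof -
  have "(\<Sum>k\<le>degree Q. coeff Q k * (if k = 0 then 2 * pi else 0)) = (\<Sum>k\<le>degree Q. if k = 0 then coeff Q 0 * of_real (2 * pi) else 0)"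
   by (intro sum.cong) auto
  also have "... = coeff Q 0 * of_real (2 * pi)" by (subst sum.delta) auto
  finally show ?thesis by (simp only: poly_0_coeff_0 mult.commute)
 qed
 ultimately have "((\<lambda>t. poly Q (of_real R * cis t)) has_integral of_real (2 * pi) * poly Q 0) {0..2 * pi}"
  by (simp add: poly_altdef)
 hence "((\<lambda>t. Re (poly Q (of_real R * cis t))) has_integral Re (of_real (2 * pi) * poly Q 0)) {0..2 * pi}"
  by (rule has_integral_linear[OF _ bounded_linear_Re, unfolded o_def])
 thus ?thesis by simp
qed

lemma Re_poly_cnj_on_circle:
 fixes A B :: "complex poly"
 shows "\<exists>Q. \<forall>w\<in>sphere 0 R. Re (poly A w * cnj (poly B w)) = Re (poly Q w)"
proof (induction A B rule: poly_induct2)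
 case 0
 thus ?case by (intro exI[of _ 0]) simp
next
 case (pCons a A b B)
 then obtain Q where Q: "\<And>w. w \<in> sphere 0 R ==> Re (poly A w * cnj (poly B w)) = Re (poly Q w)" by blast
 let ?Q = "smult (cnj a) (pCons b B) + smult (cnj b) (pCons 0 A) + smult (of_real (R^2)) Q"
 have "Re (poly (pCons a A) w * cnj (poly (pCons b B) w)) = Re (poly ?Q w)" if w: "w \<in> sphere 0 R" for w
 proof -
  have ww: "w * cnj w = of_real (R^2)" using w complex_norm_square[of w] by simp
  have "poly (pCons a A) w * cnj (poly (pCons b B) w) = a * cnj (poly (pCons b B) w) + cnj b * (w * poly A w) + (w * cnj w) * (poly A w * cnj (poly B w))"
   by (simp add: algebra_simps)
  moreover have "Re (a * cnj X) = Re (cnj a * X)" for X by simp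
  moreover have "Re (of_real (R^2) * X) = R^2 * Re X" for X by simp
  moreover have "poly ?Q w = cnj a * poly (pCons b B) w + cnj b * (w * poly A w) + of_real (R^2) * poly Q w"
   by (simp add: algebra_simps)
  ultimately show ?thesis unfolding ww using Q[OF w] by (simp only: plus_complex.simps)
 qed
 thus ?case by blast
qed

lemma circle_approximation:
 fixes u :: "complex => real"
 assumes cont: "continuous_on (sphere 0 R) u" and e: "e > 0"
 obtains Q where "\<And>w. w \<in> sphere 0 R ==> \<bar>u w - Re (poly Q w)\<bar> < e"
proof -
 define P where "P = (\<lambda>g. \<exists>Q. \<forall>w\<in>sphere 0 R. g w = Re (poly Q w))"
 have "\<exists>g. P g \<and> (\<forall>x\<in>sphere 0 R. \<bar>u x - g x\<bar> < e)"
 proof (rule Stone_Weierstrass_HOL)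
  show "compact (sphere (0::complex) R)" by simp
  show "P (\<lambda>x. c)" for c unfolding P_def by (intro exI[of _ "[:of_real c:]"]) simp
  show "continuous_on (sphere 0 R) g" if Pg: "P g" for g
  proof -
   obtain Q where "\<forall>w\<in>sphere 0 R. g w = Re (poly Q w)" using Pg unfolding P_def by blast
   thus ?thesis by (subst continuous_on_cong[OF refl]) (auto intro!: continuous_intros)
  qed
  show "P (\<lambda>x. f x + g x)" if "P f \<and> P g" for f g
   using that unfolding P_def by (metis plus_complex.simps(1) poly_add)
  show "P (\<lambda>x. f x * g x)" if "P f \<and> P g" for f g
  proof -
   obtain A B where A: "\<forall>w\<in>sphere 0 R. f w = Re (poly A w)" and B: "\<forall>w\<in>sphere 0 R. g w = Re (poly B w)"
    using \<open>P f \<and> P g\<close> unfolding P_def by blast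
   obtain Q where Q: "\<forall>w\<in>sphere 0 R. Re (poly A w * cnj (poly B w)) = Re (poly Q w)" using Re_poly_cnj_on_circle by blast
   have "f w * g w = Re (poly (smult (1/2) (A * B + Q)) w)" if "w \<in> sphere 0 R" for w
   proof -
    have "Re x * Re y = (Re (x * y) + Re (x * cnj y)) / 2" for x y by simp
    moreover have "f w = Re (poly A w)" "g w = Re (poly B w)" "Re (poly A w * cnj (poly B w)) = Re (poly Q w)"
     using A B Q that by blast+
    ultimately have "f w * g w = (Re (poly A w * poly B w) + Re (poly Q w)) / 2" by metis
    thus ?thesis by simp
   qed
   thus ?thesis unfolding P_def by blast
  qed
  show "\<exists>f. P f \<and> f x \<noteq> f y" if "x \<in> sphere 0 R \<and> y \<in> sphere 0 R \<and> x \<noteq> y" for x y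
  proof (cases "Re x = Re y")
   case False
   thus ?thesis unfolding P_def by (intro exI[of _ Re] conjI exI[of _ "[:0, 1:]"]) auto
  next
   case True
   hence "Im x \<noteq> Im y" using that complex_eqI by blast
   thus ?thesis unfolding P_def by (intro exI[of _ Im] conjI exI[of _ "[:0, -\<i>:]"]) auto
  qed
 qed (use cont e in auto)
 thus ?thesis using that unfolding P_def by (metis (no_types, lifting))
qed

lemma four_mean_sub_mean:
 assumes R: "R > 0" and cont: "continuous_on (cball c R) u"
  and four: "\<And>z. z \<in> ball c R ==> four_mean_at u z"
 shows "2 * pi * u c \<le> integral {0..2 * pi} (\<lambda>t. u (c + of_real R * cis t))"
proof (rule field_le_epsilon)
 fix e :: real assume e: "e > 0"
 define e' where "e' = e / (4 * pi)"
 have e': "e' > 0" using e by (simp add: e'_def)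
 have "continuous_on (sphere 0 R) (\<lambda>w. u (c + w))"
  by (rule continuous_on_compose2[OF cont]) (auto intro!: continuous_intros simp: dist_norm)
 then obtain Q where Q: "\<And>w. w \<in> sphere 0 R ==> \<bar>u (c + w) - Re (poly Q w)\<bar> < e'"
  using circle_approximation e' by blast
 let ?Q = "Q + [:of_real e':]"
 have "u c \<le> Re (poly ?Q 0)"
 proof (rule four_mean_max_principle[OF R cont four])
  fix w assume "w \<in> sphere c R"
  hence "w - c \<in> sphere 0 R" by (simp add: dist_norm norm_minus_commute)
  from Q[OF this] show "u w \<le> Re (poly ?Q (w - c))" by simp
 qed
 hence 1: "u c \<le> Re (poly Q 0) + e'" by simp
 have cis: "of_real R * cis t \<in> sphere 0 R" for t using R by (simp add: norm_mult)
 have ci: "(\<lambda>t. u (c + of_real R * cis t)) integrable_on {0..2 * pi}"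
  by (intro integrable_continuous_real continuous_on_compose2[OF cont] continuous_intros)
   (use R in \<open>auto simp: dist_norm norm_mult\<close>)
 have "2 * pi * Re (poly Q 0) - 2 * pi * e' \<le> integral {0..2 * pi} (\<lambda>t. u (c + of_real R * cis t))"
 proof (rule has_integral_le)
  show "((\<lambda>t. Re (poly Q (of_real R * cis t)) - e') has_integral 2 * pi * Re (poly Q 0) - 2 * pi * e') {0..2 * pi}"
   using has_integral_diff[OF poly_circle_integral[of Q R] has_integral_const_real[of e' 0 "2 * pi"]] by simp
  show "((\<lambda>t. u (c + of_real R * cis t)) has_integral integral {0..2 * pi} (\<lambda>t. u (c + of_real R * cis t))) {0..2 * pi}"
   using ci by (rule integrable_integral)
  show "Re (poly Q (of_real R * cis t)) - e' \<le> u (c + of_real R * cis t)" for t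
   using Q[OF cis[of t]] by linarith
 qed
 moreover have "2 * pi * u c \<le> 2 * pi * (Re (poly Q 0) + e')" using 1 by simp
 moreover have "2 * pi * e' = e / 2" unfolding e'_def by simp
 ultimately show "2 * pi * u c \<le> integral {0..2 * pi} (\<lambda>t. u (c + of_real R * cis t)) + e"
  by (simp add: algebra_simps)
qed

section \<open>Weights with poles\<close>

lemma inverse_prod_bound:
 fixes A :: "complex set"
 assumes "finite A"
 shows "\<exists>C\<ge>0. \<forall>x. x \<notin> A \<longrightarrow> 1 / (\<Prod>a\<in>A. cmod (x - a)) \<le> C * (1 + (\<Sum>a\<in>A. 1 / cmod (x - a)))"
 using assms
proof (induction A rule: finite_induct)
 case empty
 show ?case by (intro exI[of _ 1]) simp
next
 case (insert b A)
 then obtain C where C: "C \<ge> 0" "\<And>x. x \<notin> A ==> 1 / (\<Prod>a\<in>A. cmod (x - a)) \<le> C * (1 + (\<Sum>a\<in>A. 1 / cmod (x - a)))" by blast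
 define D where "D = 1 + (\<Sum>a\<in>A. 1 / cmod (a - b))"
 have D1: "D \<ge> 1" unfolding D_def by (simp add: sum_nonneg)
 have "1 / (\<Prod>a\<in>insert b A. cmod (x - a)) \<le> (C * D) * (1 + (\<Sum>a\<in>insert b A. 1 / cmod (x - a)))" if x: "x \<notin> insert b A" for x
 proof -
  let ?S = "\<Sum>a\<in>A. 1 / cmod (x - a)" and ?t = "1 / cmod (x - b)"
  have t0: "?t \<ge> 0" "?S \<ge> 0" by (auto intro: sum_nonneg)
  have "1 / (\<Prod>a\<in>insert b A. cmod (x - a)) = 1 / (\<Prod>a\<in>A. cmod (x - a)) * ?t" using insert.hyps by simp
  also have "... \<le> C * (1 + ?S) * ?t" using C(2)[of x] x t0 by (intro mult_right_mono) auto
  also have "... = C * (?t + (\<Sum>a\<in>A. 1 / cmod (x - a) * ?t))"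
   by (simp only: mult.assoc distrib_right mult_1 sum_distrib_right)
  also have "... \<le> C * (?t + (\<Sum>a\<in>A. 1 / cmod (a - b) * (?S + ?t)))"
  proof (intro mult_left_mono add_left_mono sum_mono C(1))
   fix a assume a: "a \<in> A"
   hence ab: "a \<noteq> b" and xa: "x \<noteq> a" and xb: "x \<noteq> b" using insert.hyps x by auto
   have "cmod (a - b) \<le> cmod (x - a) + cmod (x - b)"
    using norm_triangle_ineq4[of "x - b" "x - a"] by (simp add: add.commute)
   hence "1 / cmod (x - a) * ?t \<le> 1 / cmod (a - b) * (1 / cmod (x - a) + ?t)"
    using ab xa xb by (simp add: field_simps)
   also have "... \<le> 1 / cmod (a - b) * (?S + ?t)"
    using insert.hyps(1) a by (intro mult_left_mono add_right_mono member_le_sum) auto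
   finally show "1 / cmod (x - a) * ?t \<le> 1 / cmod (a - b) * (?S + ?t)" .
  qed
  also have "... = C * (?t + (D - 1) * (?S + ?t))" unfolding D_def by (simp add: sum_distrib_right)
  also have "... \<le> C * (D * (1 + (?t + ?S)))"
  proof (rule mult_left_mono[OF _ C(1)])
   have "D * (1 + (t + s)) - (t + (D - 1) * (s + t)) = D + s" for t s :: real by (simp add: algebra_simps)
   from this[of ?t ?S] show "?t + (D - 1) * (?S + ?t) \<le> D * (1 + (?t + ?S))" using D1 t0 by linarith
  qed
  finally show ?thesis using insert.hyps by (simp add: mult.assoc)
 qed
 thus ?case using C(1) D1 by (intro exI[of _ "C * D"]) auto
qed

lemma integrable_simple_roots:
 fixes h :: "complex poly"
 assumes sq: "rsquarefree h" and deg: "degree h \<ge> m + 3"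
 shows "L1 (\<lambda>x. (1 + cmod x) ^ m / cmod (poly h x))"
proof -
 define A where "A = {x. poly h x = 0}"
 have h0: "h \<noteq> 0" using deg by auto
 have fA: "finite A" unfolding A_def by (rule poly_roots_finite[OF h0])
 have lc: "lead_coeff h \<noteq> 0" using h0 by simp
 have ph: "cmod (poly h x) = cmod (lead_coeff h) * (\<Prod>a\<in>A. cmod (x - a))" for x
 proof -
  have "h = smult (lead_coeff h) (\<Prod>z\<in>A. [:-z, 1:])"
   using complex_poly_decompose_rsquarefree[OF sq] unfolding A_def by simp
  hence "poly h x = poly (smult (lead_coeff h) (\<Prod>z\<in>A. [:-z, 1:])) x" by (rule arg_cong)
  also have "... = lead_coeff h * (\<Prod>a\<in>A. poly [:-a, 1:] x)" by (simp only: poly_smult poly_prod)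
  also have "(\<Prod>a\<in>A. poly [:-a, 1:] x) = (\<Prod>a\<in>A. x - a)" by (intro prod.cong) auto
  finally have "poly h x = lead_coeff h * (\<Prod>a\<in>A. x - a)" .
  thus ?thesis by (simp add: norm_mult prod_norm)
 qed
 obtain C where C: "C \<ge> 0" "\<And>x. x \<notin> A ==> 1 / (\<Prod>a\<in>A. cmod (x - a)) \<le> C * (1 + (\<Sum>a\<in>A. 1 / cmod (x - a)))"
  using inverse_prod_bound[OF fA] by blast
 obtain c R where cR: "c > 0" "R \<ge> 0" "\<And>x. cmod x \<ge> R ==> c * wt (real (degree h)) x \<le> cmod (poly h x)"
  using poly_lower_bound[OF h0] by blast
 define K where "K = (1 + R) ^ (m + 3) * (C / cmod (lead_coeff h)) + 1 / c"
 have K0: "K \<ge> 0" unfolding K_def using C(1) cR by simp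
 define g where "g = (\<lambda>x. K * (wt (-3) x + (\<Sum>a\<in>A. 1 / cmod (x - a) * wt (-3) x)))"
 have pos: "1 + cmod x > 0" for x by (simp add: add_pos_nonneg)
 have bound: "(1 + cmod x) ^ m / cmod (poly h x) \<le> g x" if x: "x \<notin> A" for x
 proof -
  have g: "g x = K * (1 + (\<Sum>a\<in>A. 1 / cmod (x - a))) * wt (-3) x"
   unfolding g_def by (simp only: sum_distrib_right distrib_right mult_1 mult.assoc)
  have S0: "1 + (\<Sum>a\<in>A. 1 / cmod (x - a)) \<ge> 1" by (simp add: sum_nonneg)
  have p3: "(1 + cmod x) ^ 3 * wt (-3) x = 1"
   using powr_realpow[OF pos, of x 3] pos[of x] by (simp add: powr_minus)
  have mk: "(1 + cmod x) ^ m = (1 + cmod x) ^ (m + 3) * wt (-3) x"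
   unfolding power_add mult.assoc p3 by simp
  show ?thesis
  proof (cases "cmod x \<le> R")
   case True
   have "1 / cmod (poly h x) = 1 / cmod (lead_coeff h) * (1 / (\<Prod>a\<in>A. cmod (x - a)))" unfolding ph by simp
   also have "... \<le> 1 / cmod (lead_coeff h) * (C * (1 + (\<Sum>a\<in>A. 1 / cmod (x - a))))"
    using C(2)[OF x] by (intro mult_left_mono) auto
   finally have "(1 + cmod x) ^ (m + 3) * (1 / cmod (poly h x)) \<le> (1 + R) ^ (m + 3) * (1 / cmod (lead_coeff h) * (C * (1 + (\<Sum>a\<in>A. 1 / cmod (x - a)))))"
    using True pos[of x] by (intro mult_mono power_mono) (auto simp: add_nonneg_nonneg)
   also have "... = ((1 + R) ^ (m + 3) * (C / cmod (lead_coeff h))) * (1 + (\<Sum>a\<in>A. 1 / cmod (x - a)))" by simp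
   also have "... \<le> K * (1 + (\<Sum>a\<in>A. 1 / cmod (x - a)))"
    unfolding K_def using cR(1) S0 by (intro mult_right_mono) auto
   finally have "(1 + cmod x) ^ (m + 3) * (1 / cmod (poly h x)) * wt (-3) x \<le> K * (1 + (\<Sum>a\<in>A. 1 / cmod (x - a))) * wt (-3) x"
    by (rule mult_right_mono) simp
   thus ?thesis unfolding g mk by (simp add: mult_ac)
  next
   case False
   have "(1 + cmod x) ^ (m + 3) \<le> (1 + cmod x) ^ degree h" using deg by (intro power_increasing) auto
   also have "... = wt (real (degree h)) x" using pos[of x] by (simp add: powr_realpow)
   also have "... \<le> cmod (poly h x) / c" using cR(3)[of x] cR(1) False by (simp add: field_simps)
   finally have "(1 + cmod x) ^ (m + 3) / cmod (poly h x) \<le> 1 / c"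
    using x cR(1) unfolding A_def by (simp add: field_simps)
   also have "... \<le> K * (1 + (\<Sum>a\<in>A. 1 / cmod (x - a)))"
   proof -
    have "1 / c \<le> K * 1" unfolding K_def using C(1) cR by simp
    also have "... \<le> K * (1 + (\<Sum>a\<in>A. 1 / cmod (x - a)))" using S0 K0 by (intro mult_left_mono)
    finally show ?thesis .
   qed
   finally have "(1 + cmod x) ^ (m + 3) / cmod (poly h x) * wt (-3) x \<le> K * (1 + (\<Sum>a\<in>A. 1 / cmod (x - a))) * wt (-3) x"
    by (rule mult_right_mono) simp
   thus ?thesis unfolding g mk by (simp add: mult_ac)
  qed
 qed
 have "L1 (\<lambda>x. 1 / cmod (x - a) * wt (-3) x)" for a
 proof -
  have "L1 (\<lambda>z. 1 / cmod z * wt (-3) (- a - z))"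
   by (rule integrable_inverse_norm_decay) simp
  hence "L1 (\<lambda>x. 1 / cmod (- a + x) * wt (-3) (- a - (- a + x)))"
   by (subst integrable_translate[of "\<lambda>z. 1 / cmod z * wt (-3) (- a - z)" "- a"])
  thus ?thesis by (simp add: norm_minus_commute)
 qed
 hence ig: "L1 g" unfolding g_def
  by (intro integrable_mult_right B_integrable_add B_integrable_sum integrable_decay) auto
 have meas: "(\<lambda>x. (1 + cmod x) ^ m / cmod (poly h x)) \<in> borel_measurable borel"
  by (intro borel_measurable_divide borel_measurable_continuous_onI continuous_intros)
 show ?thesis
 proof (rule B_integrable_bound[OF ig])
  have "AE x in lborel. x \<notin> A" using fA by (intro AE_not_in) (auto intro: finite_imp_null_set_lborel)
  thus "AE x in lborel. norm ((1 + cmod x) ^ m / cmod (poly h x)) \<le> norm (g x)"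
  proof eventually_elim
   case (elim x)
   have "norm ((1 + cmod x) ^ m / cmod (poly h x)) = (1 + cmod x) ^ m / cmod (poly h x)"
    using pos[of x] by simp
   also have "... \<le> g x" by (rule bound[OF elim])
   also have "... \<le> norm (g x)" by simp
   finally show ?case .
  qed
 qed (use meas in simp)
qed

lemma singular_weight:
 fixes f :: "complex poly"
 assumes sq: "rsquarefree f" and deg: "degree f = 2 * n + 1" and n: "n > 0"
 shows "poly_weight (\<lambda>x. 1 / cmod (poly f x)) n"
proof
 show "(\<lambda>x. 1 / cmod (poly f x)) \<in> borel_measurable borel"
  by (intro borel_measurable_divide borel_measurable_continuous_onI continuous_intros)
 have "f \<noteq> 0" using deg by auto
 from poly_roots_finite[OF this] have "AE x in lborel. x \<notin> {x. poly f x = 0}"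
  by (intro AE_not_in) (auto intro: finite_imp_null_set_lborel)
 thus "AE x in lborel. 0 < 1 / cmod (poly f x)" by eventually_elim simp
 have "L1 (\<lambda>x. (1 + cmod x) ^ (2 * (n - 1)) / cmod (poly f x))"
  using n deg by (intro integrable_simple_roots sq) simp
 thus "L1 (\<lambda>x. ((1 + cmod x) ^ (n - 1))^2 * (1 / cmod (poly f x)))"
  by (simp add: power_mult[symmetric] mult.commute)
qed (use n in auto)

definition regW :: "complex poly => real => complex => real" where
 "regW f \<epsilon> x = 1 / sqrt (cmod (poly f x)^2 + \<epsilon>)"

lemma regW_eq:
 assumes "degree f = 2 * n + 1" "n > 0" "\<epsilon> > 0"
 shows "regular_weight.W f \<epsilon> = regW f \<epsilon>"
proof -
 interpret regular_weight f n \<epsilon> using assms by unfold_locales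
 show ?thesis unfolding regW_def W_def V_def by (simp add: fun_eq_iff)
qed

lemma regW_weight:
 assumes "degree f = 2 * n + 1" "n > 0" "\<epsilon> > 0"
 shows "poly_weight (regW f \<epsilon>) n"
proof -
 interpret regular_weight f n \<epsilon> using assms by unfold_locales
 show ?thesis using weight unfolding regW_eq[OF assms] .
qed

lemma regW_le: "\<epsilon> > 0 ==> poly f x \<noteq> 0 ==> regW f \<epsilon> x \<le> 1 / cmod (poly f x)"
 unfolding regW_def by (intro divide_left_mono real_le_rsqrt) (auto intro!: mult_pos_pos add_nonneg_pos)

lemma wnorm_mono:
 assumes "poly_weight W n" "poly_weight W' n" "degree p < n" "AE x in lborel. W x \<le> W' x"
 shows "wnorm W p \<le> wnorm W' p"
 unfolding wnorm_def
 using poly_weight.norm_integrable[OF assms(1) poly_weight.tame_poly[OF assms(1,3)]]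
  poly_weight.norm_integrable[OF assms(2) poly_weight.tame_poly[OF assms(2,3)]]
proof (rule integral_mono_AE)
 show "AE x in lborel. cmod (poly p x)^2 * W x \<le> cmod (poly p x)^2 * W' x"
  using assms(4) by eventually_elim (simp add: mult_left_mono)
qed

lemma kernel_antimono:
 assumes "poly_weight W n" "poly_weight W' n" "AE x in lborel. W x \<le> W' x"
 shows "poly_kernel W' n x \<le> poly_kernel W n x"
 using kernel_comparison[OF assms(1,2), of 1 x] wnorm_mono[OF assms(1,2) _ assms(3)] by simp

lemma regW_kernel_tendsto:
 fixes f :: "complex poly"
 assumes sq: "rsquarefree f" and deg: "degree f = 2 * n + 1" and n: "n > 0"
 shows "(\<lambda>j. poly_kernel (regW f (1 / real (Suc j))) n x) \<longlonglongrightarrow> poly_kernel (\<lambda>x. 1 / cmod (poly f x)) n x"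
proof -
 define W where "W = (\<lambda>x. 1 / cmod (poly f x))"
 interpret poly_weight W n unfolding W_def by (rule singular_weight[OF sq deg n])
 have pwW: "poly_weight W n" by unfold_locales
 define w where "w = (\<lambda>j. regW f (1 / real (Suc j)))"
 have pw: "poly_weight (w j) n" for j unfolding w_def by (rule regW_weight[OF deg n]) simp
 have f0: "f \<noteq> 0" using deg by auto
 have AEf: "AE x in lborel. poly f x \<noteq> 0"
  using AE_not_in[OF finite_imp_null_set_lborel[OF poly_roots_finite[OF f0]]] by simp
 have le: "AE x in lborel. w j x \<le> W x" for j
  using AEf by eventually_elim (simp add: w_def W_def regW_le)
 have w0: "w j x \<ge> 0" for j x unfolding w_def regW_def by simp
 obtain e :: "nat => complex poly" where e: "orthonormal {..<n} e" "spanning {..<n} e"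
  using orthonormal_basis_exists by blast
 define k where "k = (\<lambda>x. \<Sum>i<n. cmod (poly (e i) x)^2)"
 have de: "degree (e i) < n" if "i < n" for i using e(1) that unfolding orthonormal_def by auto
 have k0: "k x \<ge> 0" for x unfolding k_def by (intro sum_nonneg) simp
 have ik: "L1 (\<lambda>x. k x * W x)" unfolding k_def sum_distrib_right
  by (intro B_integrable_sum norm_integrable tame_poly de) simp
 have ikw: "L1 (\<lambda>x. k x * w j x)" for j unfolding k_def sum_distrib_right
  by (intro B_integrable_sum poly_weight.norm_integrable[OF pw] poly_weight.tame_poly[OF pw] de) simp
 define \<eta> where "\<eta> = (\<lambda>j. \<integral>x. k x * W x - k x * w j x)"
 have \<eta>0: "\<eta> \<longlonglongrightarrow> 0"
 proof -
  have "(\<lambda>j. \<integral>x. k x * W x - k x * w j x) \<longlonglongrightarrow> (\<integral>x. 0 \<partial>(lborel :: complex measure))"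
  proof (rule integral_dominated_convergence[OF _ _ ik])
   show "(\<lambda>x. k x * W x - k x * w j x) \<in> borel_measurable lborel" for j using ik ikw[of j] by auto
   show "AE x in lborel. (\<lambda>j. k x * W x - k x * w j x) \<longlonglongrightarrow> 0"
    using AEf
   proof eventually_elim
    case (elim x)
    have "(\<lambda>j. 1 / sqrt (cmod (poly f x)^2 + inverse (real (Suc j)))) \<longlonglongrightarrow> 1 / sqrt (cmod (poly f x)^2 + 0)"
     by (intro tendsto_intros LIMSEQ_inverse_real_of_nat) (use elim in auto)
    hence "(\<lambda>j. w j x) \<longlonglongrightarrow> W x" unfolding w_def W_def regW_def by (simp add: inverse_eq_divide)
    hence "(\<lambda>j. k x * W x - k x * w j x) \<longlonglongrightarrow> k x * W x - k x * W x" by (intro tendsto_intros)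
    thus ?case by simp
   qed
   show "AE x in lborel. norm (k x * W x - k x * w j x) \<le> k x * W x" for j
    using le[of j]
   proof eventually_elim
    case (elim x)
    hence "k x * w j x \<le> k x * W x" "0 \<le> k x * w j x" using k0[of x] w0[of j x] by (auto intro: mult_left_mono)
    thus ?case by simp
   qed
  qed simp
  thus ?thesis unfolding \<eta>_def by simp
 qed
 have lower: "(1 - \<eta> j) * wnorm W p \<le> wnorm (w j) p" if p: "degree p < n" for p j
 proof -
  have "wnorm W p - wnorm (w j) p = (\<integral>x. cmod (poly p x)^2 * W x - cmod (poly p x)^2 * w j x)"
   unfolding wnorm_def
   using norm_integrable[OF tame_poly[OF p]] poly_weight.norm_integrable[OF pw poly_weight.tame_poly[OF pw p], of j] by simp
  also have "... \<le> (\<integral>x. wnorm W p * (k x * W x - k x * w j x))"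
  proof (rule integral_mono_AE)
   show "L1 (\<lambda>x. cmod (poly p x)^2 * W x - cmod (poly p x)^2 * w j x)"
    using norm_integrable[OF tame_poly[OF p]] poly_weight.norm_integrable[OF pw poly_weight.tame_poly[OF pw p], of j] by simp
   show "L1 (\<lambda>x. wnorm W p * (k x * W x - k x * w j x))" using ik ikw[of j] by simp
   show "AE x in lborel. cmod (poly p x)^2 * W x - cmod (poly p x)^2 * w j x \<le> wnorm W p * (k x * W x - k x * w j x)"
    using le[of j]
   proof eventually_elim
    case (elim x)
    have "cmod (poly p x)^2 \<le> k x * wnorm W p" unfolding k_def by (rule kernel_orthonormal(2)[OF e finite_lessThan p])
    hence "cmod (poly p x)^2 * (W x - w j x) \<le> (k x * wnorm W p) * (W x - w j x)"
     using elim by (intro mult_right_mono) auto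
    thus ?case by (simp add: algebra_simps)
   qed
  qed
  also have "... = \<eta> j * wnorm W p" unfolding \<eta>_def by simp
  finally show ?thesis by (simp add: algebra_simps)
 qed
 have ev: "\<forall>\<^sub>F j in sequentially. \<eta> j < 1" using order_tendstoD(2)[OF \<eta>0, of 1] by simp
 have "(\<lambda>j. poly_kernel (w j) n x) \<longlonglongrightarrow> poly_kernel W n x"
 proof (rule tendsto_sandwich)
  show "\<forall>\<^sub>F j in sequentially. poly_kernel W n x \<le> poly_kernel (w j) n x"
   by (intro always_eventually allI kernel_antimono[OF pw pwW le])
  show "\<forall>\<^sub>F j in sequentially. poly_kernel (w j) n x \<le> poly_kernel W n x / (1 - \<eta> j)"
   using ev
  proof eventually_elim
   case (elim j)
   show ?case by (rule kernel_comparison[OF pwW pw _ lower]) (use elim in auto)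
  qed
  have "(\<lambda>j. poly_kernel W n x / (1 - \<eta> j)) \<longlonglongrightarrow> poly_kernel W n x / (1 - 0)"
   by (intro tendsto_intros \<eta>0) auto
  thus "(\<lambda>j. poly_kernel W n x / (1 - \<eta> j)) \<longlonglongrightarrow> poly_kernel W n x" by simp
 qed simp
 thus ?thesis unfolding w_def W_def .
qed

lemma four_mean_at_add:
 assumes "four_mean_at u z" "four_mean_at v z"
 shows "four_mean_at (\<lambda>w. u w + v w) z"
proof -
 obtain K r0 where 1: "K \<ge> 0" "r0 > 0" "\<And>r. 0 < r ==> r \<le> r0 ==> rot4 (\<lambda>d. u (z + d)) r \<ge> 4 * u z - K * r ^ 3"
  using assms(1) unfolding four_mean_at_def by blast
 obtain K' r0' where 2: "K' \<ge> 0" "r0' > 0" "\<And>r. 0 < r ==> r \<le> r0' ==> rot4 (\<lambda>d. v (z + d)) r \<ge> 4 * v z - K' * r ^ 3"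
  using assms(2) unfolding four_mean_at_def by blast
 have "rot4 (\<lambda>d. u (z + d) + v (z + d)) r \<ge> 4 * (u z + v z) - (K + K') * r ^ 3" if "0 < r" "r \<le> min r0 r0'" for r
  using 1(3)[of r] 2(3)[of r] that unfolding rot4_add by (simp add: algebra_simps)
 thus ?thesis unfolding four_mean_at_def using 1 2 by (intro exI[of _ "K + K'"] exI[of _ "min r0 r0'"]) auto
qed

lemma four_mean_at_minus_ln_poly:
 fixes g :: "complex poly"
 assumes gz: "poly g z \<noteq> 0"
 shows "four_mean_at (\<lambda>w. - ln (cmod (poly g w))) z"
proof -
 define q where "q = pcompose g [:z, 1:]"
 have gq: "poly g (z + d) = poly q d" for d unfolding q_def by (simp add: poly_pcompose)
 obtain a0 q1 where q1: "q = pCons a0 q1" by (metis pCons_cases)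
 have a0: "a0 = poly g z" "a0 \<noteq> 0" using gq[of 0] gz by (auto simp: q1)
 define T where "T = q * pcompose q [:0, \<i>:] * pcompose q [:0, -1:] * pcompose q [:0, -\<i>:]"
 have pT: "poly T d = poly q d * poly q (\<i> * d) * poly q (- d) * poly q (- (\<i> * d))" for d
  unfolding T_def by (simp add: poly_pcompose mult_ac)
 have inv: "pcompose T [:0, \<i>:] = T"
 proof (rule poly_eq_poly_eq_iff[THEN iffD1], rule ext)
  fix d
  have "poly (pcompose T [:0, \<i>:]) d = poly T (\<i> * d)" by (simp add: poly_pcompose mult.commute)
  thus "poly (pcompose T [:0, \<i>:]) d = poly T d" unfolding pT by (simp add: mult_ac)
 qed
 have cf: "coeff T k = 0" if "k \<in> {1, 2, 3}" for k
 proof -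
  have "coeff (pcompose T [:0, \<i>:]) k = \<i> ^ k * coeff T k"
   by (simp add: coeff_pcompose_linear)
  hence "(\<i> ^ k - 1) * coeff T k = 0" unfolding inv by (simp add: algebra_simps)
  moreover have "\<i> ^ k \<noteq> 1" using that by (auto simp: power2_eq_square power3_eq_cube complex_eq_iff)
  ultimately show ?thesis by simp
 qed
 obtain b0 b1 b2 s where T: "T = pCons b0 (pCons b1 (pCons b2 s))" by (metis pCons_cases)
 have b: "b0 = a0 ^ 4" "b1 = 0" "b2 = 0"
 proof -
  show "b0 = a0 ^ 4" using pT[of 0] unfolding T q1 by (simp add: power4_eq_xxxx)
  show "b1 = 0" using cf[of 1] unfolding T by simp
  show "b2 = 0" using cf[of 2] unfolding T by (simp add: numeral_eq_Suc)
 qed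
 obtain B where B: "B \<ge> 0" "\<And>d. cmod d \<le> 1 ==> cmod (poly s d) \<le> B"
 proof -
  have "compact (poly s ` cball 0 1)" by (intro compact_continuous_image continuous_intros) auto
  then obtain B where "\<forall>y\<in>poly s ` cball 0 1. norm y \<le> B"
   using compact_imp_bounded[OF \<open>compact (poly s ` cball 0 1)\<close>] unfolding bounded_iff by blast
  hence "cmod (poly s d) \<le> max B 0" if "cmod d \<le> 1" for d using that by force
  thus ?thesis by (intro that[of "max B 0"]) auto
 qed
 define K where "K = B / cmod a0 ^ 4"
 have K0: "K \<ge> 0" unfolding K_def using B(1) by simp
 have "isCont (poly q) 0" by simp
 moreover have "poly q 0 \<noteq> 0" using a0 unfolding q1 by simp
 ultimately obtain r0 where r0: "r0 > 0" "\<And>d. cmod d \<le> r0 ==> poly q d \<noteq> 0"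
  using continuous_at_avoid[of 0 "poly q" 0] by (metis (no_types, lifting) dist_0_norm half_gt_zero le_less_trans field_sum_of_halves less_add_same_cancel1)
 have "rot4 (\<lambda>d. - ln (cmod (poly g (z + d)))) r \<ge> 4 * (- ln (cmod (poly g z))) - K * r ^ 3"
  if r: "0 < r" "r \<le> min r0 1" for r
 proof -
  let ?d = "complex_of_real r"
  have nz: "poly q ?d \<noteq> 0" "poly q (\<i> * ?d) \<noteq> 0" "poly q (- ?d) \<noteq> 0" "poly q (- (\<i> * ?d)) \<noteq> 0"
   using r by (auto intro!: r0(2) simp: norm_mult)
  have "rot4 (\<lambda>d. - ln (cmod (poly g (z + d)))) r = - (ln (cmod (poly q ?d)) + ln (cmod (poly q (\<i> * ?d))) + ln (cmod (poly q (- ?d))) + ln (cmod (poly q (- (\<i> * ?d)))))"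
   unfolding rot4_def gq by simp
  also have "... = - ln (cmod (poly T ?d))" unfolding pT using nz by (simp add: norm_mult ln_mult)
  finally have e: "rot4 (\<lambda>d. - ln (cmod (poly g (z + d)))) r = - ln (cmod (poly T ?d))" .
  have "poly T ?d \<noteq> 0" unfolding pT using nz by simp
  have "cmod (poly T ?d) \<le> cmod a0 ^ 4 + r ^ 3 * B"
  proof -
   have "poly T ?d = a0 ^ 4 + ?d ^ 3 * poly s ?d" unfolding T b by (simp add: power3_eq_cube)
   hence "cmod (poly T ?d) \<le> cmod a0 ^ 4 + cmod (?d ^ 3 * poly s ?d)"
    using norm_triangle_ineq[of "a0 ^ 4" "?d ^ 3 * poly s ?d"] by (simp add: norm_power)
   also have "cmod (?d ^ 3 * poly s ?d) \<le> r ^ 3 * B"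
    unfolding norm_mult norm_power using r B(2)[of ?d] by (simp add: mult_left_mono)
   finally show ?thesis by simp
  qed
  also have "... = cmod a0 ^ 4 * (1 + K * r ^ 3)" unfolding K_def using a0(2) by (simp add: field_simps)
  finally have "ln (cmod (poly T ?d)) \<le> ln (cmod a0 ^ 4 * (1 + K * r ^ 3))"
   using \<open>poly T ?d \<noteq> 0\<close> by (intro ln_mono) auto
  also have "... = 4 * ln (cmod a0) + ln (1 + K * r ^ 3)"
  proof -
   have "1 + K * r ^ 3 > 0" using K0 r by (simp add: add_pos_nonneg)
   thus ?thesis using a0(2) by (simp add: ln_mult ln_realpow)
  qed
  also have "ln (1 + K * r ^ 3) \<le> K * r ^ 3" using K0 r by (intro ln_add_one_self_le_self) simp
  finally show ?thesis unfolding e a0(1) by simp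
 qed
 thus ?thesis unfolding four_mean_at_def using K0 r0(1) by (intro exI[of _ K] exI[of _ "min r0 1"]) auto
qed

section \<open>The limit of the smoothed kernels\<close>

locale kernel_family =
 fixes c0 c1 c2 c3 :: "complex poly" and n :: nat and S :: "complex set" and x0 :: complex and \<kappa> :: real
 assumes deg0: "degree c0 = 2 * n + 1" and degs: "degree c1 \<le> 2 * n" "degree c2 \<le> 2 * n" "degree c3 \<le> 2 * n"
  and n2: "n \<ge> 2" and S: "open S" "0 \<in> S" and x0: "x0 \<noteq> 0" and \<kappa>: "\<kappa> > 0"
begin

definition fam :: "complex => complex poly" where
 "fam l = c0 + smult l c1 + smult (l^2) c2 + smult (l ^ 3) c3"

end

locale kernel_family_regular = kernel_family +
 assumes nz: "\<And>l. l \<in> S ==> poly (fam l) x0 \<noteq> 0"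
  and sq: "\<And>l. l \<in> S ==> l \<noteq> 0 ==> rsquarefree (fam l)"
  and zero: "L1 (\<lambda>x. cmod x^2 / cmod (poly (fam 0) x))"
begin

lemma n0: "n > 0" using n2 by simp

lemma deg_fam: "degree (fam l) = 2 * n + 1"
 unfolding fam_def by (rule degree_perturbation[OF deg0 degs])

definition eps :: "nat => real" where "eps j = 1 / real (Suc j)"

lemma eps_pos: "eps j > 0" by (simp add: eps_def)

definition B :: "nat => complex => real" where "B j l = poly_kernel (regW (fam l) (eps j)) n x0"

lemma weight_j: "poly_weight (regW (fam l) (eps j)) n"
 by (rule regW_weight[OF deg_fam n0 eps_pos])

lemma B_pos: "B j l > 0" unfolding B_def by (rule poly_weight.kernel_pos[OF weight_j])

lemma B_local:
 shows "isCont (B j) l" and "four_mean_at (\<lambda>l. ln (B j l)) l"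
proof -
 define f1 where "f1 = c1 + smult (2 * l) c2 + smult (3 * l^2) c3"
 define f2 where "f2 = c2 + smult (3 * l) c3"
 have d1: "degree f1 \<le> 2 * n" "degree f2 \<le> 2 * n" unfolding f1_def f2_def
  using degs by (auto intro!: degree_add_le intro: order_trans[OF degree_smult_le])
 interpret wf: weight_family "fam l" f1 f2 c3 n "eps j"
  by unfold_locales (use deg_fam n0 eps_pos d1 degs in auto)
 have F: "wf.F d = fam (l + d)" for d
 proof (rule poly_eq_poly_eq_iff[THEN iffD1], rule ext)
  fix x
  have "poly (wf.F d) x = poly (fam l + smult d f1 + smult (d^2) f2 + smult (d ^ 3) c3) x"
   by (simp only: wf.F_def)
  thus "poly (wf.F d) x = poly (fam (l + d)) x"
   unfolding fam_def f1_def f2_def by (simp add: power2_eq_square power3_eq_cube algebra_simps)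
 qed
 have Wd: "wf.Wd d = regW (fam (l + d)) (eps j)" for d
  unfolding wf.Wd_def F by (rule regW_eq[OF deg_fam n0 eps_pos])
 have W0: "regular_weight.W (fam l) (eps j) = regW (fam l) (eps j)"
  by (rule regW_eq[OF deg_fam n0 eps_pos])
 show "isCont (B j) l"
  using wf.kernel_continuous[of x0] unfolding Wd W0 isCont_iff B_def .
 show "four_mean_at (\<lambda>l. ln (B j l)) l"
  unfolding four_mean_at_def using wf.kernel_four_mean[of x0] unfolding Wd W0 B_def by metis
qed

definition G :: "complex poly" where "G = [:poly c0 x0, poly c1 x0, poly c2 x0, poly c3 x0:]"

lemma poly_G: "poly G l = poly (fam l) x0"
 unfolding G_def fam_def by (simp add: power2_eq_square power3_eq_cube algebra_simps)

definition v :: "nat => complex => real" where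
 "v j l = (ln \<kappa> + ln (B j l)) + (- ln (cmod (poly G l)))"

lemma v_eq: "l \<in> S ==> v j l = ln (\<kappa> * B j l / cmod (poly (fam l) x0))"
 unfolding v_def poly_G using nz[of l] \<kappa> B_pos[of j l] by (simp add: ln_mult ln_div)

lemma v_continuous: "l \<in> S ==> isCont (v j) l"
 unfolding v_def using B_pos[of j l] nz[of l] B_local(1)[of l j]
 by (intro continuous_intros) (auto simp: poly_G)

lemma v_four_mean: "l \<in> S ==> four_mean_at (v j) l"
proof -
 assume l: "l \<in> S"
 have "four_mean_at (\<lambda>l. ln \<kappa>) l" unfolding four_mean_at_def by (intro exI[of _ 0] exI[of _ 1]) (simp add: rot4_const)
 thus ?thesis unfolding v_def
  using nz[OF l] by (intro four_mean_at_add B_local four_mean_at_minus_ln_poly) (auto simp: poly_G)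
qed

lemma AE_fam: "AE x in lborel. poly (fam l) x \<noteq> 0"
proof -
 have "fam l \<noteq> 0" using deg_fam[of l] by auto
 from AE_not_in[OF finite_imp_null_set_lborel[OF poly_roots_finite[OF this]]] show ?thesis by simp
qed

lemma B_decreasing: "i \<le> j ==> B j l \<le> B i l"
 unfolding B_def
proof (rule kernel_antimono[OF weight_j weight_j], rule AE_I2)
 fix x assume ij: "i \<le> j"
 have e: "eps j \<le> eps i" unfolding eps_def using ij by (intro divide_left_mono) auto
 have "cmod (poly (fam l) x)^2 + eps j > 0" "cmod (poly (fam l) x)^2 + eps i > 0"
  using eps_pos by (simp_all add: add_nonneg_pos)
 thus "regW (fam l) (eps i) x \<le> regW (fam l) (eps j) x"
  unfolding regW_def using e by (intro divide_left_mono mult_pos_pos real_sqrt_le_mono) auto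
qed

lemma v_decreasing: "l \<in> S ==> i \<le> j ==> v j l \<le> v i l"
 unfolding v_def using B_decreasing[of i j l] B_pos[of j l] by simp

lemma B_tendsto: "l \<in> S ==> l \<noteq> 0 ==> (\<lambda>j. B j l) \<longlonglongrightarrow> poly_kernel (\<lambda>x. 1 / cmod (poly (fam l) x)) n x0"
 unfolding B_def eps_def by (rule regW_kernel_tendsto[OF sq deg_fam n0])

lemma B_lower_bound: "l \<in> S ==> \<exists>m>0. \<forall>j. m \<le> B j l"
proof (cases "l = 0")
 case True
 define M where "M = (\<integral>x. cmod x^2 / cmod (poly (fam 0) x))"
 have dX: "degree [:0, 1::complex:] < n" using n2 by simp
 have M: "wnorm (regW (fam 0) (eps j)) [:0, 1:] \<le> M" for j
  unfolding wnorm_def M_def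
 proof (rule integral_mono_AE[OF _ zero])
  show "L1 (\<lambda>x. cmod (poly [:0, 1:] x)^2 * regW (fam 0) (eps j) x)"
   by (rule poly_weight.norm_integrable[OF weight_j poly_weight.tame_poly[OF weight_j dX]])
  show "AE x in lborel. cmod (poly [:0, 1:] x)^2 * regW (fam 0) (eps j) x \<le> cmod x^2 / cmod (poly (fam 0) x)"
   using AE_fam[of 0]
  proof eventually_elim
   case (elim x)
   from mult_left_mono[OF regW_le[OF eps_pos[of j] elim], of "cmod x^2"] show ?case by simp
  qed
 qed
 have pos: "wnorm (regW (fam 0) (eps j)) [:0, 1:] > 0" for j
  by (rule poly_weight.wnorm_pos[OF weight_j dX]) simp
 hence M0: "M > 0" using M[of 0] pos[of 0] by linarith
 have "cmod x0^2 / M \<le> B j l" for j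
 proof -
  have "cmod (poly [:0, 1:] x0)^2 \<le> B j 0 * wnorm (regW (fam 0) (eps j)) [:0, 1:]"
   unfolding B_def by (rule poly_weight.kernel_bound[OF weight_j dX])
  also have "... \<le> B j 0 * M" using M[of j] B_pos[of j 0] by (intro mult_left_mono) auto
  finally show ?thesis using M0 True by (simp add: divide_le_eq)
 qed
 thus ?thesis using M0 x0 by (intro exI[of _ "cmod x0^2 / M"]) auto
next
 case False
 assume l: "l \<in> S"
 let ?K = "poly_kernel (\<lambda>x. 1 / cmod (poly (fam l) x)) n x0"
 have "?K > 0" by (rule poly_weight.kernel_pos[OF singular_weight[OF sq[OF l False] deg_fam n0]])
 moreover have "decseq (\<lambda>j. B j l)" unfolding decseq_def using B_decreasing by blast
 hence "?K \<le> B j l" for j using decseq_ge[OF _ B_tendsto[OF l False]] by blast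
 ultimately show ?thesis by blast
qed

definition u :: "complex => real" where "u l = (INF j. v j l)"

lemma v_bdd_below: "l \<in> S ==> bdd_below (range (\<lambda>j. v j l))"
proof -
 assume l: "l \<in> S"
 obtain m where m: "m > 0" "\<And>j. m \<le> B j l" using B_lower_bound[OF l] by blast
 have "(ln \<kappa> + ln m) + (- ln (cmod (poly G l))) \<le> v j l" for j
  unfolding v_def using m(1) m(2)[of j] by simp
 thus ?thesis by (intro bdd_belowI[of _ "(ln \<kappa> + ln m) + (- ln (cmod (poly G l)))"]) auto
qed

lemma u_le_v: "l \<in> S ==> u l \<le> v j l"
 unfolding u_def by (rule cINF_lower[OF v_bdd_below]) auto

lemma v_tendsto_u: "l \<in> S ==> (\<lambda>j. v j l) \<longlonglongrightarrow> u l"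
proof -
 assume l: "l \<in> S"
 have "decseq (\<lambda>j. v j l)" unfolding decseq_def using v_decreasing[OF l] by blast
 thus ?thesis unfolding u_def by (rule LIMSEQ_decseq_INF[OF v_bdd_below[OF l]])
qed

lemma u_eq:
 assumes "l \<in> S" "l \<noteq> 0"
 shows "u l = ln (\<kappa> * poly_kernel (\<lambda>x. 1 / cmod (poly (fam l) x)) n x0 / cmod (poly (fam l) x0))"
proof -
 have K: "poly_kernel (\<lambda>x. 1 / cmod (poly (fam l) x)) n x0 > 0"
  by (rule poly_weight.kernel_pos[OF singular_weight[OF sq[OF assms] deg_fam n0]])
 have "(\<lambda>j. v j l) \<longlonglongrightarrow> ln (\<kappa> * poly_kernel (\<lambda>x. 1 / cmod (poly (fam l) x)) n x0 / cmod (poly (fam l) x0))"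
  unfolding v_eq[OF assms(1)] using K \<kappa> nz[OF assms(1)] by (intro tendsto_intros B_tendsto assms) auto
 from LIMSEQ_unique[OF v_tendsto_u[OF assms(1)] this] show ?thesis .
qed

lemma circle_in_ball: "r > 0 ==> cball w r \<subseteq> S ==> w + of_real r * cis t \<in> S"
 by (auto simp: dist_norm norm_mult subset_eq)

lemma v_circle:
 assumes r: "r > 0" "cball w r \<subseteq> S"
 shows "set_integrable lborel {0..2 * pi} (\<lambda>t. v j (w + of_real r * cis t))"
  and "2 * pi * v j w \<le> (LINT t:{0..2 * pi}|lborel. v j (w + of_real r * cis t))"
proof -
 have cont: "continuous_on (cball w r) (v j)"
  using v_continuous r(2) by (intro continuous_at_imp_continuous_on) auto
 have ct: "continuous_on {0..2 * pi} (\<lambda>t. v j (w + of_real r * cis t))"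
  by (rule continuous_on_compose2[OF cont]) (use r in \<open>auto intro!: continuous_intros simp: dist_norm norm_mult\<close>)
 show si: "set_integrable lborel {0..2 * pi} (\<lambda>t. v j (w + of_real r * cis t))"
  by (rule borel_integrable_atLeastAtMost'[OF ct])
 have "2 * pi * v j w \<le> integral {0..2 * pi} (\<lambda>t. v j (w + of_real r * cis t))"
 proof (rule four_mean_sub_mean[OF r(1) cont])
  show "four_mean_at (v j) z" if "z \<in> ball w r" for z
   using that r(2) by (intro v_four_mean) auto
 qed
 thus "2 * pi * v j w \<le> (LINT t:{0..2 * pi}|lborel. v j (w + of_real r * cis t))"
  using set_borel_integral_eq_integral(2)[OF si] by simp
qed

lemma u_circle:
 assumes r: "r > 0" "cball w r \<subseteq> S"
 shows "set_integrable lborel {0..2 * pi} (\<lambda>t. u (w + of_real r * cis t))"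
  and "2 * pi * u w \<le> (LINT t:{0..2 * pi}|lborel. u (w + of_real r * cis t))"
proof -
 let ?I = "indicator {0..2 * pi} :: real => real"
 define g where "g = (\<lambda>j t. ?I t * - v j (w + of_real r * cis t))"
 have wS: "w \<in> S" using r by auto
 have inS: "w + of_real r * cis t \<in> S" for t by (rule circle_in_ball[OF r])
 have gi: "L1 (g j)" for j
  unfolding g_def using v_circle(1)[OF r, of j] unfolding set_integrable_def by simp
 have gint: "(\<integral>t. g j t) = - (LINT t:{0..2 * pi}|lborel. v j (w + of_real r * cis t))" for j
  unfolding g_def set_lebesgue_integral_def by simp
 have ub: "(\<integral>t. g j t) \<le> - (2 * pi * u w)" for j
 proof -
  have "2 * pi * u w \<le> 2 * pi * v j w" using u_le_v[OF wS, of j] by simp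
  thus ?thesis unfolding gint using v_circle(2)[OF r, of j] by linarith
 qed
 have gm: "g i t \<le> g j t" if "i \<le> j" for i j t
  unfolding g_def using v_decreasing[OF inS that] by (intro mult_left_mono) auto
 have glim: "(\<lambda>j. g j t) \<longlonglongrightarrow> ?I t * - u (w + of_real r * cis t)" for t
  unfolding g_def by (intro tendsto_intros v_tendsto_u inS)
 have mono_int: "incseq (\<lambda>j. \<integral>t. g j t)"
  unfolding incseq_def using gm gi by (auto intro!: integral_mono)
 obtain L where L: "(\<lambda>j. \<integral>t. g j t) \<longlonglongrightarrow> L"
  using incseq_convergent[OF mono_int, of "- (2 * pi * u w)"] ub by blast
 have meas: "(\<lambda>t. ?I t * - u (w + of_real r * cis t)) \<in> borel_measurable lborel"
  by (rule borel_measurable_LIMSEQ_real[OF glim]) (use gi in auto)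
 have res: "L1 (\<lambda>t. ?I t * - u (w + of_real r * cis t))" "(\<integral>t. ?I t * - u (w + of_real r * cis t)) = L"
  using integrable_monotone_convergence[OF gi _ _ L meas] integral_monotone_convergence[OF gi _ _ L meas] gm glim
  by (auto simp: incseq_def mono_def)
 have LL: "L \<le> - (2 * pi * u w)" by (rule LIMSEQ_le_const2[OF L]) (use ub in auto)
 show si: "set_integrable lborel {0..2 * pi} (\<lambda>t. u (w + of_real r * cis t))"
  using res(1) unfolding set_integrable_def by simp
 have "(LINT t:{0..2 * pi}|lborel. u (w + of_real r * cis t)) = - L"
  using res(2) unfolding set_lebesgue_integral_def by simp
 thus "2 * pi * u w \<le> (LINT t:{0..2 * pi}|lborel. u (w + of_real r * cis t))" using LL by simp
qed

lemma circle_integral_u: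
 assumes r: "r > 0" "cball w r \<subseteq> S"
 shows "circle_integral (\<lambda>l. ereal (u l)) w r = ereal (LINT t:{0..2 * pi}|lborel. u (w + of_real r * cis t))"
proof -
 define h where "h = (\<lambda>t. indicator {0..2 * pi} t * u (w + of_real r * cis t))"
 have hi: "L1 h"
  using u_circle(1)[OF r] unfolding set_integrable_def h_def by simp
 have a: "e2ennreal (ereal (u (w + of_real r * cis t))) * indicator {0..2 * pi} t = ennreal (h t)" for t
  unfolding h_def by (auto simp: indicator_def e2ennreal_ereal)
 have b: "e2ennreal (- ereal (u (w + of_real r * cis t))) * indicator {0..2 * pi} t = ennreal (- h t)" for t
  unfolding h_def by (auto simp: indicator_def e2ennreal_ereal)
 have fin: "(\<integral>\<^sup>+t. ennreal (h t)) < \<infinity>" "(\<integral>\<^sup>+t. ennreal (- h t)) < \<infinity>"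
  using hi integrable_minus[OF hi] by (auto simp: real_integrable_def less_top)
 have "(LINT t:{0..2 * pi}|lborel. u (w + of_real r * cis t)) = (\<integral>t. h t)"
  unfolding set_lebesgue_integral_def h_def by simp
 also have "... = enn2real (\<integral>\<^sup>+t. ennreal (h t)) - enn2real (\<integral>\<^sup>+t. ennreal (- h t))"
  by (rule real_lebesgue_integral_def[OF hi])
 finally have eq: "(LINT t:{0..2 * pi}|lborel. u (w + of_real r * cis t)) =
  enn2real (\<integral>\<^sup>+t. ennreal (h t)) - enn2real (\<integral>\<^sup>+t. ennreal (- h t))" .
 show ?thesis
 proof -
  have "enn2ereal X = ereal (enn2real X)" if "X < \<infinity>" for X
   using that by (cases X) auto
  thus ?thesis unfolding circle_integral_def a b eq using fin by simp
 qed
qed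

lemma u_subharmonic: "subharmonic_on S (\<lambda>l. ereal (u l))"
 unfolding subharmonic_on_def
proof (intro conjI ballI allI impI)
 show "open S" by (rule S)
next
 fix w c assume w: "w \<in> S" and c: "ereal (u w) < c"
 show "\<forall>\<^sub>F l in at w within S. ereal (u l) < c"
 proof (cases c)
  case (real c')
  hence "u w < c'" using c by simp
  hence "\<forall>\<^sub>F j in sequentially. v j w < c'" using order_tendstoD(2)[OF v_tendsto_u[OF w]] by blast
  then obtain j where j: "v j w < c'" by (auto simp: eventually_sequentially)
  have "(v j \<longlongrightarrow> v j w) (at w within S)"
  proof -
   have "(v j \<longlongrightarrow> v j w) (at w)" using v_continuous[OF w] by (simp add: isCont_def)
   thus ?thesis by (rule tendsto_within_subset) simp
  qed
  hence "\<forall>\<^sub>F l in at w within S. v j l < c'" using j by (rule order_tendstoD(2))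
  moreover have "\<forall>\<^sub>F l in at w within S. l \<in> S" by (simp add: eventually_at_filter)
  ultimately show ?thesis
  proof eventually_elim
   case (elim l)
   thus ?case using u_le_v[where l = l and j = j] real by simp
  qed
 qed (use c in auto)
next
 fix C assume "C \<in> components S"
 hence "C \<noteq> {}" by (rule in_components_nonempty)
 thus "\<exists>w\<in>C. ereal (u w) \<noteq> -\<infinity>" by auto
next
 fix w and r :: real assume r: "0 < r \<and> cball w r \<subseteq> S"
 hence "2 * pi * u w \<le> (LINT t:{0..2 * pi}|lborel. u (w + of_real r * cis t))" using u_circle(2) by blast
 hence "u w \<le> (LINT t:{0..2 * pi}|lborel. u (w + of_real r * cis t)) / (2 * pi)"
  by (simp add: pos_le_divide_eq mult.commute)
 thus "ereal (u w) \<le> circle_integral (\<lambda>l. ereal (u l)) w r / ereal (2 * pi)"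
  using r circle_integral_u by simp
qed auto

lemma u_lelong: "has_lelong_number (\<lambda>l. ereal (u l)) 0 0"
proof -
 obtain r0 where r0: "r0 > 0" "cball 0 r0 \<subseteq> S" using S open_contains_cball by blast
 have "continuous_on (cball 0 r0) (v 0)"
  using v_continuous r0(2) by (intro continuous_at_imp_continuous_on) auto
 then obtain z where z: "z \<in> cball 0 r0" "\<And>w. w \<in> cball 0 r0 ==> v 0 w \<le> v 0 z"
  using continuous_attains_sup[of "cball 0 r0" "v 0"] r0 by auto
 define M where "M = v 0 z"
 have uM: "u w \<le> M" if "w \<in> cball 0 r0" for w
  using u_le_v[where l = w and j = 0] z(2)[OF that] r0(2) that unfolding M_def by force
 define s where "s = (\<lambda>r. SUP w\<in>sphere 0 r. u w)"
 have sup: "(SUP w\<in>sphere 0 r. ereal (u w)) = ereal (s r)" and lo: "u 0 \<le> s r" and hi: "s r \<le> M"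
  if r: "0 < r" "r \<le> r0" for r
 proof -
  have sub: "sphere 0 r \<subseteq> cball (0::complex) r0" using r by auto
  have ne: "sphere (0::complex) r \<noteq> {}" using r by simp
  have bdd: "bdd_above (u ` sphere 0 r)" using uM sub by (intro bdd_aboveI2[of _ _ M]) auto
  have s: "u w \<le> s r" if "w \<in> sphere 0 r" for w unfolding s_def by (rule cSUP_upper[OF that bdd])
  show "s r \<le> M" unfolding s_def using ne uM sub by (intro cSUP_least) auto
  show "(SUP w\<in>sphere 0 r. ereal (u w)) = ereal (s r)"
  proof -
   obtain w :: complex where w: "w \<in> sphere 0 r" using ne by blast
   have "(SUP w\<in>sphere 0 r. ereal (u w)) \<le> ereal (s r)" using s by (intro SUP_least) simp
   moreover have "ereal (u w) \<le> (SUP w\<in>sphere 0 r. ereal (u w))" using w by (intro SUP_upper)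
   ultimately have "\<bar>SUP w\<in>sphere 0 r. ereal (u w)\<bar> \<noteq> \<infinity>" by (cases "SUP w\<in>sphere 0 r. ereal (u w)") auto
   from ereal_SUP[OF this] show ?thesis unfolding s_def by simp
  qed
  have cb: "cball 0 r \<subseteq> S" using r r0 by force
  have "2 * pi * u 0 \<le> (LINT t:{0..2 * pi}|lborel. u (0 + of_real r * cis t))" by (rule u_circle(2)[OF r(1) cb])
  also have "... \<le> (LINT t:{0..2 * pi}|lborel. s r)"
  proof (rule set_integral_mono[OF u_circle(1)[OF r(1) cb]])
   show "u (0 + of_real r * cis t) \<le> s r" for t using r by (intro s) (simp add: norm_mult)
   show "set_integrable lborel {0..2 * pi} (\<lambda>t. s r)" by (rule borel_integrable_atLeastAtMost') (intro continuous_intros)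
  qed
  also have "... = 2 * pi * s r" by (simp add: set_lebesgue_integral_def)
  finally show "u 0 \<le> s r" by simp
 qed
 have lim: "((\<lambda>r. s r / ln r) \<longlongrightarrow> 0) (at_right 0)"
 proof (rule Lim_null_comparison)
  define N where "N = max \<bar>M\<bar> \<bar>u 0\<bar>"
  have "\<forall>\<^sub>F r in at_right 0. 0 < r \<and> r < r0" using r0(1) by (simp add: eventually_at_right_field) (metis)
  thus "\<forall>\<^sub>F r in at_right 0. norm (s r / ln r) \<le> N / \<bar>ln r\<bar>"
  proof eventually_elim
   case (elim r)
   hence "\<bar>s r\<bar> \<le> N" using lo[of r] hi[of r] unfolding N_def by auto
   thus ?case by (simp add: abs_divide divide_right_mono)
  qed
  have "((\<lambda>r. N / ln r) \<longlongrightarrow> 0) (at_right 0)"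
   by (intro tendsto_divide_0[OF tendsto_const] filterlim_at_bot_imp_at_infinity ln_at_0)
  hence "((\<lambda>r. \<bar>N / ln r\<bar>) \<longlongrightarrow> 0) (at_right 0)" by (rule tendsto_rabs_zero)
  moreover have "N \<ge> 0" unfolding N_def by auto
  ultimately show "((\<lambda>r. N / \<bar>ln r\<bar>) \<longlongrightarrow> 0) (at_right 0)" by (simp add: abs_divide)
 qed
 have ev: "\<forall>\<^sub>F r in at_right 0. ereal (s r / ln r) = (SUP w\<in>sphere 0 r. ereal (u w)) / ereal (ln r)"
 proof -
  have "\<forall>\<^sub>F r in at_right 0. 0 < r \<and> r < min r0 1" using eventually_at_right_real[of 0 "min r0 1"] r0(1) by simp
  thus ?thesis
  proof eventually_elim
   case (elim r)
   hence "ln r \<noteq> 0" by simp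
   thus ?case using sup[of r] elim by (simp add: ereal_divide)
  qed
 qed
 have "((\<lambda>r. ereal (s r / ln r)) \<longlongrightarrow> ereal 0) (at_right 0)" using lim by (rule tendsto_ereal)
 from Lim_transform_eventually[OF this ev] show ?thesis unfolding has_lelong_number_def zero_ereal_def .
qed

end

section \<open>Square-integrable holomorphic functions in the plane\<close>

lemma compact_support_facts:
 fixes k :: "complex => complex"
 assumes R: "R > 0" and k: "continuous_on (ball 0 (2 * R)) k" and z: "\<And>x. cmod x > R ==> k x = 0"
 shows "cont k" and "\<exists>C. \<forall>x. cmod (k x) \<le> C * wt (-3) x"
proof -
 have "continuous_on (- cball 0 R) k"
  using continuous_on_const[of "- cball 0 R" 0] by (rule continuous_on_eq) (use z in auto)
 hence "continuous_on (ball 0 (2 * R) \<union> - cball 0 R) k" using k by (intro continuous_on_open_Un) auto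
 moreover have "ball 0 (2 * R) \<union> - cball 0 R = (UNIV :: complex set)" using R by auto
 ultimately show c: "cont k" by simp
 show "\<exists>C. \<forall>x. cmod (k x) \<le> C * wt (-3) x"
  using decays_compact_support[OF c z] unfolding decays_def by blast
qed

lemma sub_mean_square:
 assumes F: "F holomorphic_on ball c (2 * R)" and R: "R > 0"
 shows "ennreal (poisson_mass * R^2 / 2 * cmod (F c)^2) \<le> (\<integral>\<^sup>+x\<in>cball c R. ennreal (cmod (F x)^2) \<partial>lborel)"
proof -
 define H where "H = (\<lambda>x. (F (c + x))^2)"
 define H1 where "H1 = (\<lambda>x. 2 * F (c + x) * deriv F (c + x))"
 define h where "h = (\<lambda>x. of_real (cutoff R x) * H x)"
 define a where "a = (\<lambda>x. cnj (cutoff_deriv R x) * H x + of_real (cutoff R x) * H1 x)"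
 define b where "b = (\<lambda>x. cutoff_deriv R x * H x)"
 have cF: "continuous_on (ball 0 (2 * R)) (\<lambda>x. F (c + x))"
  by (rule continuous_on_compose2[OF holomorphic_on_imp_continuous_on[OF F]])
   (auto intro!: continuous_intros simp: dist_norm)
 have cdF: "continuous_on (ball 0 (2 * R)) (\<lambda>x. deriv F (c + x))"
  by (rule continuous_on_compose2[OF holomorphic_on_imp_continuous_on[OF holomorphic_deriv[OF F open_ball]]])
   (auto intro!: continuous_intros simp: dist_norm)
 have ccut: "continuous_on A (\<lambda>x. of_real (cutoff R x) :: complex)" for A
  using wirtinger_continuous[OF cutoff_wirtinger[OF R]] by (intro continuous_at_imp_continuous_on) auto
 have ccd: "continuous_on A (cutoff_deriv R)" for A
  using cutoff_facts(6)[OF R] by (rule continuous_on_subset) simp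
 have ch: "continuous_on (ball 0 (2 * R)) h" "continuous_on (ball 0 (2 * R)) a" "continuous_on (ball 0 (2 * R)) b"
  unfolding h_def a_def b_def H_def H1_def by (intro continuous_intros cF cdF ccut ccd)+
 have z: "h x = 0" "a x = 0" "b x = 0" if "cmod x > R" for x
  using cutoff_facts(3,4)[OF R that] by (simp_all add: h_def a_def b_def)
 note ca = compact_support_facts(1)[OF R ch(2) z(2)] and cb = compact_support_facts(1)[OF R ch(3) z(3)]
 obtain C1 C2 C3 where C: "\<And>x. cmod (h x) \<le> C1 * wt (-3) x"
  "\<And>x. cmod (a x) \<le> C2 * wt (-3) x" "\<And>x. cmod (b x) \<le> C3 * wt (-3) x"
  using compact_support_facts(2)[OF R ch(1) z(1)] compact_support_facts(2)[OF R ch(2) z(2)]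
   compact_support_facts(2)[OF R ch(3) z(3)] by metis
 define C where "C = max C1 (max C2 C3)"
 have le: "k * wt (-3) x \<le> C * wt (-3) x" if "k \<le> C" for k x
  using that by (intro mult_right_mono) auto
 have Cs: "C1 \<le> C" "C2 \<le> C" "C3 \<le> C" unfolding C_def by auto
 have w: "wirtinger h (a x) (b x) x" for x
 proof (cases "cmod x < 2 * R")
  case True
  hence x: "c + x \<in> ball c (2 * R)" by (simp add: dist_norm)
  have c1: "((\<lambda>x. c + x) has_field_derivative 1) (at x)" by (auto intro!: derivative_eq_intros)
  have "(F has_field_derivative deriv F (c + x)) (at (c + x))" by (rule holomorphic_derivI[OF F open_ball x])
  hence "((\<lambda>x. F (c + x)) has_field_derivative deriv F (c + x)) (at x)"
   using DERIV_chain2[of F _ "\<lambda>x. c + x" x 1 UNIV, OF _ c1] by simp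
  hence "(H has_field_derivative H1 x) (at x)" unfolding H_def H1_def by (auto intro!: derivative_eq_intros)
  from wirtinger_mult[OF cutoff_wirtinger[OF R] wirtinger_holomorphic[OF this]]
  show ?thesis unfolding h_def a_def b_def by simp
 next
  case False
  hence x: "x \<in> - cball 0 R" using R by auto
  have "((\<lambda>_. 0) has_derivative (\<lambda>h. a x * h + b x * cnj h)) (at x)" using z x by simp
  thus ?thesis unfolding wirtinger_def
   by (rule has_derivative_transform_within_open[of _ _ _ _ "- cball 0 R"]) (use z x in auto)
 qed
 have "(\<integral>z. 1 / z * b (0 - z)) = of_real poisson_mass * h 0"
  by (rule cauchy_transform_dbar[OF w _ ca cb, of 3 C])
   (use C[THEN order_trans, OF le] Cs in auto)
 moreover have "h 0 = (F c)^2" using R by (simp add: h_def H_def cutoff_def)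
 ultimately have eq: "poisson_mass * cmod (F c)^2 = cmod (\<integral>z. 1 / z * b (0 - z))"
  using poisson_mass_pos by (simp add: norm_mult norm_power)
 define K where "K = (\<lambda>x. indicator (cball c R) x *\<^sub>R cmod (F x)^2)"
 have Ki: "L1 K" unfolding K_def
 proof (rule borel_integrable_compact)
  have "cball c R \<subseteq> ball c (2 * R)" using R by auto
  thus "continuous_on (cball c R) (\<lambda>x. cmod (F x)^2)"
   by (intro continuous_intros holomorphic_on_imp_continuous_on holomorphic_on_subset[OF F])
 qed auto
 have "cmod (\<integral>z. 1 / z * b (0 - z)) \<le> (\<integral>z. 2 / R^2 * K (c - z))"
 proof (rule norm_integral_le)
  show "L1 (\<lambda>z. 2 / R^2 * K (c - z))"
   using integrable_reflect[OF Ki] by simp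
  fix z
  show "norm (1 / z * b (0 - z)) \<le> 2 / R^2 * K (c - z)"
  proof (cases "cmod z \<le> R")
   case True
   have m: "max 0 (1 - cmod z^2 / R^2) \<le> 1" by simp
   have "norm (1 / z * b (0 - z)) = (cmod z / cmod z) * (2 * max 0 (1 - cmod z^2 / R^2) / R^2 * cmod (F (c - z))^2)"
    by (simp add: b_def cutoff_deriv_def H_def norm_mult norm_divide norm_power)
   also have "... \<le> 1 * (2 * 1 / R^2 * cmod (F (c - z))^2)"
    using m by (intro mult_mono divide_right_mono) auto
   finally show ?thesis using True by (simp add: K_def dist_norm)
  next
   case False
   thus ?thesis using z(3)[of "- z"] by (simp add: K_def dist_norm)
  qed
 qed
 also have "... = 2 / R^2 * (\<integral>x. K x)"
  using integral_reflect[of K c] Ki by simp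
 finally have "poisson_mass * cmod (F c)^2 \<le> 2 / R^2 * (\<integral>x. K x)" using eq by simp
 hence "R^2 / 2 * (poisson_mass * cmod (F c)^2) \<le> R^2 / 2 * (2 / R^2 * (\<integral>x. K x))"
  by (rule mult_left_mono) simp
 hence "poisson_mass * R^2 / 2 * cmod (F c)^2 \<le> (\<integral>x. K x)" using R by (simp add: mult_ac)
 hence "ennreal (poisson_mass * R^2 / 2 * cmod (F c)^2) \<le> ennreal (\<integral>x. K x)" by (rule ennreal_leI)
 also have "... = (\<integral>\<^sup>+x. ennreal (K x))"
  by (rule nn_integral_eq_integral[OF Ki, symmetric]) (simp add: K_def)
 also have "... = (\<integral>\<^sup>+x\<in>cball c R. ennreal (cmod (F x)^2) \<partial>lborel)"
  by (intro nn_integral_cong) (simp add: K_def indicator_def)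
 finally show ?thesis .
qed

lemma removable_finite:
 assumes "finite Z" "F holomorphic_on - Z" "\<And>a. a \<in> Z ==> ((\<lambda>x. (x - a) * F x) \<longlongrightarrow> 0) (at a)"
 shows "\<exists>g. g holomorphic_on UNIV \<and> (\<forall>x\<in>- Z. g x = F x)"
 using assms
proof (induction Z arbitrary: F rule: finite_induct)
 case empty
 thus ?case by auto
next
 case (insert a Z)
 have op: "open (- Z)" using insert.hyps(1) by (simp add: finite_imp_closed open_Compl)
 have a: "a \<in> interior (- Z)" using insert.hyps(2) op by (simp add: interior_open)
 have "F holomorphic_on (- Z) - {a}" using insert.prems(1) by (rule holomorphic_on_subset) auto
 then obtain g where g: "g holomorphic_on - Z" "\<And>x. x \<in> - Z - {a} ==> g x = F x"
  using holomorphic_on_extend_lim[OF _ a, of F] insert.prems(2)[of a] by auto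
 have "((\<lambda>x. (x - b) * g x) \<longlongrightarrow> 0) (at b)" if b: "b \<in> Z" for b
 proof (rule Lim_transform_eventually[OF insert.prems(2)[of b]])
  have "\<forall>\<^sub>F x in at b. x \<in> - (insert a Z - {b})"
   using insert.hyps(1) by (intro eventually_at_in_open' open_Compl finite_imp_closed) auto
  moreover have "\<forall>\<^sub>F x in at b. x \<noteq> b" by (simp add: eventually_at_filter)
  ultimately show "\<forall>\<^sub>F x in at b. (x - b) * F x = (x - b) * g x"
   by eventually_elim (use g(2) in auto)
 qed (use b in auto)
 from insert.IH[OF g(1) this] obtain k where k: "k holomorphic_on UNIV" "\<forall>x\<in>- Z. k x = g x" by blast
 thus ?case using g(2) by (intro exI[of _ k]) auto
qed

lemma measure_small_ball:
 fixes M :: "complex measure"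
 assumes "finite_measure M" "sets M = sets borel" "emeasure M {a} = 0" "e > 0"
 obtains \<rho> where "\<rho> > 0" "measure M (cball a \<rho>) < e"
proof -
 interpret finite_measure M by fact
 define A where "A = (\<lambda>k. cball a (1 / real (Suc k)))"
 have "(\<lambda>k. measure M (A k)) \<longlonglongrightarrow> measure M (\<Inter>k. A k)"
 proof (rule finite_Lim_measure_decseq)
  show "range A \<subseteq> sets M" by (auto simp: A_def assms(2))
  show "decseq A" unfolding A_def decseq_def by (intro allI impI subset_cball divide_left_mono) auto
 qed
 moreover have "(\<Inter>k. A k) = {a}"
 proof -
  have "x = a" if "\<And>k. dist a x \<le> 1 / real (Suc k)" for x
  proof (rule ccontr)
   assume "x \<noteq> a"
   then obtain k where "inverse (real (Suc k)) < dist a x" using reals_Archimedean[of "dist a x"] by auto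
   thus False using that[of k] by (simp add: inverse_eq_divide)
  qed
  thus ?thesis unfolding A_def by auto
 qed
 moreover have "measure M {a} = 0" using assms(3) by (simp add: measure_def)
 ultimately have "\<forall>\<^sub>F k in sequentially. measure M (A k) < e" using assms(4) by (auto intro: order_tendstoD)
 then obtain k where "measure M (A k) < e" by (auto simp: eventually_sequentially)
 thus ?thesis unfolding A_def by (intro that[of "1 / real (Suc k)"]) auto
qed

lemma entire_square_growth:
 assumes g: "g holomorphic_on UNIV" and C: "C \<ge> 0" and A: "A \<ge> 1"
  and b: "\<And>x. cmod x \<ge> A ==> cmod (g x)^2 * cmod x^2 \<le> C * cmod x ^ d"
 obtains p where "\<And>x. g x = poly p x" "p = 0 \<or> 2 * degree p + 2 \<le> d"
proof -
 have "cmod (g x) \<le> sqrt C * cmod x ^ d" if x: "cmod x \<ge> A" for x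
 proof (rule power2_le_imp_le)
  have x1: "1 \<le> cmod x" using x A by simp
  have "cmod (g x)^2 * 1 \<le> cmod (g x)^2 * cmod x^2" using x1 by (intro mult_left_mono one_le_power) auto
  also have "... \<le> C * cmod x ^ d" by (rule b[OF x])
  also have "... \<le> C * cmod x ^ (2 * d)" using x1 C by (intro mult_left_mono power_increasing) auto
  finally show "cmod (g x)^2 \<le> (sqrt C * cmod x ^ d)^2"
   using C by (simp add: power_mult_distrib power_mult[symmetric] mult.commute)
 qed (use C in auto)
 from Liouville_polynomial[OF g this]
 have g_eq: "g x = (\<Sum>k\<le>d. (deriv ^^ k) g 0 / fact k * x ^ k)" for x by simp
 define p where "p = (\<Sum>k\<le>d. monom ((deriv ^^ k) g 0 / fact k) k)"
 have p: "g x = poly p x" for x unfolding p_def g_eq[of x] by (simp add: poly_sum poly_monom)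
 have "2 * degree p + 2 \<le> d" if p0: "p \<noteq> 0"
 proof (rule ccontr)
  assume "\<not> ?thesis"
  hence e: "Suc d \<le> 2 * degree p + 2" by simp
  obtain c R where c: "c > 0" "\<And>x. cmod x \<ge> R ==> c * wt (real (degree p)) x \<le> cmod (poly p x)"
   using poly_lower_bound[OF p0] by metis
  define T where "T = max (max A R) (C / c^2 + 1)"
  define x where "x = complex_of_real T"
  have T: "T \<ge> A" "T \<ge> R" "T \<ge> C / c^2 + 1" "T \<ge> 1" using A unfolding T_def by auto
  have nx: "cmod x = T" using T(4) unfolding x_def by simp
  have "c * T ^ degree p \<le> c * wt (real (degree p)) x"
  proof (rule mult_left_mono)
   have "T ^ degree p \<le> (1 + T) ^ degree p" using T(4) by (intro power_mono) auto
   also have "... = wt (real (degree p)) x" using T(4) nx by (simp add: powr_realpow)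
   finally show "T ^ degree p \<le> wt (real (degree p)) x" .
  qed (use c in simp)
  also have "... \<le> cmod (g x)" using c(2)[of x] nx T p by simp
  finally have "(c * T ^ degree p)^2 \<le> cmod (g x)^2" using c T by (intro power_mono) auto
  hence "(c * T ^ degree p)^2 * T^2 \<le> cmod (g x)^2 * T^2" by (rule mult_right_mono) simp
  also have "... \<le> C * T ^ d" using b[of x] nx T by simp
  finally have "c^2 * T ^ (2 * degree p + 2) \<le> C * T ^ d"
   by (simp add: power_mult_distrib power_add power2_eq_square power_mult mult_ac)
  moreover have "c^2 * T ^ Suc d \<le> c^2 * T ^ (2 * degree p + 2)"
   using T e by (intro mult_left_mono power_increasing) auto
  ultimately have "(c^2 * T) * T ^ d \<le> C * T ^ d" by (simp add: mult_ac)
  hence "c^2 * T \<le> C" using T by (simp add: mult_le_cancel_right)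
  moreover have "C + c^2 = c^2 * (C / c^2 + 1)" using c by (simp add: field_simps)
  moreover have "... \<le> c^2 * T" using T(3) by (intro mult_left_mono) auto
  moreover have "c^2 > 0" using c by simp
  ultimately show False by linarith
 qed
 thus ?thesis using that p by blast
qed

lemma square_integrable_imp_poly:
 fixes w :: "complex => real"
 assumes Z: "finite Z" and F: "F holomorphic_on - Z" and w [measurable]: "w \<in> borel_measurable borel"
  and C: "C > 0" and w_low: "\<And>x. x \<notin> Z ==> 1 \<le> C * (1 + cmod x) ^ d * w x"
  and fin: "(\<integral>\<^sup>+x\<in>- Z. ennreal (cmod (F x)^2 * w x) \<partial>lborel) < \<infinity>"
 obtains p where "\<And>x. x \<notin> Z ==> F x = poly p x" "p = 0 \<or> 2 * degree p + 2 \<le> d"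
proof -
 define F' where "F' = (\<lambda>x. indicator (- Z) x *\<^sub>R F x)"
 have op: "open (- Z)" using Z by (simp add: finite_imp_closed open_Compl)
 have [measurable]: "F' \<in> borel_measurable borel" unfolding F'_def
  by (rule borel_measurable_continuous_on_indicator[OF _ holomorphic_on_imp_continuous_on[OF F]]) (use op in simp)
 define M where "M = density lborel (\<lambda>x. ennreal (cmod (F' x)^2 * w x))"
 have sM: "sets M = sets borel" unfolding M_def by simp
 have eM: "emeasure M A = (\<integral>\<^sup>+x\<in>A. ennreal (cmod (F' x)^2 * w x) \<partial>lborel)" if "A \<in> sets borel" for A
  unfolding M_def using that by (simp add: emeasure_density)
 have "emeasure M UNIV = (\<integral>\<^sup>+x\<in>- Z. ennreal (cmod (F x)^2 * w x) \<partial>lborel)"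
  by (subst eM) (auto intro!: nn_integral_cong simp: F'_def indicator_def)
 hence fM: "finite_measure M" using fin sM sets_eq_imp_space_eq[OF sM] by (intro finite_measureI) auto
 interpret finite_measure M by (rule fM)
 have sing: "emeasure M {a} = 0" for a
 proof -
  have "(\<integral>\<^sup>+x\<in>{a}. ennreal (cmod (F' x)^2 * w x) \<partial>lborel) = 0" by (rule nn_integral_null_set) (simp add: null_sets_def)
  thus ?thesis by (subst eM) auto
 qed
 define q where "q = poisson_mass / 2"
 have q: "q > 0" unfolding q_def using poisson_mass_pos by simp
 have local: "q * R^2 * cmod (F x)^2 \<le> C * (1 + cmod x + R) ^ d * measure M (cball x R)"
  if R: "R > 0" "ball x (2 * R) \<subseteq> - Z" for x R
 proof -
  let ?K = "C * (1 + cmod x + R) ^ d"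
  have K: "?K \<ge> 0" using C R by simp
  have "ennreal (q * R^2 * cmod (F x)^2) \<le> (\<integral>\<^sup>+y\<in>cball x R. ennreal (cmod (F y)^2) \<partial>lborel)"
   using sub_mean_square[OF holomorphic_on_subset[OF F R(2)] R(1)] unfolding q_def by (simp add: mult_ac)
  also have "... \<le> (\<integral>\<^sup>+y. ennreal ?K * (ennreal (cmod (F' y)^2 * w y) * indicator (cball x R) y))"
  proof (rule nn_integral_mono)
   fix y
   show "ennreal (cmod (F y)^2) * indicator (cball x R) y \<le>
    ennreal ?K * (ennreal (cmod (F' y)^2 * w y) * indicator (cball x R) y)"
   proof (cases "y \<in> cball x R")
    case True
    hence yZ: "y \<notin> Z" using R by (auto simp: subset_eq dist_norm)
    have "cmod y = cmod (x + (y - x))" by simp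
    also have "... \<le> cmod x + cmod (y - x)" by (rule norm_triangle_ineq)
    finally have ny: "cmod y \<le> cmod x + R" using True by (simp add: dist_norm norm_minus_commute)
    have p0: "0 < C * (1 + cmod y) ^ d" using C by (intro mult_pos_pos zero_less_power) (simp_all add: add_pos_nonneg)
    have "0 < C * (1 + cmod y) ^ d * w y" using w_low[OF yZ] by linarith
    hence wp: "w y > 0" by (rule zero_less_mult_pos[OF _ p0])
    have "1 \<le> C * (1 + cmod y) ^ d * w y" by (rule w_low[OF yZ])
    also have "... \<le> ?K * w y" using ny wp C by (intro mult_right_mono mult_left_mono power_mono) auto
    finally have "cmod (F y)^2 * 1 \<le> cmod (F y)^2 * (?K * w y)" by (rule mult_left_mono) simp
    hence "cmod (F y)^2 \<le> ?K * (cmod (F y)^2 * w y)" by (simp add: mult_ac)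
    hence "ennreal (cmod (F y)^2) \<le> ennreal ?K * ennreal (cmod (F y)^2 * w y)"
     using K wp by (simp add: ennreal_mult[symmetric] ennreal_leI)
    thus ?thesis using True yZ by (simp add: F'_def)
   qed simp
  qed
  also have "... = ennreal ?K * emeasure M (cball x R)"
   unfolding eM[OF borel_closed[OF closed_cball]] by (rule nn_integral_cmult) (auto intro!: borel_measurable_times_ennreal borel_measurable_indicator)
  also have "... = ennreal (?K * measure M (cball x R))"
   using K by (simp add: emeasure_eq_measure ennreal_mult)
  finally show ?thesis using K by (subst (asm) ennreal_le_iff) auto
 qed
 have "((\<lambda>x. (x - a) * F x) \<longlongrightarrow> 0) (at a)" if a: "a \<in> Z" for a
 proof (rule LIM_I)
  fix e :: real assume e: "e > 0"
  obtain \<delta> where \<delta>: "\<delta> > 0" "ball a \<delta> \<subseteq> - (Z - {a})"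
  proof -
   have "open (- (Z - {a}))" using Z by (intro open_Compl finite_imp_closed) auto
   thus ?thesis using that open_contains_ball by (metis Compl_iff Diff_iff insertI1)
  qed
  define K where "K = C * (2 + cmod a + \<delta>) ^ d"
  have K: "K > 0" using C \<delta>(1) unfolding K_def by (intro mult_pos_pos zero_less_power) (auto intro: add_pos_nonneg add_nonneg_pos)
  have "q * e^2 / (4 * K) > 0" using q e K by simp
  from measure_small_ball[OF fM sM sing this] obtain \<rho> where \<rho>: "\<rho> > 0" "measure M (cball a \<rho>) < q * e^2 / (4 * K)" by blast
  show "\<exists>s>0. \<forall>x. x \<noteq> a \<and> norm (x - a) < s \<longrightarrow> norm ((x - a) * F x - 0) < e"
  proof (intro exI[of _ "min (\<delta> / 2) (\<rho> / 2)"] conjI allI impI)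
   show "min (\<delta> / 2) (\<rho> / 2) > 0" using \<delta> \<rho> by simp
   fix x assume x: "x \<noteq> a \<and> norm (x - a) < min (\<delta> / 2) (\<rho> / 2)"
   define R where "R = norm (x - a) / 2"
   have R: "R > 0" "2 * R < \<delta> / 2" "2 * R < \<rho> / 2" "norm (x - a) = 2 * R" using x unfolding R_def by auto
   have "ball x (2 * R) \<subseteq> - Z"
   proof
    fix y assume y: "y \<in> ball x (2 * R)"
    have "y \<noteq> a" using y R(4) by (auto simp: dist_norm)
    moreover have "dist a y \<le> dist a x + dist x y" by (rule dist_triangle)
    hence "y \<in> ball a \<delta>" using y R by (simp add: dist_norm norm_minus_commute)
    ultimately show "y \<in> - Z" using \<delta>(2) by auto
   qed
   from local[OF R(1) this]
   have "q * R^2 * cmod (F x)^2 \<le> C * (1 + cmod x + R) ^ d * measure M (cball x R)" .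
   also have "... \<le> K * measure M (cball a \<rho>)"
   proof (rule mult_mono)
    have "cmod x \<le> cmod a + cmod (x - a)" using norm_triangle_ineq[of a "x - a"] by simp
    thus "C * (1 + cmod x + R) ^ d \<le> K" unfolding K_def using R C \<delta>(1)
     by (intro mult_left_mono power_mono) auto
    have "cball x R \<subseteq> cball a \<rho>"
    proof
     fix y assume y: "y \<in> cball x R"
     have "dist a y \<le> dist a x + dist x y" by (rule dist_triangle)
     thus "y \<in> cball a \<rho>" using y R \<rho>(1) by (simp add: dist_norm norm_minus_commute)
    qed
    thus "measure M (cball x R) \<le> measure M (cball a \<rho>)" by (rule finite_measure_mono) (simp add: sM)
   qed (use K in auto)
   also have "... < K * (q * e^2 / (4 * K))" using \<rho>(2) K by (rule mult_strict_left_mono)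
   also have "... = q * (e^2 / 4)" using K by simp
   finally have "R^2 * cmod (F x)^2 < e^2 / 4" using q by (simp add: mult.assoc)
   hence "cmod ((x - a) * F x)^2 < e^2" using R(4) by (simp add: norm_mult power_mult_distrib)
   thus "norm ((x - a) * F x - 0) < e" using e by (simp add: power_less_imp_less_base)
  qed
 qed
 from removable_finite[OF Z F this] obtain g where g: "g holomorphic_on UNIV" "\<And>x. x \<notin> Z ==> g x = F x" by auto
 obtain A0 where A0: "\<And>z. z \<in> Z ==> cmod z \<le> A0" using finite_imp_bounded[OF Z] bounded_iff by metis
 define A where "A = max 1 (2 * A0 + 1)"
 define T where "T = 16 * (C * 3 ^ d * measure M UNIV) / q"
 have T: "T \<ge> 0" using C q unfolding T_def by simp
 have "cmod (g x)^2 * cmod x^2 \<le> T * cmod x ^ d" if x: "cmod x \<ge> A" for x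
 proof -
  define R where "R = cmod x / 4"
  have x1: "cmod x \<ge> 1" "cmod x > 2 * A0" using x unfolding A_def by auto
  have R: "R > 0" unfolding R_def using x1(1) by (intro divide_pos_pos) linarith+
  have sub: "ball x (2 * R) \<subseteq> - Z"
  proof
   fix y assume y: "y \<in> ball x (2 * R)"
   have "cmod x \<le> cmod y + cmod (x - y)" using norm_triangle_ineq[of y "x - y"] by simp
   hence "cmod y > A0" using y x1 unfolding R_def by (simp add: dist_norm)
   thus "y \<in> - Z" using A0[of y] by auto
  qed
  hence xZ: "x \<notin> Z" using R by (auto simp: subset_eq)
  from local[OF R sub]
  have "q * R^2 * cmod (F x)^2 \<le> C * (1 + cmod x + R) ^ d * measure M (cball x R)" .
  also have "... \<le> C * (3 * cmod x) ^ d * measure M UNIV"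
  proof (rule mult_mono)
   show "C * (1 + cmod x + R) ^ d \<le> C * (3 * cmod x) ^ d" using x1 C unfolding R_def
    by (intro mult_left_mono power_mono) auto
   show "measure M (cball x R) \<le> measure M UNIV" by (rule finite_measure_mono) (simp_all add: sM)
  qed (use C in auto)
  finally have "q * (cmod (g x)^2 * cmod x^2) \<le> q * (T * cmod x ^ d)"
   using q g(2)[OF xZ] unfolding R_def T_def by (simp add: power_mult_distrib power_divide mult_ac)
  thus ?thesis using q by (simp add: mult_le_cancel_left_pos)
 qed
 moreover have "A \<ge> 1" unfolding A_def by simp
 ultimately obtain p where "\<And>x. g x = poly p x" "p = 0 \<or> 2 * degree p + 2 \<le> d"
  using entire_square_growth[OF g(1) T, of A d] by blast
 thus ?thesis using that g(2) by metis
qed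

section \<open>Change of variables\<close>

definition to_complex :: "real^2 => complex" where "to_complex v = Complex (v $ 1) (v $ 2)"

definition of_complex :: "complex => real^2" where "of_complex z = vector [Re z, Im z]"

lemma to_of_complex [simp]: "to_complex (of_complex z) = z" "of_complex (to_complex v) = v"
 by (simp_all add: to_complex_def of_complex_def vec_eq_iff forall_2)

lemma of_complex_nth [simp]: "of_complex z $ 1 = Re z" "of_complex z $ 2 = Im z"
 by (simp_all add: of_complex_def)

lemma to_complex_ReIm [simp]: "Re (to_complex v) = v $ 1" "Im (to_complex v) = v $ 2"
 by (simp_all add: to_complex_def)

lemma linear_to_complex: "linear to_complex"
 by (rule linearI) (simp_all add: complex_eq_iff)

lemma linear_of_complex: "linear of_complex"
 by (rule linearI) (simp_all add: vec_eq_iff forall_2)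

lemma to_complex_measurable [measurable]: "to_complex \<in> borel_measurable borel"
 by (intro borel_measurable_continuous_onI linear_continuous_on linear_conv_bounded_linear[THEN iffD1] linear_to_complex)

lemma distr_to_complex: "distr lborel borel to_complex = lborel"
proof (rule lborel_eqI[symmetric])
 fix l u :: complex assume le: "\<And>b. b \<in> Basis ==> l \<bullet> b \<le> u \<bullet> b"
 from le[of 1] le[of \<i>] have le': "Re l \<le> Re u" "Im l \<le> Im u" by (simp_all add: Basis_complex_def)
 have b: "to_complex -` box l u = box (of_complex l) (of_complex u)"
  by (auto simp: mem_box_cart in_box_complex_iff forall_2)
 have B: "Basis = {axis 1 1, axis 2 1 :: real^2}" unfolding Basis_vec_def UNIV_2 by auto
 have "emeasure lborel (box (of_complex l) (of_complex u)) =
   ennreal (\<Prod>b\<in>Basis. (of_complex u - of_complex l) \<bullet> b)"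
  by (rule emeasure_lborel_box) (use le' in \<open>auto simp: B inner_axis\<close>)
 also have "(\<Prod>b\<in>Basis. (of_complex u - of_complex l) \<bullet> b) = (Re u - Re l) * (Im u - Im l)"
  by (simp add: B axis_eq_axis inner_axis)
 finally show "emeasure (distr lborel borel to_complex) (box l u) = ennreal (\<Prod>b\<in>Basis. (u - l) \<bullet> b)"
  by (simp add: emeasure_distr b Basis_complex_def inner_diff_left)
qed simp

lemma emeasure_to_complex: "A \<in> sets borel ==> emeasure lborel (to_complex -` A) = emeasure lborel A"
 using emeasure_distr[of to_complex lborel borel A] by (simp add: distr_to_complex)

lemma nn_integral_to_complex:
 "F \<in> borel_measurable borel ==> (\<integral>\<^sup>+v. F (to_complex v)) = (\<integral>\<^sup>+z. F z)"
 using nn_integral_distr[of to_complex lborel borel F] by (simp add: distr_to_complex)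

lemma det_complex_mult: "det (matrix (\<lambda>v. of_complex (d * to_complex v))) = cmod d^2"
proof -
 have "to_complex (axis 1 1) = 1" "to_complex (axis 2 1) = \<i>"
  by (simp_all add: complex_eq_iff axis_def)
 hence "matrix (\<lambda>v. of_complex (d * to_complex v)) $ 1 $ 1 = Re d" "matrix (\<lambda>v. of_complex (d * to_complex v)) $ 2 $ 1 = Im d"
  "matrix (\<lambda>v. of_complex (d * to_complex v)) $ 1 $ 2 = - Im d" "matrix (\<lambda>v. of_complex (d * to_complex v)) $ 2 $ 2 = Re d"
  unfolding matrix_def by (simp_all del: to_complex_ReIm)
 thus ?thesis unfolding det_2 using cmod_power2[of d] by (simp add: power2_eq_square)
qed

lemma ennreal_eq_if_same_finite:
 fixes x y :: ennreal
 assumes "\<And>m. m \<ge> 0 ==> x = ennreal m \<longleftrightarrow> y = ennreal m"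
 shows "x = y"
 using assms by (cases x; cases y) force+

lemma emeasure_holomorphic_image:
 fixes \<xi> J :: "complex => complex"
 assumes [measurable]: "S \<in> sets borel" "J \<in> borel_measurable borel"
  and der: "\<And>t. t \<in> S ==> (\<xi> has_field_derivative J t) (at t within S)"
  and inj: "inj_on \<xi> S" and im: "\<xi> ` S \<in> sets borel"
 shows "emeasure lborel (\<xi> ` S) = (\<integral>\<^sup>+t\<in>S. ennreal (cmod (J t)^2) \<partial>lborel)"
proof (rule ennreal_eq_if_same_finite)
 fix m :: real assume m: "m \<ge> 0"
 define S' where "S' = to_complex -` S"
 define f where "f = (\<lambda>v. of_complex (\<xi> (to_complex v)))"
 have S': "S' \<in> sets borel" unfolding S'_def using measurable_sets[OF to_complex_measurable assms(1)] by simp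
 have f_im: "f ` S' = to_complex -` (\<xi> ` S)" unfolding f_def S'_def
 proof (intro equalityI subsetI)
  fix v assume "v \<in> to_complex -` \<xi> ` S"
  then obtain t where t: "t \<in> S" "to_complex v = \<xi> t" by auto
  hence "v = of_complex (\<xi> (to_complex (of_complex t)))" by (metis to_of_complex)
  moreover have "of_complex t \<in> to_complex -` S" using t by simp
  ultimately show "v \<in> (\<lambda>v. of_complex (\<xi> (to_complex v))) ` to_complex -` S" by (rule image_eqI)
 qed auto
 have fS: "f ` S' \<in> sets borel" unfolding f_im using measurable_sets[OF to_complex_measurable im] by simp
 have d: "(f has_derivative (\<lambda>h. of_complex (J (to_complex v) * to_complex h))) (at v within S')" if v: "v \<in> S'" for v
 proof -
  have "to_complex ` S' \<subseteq> S" unfolding S'_def by auto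
  moreover have "(\<xi> has_derivative (*) (J (to_complex v))) (at (to_complex v) within S)"
   using der[of "to_complex v"] v unfolding S'_def has_field_derivative_def by simp
  ultimately have "((\<lambda>v. \<xi> (to_complex v)) has_derivative (\<lambda>h. J (to_complex v) * to_complex h)) (at v within S')"
   using has_derivative_in_compose[of to_complex to_complex v S' \<xi> "(*) (J (to_complex v))"]
    linear_imp_has_derivative[OF linear_to_complex] has_derivative_subset by blast
  thus ?thesis unfolding f_def
   using has_derivative_compose[OF _ linear_imp_has_derivative[OF linear_of_complex]] by blast
 qed
 have inj': "inj_on f S'"
 proof (rule inj_onI)
  fix v w assume vw: "v \<in> S'" "w \<in> S'" "f v = f w"
  hence "\<xi> (to_complex v) = \<xi> (to_complex w)" unfolding f_def by (metis to_of_complex(1))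
  hence "to_complex v = to_complex w" using inj vw unfolding S'_def by (auto dest: inj_onD)
  thus "v = w" by (metis to_of_complex(2))
 qed
 have key: "f ` S' \<in> lmeasurable \<and> measure lebesgue (f ` S') = m \<longleftrightarrow>
  ((\<lambda>v. \<bar>det (matrix (\<lambda>h. of_complex (J (to_complex v) * to_complex h)))\<bar>) has_integral m) S'"
  by (rule has_measure_differentiable_image[OF _ d inj']) (use S' in \<open>auto simp: sets_completionI_sets\<close>)
 have "f ` S' \<in> lmeasurable \<and> measure lebesgue (f ` S') = m \<longleftrightarrow> emeasure lborel (f ` S') = ennreal m"
 proof -
  have e: "emeasure lebesgue (f ` S') = emeasure lborel (f ` S')" using fS by simp
  have s: "f ` S' \<in> sets lebesgue" using fS by (simp add: sets_completionI_sets)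
  show ?thesis
  proof
   assume h: "f ` S' \<in> lmeasurable \<and> measure lebesgue (f ` S') = m"
   hence "emeasure lebesgue (f ` S') = ennreal (measure lebesgue (f ` S'))" by (intro emeasure_eq_measure2) auto
   thus "emeasure lborel (f ` S') = ennreal m" using h e by simp
  next
   assume h: "emeasure lborel (f ` S') = ennreal m"
   hence "f ` S' \<in> lmeasurable" using e s by (intro fmeasurableI) auto
   moreover have "measure lebesgue (f ` S') = m" unfolding measure_def using e h m by simp
   ultimately show "f ` S' \<in> lmeasurable \<and> measure lebesgue (f ` S') = m" by simp
  qed
 qed
 moreover have "emeasure lborel (f ` S') = emeasure lborel (\<xi> ` S)" unfolding f_im by (rule emeasure_to_complex[OF im])
 moreover have "((\<lambda>v. \<bar>det (matrix (\<lambda>h. of_complex (J (to_complex v) * to_complex h)))\<bar>) has_integral m) S' \<longleftrightarrow>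
   (\<integral>\<^sup>+t\<in>S. ennreal (cmod (J t)^2) \<partial>lborel) = ennreal m"
 proof -
  define k where "k = (\<lambda>t. indicator S t * cmod (J t)^2)"
  have [measurable]: "k \<in> borel_measurable borel" unfolding k_def by measurable
  have "((\<lambda>v. \<bar>det (matrix (\<lambda>h. of_complex (J (to_complex v) * to_complex h)))\<bar>) has_integral m) S'
   \<longleftrightarrow> ((\<lambda>v. if v \<in> S' then \<bar>det (matrix (\<lambda>h. of_complex (J (to_complex v) * to_complex h)))\<bar> else 0) has_integral m) UNIV"
   by (rule has_integral_restrict_UNIV[symmetric])
  also have "(\<lambda>v. if v \<in> S' then \<bar>det (matrix (\<lambda>h. of_complex (J (to_complex v) * to_complex h)))\<bar> else 0) = (\<lambda>v. k (to_complex v))"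
   by (auto simp: k_def S'_def det_complex_mult)
  also have "((\<lambda>v. k (to_complex v)) has_integral m) UNIV \<longleftrightarrow> (\<integral>\<^sup>+v. ennreal (k (to_complex v))) = ennreal m"
  proof
   assume "((\<lambda>v. k (to_complex v)) has_integral m) UNIV"
   thus "(\<integral>\<^sup>+v. ennreal (k (to_complex v))) = ennreal m"
    by (intro nn_integral_has_integral_lborel) (simp_all add: k_def)
  next
   assume "(\<integral>\<^sup>+v. ennreal (k (to_complex v))) = ennreal m"
   thus "((\<lambda>v. k (to_complex v)) has_integral m) UNIV"
    using m by (intro nn_integral_has_integral) (simp_all add: k_def)
  qed
  also have "(\<integral>\<^sup>+v. ennreal (k (to_complex v))) = (\<integral>\<^sup>+t. ennreal (k t))"
   by (rule nn_integral_to_complex) simp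
  also have "... = (\<integral>\<^sup>+t\<in>S. ennreal (cmod (J t)^2) \<partial>lborel)"
   by (intro nn_integral_cong) (simp add: k_def indicator_def)
  finally show ?thesis .
 qed
 ultimately show "emeasure lborel (\<xi> ` S) = ennreal m \<longleftrightarrow> (\<integral>\<^sup>+t\<in>S. ennreal (cmod (J t)^2) \<partial>lborel) = ennreal m"
  using key by simp
qed

lemma distr_holomorphic_image:
 fixes \<xi> J :: "complex => complex"
 assumes S [measurable]: "S \<in> sets borel" and J [measurable]: "J \<in> borel_measurable borel"
  and \<xi> [measurable]: "\<xi> \<in> borel_measurable borel"
  and der: "\<And>t. t \<in> S ==> (\<xi> has_field_derivative J t) (at t within S)"
  and inj: "inj_on \<xi> S" and im [measurable]: "\<xi> ` S \<in> sets borel"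
 shows "distr (density lborel (\<lambda>t. ennreal (cmod (J t)^2) * indicator S t)) borel \<xi> = density lborel (indicator (\<xi> ` S))"
proof (rule measure_eqI)
 fix A assume "A \<in> sets (distr (density lborel (\<lambda>t. ennreal (cmod (J t)^2) * indicator S t)) borel \<xi>)"
 hence A [measurable]: "A \<in> sets borel" by simp
 define T where "T = S \<inter> \<xi> -` A"
 have pre [measurable]: "\<xi> -` A \<in> sets borel" using measurable_sets[OF \<xi> A] by simp
 have T [measurable]: "T \<in> sets borel" unfolding T_def by measurable
 have imT: "\<xi> ` T = \<xi> ` S \<inter> A" unfolding T_def by auto
 have "emeasure (distr (density lborel (\<lambda>t. ennreal (cmod (J t)^2) * indicator S t)) borel \<xi>) A
  = (\<integral>\<^sup>+t. ennreal (cmod (J t)^2) * indicator S t * indicator (\<xi> -` A) t)"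
  by (simp add: emeasure_distr emeasure_density)
 also have "... = (\<integral>\<^sup>+t\<in>T. ennreal (cmod (J t)^2) \<partial>lborel)"
  by (intro nn_integral_cong) (simp add: T_def indicator_def)
 also have "... = emeasure lborel (\<xi> ` T)"
 proof (rule emeasure_holomorphic_image[symmetric])
  show "(\<xi> has_field_derivative J t) (at t within T)" if "t \<in> T" for t
   using der[of t] that unfolding T_def by (auto intro: DERIV_subset)
  show "inj_on \<xi> T" using inj unfolding T_def by (auto intro: inj_on_subset)
  show "\<xi> ` T \<in> sets borel" unfolding imT by measurable
 qed auto
 also have "... = emeasure (density lborel (indicator (\<xi> ` S))) A"
 proof -
  have "emeasure (density lborel (indicator (\<xi> ` S))) A = (\<integral>\<^sup>+x. indicator (\<xi> ` S \<inter> A) x)"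
   by (subst emeasure_density) (auto intro!: nn_integral_cong simp: indicator_def simp del: nn_integral_indicator)
  thus ?thesis unfolding imT by simp
 qed
 finally show "emeasure (distr (density lborel (\<lambda>t. ennreal (cmod (J t)^2) * indicator S t)) borel \<xi>) A
  = emeasure (density lborel (indicator (\<xi> ` S))) A" .
qed simp

section \<open>Hyperelliptic curves\<close>

lemma Re_csqrt_pos: "w \<notin> \<real>\<^sub>\<le>\<^sub>0 ==> 0 < Re (csqrt w)"
 using csqrt_principal[of w] power2_csqrt[of w]
 by (auto simp: complex_nonpos_Reals_iff complex_eq_iff power2_eq_square)

lemma square_notin_nonpos: "0 < Re w ==> w^2 \<notin> \<real>\<^sub>\<le>\<^sub>0"
 by (auto simp: complex_nonpos_Reals_iff power2_eq_square not_le mult_pos_pos)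

lemma csqrt_square_pos: "0 < Re w ==> csqrt (w^2) = w"
 by (rule csqrt_square) simp

lemma csqrt_measurable [measurable]: "csqrt \<in> borel_measurable borel"
proof -
 have e: "csqrt z = of_real (sqrt ((cmod z + Re z) / 2)) +
  \<i> * of_real ((if Im z = 0 then 1 else sgn (Im z)) * sqrt ((cmod z - Re z) / 2))" for z
  by (simp add: complex_eq_iff)
 have [measurable]: "Re \<in> borel_measurable borel" "Im \<in> borel_measurable borel" "(sgn :: real => real) \<in> borel_measurable borel"
  "sqrt \<in> borel_measurable borel"
  by (auto intro!: borel_measurable_continuous_onI continuous_intros borel_measurable_sgn)
 show ?thesis unfolding e[abs_def] by measurable
qed

lemma open_not_nonpos:
 assumes "open A" "g holomorphic_on A"
 shows "open {t \<in> A. g t \<notin> \<real>\<^sub>\<le>\<^sub>0}"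
proof -
 have "open (A \<inter> g -` (- \<real>\<^sub>\<le>\<^sub>0))"
  using assms by (intro continuous_open_preimage holomorphic_on_imp_continuous_on) auto
 moreover have "A \<inter> g -` (- \<real>\<^sub>\<le>\<^sub>0) = {t \<in> A. g t \<notin> \<real>\<^sub>\<le>\<^sub>0}" by auto
 ultimately show ?thesis by simp
qed

lemma local_param_intro:
 assumes D: "open D" and hol: "(\<lambda>t. fst (\<phi> t)) holomorphic_on D" "(\<lambda>t. snd (\<phi> t)) holomorphic_on D"
  and imm: "\<And>t. t \<in> D ==> deriv (\<lambda>s. fst (\<phi> s)) t \<noteq> 0 \<or> deriv (\<lambda>s. snd (\<phi> s)) t \<noteq> 0"
  and U: "open U" and im: "\<And>t. t \<in> D ==> \<phi> t \<in> X \<inter> U" and \<psi>: "continuous_on (X \<inter> U) \<psi>"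
  and inv: "\<And>t. t \<in> D ==> \<psi> (\<phi> t) = t" "\<And>p. p \<in> X \<inter> U ==> \<psi> p \<in> D \<and> \<phi> (\<psi> p) = p"
 shows "local_param X D \<phi>"
proof -
 have image: "\<phi> ` D = X \<inter> U"
 proof (intro equalityI subsetI)
  fix p assume "p \<in> X \<inter> U"
  thus "p \<in> \<phi> ` D" using inv(2)[of p] by (metis image_eqI)
 qed (use im in auto)
 have "continuous_on D (\<lambda>t. (fst (\<phi> t), snd (\<phi> t)))"
  using hol by (intro continuous_on_Pair holomorphic_on_imp_continuous_on)
 hence c: "continuous_on D \<phi>" by simp
 have "homeomorphism D (\<phi> ` D) \<phi> \<psi>"
  unfolding homeomorphism_def image using c \<psi> inv image by (auto intro!: image_eqI[of _ \<psi> "\<phi> _"])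
 moreover have "openin (top_of_set X) (X \<inter> U)" using U by (rule openin_open_Int)
 ultimately show ?thesis unfolding local_param_def using D hol imm image by auto
qed

lemma sqrt_sign_choice:
 assumes "w \<noteq> (0::complex)"
 obtains c d where "c^2 * d = 1" "d * w \<notin> \<real>\<^sub>\<le>\<^sub>0" "c \<noteq> 0" "(c, d) \<in> {(1, 1), (\<i>, - 1)}"
proof (cases "w \<in> \<real>\<^sub>\<le>\<^sub>0")
 case True
 hence "- 1 * w \<notin> \<real>\<^sub>\<le>\<^sub>0" using assms by (auto simp: complex_nonpos_Reals_iff complex_eq_iff)
 thus ?thesis using that[of \<i> "- 1"] by simp
qed (use that[of 1 1] in simp)

locale hyperelliptic =
 fixes f :: "complex poly" and n :: nat
 assumes sqfree: "rsquarefree f" and deg_f: "degree f = 2 * n + 1" and n_pos: "n > 0"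
begin

definition X :: "(complex \<times> complex) set" where "X = {(x, y). y^2 = poly f x}"

definition sheet :: "complex => complex => complex => complex \<times> complex" where
 "sheet c d x = (x, c * csqrt (d * poly f x))"

definition sheet_dom :: "complex => complex set" where
 "sheet_dom d = {x. d * poly f x \<notin> \<real>\<^sub>\<le>\<^sub>0}"

lemma f_nz: "f \<noteq> 0" using sqfree by (simp add: rsquarefree_def)

lemma open_sheet_dom: "open (sheet_dom d)"
 unfolding sheet_dom_def using open_not_nonpos[of UNIV "\<lambda>x. d * poly f x"] by (simp add: holomorphic_intros)

lemma sheet_in_X: "c^2 * d = 1 ==> sheet c d x \<in> X"
 by (simp add: X_def sheet_def power_mult_distrib mult.assoc[symmetric])

lemma half_plane_sqrt:
 assumes cd: "c^2 * d = 1" and p: "(x, y) \<in> X" and re: "0 < Re (y / c)"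
 shows "d * poly f x \<notin> \<real>\<^sub>\<le>\<^sub>0" "c * csqrt (d * poly f x) = y"
proof -
 have c0: "c \<noteq> 0" using cd by auto
 have "d * c^2 = 1" using cd by (simp add: mult.commute)
 hence "d = 1 / c^2" using c0 by (simp add: eq_divide_eq)
 hence e: "d * poly f x = (y / c)^2" using p unfolding X_def by (simp add: power_divide)
 show "d * poly f x \<notin> \<real>\<^sub>\<le>\<^sub>0" unfolding e by (rule square_notin_nonpos[OF re])
 show "c * csqrt (d * poly f x) = y" unfolding e csqrt_square_pos[OF re] using c0 by simp
qed

lemma open_half_plane: "open {p :: complex \<times> complex. 0 < Re (snd p / c)}"
 unfolding divide_inverse by (intro open_Collect_less continuous_intros)

lemma sheet_param:
 assumes cd: "c^2 * d = 1"
 shows "local_param X (sheet_dom d) (sheet c d)"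
proof (rule local_param_intro[where U = "{p. 0 < Re (snd p / c)}" and \<psi> = fst])
 have c0: "c \<noteq> 0" using cd by auto
 show "open (sheet_dom d)" by (rule open_sheet_dom)
 show "(\<lambda>t. fst (sheet c d t)) holomorphic_on sheet_dom d" by (simp add: sheet_def holomorphic_intros)
 show "(\<lambda>t. snd (sheet c d t)) holomorphic_on sheet_dom d"
  unfolding sheet_def snd_conv by (intro holomorphic_intros) (simp add: sheet_dom_def)
 show "deriv (\<lambda>s. fst (sheet c d s)) t \<noteq> 0 \<or> deriv (\<lambda>s. snd (sheet c d s)) t \<noteq> 0" for t by (simp add: sheet_def)
 show "open {p :: complex \<times> complex. 0 < Re (snd p / c)}" by (rule open_half_plane)
 show "sheet c d t \<in> X \<inter> {p. 0 < Re (snd p / c)}" if "t \<in> sheet_dom d" for t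
 proof -
  have "0 < Re (csqrt (d * poly f t))" by (rule Re_csqrt_pos) (use that in \<open>simp add: sheet_dom_def\<close>)
  thus ?thesis using c0 sheet_in_X[OF cd, of t] by (simp add: sheet_def del: csqrt.simps)
 qed
 show "continuous_on (X \<inter> {p. 0 < Re (snd p / c)}) fst" by (intro continuous_intros)
 show "fst (sheet c d t) = t" for t by (simp add: sheet_def)
 show "fst p \<in> sheet_dom d \<and> sheet c d (fst p) = p" if "p \<in> X \<inter> {p. 0 < Re (snd p / c)}" for p
  using that half_plane_sqrt[OF cd, of "fst p" "snd p"] by (cases p) (auto simp: sheet_dom_def sheet_def)
qed

lemma root_param:
 assumes a: "poly f a = 0"
 shows "\<exists>D \<phi>. local_param X D \<phi> \<and> 0 \<in> D \<and> \<phi> 0 = (a, 0)"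
proof -
 obtain h where h: "f = [:- a, 1:] * h" using a by (auto simp: poly_eq_0_iff_dvd elim: dvdE)
 have fh: "poly f x = (x - a) * poly h x" for x by (simp add: h algebra_simps)
 have "poly (pderiv f) a \<noteq> 0" using sqfree a by (auto simp: rsquarefree_roots)
 moreover have "poly (pderiv f) a = poly h a" unfolding h pderiv_mult by (simp add: pderiv_pCons)
 ultimately have w0: "poly h a \<noteq> 0" by simp
 define \<rho> where "\<rho> = (\<lambda>x. csqrt (poly h a) * csqrt (poly h x / poly h a))"
 define V where "V = {x. poly h x / poly h a \<notin> \<real>\<^sub>\<le>\<^sub>0}"
 define D where "D = {t. a + t^2 \<in> V}"
 define \<phi> where "\<phi> = (\<lambda>t. (a + t^2, t * \<rho> (a + t^2)))"
 have oV: "open V"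
  using open_not_nonpos[of UNIV "\<lambda>x. poly h x / poly h a"] unfolding V_def by (simp add: holomorphic_intros w0)
 have \<rho>2: "(\<rho> x)^2 = poly h x" for x unfolding \<rho>_def using w0 by (simp add: power_mult_distrib)
 have \<rho>0: "\<rho> x \<noteq> 0" if "x \<in> V" for x using that w0 unfolding \<rho>_def V_def by auto
 have hol\<rho>: "\<rho> holomorphic_on V" unfolding \<rho>_def by (intro holomorphic_intros) (auto simp: w0 V_def)
 have vD: "D = (\<lambda>t. a + t^2) -` V" unfolding D_def by auto
 have oD: "open D" unfolding vD by (rule open_vimage[OF oV]) (intro continuous_intros)
 have hol2: "(\<lambda>t. \<rho> (a + t^2)) holomorphic_on D"
  by (rule holomorphic_on_compose_gen[OF _ hol\<rho>, unfolded o_def]) (auto intro!: holomorphic_intros simp: D_def)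
 have "local_param X D \<phi>"
 proof (rule local_param_intro[where U = "{p. fst p \<in> V}" and \<psi> = "\<lambda>p. snd p / \<rho> (fst p)"])
  show "open D" by (rule oD)
  show "(\<lambda>t. fst (\<phi> t)) holomorphic_on D" unfolding \<phi>_def fst_conv by (intro holomorphic_intros)
  show "(\<lambda>t. snd (\<phi> t)) holomorphic_on D" unfolding \<phi>_def snd_conv by (intro holomorphic_intros hol2)
  show "deriv (\<lambda>s. fst (\<phi> s)) t \<noteq> 0 \<or> deriv (\<lambda>s. snd (\<phi> s)) t \<noteq> 0" if t: "t \<in> D" for t
  proof (cases "t = 0")
   case False
   have "((\<lambda>s. fst (\<phi> s)) has_field_derivative 2 * t) (at t)" unfolding \<phi>_def fst_conv
    by (auto intro!: derivative_eq_intros)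
   thus ?thesis using False by (simp add: DERIV_imp_deriv)
  next
   case True
   have "((\<lambda>s. s * \<rho> (a + s^2)) has_field_derivative 1 * \<rho> (a + t^2) + deriv (\<lambda>s. \<rho> (a + s^2)) t * t) (at t)"
    by (intro DERIV_mult DERIV_ident holomorphic_derivI[OF hol2 oD t])
   hence "deriv (\<lambda>s. snd (\<phi> s)) t = \<rho> a" unfolding \<phi>_def snd_conv using True by (simp add: DERIV_imp_deriv)
   thus ?thesis using \<rho>0[of a] t True unfolding D_def by simp
  qed
  have "{p :: complex \<times> complex. fst p \<in> V} = fst -` V" by auto
  thus "open {p :: complex \<times> complex. fst p \<in> V}" using open_vimage_fst[OF oV] by simp
  show "\<phi> t \<in> X \<inter> {p. fst p \<in> V}" if "t \<in> D" for t
  proof -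
   have "(t * \<rho> (a + t^2))^2 = poly f (a + t^2)" unfolding fh by (simp add: power_mult_distrib \<rho>2)
   thus ?thesis using that unfolding X_def \<phi>_def D_def by simp
  qed
  show "continuous_on (X \<inter> {p. fst p \<in> V}) (\<lambda>p. snd p / \<rho> (fst p))"
   using \<rho>0 by (intro continuous_intros continuous_on_compose2[OF holomorphic_on_imp_continuous_on[OF hol\<rho>]]) auto
  show "snd (\<phi> t) / \<rho> (fst (\<phi> t)) = t" if "t \<in> D" for t
   using \<rho>0[of "a + t^2"] that unfolding \<phi>_def D_def by simp
  show "snd p / \<rho> (fst p) \<in> D \<and> \<phi> (snd p / \<rho> (fst p)) = p" if p: "p \<in> X \<inter> {p. fst p \<in> V}" for p
  proof -
   obtain x y where xy: "p = (x, y)" using prod.exhaust by blast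
   have r: "\<rho> x \<noteq> 0" using \<rho>0 p xy by simp
   have "y^2 = (x - a) * poly h x" using p fh[of x] unfolding xy X_def by simp
   moreover have "poly h x \<noteq> 0" using r \<rho>2[of x] by auto
   ultimately have "(y / \<rho> x)^2 = x - a" using \<rho>2[of x] by (simp add: power_divide)
   hence "a + (y / \<rho> x)^2 = x" by simp
   thus ?thesis using p r unfolding xy D_def \<phi>_def by simp
  qed
 qed
 moreover have "0 \<in> D" unfolding D_def V_def using w0 by (simp add: complex_nonpos_Reals_iff)
 moreover have "\<phi> 0 = (a, 0)" unfolding \<phi>_def by simp
 ultimately show ?thesis by blast
qed

lemma sqrt_param:
 assumes z: "z \<noteq> 0" "poly f (z^2) \<noteq> 0"
 shows "\<exists>D \<phi>. local_param X D \<phi> \<and> (\<forall>t\<in>D. fst (\<phi> t) = t^2) \<and> z \<in> D"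
proof -
 obtain c d where cd: "c^2 * d = 1" "d * poly f (z^2) \<notin> \<real>\<^sub>\<le>\<^sub>0" "c \<noteq> 0" using sqrt_sign_choice[OF z(2)] by metis
 define D where "D = {t. t^2 \<in> sheet_dom d} \<inter> {t. 0 < Re (t / z)}"
 define \<phi> where "\<phi> = (\<lambda>t. sheet c d (t^2))"
 have oD: "open D" unfolding D_def
 proof (rule open_Int)
  have "{t. t^2 \<in> sheet_dom d} = (\<lambda>t. t^2) -` sheet_dom d" by auto
  thus "open {t. t^2 \<in> sheet_dom d}" 
   using open_vimage[OF open_sheet_dom, of "\<lambda>t. t^2" d] by (simp add: continuous_on_power)
  show "open {t. 0 < Re (t / z)}" by (intro open_Collect_less continuous_intros) (use z in auto)
 qed
 have Dnz: "t \<noteq> 0" if "t \<in> D" for t using that unfolding D_def by auto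
 have "local_param X D \<phi>"
 proof (rule local_param_intro[where U = "{p. 0 < Re (snd p / c)} \<inter> {p. fst p / z^2 \<in> - \<real>\<^sub>\<le>\<^sub>0}" and \<psi> = "\<lambda>p. z * csqrt (fst p / z^2)"])
  show "open D" by (rule oD)
  show "(\<lambda>t. fst (\<phi> t)) holomorphic_on D" unfolding \<phi>_def sheet_def fst_conv by (intro holomorphic_intros)
  show "(\<lambda>t. snd (\<phi> t)) holomorphic_on D" unfolding \<phi>_def sheet_def snd_conv
   by (intro holomorphic_intros) (auto simp: D_def sheet_dom_def)
  show "deriv (\<lambda>s. fst (\<phi> s)) t \<noteq> 0 \<or> deriv (\<lambda>s. snd (\<phi> s)) t \<noteq> 0" if t: "t \<in> D" for t
  proof -
   have "((\<lambda>s. fst (\<phi> s)) has_field_derivative 2 * t) (at t)" unfolding \<phi>_def sheet_def fst_conv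
    by (auto intro!: derivative_eq_intros)
   thus ?thesis using Dnz[OF t] by (simp add: DERIV_imp_deriv)
  qed
  have e: "{p :: complex \<times> complex. fst p / z^2 \<in> - \<real>\<^sub>\<le>\<^sub>0} = (\<lambda>p. fst p / z^2) -` (- \<real>\<^sub>\<le>\<^sub>0)" by auto
  have "open ((\<lambda>p :: complex \<times> complex. fst p / z^2) -` (- \<real>\<^sub>\<le>\<^sub>0))"
   using z by (intro open_vimage continuous_intros) auto
  thus "open ({p :: complex \<times> complex. 0 < Re (snd p / c)} \<inter> {p. fst p / z^2 \<in> - \<real>\<^sub>\<le>\<^sub>0})"
   unfolding e by (intro open_Int open_half_plane)
  show "\<phi> t \<in> X \<inter> ({p. 0 < Re (snd p / c)} \<inter> {p. fst p / z^2 \<in> - \<real>\<^sub>\<le>\<^sub>0})" if t: "t \<in> D" for t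
  proof -
   have "(t / z)^2 \<notin> \<real>\<^sub>\<le>\<^sub>0" by (rule square_notin_nonpos) (use t in \<open>simp add: D_def\<close>)
   moreover have "0 < Re (csqrt (d * poly f (t^2)))" by (rule Re_csqrt_pos) (use t in \<open>simp add: D_def sheet_dom_def\<close>)
   ultimately show ?thesis using sheet_in_X[OF cd(1)] cd(3) unfolding \<phi>_def by (simp add: sheet_def power_divide)
  qed
  show "continuous_on (X \<inter> ({p. 0 < Re (snd p / c)} \<inter> {p. fst p / z^2 \<in> - \<real>\<^sub>\<le>\<^sub>0})) (\<lambda>p. z * csqrt (fst p / z^2))"
   using z by (intro continuous_intros continuous_on_compose2[OF continuous_on_csqrt]) auto
  show "z * csqrt (fst (\<phi> t) / z^2) = t" if t: "t \<in> D" for t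
  proof -
   have "csqrt ((t / z)^2) = t / z" by (rule csqrt_square_pos) (use t in \<open>simp add: D_def\<close>)
   thus ?thesis using z unfolding \<phi>_def by (simp add: sheet_def power_divide)
  qed
  show "z * csqrt (fst p / z^2) \<in> D \<and> \<phi> (z * csqrt (fst p / z^2)) = p"
   if p: "p \<in> X \<inter> ({p. 0 < Re (snd p / c)} \<inter> {p. fst p / z^2 \<in> - \<real>\<^sub>\<le>\<^sub>0})" for p
  proof -
   obtain x y where xy: "p = (x, y)" using prod.exhaust by blast
   have s: "(z * csqrt (x / z^2))^2 = x" using z by (simp add: power_mult_distrib)
   have "0 < Re (csqrt (x / z^2))" by (rule Re_csqrt_pos) (use p xy in simp)
   moreover have "d * poly f x \<notin> \<real>\<^sub>\<le>\<^sub>0" "c * csqrt (d * poly f x) = y"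
    using half_plane_sqrt[OF cd(1), of x y] p xy by auto
   ultimately show ?thesis using z s unfolding xy D_def \<phi>_def sheet_dom_def sheet_def by simp
  qed
 qed
 moreover have "z \<in> D" unfolding D_def sheet_dom_def using cd z by simp
 moreover have "\<forall>t\<in>D. fst (\<phi> t) = t^2" unfolding \<phi>_def sheet_def by simp
 ultimately show ?thesis by blast
qed

lemma X_cases:
 assumes "(x, y) \<in> X"
 shows "y = 0 \<and> poly f x = 0 \<or> poly f x \<noteq> 0 \<and> (\<exists>s\<in>{1, - 1}. y = s * csqrt (poly f x))"
proof -
 have "y^2 = (csqrt (poly f x))^2" using assms by (simp add: X_def)
 hence "y = csqrt (poly f x) \<or> y = - csqrt (poly f x)" by (simp only: power2_eq_iff)
 thus ?thesis by (cases "poly f x = 0") auto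
qed

lemma tiling_exists: "\<exists>T. tiling X T"
proof -
 have fin: "finite {a. poly f a = 0}" by (rule poly_roots_finite[OF f_nz])
 then obtain rs where rs: "set rs = {a. poly f a = 0}" "distinct rs" using finite_distinct_list by metis
 obtain D \<phi> where R: "\<And>a. poly f a = 0 ==> local_param X (D a) (\<phi> a) \<and> 0 \<in> D a \<and> \<phi> a 0 = (a, 0)"
  using root_param by metis
 define \<Omega>1 where "\<Omega>1 = sheet_dom 1"
 define \<Omega>2 where "\<Omega>2 = {x. poly f x \<noteq> 0} - \<Omega>1"
 define \<Phi> where "\<Phi> = (\<lambda>k::nat. if k < 2 then sheet ((- 1) ^ k) 1 else if k < 4 then sheet ((- 1) ^ k * \<i>) (- 1)
   else if k - 4 < length rs then \<phi> (rs ! (k - 4)) else sheet 1 1)"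
 define B where "B = (\<lambda>k::nat. if k < 2 then \<Omega>1 else if k < 4 then \<Omega>2 else if k - 4 < length rs then {0} else {})"
 have sub2: "\<Omega>2 \<subseteq> sheet_dom (- 1)" unfolding \<Omega>2_def \<Omega>1_def sheet_dom_def
  by (auto simp: complex_nonpos_Reals_iff complex_eq_iff)
 have op: "open {x. poly f x \<noteq> 0}" using fin finite_imp_closed[OF fin] by (simp add: open_closed Collect_neg_eq[symmetric] Compl_eq)
 have pw: "((- 1 :: complex) ^ k)^2 = 1" for k by (metis power_even_eq power_mult mult.commute power2_minus power_one)
 have c1: "sheet c d x = (x, c * csqrt (d * poly f x))" for c d x by (simp add: sheet_def)
 have "tiling X (\<Phi>, B)" unfolding tiling_def prod.case
 proof (intro conjI allI)
  fix k
  show "B k \<in> sets borel" unfolding B_def \<Omega>2_def \<Omega>1_def using open_sheet_dom[of 1] op by auto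
  show "\<exists>D. B k \<subseteq> D \<and> local_param X D (\<Phi> k)"
  proof -
   have "rs ! (k - 4) \<in> set rs" if "k - 4 < length rs" using that by simp
   then consider "k < 2" | "\<not> k < 2" "k < 4" | "\<not> k < 4" "k - 4 < length rs" "poly f (rs ! (k - 4)) = 0" | "\<not> k < 4" "\<not> k - 4 < length rs"
    using rs(1) by auto
   thus ?thesis
   proof cases
    case 1
    thus ?thesis using sheet_param[of "(- 1) ^ k" 1] pw[of k] unfolding B_def \<Phi>_def \<Omega>1_def
     by (intro exI[of _ "sheet_dom 1"]) simp
   next
    case 2
    thus ?thesis using sheet_param[of "(- 1) ^ k * \<i>" "- 1"] pw[of k] sub2 unfolding B_def \<Phi>_def
     by (intro exI[of _ "sheet_dom (- 1)"]) (simp add: power_mult_distrib)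
   next
    case 3
    thus ?thesis using R[of "rs ! (k - 4)"] unfolding B_def \<Phi>_def
     by (intro exI[of _ "D (rs ! (k - 4))"]) simp
   next
    case 4
    thus ?thesis using sheet_param[of 1 1] unfolding B_def \<Phi>_def
     by (intro exI[of _ "sheet_dom 1"]) simp
   qed
  qed
 next
  show "(\<Union>k. \<Phi> k ` B k) = X"
  proof (intro equalityI subsetI)
   fix p assume p: "p \<in> X"
   obtain x y where xy: "p = (x, y)" using prod.exhaust by blast
   consider "y = 0" "poly f x = 0" | s where "poly f x \<noteq> 0" "s \<in> {1, - 1}" "y = s * csqrt (poly f x)"
    using X_cases[of x y] p xy by blast
   thus "p \<in> (\<Union>k. \<Phi> k ` B k)"
   proof cases
    case 1
    hence "x \<in> set rs" using rs by simp
    then obtain j where j: "j < length rs" "rs ! j = x" by (auto simp: in_set_conv_nth)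
    have "p = \<Phi> (j + 4) 0" "0 \<in> B (j + 4)" using 1 j R[of x] xy unfolding \<Phi>_def B_def by auto
    thus ?thesis by blast
   next
    case (2 s)
    show ?thesis
    proof (cases "x \<in> \<Omega>1")
     case True
     have "p = \<Phi> (if s = 1 then 0 else 1) x" "x \<in> B (if s = 1 then 0 else 1)"
      using 2 True xy unfolding \<Phi>_def B_def by (auto simp: c1)
     thus ?thesis by blast
    next
     case False
     have "y^2 = poly f x" using p xy by (simp add: X_def)
     hence "y^2 = (\<i> * csqrt (- poly f x))^2" by (simp add: power_mult_distrib)
     hence "y = \<i> * csqrt (- poly f x) \<or> y = - (\<i> * csqrt (- poly f x))" by (simp only: power2_eq_iff)
     thus ?thesis
     proof
      assume "y = \<i> * csqrt (- poly f x)"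
      hence "p = \<Phi> 2 x" "x \<in> B 2" using 2 False xy unfolding \<Phi>_def B_def \<Omega>2_def by (auto simp: c1)
      thus ?thesis by blast
     next
      assume "y = - (\<i> * csqrt (- poly f x))"
      hence "p = \<Phi> 3 x" "x \<in> B 3" using 2 False xy unfolding \<Phi>_def B_def \<Omega>2_def by (auto simp: c1)
      thus ?thesis by blast
     qed
    qed
   qed
  next
   fix p assume "p \<in> (\<Union>k. \<Phi> k ` B k)"
   then obtain k t where k: "t \<in> B k" "p = \<Phi> k t" by auto
   have "rs ! (k - 4) \<in> set rs" if "k - 4 < length rs" using that by simp
   thus "p \<in> X" using k sheet_in_X[of "(- 1) ^ k" 1 t] sheet_in_X[of "(- 1) ^ k * \<i>" "- 1" t] pw[of k] rs(1) R[of "rs ! (k - 4)"]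
    unfolding \<Phi>_def B_def by (auto simp: power_mult_distrib X_def split: if_splits)
  qed
 next
  have disj: "\<Phi> k t \<noteq> \<Phi> l s" if kl: "k < l" and t: "t \<in> B k" and s: "s \<in> B l" for k l t s
  proof
   assume eq: "\<Phi> k t = \<Phi> l s"
   have l: "l < 4 \<or> (4 \<le> l \<and> l - 4 < length rs)" using s unfolding B_def by (auto split: if_splits)
   show False
   proof (cases "l < 4")
    case False
    hence l': "4 \<le> l" "l - 4 < length rs" using l by auto
    hence a: "rs ! (l - 4) \<in> set rs" by simp
    hence L: "\<Phi> l s = (rs ! (l - 4), 0)" using l' s R[of "rs ! (l - 4)"] rs(1) unfolding \<Phi>_def B_def by auto
    show False
    proof (cases "k < 4")
     case True
     hence "fst (\<Phi> k t) = t" "poly f t \<noteq> 0" using t unfolding \<Phi>_def B_def \<Omega>2_def \<Omega>1_def sheet_dom_def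
      by (auto simp: c1 split: if_splits)
     thus False using L eq a rs(1) by auto
    next
     case False
     hence k': "4 \<le> k" "k - 4 < length rs" using kl l' by auto
     hence "rs ! (k - 4) \<in> set rs" by simp
     hence "\<Phi> k t = (rs ! (k - 4), 0)" using k' t R[of "rs ! (k - 4)"] rs(1) unfolding \<Phi>_def B_def by auto
     hence "rs ! (k - 4) = rs ! (l - 4)" using L eq by simp
     thus False using rs(2) k' l' kl by (simp add: nth_eq_iff_index_eq)
    qed
   next
    case True
    hence "k = 0 \<and> l = 1 \<or> k = 2 \<and> l = 3 \<or> k < 2 \<and> 2 \<le> l" using kl by auto
    thus False
    proof (elim disjE)
     assume "k = 0 \<and> l = 1"
     thus False using eq t unfolding \<Phi>_def B_def \<Omega>1_def sheet_dom_def by (auto simp: c1)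
    next
     assume "k = 2 \<and> l = 3"
     thus False using eq t unfolding \<Phi>_def B_def \<Omega>2_def by (auto simp: c1)
    next
     assume "k < 2 \<and> 2 \<le> l"
     thus False using eq t s True unfolding \<Phi>_def B_def \<Omega>2_def by (auto simp: c1)
    qed
   qed
  qed
  show "disjoint_family (\<lambda>k. \<Phi> k ` B k)"
   unfolding disjoint_family_on_def
  proof (intro ballI impI)
   fix k l :: nat assume "k \<noteq> l"
   then consider "k < l" | "l < k" by linarith
   thus "\<Phi> k ` B k \<inter> \<Phi> l ` B l = {}"
   proof cases
    case 1
    thus ?thesis using disj[OF 1] by blast
   next
    case 2
    thus ?thesis using disj[OF 2] by fastforce
   qed
  qed
 qed
 thus ?thesis by blast
qed

lemma some_tiling: "tiling X (some_tiling X)"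
 unfolding some_tiling_def using tiling_exists by (rule someI_ex)

end

section \<open>Integration over hyperelliptic curves\<close>

lemma set_integral_sums:
 fixes g :: "'a => 'b::{banach, second_countable_topology}"
 assumes E: "\<And>k::nat. E k \<in> sets M" and d: "disjoint_family E" and g: "set_integrable M (\<Union>k. E k) g"
 shows "(\<lambda>k. LINT x:E k|M. g x) sums (LINT x:(\<Union>k. E k)|M. g x)"
proof -
 define A where "A = (\<lambda>m. \<Union>k<m. E k)"
 have A: "A m \<in> sets M" for m unfolding A_def using E by auto
 have U: "(\<Union>m. A m) = (\<Union>k. E k)" unfolding A_def by auto
 have "(\<lambda>m. LINT x:A m|M. g x) \<longlonglongrightarrow> (LINT x:(\<Union>m. A m)|M. g x)"
 proof (rule set_integral_cont_up[OF A])
  show "incseq A" unfolding A_def incseq_def by (auto intro: less_le_trans)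
  show "set_integrable M (\<Union>m. A m) g" using g U by simp
 qed
 moreover have "(LINT x:A m|M. g x) = (\<Sum>k<m. LINT x:E k|M. g x)" for m
  unfolding A_def
 proof (rule set_integral_finite_Union)
  show "disjoint_family_on E {..<m}" using d by (rule disjoint_family_on_mono[rotated]) simp
  show "set_integrable M (E k) g" for k by (rule set_integrable_subset[OF g E]) auto
 qed (use E in auto)
 ultimately show ?thesis unfolding sums_def U by simp
qed

context hyperelliptic
begin

lemma param_facts:
 assumes "local_param X D \<phi>"
 shows "open D" "(\<lambda>t. fst (\<phi> t)) holomorphic_on D" "(\<lambda>t. snd (\<phi> t)) holomorphic_on D"
  "\<And>t. t \<in> D ==> (snd (\<phi> t))^2 = poly f (fst (\<phi> t))" "inj_on \<phi> D" "continuous_on D \<phi>"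
  "\<And>t. t \<in> D ==> \<phi> t \<in> X"
proof -
 note L = assms[unfolded local_param_def]
 show "open D" "(\<lambda>t. fst (\<phi> t)) holomorphic_on D" "(\<lambda>t. snd (\<phi> t)) holomorphic_on D" using L by auto
 show "\<phi> t \<in> X" if "t \<in> D" for t using L that by auto
 thus "(snd (\<phi> t))^2 = poly f (fst (\<phi> t))" if "t \<in> D" for t
  using that unfolding X_def by (metis (mono_tags, lifting) case_prod_conv mem_Collect_eq prod.collapse)
 obtain \<psi> where "homeomorphism D (\<phi> ` D) \<phi> \<psi>" using L by auto
 thus "inj_on \<phi> D" "continuous_on D \<phi>" by (auto simp: homeomorphism_def intro: inj_on_inverseI)
qed

abbreviation "dx \<phi> t \<equiv> deriv (\<lambda>s. fst (\<phi> s :: complex \<times> complex)) (t :: complex)"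
abbreviation "dy \<phi> t \<equiv> deriv (\<lambda>s. snd (\<phi> s :: complex \<times> complex)) (t :: complex)"

lemma param_deriv:
 assumes P: "local_param X D \<phi>" and t: "t \<in> D"
 defines "x \<equiv> fst (\<phi> t)" and "y \<equiv> snd (\<phi> t)"
 shows "2 * y * dy \<phi> t = poly (pderiv f) x * dx \<phi> t"
  and "y \<noteq> 0 ==> dx \<phi> t \<noteq> 0"
  and "y = 0 ==> dy \<phi> t \<noteq> 0"
  and "y = 0 ==> dx \<phi> t = 0"
  and "y = 0 \<longleftrightarrow> poly f x = 0"
proof -
 note F = param_facts[OF P]
 have d1: "((\<lambda>s. fst (\<phi> s)) has_field_derivative dx \<phi> t) (at t)" by (rule holomorphic_derivI[OF F(2,1) t])
 have d2: "((\<lambda>s. snd (\<phi> s)) has_field_derivative dy \<phi> t) (at t)" by (rule holomorphic_derivI[OF F(3,1) t])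
 have "((\<lambda>s. (snd (\<phi> s))^2) has_field_derivative 2 * y * dy \<phi> t) (at t)"
  unfolding y_def using d2 by (auto intro!: derivative_eq_intros)
 moreover have "((\<lambda>s. poly f (fst (\<phi> s))) has_field_derivative poly (pderiv f) x * dx \<phi> t) (at t)"
  unfolding x_def by (rule DERIV_chain2[OF poly_DERIV d1])
 hence "((\<lambda>s. (snd (\<phi> s))^2) has_field_derivative poly (pderiv f) x * dx \<phi> t) (at t)"
  by (rule has_field_derivative_transform_within_open[OF _ F(1) t]) (simp add: F(4))
 ultimately show e: "2 * y * dy \<phi> t = poly (pderiv f) x * dx \<phi> t" by (rule DERIV_unique)
 have imm: "dx \<phi> t \<noteq> 0 \<or> dy \<phi> t \<noteq> 0" using P t unfolding local_param_def by auto
 show y0: "y = 0 \<longleftrightarrow> poly f x = 0" using F(4)[OF t] unfolding x_def y_def by (metis power_eq_0_iff zero_eq_power2)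
 show "y \<noteq> 0 ==> dx \<phi> t \<noteq> 0" using imm e by auto
 have "y = 0 ==> poly (pderiv f) x \<noteq> 0" using y0 sqfree by (auto simp: rsquarefree_roots)
 thus "y = 0 ==> dx \<phi> t = 0" using e by simp
 thus "y = 0 ==> dy \<phi> t \<noteq> 0" using imm by blast
qed

lemma branch_points_finite:
 assumes P: "local_param X D \<phi>"
 shows "finite {t \<in> D. snd (\<phi> t) = 0}"
proof (rule finite_imageD)
 have "\<phi> ` {t \<in> D. snd (\<phi> t) = 0} \<subseteq> (\<lambda>a. (a, 0)) ` {a. poly f a = 0}"
  using param_facts(4)[OF P] by (force simp: image_iff prod_eq_iff)
 thus "finite (\<phi> ` {t \<in> D. snd (\<phi> t) = 0})" by (rule finite_subset) (intro finite_imageI poly_roots_finite f_nz)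
 show "inj_on \<phi> {t \<in> D. snd (\<phi> t) = 0}" using param_facts(5)[OF P] by (rule inj_on_subset) auto
qed

text \<open>The coefficient of a form with respect to \<open>dx\<close>, valid where \<open>y \<noteq> 0\<close>.\<close>

definition dx_coeff :: "one_form => complex \<times> complex => complex" where
 "dx_coeff \<omega> p = fst (\<omega> p) + snd (\<omega> p) * poly (pderiv f) (fst p) / (2 * snd p)"

lemma pullback_dx_coeff:
 assumes P: "local_param X D \<phi>" and t: "t \<in> D" and y: "snd (\<phi> t) \<noteq> 0"
 shows "pullback \<phi> \<omega> t = dx_coeff \<omega> (\<phi> t) * dx \<phi> t"
proof -
 have "dy \<phi> t = poly (pderiv f) (fst (\<phi> t)) * dx \<phi> t / (2 * snd (\<phi> t))"
  using param_deriv(1)[OF P t] y by (simp add: eq_divide_eq mult_ac)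
 thus ?thesis unfolding pullback_def dx_coeff_def by (simp add: algebra_simps)
qed

definition pieces :: "(complex => complex \<times> complex) => complex set => complex => complex set" where
 "pieces \<phi> B s = {x. poly f x \<noteq> 0 \<and> sheet s 1 x \<in> \<phi> ` B}"

lemma sheet_measurable: "sheet s d \<in> borel_measurable borel"
proof -
 have "(\<lambda>x. s * csqrt (d * poly f x)) \<in> borel_measurable borel"
  by (intro borel_measurable_times borel_measurable_const measurable_compose[OF _ csqrt_measurable]
    borel_measurable_continuous_onI continuous_intros)
 thus ?thesis unfolding sheet_def[abs_def] by (intro borel_measurable_Pair) auto
qed

lemma closed_X: "closed X"
proof -
 have "X = {p. (snd p)^2 = poly f (fst p)}" unfolding X_def by auto
 thus ?thesis by (simp only:) (intro closed_Collect_eq continuous_intros)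
qed

lemma pieces_measurable:
 assumes P: "local_param X D \<phi>" and B: "B \<in> sets borel" "B \<subseteq> D" and s: "s \<in> {1, - 1}"
 shows "pieces \<phi> B s \<in> sets borel"
proof -
 obtain U where U: "open U" "\<phi> ` D = X \<inter> U" using P unfolding local_param_def openin_open by auto
 obtain \<psi> where h: "homeomorphism D (\<phi> ` D) \<phi> \<psi>" using P unfolding local_param_def by auto
 have XU: "X \<inter> U \<in> sets borel" using closed_X U(1) by auto
 define \<psi>' where "\<psi>' = (\<lambda>p. indicator (X \<inter> U) p *\<^sub>R \<psi> p)"
 have \<psi>': "\<psi>' \<in> borel_measurable borel" unfolding \<psi>'_def
  by (rule borel_measurable_continuous_on_indicator[OF XU]) (use h U(2) in \<open>simp add: homeomorphism_def\<close>)
 have "\<phi> ` B = {p \<in> X \<inter> U. \<psi>' p \<in> B}"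
 proof (intro equalityI subsetI)
  fix p assume "p \<in> \<phi> ` B"
  then obtain t where t: "t \<in> B" "p = \<phi> t" by auto
  hence "\<psi> p = t" "p \<in> X \<inter> U" using h B(2) U(2) by (auto simp: homeomorphism_def)
  thus "p \<in> {p \<in> X \<inter> U. \<psi>' p \<in> B}" using t by (simp add: \<psi>'_def)
 next
  fix p assume "p \<in> {p \<in> X \<inter> U. \<psi>' p \<in> B}"
  hence "p \<in> \<phi> ` D" "\<psi> p \<in> B" using U(2) by (auto simp: \<psi>'_def)
  hence "p = \<phi> (\<psi> p)" "\<psi> p \<in> B" using h by (auto simp: homeomorphism_def)
  thus "p \<in> \<phi> ` B" by blast
 qed
 also have "... = (X \<inter> U) \<inter> \<psi>' -` B" by auto
 also have "... \<in> sets borel" using sets.Int[OF XU, of "\<psi>' -` B"] measurable_sets[OF \<psi>' B(1)] by simp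
 finally have "\<phi> ` B \<in> sets borel" .
 hence "sheet s 1 -` (\<phi> ` B) \<in> sets borel" using measurable_sets[OF sheet_measurable[of s 1]] by simp
 moreover have "open {x. poly f x \<noteq> 0}"
  using finite_imp_closed[OF poly_roots_finite[OF f_nz]] by (simp add: open_closed Collect_neg_eq[symmetric] Compl_eq)
 moreover have "pieces \<phi> B s = {x. poly f x \<noteq> 0} \<inter> sheet s 1 -` (\<phi> ` B)" unfolding pieces_def by auto
 ultimately show ?thesis by auto
qed

definition sheet_part :: "(complex => complex \<times> complex) => complex set => complex => complex set" where
 "sheet_part \<phi> B s = {t \<in> B. snd (\<phi> t) \<noteq> 0 \<and> snd (\<phi> t) = s * csqrt (poly f (fst (\<phi> t)))}"

definition ext :: "complex set => (complex => complex) => complex => complex" where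
 "ext D h t = (if t \<in> D then h t else 0)"

lemma ext_measurable: "open D ==> h holomorphic_on D ==> ext D h \<in> borel_measurable borel"
proof -
 assume "open D" "h holomorphic_on D"
 hence "(\<lambda>t. indicator D t *\<^sub>R h t) \<in> borel_measurable borel"
  by (intro borel_measurable_continuous_on_indicator holomorphic_on_imp_continuous_on) auto
 moreover have "(\<lambda>t. indicator D t *\<^sub>R h t) = ext D h" by (auto simp: ext_def indicator_def)
 ultimately show ?thesis by simp
qed

lemma sheet_part_facts:
 assumes P: "local_param X D \<phi>" and B: "B \<in> sets borel" "B \<subseteq> D" and s: "s \<in> {1, - 1}"
 shows "sheet_part \<phi> B s \<in> sets borel"
  and "t \<in> sheet_part \<phi> B s ==> \<phi> t = sheet s 1 (fst (\<phi> t))"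
  and "inj_on (ext D (\<lambda>t. fst (\<phi> t))) (sheet_part \<phi> B s)"
  and "ext D (\<lambda>t. fst (\<phi> t)) ` sheet_part \<phi> B s = pieces \<phi> B s"
  and "distr (density lborel (\<lambda>t. ennreal (cmod (ext D (deriv (\<lambda>t. fst (\<phi> t))) t)^2) * indicator (sheet_part \<phi> B s) t)) borel (ext D (\<lambda>t. fst (\<phi> t)))
   = density lborel (indicator (pieces \<phi> B s))"
proof -
 note F = param_facts[OF P]
 let ?x = "ext D (\<lambda>t. fst (\<phi> t))" and ?y = "ext D (\<lambda>t. snd (\<phi> t))" and ?J = "ext D (deriv (\<lambda>t. fst (\<phi> t)))"
 have [measurable]: "?x \<in> borel_measurable borel" "?y \<in> borel_measurable borel" "?J \<in> borel_measurable borel"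
  using F by (auto intro!: ext_measurable holomorphic_deriv)
 have [measurable]: "poly f \<in> borel_measurable borel" by (intro borel_measurable_continuous_onI continuous_intros)
 have T: "sheet_part \<phi> B s = B \<inter> {t. ?y t \<noteq> 0 \<and> ?y t = s * csqrt (poly f (?x t))}"
  unfolding sheet_part_def using B(2) by (auto simp: ext_def subset_eq)
 have "{t. ?y t \<noteq> 0 \<and> ?y t = s * csqrt (poly f (?x t))} \<in> sets borel" by measurable
 thus m: "sheet_part \<phi> B s \<in> sets borel" unfolding T using B(1) by (rule sets.Int[rotated])
 show sh: "\<phi> t = sheet s 1 (fst (\<phi> t))" if "t \<in> sheet_part \<phi> B s" for t
  using that unfolding sheet_part_def sheet_def by (simp add: prod_eq_iff)
 have inD: "t \<in> D" if "t \<in> sheet_part \<phi> B s" for t using that B(2) unfolding sheet_part_def by auto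
 show i: "inj_on ?x (sheet_part \<phi> B s)"
 proof (rule inj_onI)
  fix t t' assume t: "t \<in> sheet_part \<phi> B s" "t' \<in> sheet_part \<phi> B s" "?x t = ?x t'"
  hence "fst (\<phi> t) = fst (\<phi> t')" using inD by (simp add: ext_def)
  hence "\<phi> t = \<phi> t'" using sh t by metis
  thus "t = t'" using F(5) inD t by (auto dest: inj_onD)
 qed
 show im: "?x ` sheet_part \<phi> B s = pieces \<phi> B s"
 proof (intro equalityI subsetI)
  fix x assume "x \<in> ?x ` sheet_part \<phi> B s"
  then obtain t where t: "t \<in> sheet_part \<phi> B s" "x = fst (\<phi> t)" using inD by (auto simp: ext_def)
  hence "poly f x \<noteq> 0" using F(4)[OF inD[OF t(1)]] unfolding sheet_part_def by auto
  thus "x \<in> pieces \<phi> B s" unfolding pieces_def using t sh[OF t(1)] by (auto simp: sheet_part_def)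
 next
  fix x assume "x \<in> pieces \<phi> B s"
  then obtain t where t: "poly f x \<noteq> 0" "t \<in> B" "\<phi> t = (x, s * csqrt (poly f x))" unfolding pieces_def sheet_def by auto
  hence "t \<in> sheet_part \<phi> B s" unfolding sheet_part_def using s by auto
  moreover have "?x t = x" using t B(2) by (auto simp: ext_def)
  ultimately show "x \<in> ?x ` sheet_part \<phi> B s" by blast
 qed
 show "distr (density lborel (\<lambda>t. ennreal (cmod (?J t)^2) * indicator (sheet_part \<phi> B s) t)) borel ?x = density lborel (indicator (pieces \<phi> B s))"
  unfolding im[symmetric]
 proof (rule distr_holomorphic_image[OF m _ _ _ i])
  show "?x ` sheet_part \<phi> B s \<in> sets borel" unfolding im by (rule pieces_measurable[OF P B s])
  show "(?x has_field_derivative ?J t) (at t within sheet_part \<phi> B s)" if t: "t \<in> sheet_part \<phi> B s" for t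
  proof -
   have "((\<lambda>s. fst (\<phi> s)) has_field_derivative ?J t) (at t)"
    using holomorphic_derivI[OF F(2,1) inD[OF t]] inD[OF t] by (simp add: ext_def)
   hence "(?x has_field_derivative ?J t) (at t)"
    by (rule has_field_derivative_transform_within_open[OF _ F(1) inD[OF t]]) (simp add: ext_def)
   thus ?thesis by (rule has_field_derivative_at_within)
  qed
 qed measurable
qed

lemma sheet_parts_cover:
 assumes P: "local_param X D \<phi>" and B: "B \<subseteq> D" and t: "snd (\<phi> t) \<noteq> 0"
 shows "indicator B t = (indicator (sheet_part \<phi> B 1) t + indicator (sheet_part \<phi> B (- 1)) t :: 'a::{semiring_1})"
proof (cases "t \<in> B")
 case True
 hence "(fst (\<phi> t), snd (\<phi> t)) \<in> X" using param_facts(7)[OF P] B by auto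
 from X_cases[OF this] t have s: "snd (\<phi> t) = csqrt (poly f (fst (\<phi> t))) \<or> snd (\<phi> t) = - csqrt (poly f (fst (\<phi> t)))" by auto
 have "csqrt (poly f (fst (\<phi> t))) \<noteq> - csqrt (poly f (fst (\<phi> t)))" using s t by auto
 thus ?thesis using s t True unfolding sheet_part_def by (auto simp: indicator_def)
qed (auto simp: sheet_part_def indicator_def)

lemma piece_nn_integral:
 assumes P: "local_param X D \<phi>" and B: "B \<in> sets borel" "B \<subseteq> D"
  and H: "\<And>s. s \<in> {1, - 1} ==> (\<lambda>x. H (sheet s 1 x)) \<in> borel_measurable borel"
  and G: "\<And>t. t \<in> B ==> snd (\<phi> t) \<noteq> 0 ==> G t = H (\<phi> t) * ennreal (cmod (dx \<phi> t)^2)"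
 shows "(\<integral>\<^sup>+t\<in>B. G t \<partial>lborel) = (\<integral>\<^sup>+x\<in>pieces \<phi> B 1. H (sheet 1 1 x) \<partial>lborel) + (\<integral>\<^sup>+x\<in>pieces \<phi> B (- 1). H (sheet (- 1) 1 x) \<partial>lborel)"
proof -
 note F = param_facts[OF P]
 let ?x = "ext D (\<lambda>t. fst (\<phi> t))" and ?J = "ext D (deriv (\<lambda>t. fst (\<phi> t)))"
 have [measurable]: "?x \<in> borel_measurable borel" "?J \<in> borel_measurable borel"
  using F by (auto intro!: ext_measurable holomorphic_deriv)
 define K where "K = (\<lambda>s t. ennreal (cmod (?J t)^2) * indicator (sheet_part \<phi> B s) t)"
 have Km: "K s \<in> borel_measurable borel" if "s \<in> {1, - 1}" for s
  using sheet_part_facts(1)[OF P B that] unfolding K_def by measurable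
 have one: "(\<integral>\<^sup>+t. K s t * H (sheet s 1 (?x t))) = (\<integral>\<^sup>+x\<in>pieces \<phi> B s. H (sheet s 1 x) \<partial>lborel)" if s: "s \<in> {1, - 1}" for s
 proof -
  have "(\<integral>\<^sup>+t. K s t * H (sheet s 1 (?x t))) = (\<integral>\<^sup>+t. H (sheet s 1 (?x t)) \<partial>density lborel (K s))"
   using Km[OF s] measurable_compose[OF _ H[OF s], of ?x] by (subst nn_integral_density) auto
  also have "... = (\<integral>\<^sup>+x. H (sheet s 1 x) \<partial>distr (density lborel (K s)) borel ?x)"
   using H[OF s] by (subst nn_integral_distr) auto
  also have "... = (\<integral>\<^sup>+x. H (sheet s 1 x) \<partial>density lborel (indicator (pieces \<phi> B s)))"
   using sheet_part_facts(5)[OF P B s] unfolding K_def by simp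
  also have "... = (\<integral>\<^sup>+x\<in>pieces \<phi> B s. H (sheet s 1 x) \<partial>lborel)"
   using H[OF s] pieces_measurable[OF P B s] by (subst nn_integral_density) (auto simp: mult.commute)
  finally show ?thesis .
 qed
 have "AE t in lborel. t \<notin> {t \<in> D. snd (\<phi> t) = 0}"
  by (rule AE_not_in[OF finite_imp_null_set_lborel[OF branch_points_finite[OF P]]])
 hence "(\<integral>\<^sup>+t\<in>B. G t \<partial>lborel) = (\<integral>\<^sup>+t. K 1 t * H (sheet 1 1 (?x t)) + K (- 1) t * H (sheet (- 1) 1 (?x t)))"
 proof (intro nn_integral_cong_AE, eventually_elim)
  case (elim t)
  show ?case
  proof (cases "t \<in> B")
   case True
   hence t: "t \<in> D" "snd (\<phi> t) \<noteq> 0" using elim B by auto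
   have r: "K s t * H (sheet s 1 (?x t)) = indicator (sheet_part \<phi> B s) t * G t" if s: "s \<in> {1, - 1}" for s
   proof (cases "t \<in> sheet_part \<phi> B s")
    case True
    thus ?thesis using G[of t] t \<open>t \<in> B\<close> sheet_part_facts(2)[OF P B s True] unfolding K_def by (simp add: ext_def mult.commute)
   qed (simp add: K_def)
   show ?thesis using r[of 1] r[of "- 1"] sheet_parts_cover[OF P B(2) t(2), where 'a = ennreal] by (simp add: distrib_left distrib_right mult.commute)
  qed (simp add: K_def sheet_part_def)
 qed
 also have "... = (\<integral>\<^sup>+t. K 1 t * H (sheet 1 1 (?x t))) + (\<integral>\<^sup>+t. K (- 1) t * H (sheet (- 1) 1 (?x t)))"
  using Km measurable_compose[OF _ H, of ?x] by (intro nn_integral_add) auto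
 finally show ?thesis using one by simp
qed

lemma piece_integral:
 fixes h :: "complex => complex"
 assumes P: "local_param X D \<phi>" and B: "B \<in> sets borel" "B \<subseteq> D"
  and h: "L1 h"
  and G: "\<And>t. t \<in> B ==> snd (\<phi> t) \<noteq> 0 ==> G t = h (fst (\<phi> t)) * of_real (cmod (dx \<phi> t)^2)"
 shows "(LINT t:B|lborel. G t) = (LINT x:pieces \<phi> B 1|lborel. h x) + (LINT x:pieces \<phi> B (- 1)|lborel. h x)"
proof -
 note F = param_facts[OF P]
 let ?x = "ext D (\<lambda>t. fst (\<phi> t))" and ?J = "ext D (deriv (\<lambda>t. fst (\<phi> t)))"
 have [measurable]: "?x \<in> borel_measurable borel" "?J \<in> borel_measurable borel"
  using F by (auto intro!: ext_measurable holomorphic_deriv)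
 have hm [measurable]: "h \<in> borel_measurable borel" using h by auto
 define K where "K = (\<lambda>s t. cmod (?J t)^2 * indicator (sheet_part \<phi> B s) t)"
 have Km: "K s \<in> borel_measurable borel" if "s \<in> {1, - 1}" for s
  using sheet_part_facts(1)[OF P B that] unfolding K_def by measurable
 have K0: "K s t \<ge> 0" for s t unfolding K_def by simp
 have Ke: "(\<lambda>t. ennreal (cmod (?J t)^2) * indicator (sheet_part \<phi> B s) t) = (\<lambda>t. ennreal (K s t))" for s
  unfolding K_def by (auto simp: indicator_def)
 have pi: "(indicator (pieces \<phi> B s) :: complex => ennreal) = (\<lambda>x. ennreal (indicator (pieces \<phi> B s) x))" for s
  by (auto simp: indicator_def)
 have one: "L1 (\<lambda>t. K s t *\<^sub>R h (?x t))" "(\<integral>t. K s t *\<^sub>R h (?x t)) = (LINT x:pieces \<phi> B s|lborel. h x)" if s: "s \<in> {1, - 1}" for s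
 proof -
  note dist = sheet_part_facts(5)[OF P B s, unfolded Ke]
  have pm [measurable]: "pieces \<phi> B s \<in> sets borel" by (rule pieces_measurable[OF P B s])
  have "L1 (\<lambda>x. indicator (pieces \<phi> B s) x *\<^sub>R h x)"
   using h by (rule integrable_mult_indicator[rotated]) simp
  hence "integrable (density lborel (indicator (pieces \<phi> B s))) h"
   unfolding pi by (subst integrable_density) auto
  hence "integrable (distr (density lborel (\<lambda>t. ennreal (K s t))) borel ?x) h" unfolding dist .
  hence "integrable (density lborel (\<lambda>t. ennreal (K s t))) (\<lambda>t. h (?x t))"
   by (subst (asm) integrable_distr_eq) auto
  thus "L1 (\<lambda>t. K s t *\<^sub>R h (?x t))"
   using Km[OF s] K0 measurable_compose[OF _ hm, of ?x] by (subst (asm) integrable_density) auto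
  have "(\<integral>t. K s t *\<^sub>R h (?x t)) = (\<integral>t. h (?x t) \<partial>density lborel (\<lambda>t. ennreal (K s t)))"
   using Km[OF s] K0 measurable_compose[OF _ hm, of ?x] by (subst integral_density) auto
  also have "... = (\<integral>x. h x \<partial>distr (density lborel (\<lambda>t. ennreal (K s t))) borel ?x)"
   by (subst integral_distr) auto
  also have "... = (\<integral>x. h x \<partial>density lborel (indicator (pieces \<phi> B s)))" unfolding dist ..
  also have "... = (LINT x:pieces \<phi> B s|lborel. h x)"
   unfolding pi set_lebesgue_integral_def by (subst integral_density) auto
  finally show "(\<integral>t. K s t *\<^sub>R h (?x t)) = (LINT x:pieces \<phi> B s|lborel. h x)" .
 qed
 have "(LINT t:B|lborel. G t) = (\<integral>t. K 1 t *\<^sub>R h (?x t) + K (- 1) t *\<^sub>R h (?x t))"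
  unfolding set_lebesgue_integral_def
 proof (rule integral_discrete_difference[where X = "{t \<in> D. snd (\<phi> t) = 0}"])
  show "countable {t \<in> D. snd (\<phi> t) = 0}" using branch_points_finite[OF P] by (rule countable_finite)
  fix t assume nt: "t \<notin> {t \<in> D. snd (\<phi> t) = 0}"
  show "indicator B t *\<^sub>R G t = K 1 t *\<^sub>R h (?x t) + K (- 1) t *\<^sub>R h (?x t)"
  proof (cases "t \<in> B")
   case True
   hence t: "t \<in> D" "snd (\<phi> t) \<noteq> 0" using nt B by auto
   have r: "K s t *\<^sub>R h (?x t) = indicator (sheet_part \<phi> B s) t *\<^sub>R G t" for s
    using G[OF True t(2)] t unfolding K_def by (simp add: ext_def scaleR_conv_of_real)
   show ?thesis unfolding r scaleR_add_left[symmetric] sheet_parts_cover[OF P B(2) t(2), symmetric] ..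
  qed (simp add: K_def sheet_part_def)
 qed auto
 also have "... = (\<integral>t. K 1 t *\<^sub>R h (?x t)) + (\<integral>t. K (- 1) t *\<^sub>R h (?x t))"
  using one(1) by (intro B_integral_add) auto
 finally show ?thesis using one(2) by simp
qed

lemma tiling_pieces:
 assumes T: "tiling X (\<phi>, B)" and s: "s \<in> {1, - 1}"
 shows "disjoint_family (\<lambda>k. pieces (\<phi> k) (B k) s)" and "(\<Union>k. pieces (\<phi> k) (B k) s) = {x. poly f x \<noteq> 0}"
  and "pieces (\<phi> k) (B k) s \<in> sets borel"
proof -
 have d: "disjoint_family (\<lambda>k. \<phi> k ` B k)" and u: "(\<Union>k. \<phi> k ` B k) = X" using T unfolding tiling_def by auto
 show "disjoint_family (\<lambda>k. pieces (\<phi> k) (B k) s)"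
  using d unfolding disjoint_family_on_def pieces_def by fast
 have "sheet s 1 x \<in> X" for x by (rule sheet_in_X) (use s in auto)
 thus "(\<Union>k. pieces (\<phi> k) (B k) s) = {x. poly f x \<noteq> 0}" unfolding u[symmetric] pieces_def by auto
 obtain D where "B k \<in> sets borel" "B k \<subseteq> D" "local_param X D (\<phi> k)" using T unfolding tiling_def prod.case by blast
 thus "pieces (\<phi> k) (B k) s \<in> sets borel" using pieces_measurable s by blast
qed

lemma tiling_nn_integral:
 assumes T: "tiling X (\<phi>, B)"
  and H: "\<And>s. s \<in> {1, - 1} ==> (\<lambda>x. H (sheet s 1 x)) \<in> borel_measurable borel"
  and G: "\<And>k t. t \<in> B k ==> snd (\<phi> k t) \<noteq> 0 ==> G k t = H (\<phi> k t) * ennreal (cmod (dx (\<phi> k) t)^2)"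
 shows "(\<Sum>k. \<integral>\<^sup>+t\<in>B k. G k t \<partial>lborel) =
  (\<integral>\<^sup>+x\<in>{x. poly f x \<noteq> 0}. H (sheet 1 1 x) \<partial>lborel) + (\<integral>\<^sup>+x\<in>{x. poly f x \<noteq> 0}. H (sheet (- 1) 1 x) \<partial>lborel)"
proof -
 have one: "(\<integral>\<^sup>+x\<in>{x. poly f x \<noteq> 0}. H (sheet s 1 x) \<partial>lborel) = (\<Sum>k. \<integral>\<^sup>+x\<in>pieces (\<phi> k) (B k) s. H (sheet s 1 x) \<partial>lborel)"
  if s: "s \<in> {1, - 1}" for s
  unfolding tiling_pieces(2)[OF T s, symmetric]
  by (rule nn_integral_disjoint_family) (use H[OF s] tiling_pieces[OF T s] in auto)
 have "(\<integral>\<^sup>+t\<in>B k. G k t \<partial>lborel) = (\<integral>\<^sup>+x\<in>pieces (\<phi> k) (B k) 1. H (sheet 1 1 x) \<partial>lborel) + (\<integral>\<^sup>+x\<in>pieces (\<phi> k) (B k) (- 1). H (sheet (- 1) 1 x) \<partial>lborel)" for k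
 proof -
  obtain D where D: "B k \<in> sets borel" "B k \<subseteq> D" "local_param X D (\<phi> k)" using T unfolding tiling_def prod.case by blast
  show ?thesis by (rule piece_nn_integral[OF D(3,1,2) H G])
 qed
 thus ?thesis using one by (simp add: suminf_add[symmetric])
qed

lemma tiling_integral:
 fixes h :: "complex => complex"
 assumes T: "tiling X (\<phi>, B)" and h: "L1 h"
  and G: "\<And>k t. t \<in> B k ==> snd (\<phi> k t) \<noteq> 0 ==> G k t = h (fst (\<phi> k t)) * of_real (cmod (dx (\<phi> k) t)^2)"
 shows "(\<Sum>k. LINT t:B k|lborel. G k t) = 2 * (\<integral>x. h x)"
proof -
 have one: "(\<lambda>k. LINT x:pieces (\<phi> k) (B k) s|lborel. h x) sums (\<integral>x. h x)" if s: "s \<in> {1, - 1}" for s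
 proof -
  have "(\<lambda>k. LINT x:pieces (\<phi> k) (B k) s|lborel. h x) sums (LINT x:(\<Union>k. pieces (\<phi> k) (B k) s)|lborel. h x)"
  proof (rule set_integral_sums)
   show "set_integrable lborel (\<Union>k. pieces (\<phi> k) (B k) s) h" unfolding set_integrable_def
    using h by (rule integrable_mult_indicator[rotated]) (use tiling_pieces(3)[OF T s] in auto)
  qed (use tiling_pieces[OF T s] in auto)
  also have "(LINT x:(\<Union>k. pieces (\<phi> k) (B k) s)|lborel. h x) = (\<integral>x. h x)"
   unfolding tiling_pieces(2)[OF T s] set_lebesgue_integral_def
   by (rule integral_discrete_difference[where X = "{x. poly f x = 0}"])
    (use poly_roots_finite[OF f_nz] in \<open>auto intro: countable_finite\<close>)
  finally show ?thesis .
 qed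
 have "(LINT t:B k|lborel. G k t) = (LINT x:pieces (\<phi> k) (B k) 1|lborel. h x) + (LINT x:pieces (\<phi> k) (B k) (- 1)|lborel. h x)" for k
 proof -
  obtain D where D: "B k \<in> sets borel" "B k \<subseteq> D" "local_param X D (\<phi> k)" using T unfolding tiling_def prod.case by blast
  show ?thesis by (rule piece_integral[OF D(3,1,2) h G])
 qed
 hence "(\<lambda>k. LINT t:B k|lborel. G k t) sums ((\<integral>x. h x) + (\<integral>x. h x))"
  using sums_add[OF one[of 1] one[of "- 1"]] by simp
 thus ?thesis by (simp add: sums_iff)
qed

end

section \<open>Holomorphic forms\<close>

context hyperelliptic
begin

abbreviation W :: "complex => real" where "W \<equiv> \<lambda>x. 1 / cmod (poly f x)"

sublocale pw: poly_weight W n by (rule singular_weight[OF sqfree deg_f n_pos])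

definition poly_form :: "complex poly => one_form" where
 "poly_form p q = (if snd q \<noteq> 0 then (poly p (fst q) / snd q, 0) else (0, 2 * poly p (fst q) / poly (pderiv f) (fst q)))"

definition represents :: "one_form => complex poly => bool" where
 "represents \<omega> p \<longleftrightarrow> (\<forall>D \<phi>. local_param X D \<phi> \<longrightarrow> (\<forall>t\<in>D. snd (\<phi> t) \<noteq> 0 \<longrightarrow>
   pullback \<phi> \<omega> t = poly p (fst (\<phi> t)) / snd (\<phi> t) * dx \<phi> t))"

lemma representsD:
 "represents \<omega> p ==> local_param X D \<phi> ==> t \<in> D ==> snd (\<phi> t) \<noteq> 0 ==>
   pullback \<phi> \<omega> t = poly p (fst (\<phi> t)) / snd (\<phi> t) * dx \<phi> t"
 unfolding represents_def by blast

lemma norm_snd_param: "local_param X D \<phi> ==> t \<in> D ==> cmod (snd (\<phi> t))^2 = cmod (poly f (fst (\<phi> t)))"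
 using param_facts(4) by (metis norm_power)

lemma poly_form_represents: "represents (poly_form p) p"
 unfolding represents_def by (simp add: poly_form_def pullback_def)

lemma poly_form_holomorphic: "holomorphic_form X (poly_form p)"
 unfolding holomorphic_form_def
proof (intro allI impI)
 fix D \<phi> assume P: "local_param X D \<phi>"
 note F = param_facts[OF P]
 let ?x = "\<lambda>t. fst (\<phi> t)" and ?y = "\<lambda>t. snd (\<phi> t)"
 define D1 where "D1 = D \<inter> ?y -` (- {0})"
 define D2 where "D2 = D \<inter> (\<lambda>t. poly (pderiv f) (?x t)) -` (- {0})"
 have cx: "continuous_on D ?x" "continuous_on D ?y" using F(2,3) by (auto intro: holomorphic_on_imp_continuous_on)
 have hx: "?x holomorphic_on S" "?y holomorphic_on S" "deriv ?x holomorphic_on S" "deriv ?y holomorphic_on S" if "S \<subseteq> D" for S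
  using F(1,2,3) that by (auto intro: holomorphic_on_subset holomorphic_deriv)
 have poly_hol: "(\<lambda>t. poly r (?x t)) holomorphic_on S" if "S \<subseteq> D" for S r
  by (rule holomorphic_on_compose_gen[OF hx(1)[OF that], of "poly r" UNIV, unfolded o_def]) (auto intro: holomorphic_intros)
 have o1: "open D1" unfolding D1_def by (intro continuous_open_preimage cx F) auto
 have o2: "open D2" unfolding D2_def by (intro continuous_open_preimage holomorphic_on_imp_continuous_on poly_hol F) auto
 have s: "D1 \<subseteq> D" "D2 \<subseteq> D" unfolding D1_def D2_def by auto
 have "(\<lambda>t. poly p (?x t) / ?y t * deriv ?x t) holomorphic_on D1"
  by (intro holomorphic_on_mult holomorphic_on_divide hx poly_hol s) (auto simp: D1_def)
 hence h1: "pullback \<phi> (poly_form p) holomorphic_on D1"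
  by (rule holomorphic_transform) (use representsD[OF poly_form_represents P] in \<open>auto simp: D1_def\<close>)
 have "(\<lambda>t. 2 * poly p (?x t) / poly (pderiv f) (?x t) * deriv ?y t) holomorphic_on D2"
  by (intro holomorphic_on_mult holomorphic_on_divide holomorphic_on_const hx poly_hol s) (auto simp: D2_def)
 hence h2: "pullback \<phi> (poly_form p) holomorphic_on D2"
 proof (rule holomorphic_transform)
  fix t assume t: "t \<in> D2"
  hence tD: "t \<in> D" and nz: "poly (pderiv f) (?x t) \<noteq> 0" unfolding D2_def by auto
  show "2 * poly p (?x t) / poly (pderiv f) (?x t) * deriv ?y t = pullback \<phi> (poly_form p) t"
  proof (cases "?y t = 0")
   case True
   thus ?thesis by (simp add: pullback_def poly_form_def)
  next
   case False
   have "deriv ?x t = 2 * ?y t * deriv ?y t / poly (pderiv f) (?x t)"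
    using param_deriv(1)[OF P tD] nz by (simp add: eq_divide_eq mult_ac)
   thus ?thesis using representsD[OF poly_form_represents P tD False, of p] False by simp
  qed
 qed
 have "t \<in> D1 \<union> D2" if t: "t \<in> D" for t
  using param_deriv(5)[OF P t] sqfree t unfolding D1_def D2_def by (auto simp: rsquarefree_roots)
 hence "D1 \<union> D2 = D" using s by auto
 thus "pullback \<phi> (poly_form p) holomorphic_on D" using holomorphic_on_Un[OF h1 h2 o1 o2] by simp
qed

lemma poly_form_L2:
 assumes p: "degree p < n"
 shows "poly_form p \<in> L2_holomorphic_forms X"
proof -
 obtain \<phi> B where T: "some_tiling X = (\<phi>, B)" using prod.exhaust by blast
 have til: "tiling X (\<phi>, B)" using some_tiling T by simp
 define H where "H = (\<lambda>q :: complex \<times> complex. ennreal (cmod (poly p (fst q))^2 * W (fst q)))"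
 have i: "L1 (\<lambda>x. cmod (poly p x)^2 * W x)" by (rule pw.norm_integrable[OF pw.tame_poly[OF p]])
 have fin: "(\<integral>\<^sup>+x. ennreal (cmod (poly p x)^2 * W x)) < \<infinity>"
  using i by (subst nn_integral_eq_integral) auto
 have "(\<Sum>k. \<integral>\<^sup>+t\<in>B k. ennreal (cmod (pullback (\<phi> k) (poly_form p) t)^2) \<partial>lborel) =
  (\<integral>\<^sup>+x\<in>{x. poly f x \<noteq> 0}. H (sheet 1 1 x) \<partial>lborel) + (\<integral>\<^sup>+x\<in>{x. poly f x \<noteq> 0}. H (sheet (- 1) 1 x) \<partial>lborel)"
 proof (rule tiling_nn_integral[OF til])
  show "(\<lambda>x. H (sheet s 1 x)) \<in> borel_measurable borel" for s
   using i unfolding H_def sheet_def by (auto dest!: borel_measurable_integrable)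
  fix k t assume t: "t \<in> B k" "snd (\<phi> k t) \<noteq> 0"
  obtain D where D: "B k \<subseteq> D" "local_param X D (\<phi> k)" using til unfolding tiling_def prod.case by blast
  hence tD: "t \<in> D" using t by auto
  show "ennreal (cmod (pullback (\<phi> k) (poly_form p) t)^2) = H (\<phi> k t) * ennreal (cmod (dx (\<phi> k) t)^2)"
   unfolding representsD[OF poly_form_represents D(2) tD t(2)] H_def
   using norm_snd_param[OF D(2) tD] by (simp add: norm_mult norm_divide power_mult_distrib power_divide ennreal_mult[symmetric])
 qed
 also have "... \<le> (\<integral>\<^sup>+x. ennreal (cmod (poly p x)^2 * W x)) + (\<integral>\<^sup>+x. ennreal (cmod (poly p x)^2 * W x))"
  by (intro add_mono nn_integral_mono) (auto simp: H_def sheet_def indicator_def)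
 also have "... < \<infinity>" using fin by simp
 finally show ?thesis
  unfolding L2_holomorphic_forms_def square_integrable_form_def T using poly_form_holomorphic by simp
qed

lemma form_inner_represents:
 assumes p: "degree p < n" and q: "degree q < n" and a: "represents \<alpha> p" and b: "represents \<beta> q"
 shows "form_inner X \<alpha> \<beta> = 2 * pw.ip (poly p) (poly q)"
proof -
 obtain \<phi> B where T: "some_tiling X = (\<phi>, B)" using prod.exhaust by blast
 have til: "tiling X (\<phi>, B)" using some_tiling T by simp
 have "(\<Sum>k. LINT t:B k|lborel. pullback (\<phi> k) \<alpha> t * cnj (pullback (\<phi> k) \<beta> t)) =
  2 * (\<integral>x. poly p x * cnj (poly q x) * of_real (W x))"
 proof (rule tiling_integral[OF til])
  show "L1 (\<lambda>x. poly p x * cnj (poly q x) * of_real (W x))"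
   by (rule pw.ip_integrable[OF pw.tame_poly[OF p] pw.tame_poly[OF q]])
  fix k t assume t: "t \<in> B k" "snd (\<phi> k t) \<noteq> 0"
  obtain D where D: "B k \<subseteq> D" "local_param X D (\<phi> k)" using til unfolding tiling_def prod.case by blast
  hence tD: "t \<in> D" using t by auto
  let ?y = "snd (\<phi> k t)" and ?x' = "dx (\<phi> k) t"
  have y: "?y * cnj ?y = of_real (cmod (poly f (fst (\<phi> k t))))"
   using norm_snd_param[OF D(2) tD] complex_norm_square[of ?y] by simp
  have x: "?x' * cnj ?x' = of_real (cmod ?x'^2)" using complex_norm_square[of ?x'] by simp
  have "pullback (\<phi> k) \<alpha> t * cnj (pullback (\<phi> k) \<beta> t) =
   (poly p (fst (\<phi> k t)) * cnj (poly q (fst (\<phi> k t)))) / (?y * cnj ?y) * (?x' * cnj ?x')"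
   unfolding representsD[OF a D(2) tD t(2)] representsD[OF b D(2) tD t(2)] by simp
  thus "pullback (\<phi> k) \<alpha> t * cnj (pullback (\<phi> k) \<beta> t) =
    poly p (fst (\<phi> k t)) * cnj (poly q (fst (\<phi> k t))) * of_real (W (fst (\<phi> k t))) * of_real (cmod ?x'^2)"
   unfolding x y by simp
 qed
 thus ?thesis unfolding form_inner_def T pw.ip_def by simp
qed

lemma sheet_dom_union: "sheet_dom 1 \<union> sheet_dom (- 1) = {x. poly f x \<noteq> 0}"
 unfolding sheet_dom_def by (auto simp: complex_nonpos_Reals_iff complex_eq_iff)

lemma dx_coeff_sheet:
 assumes cd: "c^2 * d = 1" and x: "x \<in> sheet_dom d"
 shows "dx_coeff \<omega> (sheet c d x) = pullback (sheet c d) \<omega> x"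
proof -
 have "c \<noteq> 0" "d \<noteq> 0" using cd by auto
 hence "snd (sheet c d x) \<noteq> 0" using x by (auto simp: sheet_def sheet_dom_def)
 moreover have "deriv (\<lambda>s. fst (sheet c d s)) x = 1" by (simp add: sheet_def)
 ultimately show ?thesis using pullback_dx_coeff[OF sheet_param[OF cd] x] by simp
qed

lemma L2_represented:
 assumes \<omega>: "\<omega> \<in> L2_holomorphic_forms X"
 obtains p where "degree p < n" "represents \<omega> p"
proof -
 have hol: "holomorphic_form X \<omega>" and sqi: "square_integrable_form X \<omega>" using \<omega> by (auto simp: L2_holomorphic_forms_def)
 let ?R = "dx_coeff \<omega>"
 have R_hol: "(\<lambda>x. ?R (sheet c d x)) holomorphic_on sheet_dom d" if cd: "c^2 * d = 1" for c d
 proof -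
  have "pullback (sheet c d) \<omega> holomorphic_on sheet_dom d"
   using hol sheet_param[OF cd] unfolding holomorphic_form_def by blast
  thus ?thesis by (rule holomorphic_transform) (simp add: dx_coeff_sheet[OF cd])
 qed
 have im: "sheet s 1 x = sheet (s * \<i>) (- 1) x" if "x \<in> sheet_dom (- 1)" "x \<notin> sheet_dom 1" for s x
 proof -
  have "csqrt (- (- poly f x)) = \<i> * csqrt (- poly f x)"
   by (rule csqrt_minus) (use that in \<open>auto simp: sheet_dom_def complex_nonpos_Reals_iff\<close>)
  thus ?thesis by (simp add: sheet_def)
 qed
 define H where "H = (\<lambda>q. if snd q \<noteq> 0 then ennreal (cmod (?R q)^2) else 0)"
 have Hm: "(\<lambda>x. H (sheet s 1 x)) \<in> borel_measurable borel" if s: "s \<in> {1, - 1}" for s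
 proof -
  define k1 where "k1 = ext (sheet_dom 1) (\<lambda>x. ?R (sheet s 1 x))"
  define k2 where "k2 = ext (sheet_dom (- 1)) (\<lambda>x. ?R (sheet (s * \<i>) (- 1) x))"
  have [measurable]: "k1 \<in> borel_measurable borel" "k2 \<in> borel_measurable borel"
   unfolding k1_def k2_def using s by (auto intro!: ext_measurable open_sheet_dom R_hol simp: power_mult_distrib)
  have [measurable]: "sheet_dom 1 \<in> sets borel" "sheet_dom (- 1) \<in> sets borel" using open_sheet_dom by auto
  have "H (sheet s 1 x) = ennreal (cmod (k1 x)^2) * indicator (sheet_dom 1) x +
   ennreal (cmod (k2 x)^2) * indicator (sheet_dom (- 1) - sheet_dom 1) x" for x
  proof -
   have z: "snd (sheet s 1 x) = 0 \<longleftrightarrow> poly f x = 0" using s by (auto simp: sheet_def)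
   have u: "poly f x \<noteq> 0 \<longleftrightarrow> x \<in> sheet_dom 1 \<or> x \<in> sheet_dom (- 1)" using sheet_dom_union by blast
   show ?thesis using z u im[of x s] unfolding H_def k1_def k2_def ext_def by (auto simp: indicator_def)
  qed
  thus ?thesis by simp
 qed
 obtain \<phi> B where T: "some_tiling X = (\<phi>, B)" using prod.exhaust by blast
 have til: "tiling X (\<phi>, B)" using some_tiling T by simp
 have "(\<Sum>k. \<integral>\<^sup>+t\<in>B k. ennreal (cmod (pullback (\<phi> k) \<omega> t)^2) \<partial>lborel) =
  (\<integral>\<^sup>+x\<in>{x. poly f x \<noteq> 0}. H (sheet 1 1 x) \<partial>lborel) + (\<integral>\<^sup>+x\<in>{x. poly f x \<noteq> 0}. H (sheet (- 1) 1 x) \<partial>lborel)"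
 proof (rule tiling_nn_integral[OF til Hm])
  fix k t assume t: "t \<in> B k" "snd (\<phi> k t) \<noteq> 0"
  obtain D where D: "B k \<subseteq> D" "local_param X D (\<phi> k)" using til unfolding tiling_def prod.case by blast
  hence tD: "t \<in> D" using t by auto
  show "ennreal (cmod (pullback (\<phi> k) \<omega> t)^2) = H (\<phi> k t) * ennreal (cmod (dx (\<phi> k) t)^2)"
   unfolding pullback_dx_coeff[OF D(2) tD t(2)] H_def using t(2) by (simp add: norm_mult power_mult_distrib ennreal_mult)
 qed
 hence fin: "(\<integral>\<^sup>+x\<in>{x. poly f x \<noteq> 0}. H (sheet 1 1 x) \<partial>lborel) + (\<integral>\<^sup>+x\<in>{x. poly f x \<noteq> 0}. H (sheet (- 1) 1 x) \<partial>lborel) < \<infinity>"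
  using sqi unfolding square_integrable_form_def T by simp
 have mm: "{x. poly f x \<noteq> 0} \<in> sets borel" unfolding sheet_dom_union[symmetric] using open_sheet_dom by auto
 define Z where "Z = {x. poly f x = 0}"
 have Z: "finite Z" "- Z = {x. poly f x \<noteq> 0}" unfolding Z_def using poly_roots_finite[OF f_nz] by auto
 have bound: "(\<integral>\<^sup>+x\<in>- Z. ennreal (E x) \<partial>lborel) < \<infinity>"
  if E: "\<And>x. poly f x \<noteq> 0 ==> E x \<le> cmod (?R (sheet 1 1 x))^2 + cmod (?R (sheet (- 1) 1 x))^2" for E
 proof -
  have "(\<integral>\<^sup>+x\<in>- Z. ennreal (E x) \<partial>lborel) \<le> (\<integral>\<^sup>+x. H (sheet 1 1 x) * indicator {x. poly f x \<noteq> 0} x + H (sheet (- 1) 1 x) * indicator {x. poly f x \<noteq> 0} x)"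
  proof (rule nn_integral_mono)
   fix x
   show "ennreal (E x) * indicator (- Z) x \<le> H (sheet 1 1 x) * indicator {x. poly f x \<noteq> 0} x + H (sheet (- 1) 1 x) * indicator {x. poly f x \<noteq> 0} x"
   proof (cases "poly f x = 0")
    case False
    hence "snd (sheet 1 1 x) \<noteq> 0" "snd (sheet (- 1) 1 x) \<noteq> 0" by (auto simp: sheet_def)
    thus ?thesis using ennreal_leI[OF E[OF False]] False Z(2) unfolding H_def by (simp add: ennreal_plus)
   qed (simp add: Z)
  qed
  also have "... = (\<integral>\<^sup>+x\<in>{x. poly f x \<noteq> 0}. H (sheet 1 1 x) \<partial>lborel) + (\<integral>\<^sup>+x\<in>{x. poly f x \<noteq> 0}. H (sheet (- 1) 1 x) \<partial>lborel)"
   using Hm[of 1] Hm[of "- 1"] mm by (intro nn_integral_add) auto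
  finally show ?thesis using fin by (rule order_le_less_trans)
 qed
 define Ev where "Ev = (\<lambda>x. (?R (sheet 1 1 x) + ?R (sheet (- 1) 1 x)) / 2)"
 define Od where "Od = (\<lambda>x. csqrt (poly f x) * (?R (sheet 1 1 x) - ?R (sheet (- 1) 1 x)) / 2)"
 text \<open>Both functions are symmetric under exchanging the two sheets, so that either branch of the root may be used.\<close>
 have sym: "Ev x = (?R (sheet c d x) + ?R (sheet (- c) d x)) / 2"
  "Od x = c * csqrt (d * poly f x) * (?R (sheet c d x) - ?R (sheet (- c) d x)) / 2" if cd: "c^2 * d = 1" for c d x
 proof -
  define k r where "k = c * csqrt (d * poly f x)" and "r = csqrt (poly f x)"
  have "k^2 = r^2" unfolding k_def r_def using cd by (simp add: power_mult_distrib mult.assoc[symmetric])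
  hence kr: "k = r \<or> k = - r" by (simp only: power2_eq_iff)
  have sh: "sheet c d x = (x, k)" "sheet (- c) d x = (x, - k)" "sheet 1 1 x = (x, r)" "sheet (- 1) 1 x = (x, - r)"
   by (simp_all add: sheet_def k_def r_def)
  show "Ev x = (?R (sheet c d x) + ?R (sheet (- c) d x)) / 2" unfolding Ev_def sh using kr by (auto simp: add.commute)
  have "Od x = k * (?R (sheet c d x) - ?R (sheet (- c) d x)) / 2"
   unfolding Od_def sh r_def[symmetric] using kr by (auto simp: right_diff_distrib)
  thus "Od x = c * csqrt (d * poly f x) * (?R (sheet c d x) - ?R (sheet (- c) d x)) / 2" unfolding k_def .
 qed
 have hol_d: "Ev holomorphic_on sheet_dom d" "Od holomorphic_on sheet_dom d" if cd: "c^2 * d = 1" for c d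
 proof -
  have cd': "(- c)^2 * d = 1" using cd by simp
  have "(\<lambda>x. (?R (sheet c d x) + ?R (sheet (- c) d x)) / 2) holomorphic_on sheet_dom d"
   by (intro holomorphic_intros R_hol cd cd') auto
  thus "Ev holomorphic_on sheet_dom d" unfolding sym(1)[OF cd, abs_def] .
  have "(\<lambda>x. c * csqrt (d * poly f x) * (?R (sheet c d x) - ?R (sheet (- c) d x)) / 2) holomorphic_on sheet_dom d"
   by (intro holomorphic_intros R_hol cd cd') (auto simp: sheet_dom_def)
  thus "Od holomorphic_on sheet_dom d" unfolding sym(2)[OF cd, abs_def] .
 qed
 have hE: "Ev holomorphic_on - Z" "Od holomorphic_on - Z"
  unfolding Z(2) sheet_dom_union[symmetric]
  using hol_d[of 1 1] hol_d[of \<i> "- 1"] by (auto intro!: holomorphic_on_Un open_sheet_dom)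
 have par: "cmod ((a + b) / 2)^2 \<le> cmod a^2 + cmod b^2" "cmod ((a - b) / 2)^2 \<le> cmod a^2 + cmod b^2" for a b
 proof -
  have p1: "cmod (a + b)^2 \<le> (cmod a + cmod b)^2" by (intro power_mono norm_triangle_ineq) auto
  have p2: "cmod (a - b)^2 \<le> (cmod a + cmod b)^2" by (intro power_mono norm_triangle_ineq4) auto
  have "0 \<le> (cmod a - cmod b)^2" by simp
  hence p3: "(cmod a + cmod b)^2 \<le> 2 * (cmod a^2 + cmod b^2)" by (simp add: power2_eq_square algebra_simps)
  have p4: "0 \<le> cmod a^2 + cmod b^2" by simp
  have gen: "u \<le> 2 * v ==> 0 \<le> v ==> u / 4 \<le> v" for u v :: real by linarith
  have p5: "cmod ((a + b) / 2)^2 = cmod (a + b)^2 / 4" "cmod ((a - b) / 2)^2 = cmod (a - b)^2 / 4"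
   by (simp_all add: norm_divide power_divide)
  show "cmod ((a + b) / 2)^2 \<le> cmod a^2 + cmod b^2"
   unfolding p5 using gen[OF order_trans[OF p1 p3] p4] .
  show "cmod ((a - b) / 2)^2 \<le> cmod a^2 + cmod b^2"
   unfolding p5 using gen[OF order_trans[OF p2 p3] p4] .
 qed
 have Ev0: "Ev x = 0" if "poly f x \<noteq> 0" for x
 proof -
  have "(\<integral>\<^sup>+x\<in>- Z. ennreal (cmod (Ev x)^2 * 1) \<partial>lborel) < \<infinity>"
   by (rule bound) (use par(1) in \<open>simp add: Ev_def\<close>)
  then obtain p where "\<And>x. x \<notin> Z ==> Ev x = poly p x" "p = 0 \<or> 2 * degree p + 2 \<le> 0"
   using square_integrable_imp_poly[OF Z(1) hE(1), of "\<lambda>_. 1" 1 0] by auto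
  thus ?thesis using that unfolding Z_def by auto
 qed
 have "(\<integral>\<^sup>+x\<in>- Z. ennreal (cmod (Od x)^2 * W x) \<partial>lborel) < \<infinity>"
 proof (rule bound)
  fix x assume x: "poly f x \<noteq> 0"
  have "cmod (Od x)^2 * W x = cmod ((?R (sheet 1 1 x) - ?R (sheet (- 1) 1 x)) / 2)^2"
   using x unfolding Od_def by (simp add: norm_mult norm_divide power_mult_distrib power_divide del: csqrt.simps)
  thus "cmod (Od x)^2 * W x \<le> cmod (?R (sheet 1 1 x))^2 + cmod (?R (sheet (- 1) 1 x))^2" using par(2) by simp
 qed
 moreover obtain C where C: "C > 0" "\<And>x. cmod (poly f x) \<le> C * (1 + cmod x) ^ (2 * n + 1)"
 proof -
  obtain C where C: "C \<ge> 0" "\<And>x. cmod (poly f x) \<le> C * wt (real (2 * n + 1)) x"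
   using growth_bound[OF growth_poly[of f "real (2 * n + 1)"]] deg_f by auto
  have "cmod (poly f x) \<le> (C + 1) * (1 + cmod x) ^ (2 * n + 1)" for x
  proof -
   have "0 < 1 + cmod x" by (simp add: add_pos_nonneg)
   hence "cmod (poly f x) \<le> C * (1 + cmod x) ^ (2 * n + 1)" using C(2)[of x] by (simp only: powr_realpow)
   also have "... \<le> (C + 1) * (1 + cmod x) ^ (2 * n + 1)" by (intro mult_right_mono) auto
   finally show ?thesis .
  qed
  thus ?thesis using that[of "C + 1"] C(1) by simp
 qed
 ultimately obtain p where p: "\<And>x. x \<notin> Z ==> Od x = poly p x" "p = 0 \<or> 2 * degree p + 2 \<le> 2 * n + 1"
  using square_integrable_imp_poly[OF Z(1) hE(2) pw.W_meas C(1), of "2 * n + 1"] unfolding Z_def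
  by (auto simp: divide_simps)
 have "degree p < n" using p(2) n_pos by auto
 moreover have "represents \<omega> p" unfolding represents_def
 proof (intro allI impI ballI)
  fix D \<phi> t assume P: "local_param X D \<phi>" and t: "t \<in> D" and y: "snd (\<phi> t) \<noteq> 0"
  obtain x where x: "fst (\<phi> t) = x" by blast
  have "(x, snd (\<phi> t)) \<in> X" using param_facts(7)[OF P t] x by auto
  from X_cases[OF this] y obtain s where s: "poly f x \<noteq> 0" "s \<in> {1, - 1}" "snd (\<phi> t) = s * csqrt (poly f x)" by blast
  have \<phi>: "\<phi> t = sheet s 1 x" using x s by (simp add: sheet_def prod_eq_iff)
  have c0: "csqrt (poly f x) \<noteq> 0" using s by simp
  have e: "?R (sheet 1 1 x) + ?R (sheet (- 1) 1 x) = 0" using Ev0[OF s(1)] unfolding Ev_def by simp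
  have o: "csqrt (poly f x) * (?R (sheet 1 1 x) - ?R (sheet (- 1) 1 x)) = 2 * poly p x"
   using p(1)[of x] s(1) unfolding Od_def Z_def by (simp add: field_simps del: csqrt.simps)
  have "?R (sheet (- 1) 1 x) = - ?R (sheet 1 1 x)" using e by (simp add: add_eq_0_iff)
  hence "csqrt (poly f x) * ?R (sheet 1 1 x) = poly p x" "csqrt (poly f x) * ?R (sheet (- 1) 1 x) = - poly p x"
   using o by auto
  hence "s * csqrt (poly f x) * ?R (sheet s 1 x) = poly p x" using s(2) by auto
  hence "?R (\<phi> t) = poly p (fst (\<phi> t)) / snd (\<phi> t)" using s c0 x unfolding \<phi> by (auto simp: sheet_def eq_divide_eq mult_ac)
  thus "pullback \<phi> \<omega> t = poly p (fst (\<phi> t)) / snd (\<phi> t) * dx \<phi> t"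
   using pullback_dx_coeff[OF P t y] by simp
 qed
 ultimately show ?thesis using that by blast
qed

lemma zero_form_represents:
 assumes r: "represents \<omega> p" and h: "holomorphic_form X \<omega>"
 shows "zero_form X \<omega> \<longleftrightarrow> p = 0"
proof
 assume z: "zero_form X \<omega>"
 have "poly p x = 0" if x: "poly f x \<noteq> 0" for x
 proof -
  obtain c d where cd: "c^2 * d = 1" "d * poly f x \<notin> \<real>\<^sub>\<le>\<^sub>0" "c \<noteq> 0" using sqrt_sign_choice[OF x] by metis
  have xd: "x \<in> sheet_dom d" unfolding sheet_dom_def using cd by simp
  note P = sheet_param[OF cd(1)]
  have y: "snd (sheet c d x) \<noteq> 0" using cd by (auto simp: sheet_def)
  have "pullback (sheet c d) \<omega> x = 0" using z P xd unfolding zero_form_def by blast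
  moreover have "deriv (\<lambda>s. fst (sheet c d s)) x = 1" "fst (sheet c d x) = x" by (simp_all add: sheet_def)
  ultimately show ?thesis using representsD[OF r P xd y] y by simp
 qed
 hence "poly (p * f) x = 0" for x by auto
 hence "p * f = 0" using poly_all_0_iff_0 by blast
 thus "p = 0" using f_nz by simp
next
 assume p: "p = 0"
 show "zero_form X \<omega>" unfolding zero_form_def
 proof (intro allI impI ballI)
  fix D \<phi> t assume P: "local_param X D \<phi>" and t: "t \<in> D"
  have "pullback \<phi> \<omega> holomorphic_on D" using h P unfolding holomorphic_form_def by blast
  hence "open (D \<inter> pullback \<phi> \<omega> -` (- {0}))"
   by (intro continuous_open_preimage holomorphic_on_imp_continuous_on param_facts(1)[OF P]) auto
  moreover have "D \<inter> pullback \<phi> \<omega> -` (- {0}) \<subseteq> {t \<in> D. snd (\<phi> t) = 0}"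
   using representsD[OF r P] p by auto
  ultimately have "D \<inter> pullback \<phi> \<omega> -` (- {0}) = {}"
   using branch_points_finite[OF P] finite_subset finite_imp_not_open by metis
  thus "pullback \<phi> \<omega> t = 0" using t by auto
 qed
qed


lemma ip_smult: "pw.ip (poly r) (poly (smult c s)) = cnj c * pw.ip (poly r) (poly s)"
 using pw.ip_cmult_left[of c "poly s" "poly r"] pw.ip_cnj[of "poly r" "poly (smult c s)"] pw.ip_cnj[of "poly r" "poly s"]
  pw.ip_cnj[of "\<lambda>x. c * poly s x" "poly r"] by (simp add: poly_smult[abs_def])

lemma complete_orthonormal_kernel:
 assumes E: "complete_orthonormal X E" and P: "local_param X D \<phi>" and t: "t \<in> D" and y: "snd (\<phi> t) \<noteq> 0"
 shows "((\<lambda>e. cmod (pullback \<phi> e t)^2) has_sum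
  cmod (dx \<phi> t)^2 * poly_kernel W n (fst (\<phi> t)) / (2 * cmod (poly f (fst (\<phi> t))))) E"
proof -
 have EL: "E \<subseteq> L2_holomorphic_forms X" using E unfolding complete_orthonormal_def by blast
 have ei: "form_inner X \<alpha> \<beta> = (if \<alpha> = \<beta> then 1 else 0)" if "\<alpha> \<in> E" "\<beta> \<in> E" for \<alpha> \<beta>
  using E that unfolding complete_orthonormal_def by blast
 have ez: "zero_form X \<omega>" if "\<omega> \<in> L2_holomorphic_forms X" "\<And>\<alpha>. \<alpha> \<in> E ==> form_inner X \<omega> \<alpha> = 0" for \<omega>
  using E that unfolding complete_orthonormal_def by blast
 have "\<forall>e\<in>E. \<exists>p. degree p < n \<and> represents e p" using L2_represented EL by (metis subsetD)
 then obtain p where p: "\<And>e. e \<in> E ==> degree (p e) < n" "\<And>e. e \<in> E ==> represents e (p e)" by metis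
 define c where "c = complex_of_real (sqrt 2)"
 have c: "c * cnj c = 2" "cmod c^2 = 2" "c \<noteq> 0" unfolding c_def by (simp_all flip: of_real_mult)
 define q where "q = (\<lambda>e. smult c (p e))"
 have ip_q: "pw.ip (poly r) (poly (q e)) = 0 ==> pw.ip (poly r) (poly (p e)) = 0" for r e
  unfolding q_def ip_smult using c by auto
 have dq: "degree (q e) < n" if "e \<in> E" for e
  unfolding q_def using p(1)[OF that] degree_smult_le[of c "p e"] by linarith
 have on: "pw.orthonormal I q" if I: "I \<subseteq> E" for I
  unfolding pw.orthonormal_def
 proof (intro conjI ballI)
  fix i j assume ij: "i \<in> I" "j \<in> I"
  hence ijE: "i \<in> E" "j \<in> E" using I by auto
  have "pw.ip (poly (q i)) (poly (q j)) = (c * cnj c) * pw.ip (poly (p i)) (poly (p j))"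
   unfolding q_def ip_smult using pw.ip_cmult_left[of c "poly (p i)" "poly (p j)"] by (simp add: poly_smult[abs_def])
  also have "... = form_inner X i j" unfolding c(1) using form_inner_represents p ijE by metis
  finally show "pw.ip (poly (q i)) (poly (q j)) = (if i = j then 1 else 0)" using ei[OF ijE] by simp
 qed (use dq I in auto)
 have fin: "finite E"
  by (rule conjunct1[OF finite_if_finite_subsets_card_bdd[of E n]]) (use pw.orthonormal_card_le[OF on] in auto)
 have sp: "pw.spanning E q" unfolding pw.spanning_def
 proof (intro allI impI)
  fix r :: "complex poly" assume r: "degree r < n"
  define b where "b = (\<lambda>i. pw.ip (poly r) (poly (q i)))"
  define r' where "r' = (\<Sum>i\<in>E. smult (b i) (q i))"
  have dr': "degree r' < n" unfolding r'_def by (rule pw.degree_sum_smult[OF dq])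
  have d: "degree (r - r') < n" using r dr' degree_diff_le_max[of r r'] by linarith
  have orth: "pw.ip (poly (r - r')) (poly (q j)) = 0" if j: "j \<in> E" for j
  proof -
   have pd: "poly (r - r') = (\<lambda>x. poly r x - poly r' x)" by auto
   have "pw.ip (poly (r - r')) (poly (q j)) = pw.ip (poly r) (poly (q j)) - pw.ip (poly r') (poly (q j))"
    using pw.ip_diff_left[OF pw.tame_poly[OF r] pw.tame_poly[OF dr'] pw.tame_poly[OF dq[OF j]]]
    unfolding pd .
   also have "pw.ip (poly r') (poly (q j)) = b j" unfolding r'_def
    by (rule pw.ip_combination_left[OF on[OF subset_refl] fin j])
   finally show ?thesis unfolding b_def pd by simp
  qed
  have "zero_form X (poly_form (r - r'))"
  proof (rule ez[OF poly_form_L2[OF d]])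
   fix \<alpha> assume a: "\<alpha> \<in> E"
   show "form_inner X (poly_form (r - r')) \<alpha> = 0"
    unfolding form_inner_represents[OF d p(1)[OF a] poly_form_represents p(2)[OF a]] using ip_q[OF orth[OF a]] by simp
  qed
  hence "r - r' = 0" using zero_form_represents[OF poly_form_represents poly_form_holomorphic] by blast
  hence "r = (\<Sum>i\<in>E. smult (b i) (q i))" unfolding r'_def by simp
  thus "\<exists>b. r = (\<Sum>i\<in>E. smult (b i) (q i))" by blast
 qed
 let ?x = "fst (\<phi> t)" and ?x' = "dx \<phi> t"
 have "cmod (pullback \<phi> e t)^2 = cmod ?x'^2 / (2 * cmod (poly f ?x)) * cmod (poly (q e) ?x)^2" if e: "e \<in> E" for e
 proof -
  have "cmod (poly (q e) ?x)^2 = 2 * cmod (poly (p e) ?x)^2" unfolding q_def using c(2) by (simp add: norm_mult power_mult_distrib)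
  thus ?thesis unfolding representsD[OF p(2)[OF e] P t y]
   using norm_snd_param[OF P t] by (simp add: norm_mult norm_divide power_mult_distrib power_divide)
 qed
 hence "(\<Sum>e\<in>E. cmod (pullback \<phi> e t)^2) = cmod ?x'^2 / (2 * cmod (poly f ?x)) * (\<Sum>e\<in>E. cmod (poly (q e) ?x)^2)"
  unfolding sum_distrib_left by (intro sum.cong) auto
 also have "(\<Sum>e\<in>E. cmod (poly (q e) ?x)^2) = poly_kernel W n ?x"
  by (rule pw.kernel_orthonormal(1)[OF on[OF subset_refl] sp fin, symmetric])
 finally have "(\<Sum>e\<in>E. cmod (pullback \<phi> e t)^2) = cmod ?x'^2 * poly_kernel W n ?x / (2 * cmod (poly f ?x))" by simp
 thus ?thesis using has_sum_finite[OF fin, of "\<lambda>e. cmod (pullback \<phi> e t)^2"] by simp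
qed

lemma complete_orthonormal_exists: "\<exists>E. complete_orthonormal X E"
proof -
 obtain e where e: "pw.orthonormal {..<n} e" "pw.spanning {..<n} e" using pw.orthonormal_basis_exists by blast
 define c where "c = complex_of_real (1 / sqrt 2)"
 have c: "2 * (c * cnj c) = 1" "c \<noteq> 0" unfolding c_def by (simp_all add: field_simps flip: of_real_mult)
 define q where "q = (\<lambda>i. smult c (e i))"
 define F where "F = (\<lambda>i. poly_form (q i))"
 have dq: "degree (q i) < n" if "i < n" for i
  using e(1) that degree_smult_le[of c "e i"] unfolding q_def pw.orthonormal_def by fastforce
 have FF: "form_inner X (F i) (F j) = (if i = j then 1 else 0)" if ij: "i < n" "j < n" for i j
 proof -
  have "form_inner X (F i) (F j) = 2 * pw.ip (poly (q i)) (poly (q j))"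
   unfolding F_def by (rule form_inner_represents[OF dq[OF ij(1)] dq[OF ij(2)] poly_form_represents poly_form_represents])
  also have "pw.ip (poly (q i)) (poly (q j)) = (c * cnj c) * pw.ip (poly (e i)) (poly (e j))"
   unfolding q_def ip_smult using pw.ip_cmult_left[of c "poly (e i)" "poly (e j)"] by (simp add: poly_smult[abs_def])
  also have "2 * ((c * cnj c) * pw.ip (poly (e i)) (poly (e j))) = pw.ip (poly (e i)) (poly (e j))"
   using c(1) by (simp add: mult.assoc[symmetric])
  finally show ?thesis using e(1) ij unfolding pw.orthonormal_def by simp
 qed
 have "complete_orthonormal X (F ` {..<n})" unfolding complete_orthonormal_def
 proof (intro conjI ballI impI)
  show "F ` {..<n} \<subseteq> L2_holomorphic_forms X" unfolding F_def using poly_form_L2[OF dq] by auto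
  fix \<alpha> \<beta> assume "\<alpha> \<in> F ` {..<n}" "\<beta> \<in> F ` {..<n}"
  then obtain i j where ij: "i < n" "j < n" "\<alpha> = F i" "\<beta> = F j" by auto
  have "F i = F j \<longleftrightarrow> i = j" using FF[OF ij(1,1)] FF[OF ij(1,2)] by (auto split: if_splits)
  thus "form_inner X \<alpha> \<beta> = (if \<alpha> = \<beta> then 1 else 0)" using FF[OF ij(1,2)] ij by simp
 next
  fix \<omega> assume w: "\<omega> \<in> L2_holomorphic_forms X" and z: "\<forall>\<alpha>\<in>F ` {..<n}. form_inner X \<omega> \<alpha> = 0"
  obtain p where p: "degree p < n" "represents \<omega> p" using L2_represented[OF w] by blast
  obtain b where b: "p = (\<Sum>i<n. smult (b i) (e i))" using e(2) p(1) unfolding pw.spanning_def by blast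
  have "b j = 0" if j: "j < n" for j
  proof -
   have "0 = form_inner X \<omega> (F j)" using z j by simp
   also have "... = 2 * pw.ip (poly p) (poly (q j))"
    unfolding F_def by (rule form_inner_represents[OF p(1) dq[OF j] p(2) poly_form_represents])
   also have "pw.ip (poly p) (poly (q j)) = cnj c * pw.ip (poly p) (poly (e j))" unfolding q_def by (rule ip_smult)
   finally have "pw.ip (poly p) (poly (e j)) = 0" using c(2) by simp
   thus ?thesis using pw.ip_combination_left[OF e(1), of j b] j unfolding b by simp
  qed
  hence "p = 0" unfolding b by simp
  thus "zero_form X \<omega>" using zero_form_represents[OF p(2)] w unfolding L2_holomorphic_forms_def by blast
 qed
 thus ?thesis by blast
qed

lemma bergman_coeff_eq:
 assumes P: "local_param X D \<phi>" and t: "t \<in> D" and y: "snd (\<phi> t) \<noteq> 0"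
 shows "bergman_coeff X \<phi> t = cmod (dx \<phi> t)^2 * poly_kernel W n (fst (\<phi> t)) / (2 * cmod (poly f (fst (\<phi> t))))"
 unfolding bergman_coeff_def
proof (rule the_equality)
 obtain E where E: "complete_orthonormal X E" using complete_orthonormal_exists by blast
 thus "\<exists>E. complete_orthonormal X E \<and> ((\<lambda>e. cmod (pullback \<phi> e t)^2) has_sum
   cmod (dx \<phi> t)^2 * poly_kernel W n (fst (\<phi> t)) / (2 * cmod (poly f (fst (\<phi> t))))) E"
  using complete_orthonormal_kernel[OF E P t y] by blast
next
 fix k assume "\<exists>E. complete_orthonormal X E \<and> ((\<lambda>e. cmod (pullback \<phi> e t)^2) has_sum k) E"
 then obtain E where "complete_orthonormal X E" "((\<lambda>e. cmod (pullback \<phi> e t)^2) has_sum k) E" by blast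
 thus "k = cmod (dx \<phi> t)^2 * poly_kernel W n (fst (\<phi> t)) / (2 * cmod (poly f (fst (\<phi> t))))"
  using complete_orthonormal_kernel[OF _ P t y] has_sum_unique by blast
qed

theorem bergman_sqrt_coeff_eq:
 assumes z: "z \<noteq> 0" "poly f (z^2) \<noteq> 0"
 shows "bergman_sqrt_coeff X z = 2 * cmod z^2 * poly_kernel W n (z^2) / cmod (poly f (z^2))"
proof -
 have val: "bergman_coeff X \<phi> z = 2 * cmod z^2 * poly_kernel W n (z^2) / cmod (poly f (z^2))"
  if P: "local_param X D \<phi>" and x: "\<forall>t\<in>D. fst (\<phi> t) = t^2" and zD: "z \<in> D" for D \<phi>
 proof -
  have "((\<lambda>t. t^2) has_field_derivative 2 * z) (at z)" by (auto intro!: derivative_eq_intros)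
  hence "((\<lambda>t. fst (\<phi> t)) has_field_derivative 2 * z) (at z)"
   by (rule has_field_derivative_transform_within_open[OF _ param_facts(1)[OF P] zD]) (use x in auto)
  hence d: "dx \<phi> z = 2 * z" by (rule DERIV_imp_deriv)
  have "snd (\<phi> z) \<noteq> 0" using param_deriv(5)[OF P zD] x zD z by auto
  from bergman_coeff_eq[OF P zD this] show ?thesis
   using x zD unfolding d by (simp add: norm_mult power_mult_distrib)
 qed
 show ?thesis unfolding bergman_sqrt_coeff_def
 proof (rule the_equality)
  obtain D \<phi> where "local_param X D \<phi>" "\<forall>t\<in>D. fst (\<phi> t) = t^2" "z \<in> D" using sqrt_param[OF z] by blast
  thus "\<exists>D \<phi>. local_param X D \<phi> \<and> (\<forall>t\<in>D. fst (\<phi> t) = t^2) \<and> z \<in> D \<and>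
   2 * cmod z^2 * poly_kernel W n (z^2) / cmod (poly f (z^2)) = bergman_coeff X \<phi> z" using val by metis
 next
  fix k assume "\<exists>D \<phi>. local_param X D \<phi> \<and> (\<forall>t\<in>D. fst (\<phi> t) = t^2) \<and> z \<in> D \<and> k = bergman_coeff X \<phi> z"
  thus "k = 2 * cmod z^2 * poly_kernel W n (z^2) / cmod (poly f (z^2))" using val by blast
 qed
qed

end

section \<open>The three families\<close>

lemma rsquarefree_mult:
 fixes p q :: "complex poly"
 assumes "rsquarefree p" "rsquarefree q" "\<And>a. poly p a = 0 ==> poly q a \<noteq> 0"
 shows "rsquarefree (p * q)"
 using assms unfolding rsquarefree_roots by (auto simp: pderiv_mult)

lemma rsquarefree_linear: "rsquarefree [:- a, 1 :: complex:]"
 unfolding rsquarefree_roots by (simp add: pderiv_pCons)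

lemma rsquarefree_if_card_roots:
 fixes p :: "complex poly"
 assumes card: "card {x. poly p x = 0} = degree p" and p: "p \<noteq> 0"
 shows "rsquarefree p"
 unfolding rsquarefree_roots
proof (intro allI notI)
 fix a assume a: "poly p a = 0 \<and> poly (pderiv p) a = 0"
 then obtain h where h: "p = [:- a, 1:] * h" by (auto simp: poly_eq_0_iff_dvd elim: dvdE)
 have "poly h a = 0" using a unfolding h pderiv_mult by (simp add: pderiv_pCons)
 then obtain q where q: "h = [:- a, 1:] * q" by (auto simp: poly_eq_0_iff_dvd elim: dvdE)
 have q0: "q \<noteq> 0" using p h q by auto
 have "{x. poly p x = 0} \<subseteq> insert a {x. poly q x = 0}" unfolding h q by auto
 hence "card {x. poly p x = 0} \<le> card (insert a {x. poly q x = 0})"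
  by (rule card_mono[rotated]) (simp add: poly_roots_finite q0)
 also have "... \<le> Suc (degree q)" using card_poly_roots_bound[OF q0] by (intro order_trans[OF card_insert_le_m1]) (auto simp: card_insert_if poly_roots_finite q0)
 finally have "degree p \<le> Suc (degree q)" using card by simp
 moreover have "degree p = degree q + 2" unfolding h q using q0 by (simp add: degree_mult_eq del: mult_pCons_left)
 ultimately show False by simp
qed

lemma integrable_square_quotient:
 fixes h q :: "complex poly"
 assumes sq: "rsquarefree h" and deg: "degree h \<ge> 3" and q: "\<And>x. poly q x = x^2 * poly h x"
 shows "L1 (\<lambda>x. cmod x^2 / cmod (poly q x))"
proof -
 have "L1 (\<lambda>x. (1 + cmod x) ^ 0 / cmod (poly h x))" by (rule integrable_simple_roots[OF sq]) (use deg in simp)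
 moreover have "L1 (\<lambda>x. cmod x^2 / cmod (poly q x)) = L1 (\<lambda>x. (1 + cmod x) ^ 0 / cmod (poly h x))"
  by (rule integrable_discrete_difference[where X = "{0}"]) (auto simp: q norm_mult norm_power)
 ultimately show ?thesis by simp
qed

lemma family_kernel:
 fixes c0 c1 c2 c3 :: "complex poly" and Q :: "complex => complex poly"
 assumes deg: "degree c0 = 2 * n + 1" "degree c1 \<le> 2 * n" "degree c2 \<le> 2 * n" "degree c3 \<le> 2 * n"
  and n: "n \<ge> 2" and z: "z \<noteq> 0" and adm: "0 \<in> admissible_params X z"
  and X: "\<And>l. X l = {(x, y). y^2 = poly (Q l) x}"
  and Q: "\<And>l. Q l = c0 + smult l c1 + smult (l^2) c2 + smult (l ^ 3) c3"
  and sq: "\<And>l. l \<noteq> 0 ==> cmod l < 1 ==> rsquarefree (Q l)"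
  and zero: "rsquarefree h" "degree h \<ge> 3" "\<And>x. poly (Q 0) x = x^2 * poly h x"
 shows "\<exists>u. subharmonic_on (admissible_params X z) u \<and>
  (\<forall>lam\<in>admissible_params X z - {0}. u lam = log_ext (bergman_sqrt_coeff (X lam) z)) \<and> has_lelong_number u 0 0"
proof -
 define S where "S = admissible_params X z"
 have S: "S = ball 0 1 \<inter> {l. poly (Q l) (z^2) \<noteq> 0}" unfolding S_def admissible_params_def X by auto
 have "open {l. poly (Q l) (z^2) \<noteq> 0}" unfolding Q poly_add poly_smult by (intro open_Collect_neq continuous_intros)
 hence oS: "open S" unfolding S by auto
 interpret kf: kernel_family c0 c1 c2 c3 n S "z^2" "2 * cmod z^2"
  by unfold_locales (use deg n z adm oS in \<open>auto simp: S_def\<close>)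
 have fam: "kf.fam = Q" by (rule ext) (simp add: kf.fam_def Q)
 interpret r: kernel_family_regular c0 c1 c2 c3 n S "z^2" "2 * cmod z^2"
  by unfold_locales (use sq integrable_square_quotient[OF zero] in \<open>auto simp: fam S\<close>)
 have "ereal (r.u l) = log_ext (bergman_sqrt_coeff (X l) z)" if l: "l \<in> S" "l \<noteq> 0" for l
 proof -
  have sql: "rsquarefree (Q l)" by (rule sq) (use l S in auto)
  have degl: "degree (Q l) = 2 * n + 1" using r.deg_fam[of l] unfolding fam .
  interpret h: hyperelliptic "Q l" n by unfold_locales (use sql degl n in auto)
  have XX: "X l = h.X" unfolding X h.X_def ..
  have nz: "poly (Q l) (z^2) \<noteq> 0" using l S by auto
  have b: "bergman_sqrt_coeff (X l) z = 2 * cmod z^2 * poly_kernel (\<lambda>x. 1 / cmod (poly (Q l) x)) n (z^2) / cmod (poly (Q l) (z^2))"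
   unfolding XX by (rule h.bergman_sqrt_coeff_eq[OF z nz])
  have "bergman_sqrt_coeff (X l) z > 0" unfolding b using z nz h.pw.kernel_pos[of "z^2"] by simp
  moreover have "r.u l = ln (bergman_sqrt_coeff (X l) z)" using r.u_eq[OF l] unfolding fam b .
  ultimately show ?thesis unfolding log_ext_def by simp
 qed
 thus ?thesis using r.u_subharmonic r.u_lelong unfolding S_def[symmetric] by (intro exI[of _ "\<lambda>l. ereal (r.u l)"]) auto
qed

lemma roots_increasing:
 fixes a :: "nat => complex"
 assumes "1 < cmod (a 1)" "\<forall>j\<in>{1..<m}. cmod (a j) < cmod (a (Suc j))"
 shows "strict_mono_on {1..m} (\<lambda>j. cmod (a j))" and "j \<in> {1..m} ==> 1 < cmod (a j)"
proof -
 have step: "cmod (a i) < cmod (a (i + Suc k))" if "1 \<le> i" "i + Suc k \<le> m" for i k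
  using that
 proof (induction k)
  case 0
  thus ?case using assms(2) by auto
 next
  case (Suc k)
  hence "cmod (a i) < cmod (a (i + Suc k))" by simp
  also have "... < cmod (a (Suc (i + Suc k)))" using assms(2) Suc.prems by auto
  finally show ?case by simp
 qed
 show "strict_mono_on {1..m} (\<lambda>j. cmod (a j))"
 proof (rule strict_mono_onI)
  fix r s assume rs: "r \<in> {1..m}" "s \<in> {1..m}" "r < s"
  hence e: "s = r + Suc (s - Suc r)" by simp
  show "cmod (a r) < cmod (a s)" using step[of r "s - Suc r"] rs e by simp
 qed
 show "1 < cmod (a j)" if j: "j \<in> {1..m}"
 proof (cases "j = 1")
  case False
  hence "j = 1 + Suc (j - 2)" using j by auto
  thus ?thesis using step[of 1 "j - 2"] j assms(1) by simp
 qed (use assms(1) in simp)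
qed

theorem corollary1p4:
  fixes g :: nat and P :: "complex poly" and a :: "nat \<Rightarrow> complex"
  assumes "g \<ge> 2"
    and "degree P = 2 * g - 2"
    and "{x. poly P x = 0} = a ` {1..2 * g - 2}"
    and "1 < cmod (a 1)"
    and "\<forall>j\<in>{1..<2 * g - 2}. cmod (a j) < cmod (a (Suc j))"
  shows "\<forall>X\<in>{curve_a P, curve_b P, curve_c P}. \<forall>z. z \<noteq> 0 \<and> 0 \<in> admissible_params X z \<longrightarrow>
           (\<exists>u. subharmonic_on (admissible_params X z) u \<and>
                (\<forall>lam\<in>admissible_params X z - {0}.
                   u lam = log_ext (bergman_sqrt_coeff (X lam) z)) \<and>
                has_lelong_number u 0 0)"
proof (intro ballI allI impI)
 fix X and z :: complex
 assume X: "X \<in> {curve_a P, curve_b P, curve_c P}" and "z \<noteq> 0 \<and> 0 \<in> admissible_params X z"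
 hence z: "z \<noteq> 0" and adm: "0 \<in> admissible_params X z" by auto
 have P0: "P \<noteq> 0" using assms(1,2) by auto
 note inc = roots_increasing[OF assms(4,5)]
 have "inj_on a {1..2 * g - 2}" using strict_mono_on_imp_inj_on[OF inc(1)] by (auto simp: inj_on_def)
 hence "card {x. poly P x = 0} = degree P" unfolding assms(2,3) by (simp add: card_image)
 hence sqP: "rsquarefree P" using P0 by (rule rsquarefree_if_card_roots)
 have rootP: "cmod x > 1" if "poly P x = 0" for x
 proof -
  have "x \<in> a ` {1..2 * g - 2}" using assms(3) that by blast
  thus ?thesis using inc(2) by blast
 qed
 have sq1: "rsquarefree ([:- b, 1:] * q)" if "rsquarefree q" "poly q b \<noteq> 0" for b and q :: "complex poly"
  using that by (intro rsquarefree_mult rsquarefree_linear) auto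
 have dP: "degree (q * P) = degree q + (2 * g - 2)" if "q \<noteq> 0" for q
  using that P0 assms(2) by (simp add: degree_mult_eq)
 have P1: "poly P x \<noteq> 0" if "cmod x \<le> 1" for x using rootP[of x] that by fastforce
 have z3: "[:0, 0, 0, 1 :: complex:] = [:0, 1:] * ([:0, 1:] * [:0, 1:])" by simp
 consider "X = curve_a P" | "X = curve_b P" | "X = curve_c P" using X by blast
 thus "\<exists>u. subharmonic_on (admissible_params X z) u \<and>
   (\<forall>lam\<in>admissible_params X z - {0}. u lam = log_ext (bergman_sqrt_coeff (X lam) z)) \<and> has_lelong_number u 0 0"
 proof cases
  case 1
  define Q where "Q = (\<lambda>l. [:- 0, 1:] * ([:- l, 1:] * ([:- 1, 1:] * P)))"
  have sq11: "rsquarefree ([:- 1, 1:] * P)" by (rule sq1[OF sqP P1]) simp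
  show ?thesis
  proof (rule family_kernel[OF _ _ _ _ assms(1) z adm _ _ _ sq11])
   show "degree ([:0, 0, - 1, 1:] * P) = 2 * g + 1" "degree ([:0, 1, - 1:] * P) \<le> 2 * g"
    using assms(1) by (simp_all add: dP del: mult_pCons_left)
   show "degree (0 :: complex poly) \<le> 2 * g" "degree (0 :: complex poly) \<le> 2 * g" by simp_all
   show "X l = {(x, y). y^2 = poly (Q l) x}" for l
   proof -
    have e: "poly (Q l) x = x * (x - l) * (x - 1) * poly P x" for x by (simp add: Q_def power2_eq_square algebra_simps)
    show ?thesis unfolding 1 curve_a_def e ..
   qed
   show "Q l = [:0, 0, - 1, 1:] * P + smult l ([:0, 1, - 1:] * P) + smult (l^2) 0 + smult (l ^ 3) 0" for l
    by (rule poly_eq_poly_eq_iff[THEN iffD1], rule ext) (simp add: Q_def algebra_simps)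
   show "rsquarefree (Q l)" if "l \<noteq> 0" "cmod l < 1" for l
    unfolding Q_def using that P1 by (intro sq1 sqP) auto
   show "3 \<le> degree ([:- 1, 1:] * P)" using assms(1) by (simp add: dP del: mult_pCons_left)
   show "poly (Q 0) x = x^2 * poly ([:- 1, 1:] * P) x" for x unfolding Q_def by (simp add: power2_eq_square algebra_simps)
  qed
 next
  case 2
  define Q where "Q = (\<lambda>l. [:- 0, 1:] * ([:- l, 0, 1:] * P))"
  have sq11: "rsquarefree ([:- 0, 1:] * P)" by (rule sq1[OF sqP P1]) simp
  show ?thesis
  proof (rule family_kernel[OF _ _ _ _ assms(1) z adm _ _ _ sq11])
   show "degree ([:0, 0, 0, 1:] * P) = 2 * g + 1" "degree ([:0, - 1:] * P) \<le> 2 * g"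
    using assms(1) by (simp_all add: dP del: mult_pCons_left)
   show "degree (0 :: complex poly) \<le> 2 * g" "degree (0 :: complex poly) \<le> 2 * g" by simp_all
   show "X l = {(x, y). y^2 = poly (Q l) x}" for l
   proof -
    have e: "poly (Q l) x = x * (x^2 - l) * poly P x" for x by (simp add: Q_def power2_eq_square algebra_simps)
    show ?thesis unfolding 2 curve_b_def e ..
   qed
   show "Q l = [:0, 0, 0, 1:] * P + smult l ([:0, - 1:] * P) + smult (l^2) 0 + smult (l ^ 3) 0" for l
    by (rule poly_eq_poly_eq_iff[THEN iffD1], rule ext) (simp add: Q_def algebra_simps)
   show "rsquarefree (Q l)" if l: "l \<noteq> 0" "cmod l < 1" for l
   proof -
    have "rsquarefree ([:- l, 0, 1:] * P)"
    proof (rule rsquarefree_mult[OF _ sqP])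
     show "rsquarefree [:- l, 0, 1:]" unfolding rsquarefree_roots using l by (auto simp: pderiv_pCons)
     fix b assume "poly [:- l, 0, 1:] b = 0"
     hence "b^2 = l" by (simp add: power2_eq_square)
     hence "cmod b^2 < 1" using l(2) by (simp flip: norm_power)
     hence "cmod b \<le> 1" by (simp add: power_less_one_iff abs_square_less_1)
     thus "poly P b \<noteq> 0" by (rule P1)
    qed
    thus ?thesis unfolding Q_def using l P1[of 0] by (intro sq1) auto
   qed
   show "3 \<le> degree ([:- 0, 1:] * P)" using assms(1) by (simp add: dP del: mult_pCons_left)
   show "poly (Q 0) x = x^2 * poly ([:- 0, 1:] * P) x" for x unfolding Q_def by (simp add: power2_eq_square algebra_simps)
  qed
 next
  case 3
  define Q where "Q = (\<lambda>l. [:- 0, 1:] * ([:- l, 1:] * ([:- (l^2), 1:] * P)))"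
  have sq11: "rsquarefree ([:- 0, 1:] * P)" by (rule sq1[OF sqP P1]) simp
  show ?thesis
  proof (rule family_kernel[OF _ _ _ _ assms(1) z adm _ _ _ sq11])
   show "degree ([:0, 0, 0, 1:] * P) = 2 * g + 1" "degree ([:0, 0, - 1:] * P) \<le> 2 * g" "degree ([:0, 0, - 1:] * P) \<le> 2 * g"
    "degree ([:0, 1:] * P) \<le> 2 * g"
    using assms(1) by (simp_all add: dP del: mult_pCons_left)
   show "X l = {(x, y). y^2 = poly (Q l) x}" for l
   proof -
    have e: "poly (Q l) x = x * (x - l) * (x - l^2) * poly P x" for x by (simp add: Q_def power2_eq_square algebra_simps)
    show ?thesis unfolding 3 curve_c_def e ..
   qed
   show "Q l = [:0, 0, 0, 1:] * P + smult l ([:0, 0, - 1:] * P) + smult (l^2) ([:0, 0, - 1:] * P) + smult (l ^ 3) ([:0, 1:] * P)" for l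
    by (rule poly_eq_poly_eq_iff[THEN iffD1], rule ext) (simp add: Q_def power2_eq_square power3_eq_cube algebra_simps)
   show "rsquarefree (Q l)" if l: "l \<noteq> 0" "cmod l < 1" for l
   proof -
    have l2: "cmod (l^2) \<le> 1" using l(2) by (simp add: norm_power power_le_one)
    have "l - l^2 \<noteq> 0"
    proof
     assume "l - l^2 = 0"
     hence "l = 1" using l(1) by (simp add: power2_eq_square)
     thus False using l(2) by simp
    qed
    thus ?thesis unfolding Q_def using l P1[OF l2] P1[of l] P1[of 0] by (intro sq1 sqP) auto
   qed
   show "3 \<le> degree ([:- 0, 1:] * P)" using assms(1) by (simp add: dP del: mult_pCons_left)
   show "poly (Q 0) x = x^2 * poly ([:- 0, 1:] * P) x" for x unfolding Q_def by (simp add: power2_eq_square algebra_simps)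
  qed
 qed
qed

end
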